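(* Let $u$ be the solution of $$u_t+uu_x-\mathcal I^{(\alpha)}u_{xx}=f\ \text{ in }(0,L)\times(0,T],\qquad u(0,t)=u(L,t)=0\ (0<t\le T),\qquad u(x,0)=u_0(x)\ (0\le x\le L),$$ with $u^n=u(\cdot,t_n)\in C^4([0,L])$ for $0\le n\le N$, and let $\{U^n\}_{n=0}^N$ be the solution of the implicit difference scheme $$\delta_tU_j^{1/2}+\nabla U_j^1\,\Delta_xU_j^1=I^{(\alpha)}\delta_x^2U_j^{1/2}+f_j^{1/2},\qquad 1\le j\le J-1,$$ $$\delta_tU_j^{n-1/2}+\nabla U_j^{n-1/2}\,\Delta_xU_j^{n-1/2}=I^{(\alpha)}\delta_x^2U_j^{n-1/2}+f_j^{n-1/2},\qquad 1\le j\le J-1,\ 2\le n\le N,$$ $$U_j^0=u_0(x_j),\quad 1\le j\le J-1,\qquad U_0^n=U_J^n=0,\quad 1\le n\le N.$$ Assume that $f^{n-1/2}$ is selected so that $$\Big\|f^{1/2}k_1-\int_{t_0}^{t_1}f(\cdot,t)\,dt\Big\|\le C\int_{t_0}^{t_1}t\,\|f'(\cdot,t)\|\,dt,\qquad \Big\|f^{n-1/2}k_n-\int_{t_{n-1}}^{t_n}f(\cdot,t)\,dt\Big\|\le Ck_n^2\int_{t_{n-1}}^{t_n}\|f''(\cdot,t)\|\,dt\quad(n\ge2).$$ Assume further that the exact solution and the forcing term satisfy, for some $\sigma>0$ and all $t>0$, $$t\|u_{xx}'(\cdot,t)\|+t^2\|u_{xx}''(\cdot,t)\|\le\mathcal M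 t^{\sigma-1},\qquad t\|f'(\cdot,t)\|+t^2\|f''(\cdot,t)\|\le\mathcal M t^{\sigma-1}.$$ Then for $t_n\in[0,T]$ and $\gamma\ge1$, $$\max_{1\le n\le N}\|U^n-u^n\|\le C(T)\,\big(h^2+\mathcal K_L\big),\qquad \mathcal K_L=\begin{cases}k^{\gamma\sigma},&1\le\gamma<2/\sigma,\\ k^2\log(t_N/t_1),&\gamma=2/\sigma,\\ k^2,&\gamma>2/\sigma,\end{cases}$$ where $C(T)$ is a positive constant independent of the step sizes $h$ and $k_n$, $1\le n\le N$.
   Context: Fix $L,T>0$, $0<\alpha<1$, $\beta(t)=t^{\alpha-1}/\Gamma(\alpha)$, and $\mathcal I^{(\alpha)}\varpi(t)=\int_0^t\beta(t-\zeta)\varpi(\zeta)\,d\zeta$. Primes denote derivatives in $t$. Grids: $J,N$ are positive integers, $h=L/J$, $x_j=jh$ ($0\le j\le J$); temporal levels $0=t_0<t_1<\dots<t_N=T$, $k_n=t_n-t_{n-1}$. The temporal mesh depends on a parameter $k>0$ and a grading exponent $\gamma\ge1$, and satisfies, with positive constants $\widetilde C_\gamma,\widetilde c_\gamma$ independent of $k$: $k_n\le\widetilde C_\gamma k\min\{1,t_n^{1-1/\gamma}\}$ for $n\ge1$; $t_1=k_1\ge\widetilde c_\gamma k^\gamma$; $t_n\le\widetilde C_\gamma t_{n-1}$ for $n\ge2$; and $0\le k_{n+1}-k_n\le\widetilde C_\gamma k^2\min\{1,t_n^{1-2/\gamma}\}$ for $n\ge2$. (Example: $t_n=(nk)^\gamma$,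 $k=T^{1/\gamma}/N$.) Time operators, for a sequence $W^0,\dots,W^N$: $\delta_tW^{n-1/2}=\frac{1}{k_n}(W^n-W^{n-1})$, $W^{n-1/2}=\frac12(W^n+W^{n-1})$ for $n\ge1$, and $$I^{(\alpha)}W^{n-1/2}=\widehat w_{n1}W^1k_1+\sum_{s=2}^{n}\widehat w_{ns}W^{s-1/2}k_s,\qquad \widehat w_{ns}=\frac{1}{k_nk_s}\int_{t_{n-1}}^{t_n}\int_{t_{s-1}}^{\min\{t,t_s\}}\beta(t-\zeta)\,d\zeta\,dt;$$ $I^{(\alpha)}\delta_x^2U_j^{n-1/2}$ means this expression with $W^m=\delta_x^2U_j^m$. Space operators, for $1\le j\le J-1$: $\Delta_xW_j=\frac{1}{2h}(W_{j+1}-W_{j-1})$, $\delta_x^2W_j=\frac{1}{h^2}(W_{j+1}-2W_j+W_{j-1})$, $\nabla W_j=\frac13(W_{j-1}+W_j+W_{j+1})$. $f^{n-1/2}$ denotes an approximation of $\frac1{k_n}\int_{t_{n-1}}^{t_n}f(\cdot,t)\,dt$, and $f_j^{n-1/2}$ is its value at $x_j$ (it is not the average $\frac12(f^n+f^{n-1})$ by definition, though that is one permissible choice). Norm: $\|w\|=\big(h\sum_{s=1}^{J-1}w_s^2\big)^{1/2}$ for grid functions; applied to a function of $x$, it is taken on its grid values $w_s=w(x_s)$. $C$ and $\mathcal M$ are positive constants independent of the step sizes. Standing assumption on $u$: $c_0=\max_{(x,t)\in[0,L]\times(0,T]}\{|u(x,t)|,|u_x(x,t)|\}$ is finite.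
   Formalization: For γ=2/σ it is assumed that t_N ≥ ρt_1 with a fixed ρ>1 on which C(T) may depend (for N=1 the logarithm is 0 and the claim fails); u^n∈C^4 is taken with a mesh-independent bound on the fourth x-derivative of u at the levels t_n, on which C(T) may depend. *)

theory Defs
  imports "HOL-Analysis.Analysis"
begin

section \<open>The continuous problem\<close>

definition beta_kernel :: "real \<Rightarrow> real \<Rightarrow> real" where
  "beta_kernel \<alpha> t = t powr (\<alpha> - 1) / Gamma \<alpha>"

definition frac_integral :: "real \<Rightarrow> (real \<Rightarrow> real) \<Rightarrow> real \<Rightarrow> real" where
  "frac_integral \<alpha> w t = integral {0..t} (\<lambda>\<zeta>. beta_kernel \<alpha> (t - \<zeta>) * w \<zeta>)"

text \<open>\<open>Ck_derivs k S w d\<close>: \<open>w\<close> is of class \<open>C\<^sup>k\<close> on \<open>S\<close>, and \<open>d i\<close> is its \<open>i\<close>-th derivative on \<open>S\<close>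
  (one-sided at the end points when \<open>S\<close> is a closed interval).\<close>

definition Ck_derivs ::
    "nat \<Rightarrow> real set \<Rightarrow> (real \<Rightarrow> real) \<Rightarrow> (nat \<Rightarrow> real \<Rightarrow> real) \<Rightarrow> bool" where
  "Ck_derivs k S w d \<longleftrightarrow>
     (\<forall>x\<in>S. d 0 x = w x) \<and>
     (\<forall>i<k. \<forall>x\<in>S. (d i has_real_derivative d (Suc i) x) (at x within S)) \<and>
     continuous_on S (d k)"

text \<open>Functions of space and time are written \<open>u x t\<close>. The functions \<open>ut\<close>, \<open>ux\<close>, \<open>uxx\<close> are the
  partial derivatives of \<open>u\<close>; only their values at the points listed below matter. Continuity of
  \<open>u x\<close> on the closed interval gives the initial condition its meaning as a limit, and the
  integrability condition that of the memory term.\<close>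

definition classical_solution ::
    "real \<Rightarrow> real \<Rightarrow> real \<Rightarrow> (real \<Rightarrow> real) \<Rightarrow> (real \<Rightarrow> real \<Rightarrow> real) \<Rightarrow>
     (real \<Rightarrow> real \<Rightarrow> real) \<Rightarrow> (real \<Rightarrow> real \<Rightarrow> real) \<Rightarrow> (real \<Rightarrow> real \<Rightarrow> real) \<Rightarrow>
     (real \<Rightarrow> real \<Rightarrow> real) \<Rightarrow> bool" where
  "classical_solution \<alpha> L T u0 f u ut ux uxx \<longleftrightarrow>
     (\<forall>x\<in>{0<..<L}. continuous_on {0..T} (u x)) \<and>
     (\<forall>x\<in>{0<..<L}. \<forall>t\<in>{0<..T}. (u x has_real_derivative ut x t) (at t within {0..T})) \<and>
     (\<forall>x\<in>{0..L}. \<forall>t\<in>{0<..T}. ((\<lambda>y. u y t) has_real_derivative ux x t) (at x within {0..L})) \<and>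
     (\<forall>x\<in>{0..L}. \<forall>t\<in>{0<..T}. ((\<lambda>y. ux y t) has_real_derivative uxx x t) (at x within {0..L})) \<and>
     (\<forall>t\<in>{0<..T}. continuous_on {0..L} (\<lambda>x. uxx x t)) \<and>
     (\<forall>x\<in>{0<..<L}. \<forall>t\<in>{0<..T}.
        (\<lambda>\<zeta>. beta_kernel \<alpha> (t - \<zeta>) * uxx x \<zeta>) absolutely_integrable_on {0..t}) \<and>
     (\<forall>x\<in>{0<..<L}. \<forall>t\<in>{0<..T}.
        ut x t + u x t * ux x t - frac_integral \<alpha> (uxx x) t = f x t) \<and>
     (\<forall>t\<in>{0<..T}. u 0 t = 0 \<and> u L t = 0) \<and>
     (\<forall>x\<in>{0..L}. u x 0 = u0 x)"

section \<open>Grids\<close>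

definition grid_pt :: "real \<Rightarrow> nat \<Rightarrow> nat \<Rightarrow> real" where
  "grid_pt L J j = real j * (L / real J)"

definition step :: "(nat \<Rightarrow> real) \<Rightarrow> nat \<Rightarrow> real" where
  "step t n = t n - t (n - 1)"

definition graded_mesh ::
    "real \<Rightarrow> real \<Rightarrow> real \<Rightarrow> real \<Rightarrow> real \<Rightarrow> nat \<Rightarrow> (nat \<Rightarrow> real) \<Rightarrow> bool" where
  "graded_mesh T \<gamma> Cg cg k N t \<longleftrightarrow>
     1 \<le> N \<and> 0 < k \<and> t 0 = 0 \<and> t N = T \<and>
     (\<forall>n\<in>{1..N}. t (n - 1) < t n) \<and>
     (\<forall>n\<in>{1..N}. step t n \<le> Cg * k * min 1 (t n powr (1 - 1 / \<gamma>))) \<and>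
     cg * k powr \<gamma> \<le> t 1 \<and>
     (\<forall>n\<in>{2..N}. t n \<le> Cg * t (n - 1)) \<and>
     (\<forall>n\<in>{2..<N}. 0 \<le> step t (n + 1) - step t n \<and>
        step t (n + 1) - step t n \<le> Cg * k\<^sup>2 * min 1 (t n powr (1 - 2 / \<gamma>)))"

definition grid_norm :: "real \<Rightarrow> nat \<Rightarrow> (nat \<Rightarrow> real) \<Rightarrow> real" where
  "grid_norm L J w = sqrt ((L / real J) * (\<Sum>s=1..J-1. (w s)\<^sup>2))"

definition fun_norm :: "real \<Rightarrow> nat \<Rightarrow> (real \<Rightarrow> real) \<Rightarrow> real" where
  "fun_norm L J g = grid_norm L J (\<lambda>s. g (grid_pt L J s))"

section \<open>Difference operators and the scheme\<close>

text \<open>Space operators act on grid functions \<open>w :: nat \<Rightarrow> real\<close> and are used only for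
  \<open>1 \<le> j \<le> J - 1\<close>; time operators act on sequences \<open>W :: nat \<Rightarrow> real\<close>, and their argument \<open>n \<ge> 1\<close>
  stands for the half-integer level \<open>n - 1/2\<close>. A double sequence \<open>U n j\<close> has the time level first.\<close>

definition central_diff :: "real \<Rightarrow> (nat \<Rightarrow> real) \<Rightarrow> nat \<Rightarrow> real" where
  "central_diff h w j = (w (j + 1) - w (j - 1)) / (2 * h)"

definition second_diff :: "real \<Rightarrow> (nat \<Rightarrow> real) \<Rightarrow> nat \<Rightarrow> real" where
  "second_diff h w j = (w (j + 1) - 2 * w j + w (j - 1)) / h\<^sup>2"

definition local_mean :: "(nat \<Rightarrow> real) \<Rightarrow> nat \<Rightarrow> real" where
  "local_mean w j = (w (j - 1) + w j + w (j + 1)) / 3"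

definition time_diff :: "(nat \<Rightarrow> real) \<Rightarrow> (nat \<Rightarrow> real) \<Rightarrow> nat \<Rightarrow> real" where
  "time_diff t W n = (W n - W (n - 1)) / step t n"

definition time_mean :: "(nat \<Rightarrow> real) \<Rightarrow> nat \<Rightarrow> real" where
  "time_mean W n = (W n + W (n - 1)) / 2"

definition quad_weight :: "real \<Rightarrow> (nat \<Rightarrow> real) \<Rightarrow> nat \<Rightarrow> nat \<Rightarrow> real" where
  "quad_weight \<alpha> t n s =
     1 / (step t n * step t s) *
     integral {t (n - 1)..t n}
       (\<lambda>\<tau>. integral {t (s - 1)..min \<tau> (t s)} (\<lambda>\<zeta>. beta_kernel \<alpha> (\<tau> - \<zeta>)))"

definition frac_quad :: "real \<Rightarrow> (nat \<Rightarrow> real) \<Rightarrow> (nat \<Rightarrow> real) \<Rightarrow> nat \<Rightarrow> real" where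
  "frac_quad \<alpha> t W n =
     quad_weight \<alpha> t n 1 * W 1 * step t 1 +
     (\<Sum>s=2..n. quad_weight \<alpha> t n s * time_mean W s * step t s)"

text \<open>\<open>fh n\<close> is the function of \<open>x\<close> that approximates the mean of the forcing term over the
  \<open>n\<close>-th time interval. The value of \<open>U 0\<close> at the two boundary nodes is left open; it does not
  enter the equations.\<close>

definition scheme_solution ::
    "real \<Rightarrow> real \<Rightarrow> nat \<Rightarrow> nat \<Rightarrow> (nat \<Rightarrow> real) \<Rightarrow> (real \<Rightarrow> real) \<Rightarrow> (nat \<Rightarrow> real \<Rightarrow> real) \<Rightarrow>
     (nat \<Rightarrow> nat \<Rightarrow> real) \<Rightarrow> bool" where
  "scheme_solution \<alpha> L J N t u0 fh U \<longleftrightarrow>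
     (let h = L / real J in
     (\<forall>j\<in>{1..J-1}.
        time_diff t (\<lambda>m. U m j) 1 + local_mean (U 1) j * central_diff h (U 1) j
        = frac_quad \<alpha> t (\<lambda>m. second_diff h (U m) j) 1 + fh 1 (grid_pt L J j)) \<and>
     (\<forall>n\<in>{2..N}. \<forall>j\<in>{1..J-1}.
        time_diff t (\<lambda>m. U m j) n
        + local_mean (\<lambda>i. time_mean (\<lambda>m. U m i) n) j
          * central_diff h (\<lambda>i. time_mean (\<lambda>m. U m i) n) j
        = frac_quad \<alpha> t (\<lambda>m. second_diff h (U m) j) n + fh n (grid_pt L J j)) \<and>
     (\<forall>j\<in>{1..J-1}. U 0 j = u0 (grid_pt L J j)) \<and>
     (\<forall>n\<in>{1..N}. U n 0 = 0 \<and> U n J = 0))"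

text \<open>The conditions on the choice of \<open>fh\<close>; \<open>ft\<close> and \<open>ftt\<close> are the first and second time
  derivatives of \<open>f\<close>.\<close>

definition forcing_approx ::
    "real \<Rightarrow> real \<Rightarrow> nat \<Rightarrow> nat \<Rightarrow> (nat \<Rightarrow> real) \<Rightarrow> (real \<Rightarrow> real \<Rightarrow> real) \<Rightarrow>
     (real \<Rightarrow> real \<Rightarrow> real) \<Rightarrow> (real \<Rightarrow> real \<Rightarrow> real) \<Rightarrow> (nat \<Rightarrow> real \<Rightarrow> real) \<Rightarrow> bool" where
  "forcing_approx Cf L J N t f ft ftt fh \<longleftrightarrow>
     fun_norm L J (\<lambda>x. fh 1 x * step t 1 - integral {t 0..t 1} (f x))
       \<le> Cf * integral {t 0..t 1} (\<lambda>s. s * fun_norm L J (\<lambda>x. ft x s)) \<and>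
     (\<forall>n\<in>{2..N}.
        fun_norm L J (\<lambda>x. fh n x * step t n - integral {t (n - 1)..t n} (f x))
        \<le> Cf * (step t n)\<^sup>2 * integral {t (n - 1)..t n} (\<lambda>s. fun_norm L J (\<lambda>x. ftt x s)))"

definition K_L :: "real \<Rightarrow> real \<Rightarrow> real \<Rightarrow> nat \<Rightarrow> (nat \<Rightarrow> real) \<Rightarrow> real" where
  "K_L \<gamma> \<sigma> k N t =
     (if \<gamma> < 2 / \<sigma> then k powr (\<gamma> * \<sigma>)
      else if \<gamma> = 2 / \<sigma> then k\<^sup>2 * ln (t N / t 1)
      else k\<^sup>2)"

end

theory Submission
  imports Defs
begin

text \<open>The proof is an energy argument for the error \<open>e = U - u\<close> on the space-time grid, together with a
bound of the sum of the truncation errors.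

Multiplied by the step, the scheme says that the increment \<open>U n - U (n - 1)\<close> equals a
memory term, a convection term and a forcing term, all of them evaluated at \<open>level U\<close>, which is the
end value on the first interval and the mean of the two end values on the later ones. The
equation of the error has the same form and is tested with \<open>level e\<close>. The memory term then
contributes a quadratic form with the weights \<open>mem_weight n s\<close>. Adding the transposed weights gives
second differences of \<open>\<bar>r\<bar> powr (\<alpha> + 1)\<close>, and this function is a positive mixture of the
functions \<open>1 - cos (r * l)\<close>; hence the form has the right sign (\<open>memory_form_nonneg\<close>) on every mesh.
The discrete convection term is orthogonal to its argument (\<open>grid_ip_convection_self\<close>), so that only
terms linear in \<open>u\<close> survive, and these cost \<open>2 * c0 * \<parallel>e\<parallel>\<^sup>2\<close> (\<open>grid_ip_convection_diff_ge\<close>). A discrete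
Gronwall inequality bounds the error by the sum of the residuals (\<open>error_bound_small_steps\<close>), provided
that the steps are small compared with \<open>1 / c0\<close>. When the mesh parameter \<open>k\<close> is bounded below, so is
\<open>K_L\<close>, and it is enough to know that \<open>U\<close> is bounded. This follows by testing the scheme with \<open>level U\<close>
itself, where the convection term disappears entirely (\<open>error_bound_stability\<close>).

The residual is found by integrating the differential equation over a time interval.
Its part in space is of order \<open>h\<^sup>2\<close> by Taylor expansion. The parts in time are sums over the mesh of
\<open>step t s ^ 3 * t s powr (\<sigma> - 3)\<close>, with separate contributions of the first and the last step; the
grading turns them into the three cases of \<open>K_L\<close> (\<open>mesh_error_le_K_L\<close>).

The memory term needs most care. On each interval the integrand is replaced by its mean value; this
differs from the integrand by a linear interpolation error, which is of second order, and by the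
slope times the distance to the midpoint, which is only of first order and has to be integrated
against the kernel. The resulting first moments are not small one by one, but their sums up to
level \<open>n\<close> increase with \<open>n\<close>, because the steps do not decrease (\<open>moment_sum_mono\<close>). Two summations
by parts then leave only second differences of \<open>u\<^sub>x\<^sub>x\<close> and one boundary term (\<open>sum_norm_moments_le\<close>).

The convection term needs pointwise control of \<open>u\<close> and \<open>u\<^sub>x\<close> in time, whereas the hypotheses speak of
\<open>u\<^sub>x\<^sub>x\<close> in the discrete norms. Bounds in these norms on all grids give bounds of the integral over
the interval, and \<open>u\<close> vanishes at both ends, so \<open>u\<close> and \<open>u\<^sub>x\<close> inherit the estimates
(\<open>sup_bound_of_grid_norm\<close>). The error of the midpoint rule for the product \<open>u u\<^sub>x\<close> contains
the product of two first increments; each of them is bounded by a quantity whose square has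
the size of a second difference, through an interpolation inequality of Landau type (\<open>increment_interpolation\<close>).\<close>

section \<open>The discrete L2 norm\<close>

definition grid_ip :: "real \<Rightarrow> nat \<Rightarrow> (nat \<Rightarrow> real) \<Rightarrow> (nat \<Rightarrow> real) \<Rightarrow> real" where
  "grid_ip L J v w = (L / real J) * (\<Sum>s=1..J-1. v s * w s)"

lemma grid_ip_add_right: "grid_ip L J c (\<lambda>s. v s + w s) = grid_ip L J c v + grid_ip L J c w"
  by (simp add: grid_ip_def algebra_simps sum.distrib)

lemma grid_ip_diff_right: "grid_ip L J c (\<lambda>s. v s - w s) = grid_ip L J c v - grid_ip L J c w"
  by (simp add: grid_ip_def algebra_simps sum_subtractf)

lemma grid_ip_scale_right: "grid_ip L J c (\<lambda>s. a * v s) = a * grid_ip L J c v"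
  by (simp add: grid_ip_def sum_distrib_left mult.left_commute)

lemma grid_ip_sum_right: "grid_ip L J c (\<lambda>s. \<Sum>i\<in>I. v i s) = (\<Sum>i\<in>I. grid_ip L J c (v i))"
  unfolding grid_ip_def sum_distrib_left by (rule sum.swap)

lemma grid_ip_cong:
  "(\<And>s. s \<in> {1..J-1} \<Longrightarrow> v s = v' s) \<Longrightarrow> (\<And>s. s \<in> {1..J-1} \<Longrightarrow> w s = w' s) \<Longrightarrow>
    grid_ip L J v w = grid_ip L J v' w'"
  unfolding grid_ip_def by (intro arg_cong2[where f="(*)"] sum.cong) auto

lemma grid_norm_cong:
  "(\<And>s. s \<in> {1..J-1} \<Longrightarrow> v s = w s) \<Longrightarrow> grid_norm L J v = grid_norm L J w"
  by (simp add: grid_norm_def)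

lemma grid_norm_L2: "0 < L \<Longrightarrow> grid_norm L J w = sqrt (L / real J) * L2_set w {1..J-1}"
  unfolding grid_norm_def L2_set_def by (rule real_sqrt_mult)

lemma grid_norm_nonneg [simp]: "0 < L \<Longrightarrow> 0 \<le> grid_norm L J w"
  by (simp add: grid_norm_L2 L2_set_nonneg)

lemma grid_norm_power2: "0 < L \<Longrightarrow> (grid_norm L J w)\<^sup>2 = grid_ip L J w w"
  unfolding grid_norm_def grid_ip_def
  by (subst real_sqrt_pow2) (auto intro!: divide_nonneg_nonneg mult_nonneg_nonneg sum_nonneg, simp add: power2_eq_square)

lemma grid_norm_zero [simp]: "grid_norm L J (\<lambda>s. 0) = 0"
  by (simp add: grid_norm_def)

lemma grid_norm_triangle:
  "0 < L \<Longrightarrow> grid_norm L J (\<lambda>s. v s + w s) \<le> grid_norm L J v + grid_norm L J w"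
  by (simp only: grid_norm_L2 flip: distrib_left) (intro mult_left_mono L2_set_triangle_ineq, simp)

lemma grid_norm_scale: "0 < L \<Longrightarrow> grid_norm L J (\<lambda>s. a * w s) = \<bar>a\<bar> * grid_norm L J w"
  by (simp only: grid_norm_L2 L2_set_def power_mult_distrib real_sqrt_mult real_sqrt_abs mult.left_commute
    flip: sum_distrib_left)

lemma grid_norm_minus: "grid_norm L J (\<lambda>s. - w s) = grid_norm L J w"
  by (simp add: grid_norm_def)

lemma grid_norm_diff:
  "0 < L \<Longrightarrow> grid_norm L J (\<lambda>s. v s - w s) \<le> grid_norm L J v + grid_norm L J w"
  using grid_norm_triangle[of L J v "\<lambda>s. - w s"] by (simp add: grid_norm_minus)

lemma grid_norm_sum:
  "0 < L \<Longrightarrow> grid_norm L J (\<lambda>s. \<Sum>i\<in>I. w i s) \<le> (\<Sum>i\<in>I. grid_norm L J (w i))"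
proof (induction I rule: infinite_finite_induct)
  case (insert i I)
  then show ?case
    using grid_norm_triangle[of L J "w i" "\<lambda>s. \<Sum>i\<in>I. w i s"] by simp
qed auto

lemma grid_ip_le_norm:
  assumes "0 < L" shows "grid_ip L J v w \<le> grid_norm L J v * grid_norm L J w"
proof -
  have "(\<Sum>s=1..J-1. v s * w s) \<le> (\<Sum>s=1..J-1. \<bar>v s\<bar> * \<bar>w s\<bar>)"
    by (intro sum_mono) (metis abs_ge_self abs_mult)
  also have "\<dots> \<le> L2_set v {1..J-1} * L2_set w {1..J-1}"
    by (rule L2_set_mult_ineq)
  finally have "grid_ip L J v w \<le> (L / real J) * (L2_set v {1..J-1} * L2_set w {1..J-1})"
    unfolding grid_ip_def using assms by (intro mult_left_mono) auto
  also have "\<dots> = sqrt (L / real J) * sqrt (L / real J) * (L2_set v {1..J-1} * L2_set w {1..J-1})"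
    using assms(1) by (simp only: real_sqrt_mult_self) simp
  also have "\<dots> = grid_norm L J v * grid_norm L J w"
    unfolding grid_norm_L2[OF assms] by (simp only: ac_simps)
  finally show ?thesis .
qed

lemma grid_norm_bounded:
  assumes "0 < L" "\<And>s. s \<in> {1..J-1} \<Longrightarrow> \<bar>w s\<bar> \<le> c" "0 \<le> c"
  shows "grid_norm L J w \<le> c * sqrt L"
proof (cases "J = 0")
  case False
  have "(\<Sum>s=1..J-1. (w s)\<^sup>2) \<le> (\<Sum>s=1..J-1. c\<^sup>2)"
    using assms by (intro sum_mono) (simp add: abs_le_square_iff[symmetric])
  also have "\<dots> \<le> real J * c\<^sup>2"
    by (simp add: mult_right_mono)
  finally have "(L / real J) * (\<Sum>s=1..J-1. (w s)\<^sup>2) \<le> (L / real J) * (real J * c\<^sup>2)"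
    using assms by (intro mult_left_mono) auto
  also have "\<dots> = L * c\<^sup>2" using False by simp
  finally have "grid_norm L J w \<le> sqrt (L * c\<^sup>2)"
    unfolding grid_norm_def by simp
  then show ?thesis using assms by (simp add: real_sqrt_mult mult.commute)
qed (use assms in \<open>simp add: grid_norm_def\<close>)

lemma abs_le_grid_norm:
  assumes "0 < L" "s \<in> {1..J-1}"
  shows "\<bar>w s\<bar> \<le> sqrt (real J / L) * grid_norm L J w"
proof -
  have "(w s)\<^sup>2 \<le> (\<Sum>s=1..J-1. (w s)\<^sup>2)"
    using assms by (intro member_le_sum) auto
  then have "\<bar>w s\<bar> \<le> L2_set w {1..J-1}"
    unfolding L2_set_def by (simp add: real_le_rsqrt)
  also have "\<dots> = sqrt (real J / L) * grid_norm L J w"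
    using assms by (simp add: grid_norm_L2 real_sqrt_divide)
  finally show ?thesis .
qed

text \<open>Testing against the vector itself reduces statements about grid functions to statements about
  real functions. In this way \<open>grid_norm_integral_le\<close> and \<open>grid_norm_mean_value\<close> transfer the
  integral triangle inequality and the mean value inequality.\<close>

lemma grid_norm_leI:
  assumes "0 < L" "0 \<le> R" "\<And>c. grid_ip L J c w \<le> grid_norm L J c * R"
  shows "grid_norm L J w \<le> R"
proof (rule ccontr)
  assume *: "\<not> ?thesis"
  have "(grid_norm L J w)\<^sup>2 \<le> grid_norm L J w * R"
    using assms(3)[of w] assms(1) by (simp add: grid_norm_power2)
  with * assms(2) show False
    by (auto simp: power2_eq_square not_le mult_le_cancel_left)
qed

lemma grid_norm_integral_le:
  fixes \<epsilon> :: "real \<Rightarrow> real"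
  assumes L: "0 < L" and y: "\<And>s. s \<in> {1..J-1} \<Longrightarrow> (y s) integrable_on S"
    and e: "\<epsilon> integrable_on S" and le: "\<And>\<tau>. \<tau> \<in> S \<Longrightarrow> grid_norm L J (\<lambda>s. y s \<tau>) \<le> \<epsilon> \<tau>"
  shows "grid_norm L J (\<lambda>s. integral S (y s)) \<le> integral S \<epsilon>"
proof (rule grid_norm_leI[OF L])
  show "0 \<le> integral S \<epsilon>"
    by (rule integral_nonneg[OF e]) (use le grid_norm_nonneg[OF L] order_trans in blast)
  fix c
  have "((\<lambda>\<tau>. grid_ip L J c (\<lambda>s. y s \<tau>)) has_integral grid_ip L J c (\<lambda>s. integral S (y s))) S"
    unfolding grid_ip_def
    by (intro has_integral_mult_right has_integral_sum) (use y in \<open>auto simp: integrable_integral\<close>)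
  moreover have "((\<lambda>\<tau>. grid_norm L J c * \<epsilon> \<tau>) has_integral grid_norm L J c * integral S \<epsilon>) S"
    using e by (intro has_integral_mult_right) auto
  ultimately show "grid_ip L J c (\<lambda>s. integral S (y s)) \<le> grid_norm L J c * integral S \<epsilon>"
  proof (rule has_integral_le)
    fix \<tau> assume "\<tau> \<in> S"
    then show "grid_ip L J c (\<lambda>s. y s \<tau>) \<le> grid_norm L J c * \<epsilon> \<tau>"
      using grid_ip_le_norm[OF L] mult_left_mono[OF le grid_norm_nonneg[OF L]] order_trans by blast
  qed
qed

lemma grid_ip_has_derivative:
  assumes "\<And>s. s \<in> {1..J-1} \<Longrightarrow> (y s has_real_derivative y' s) (at \<tau> within S)"
  shows "((\<lambda>\<tau>. grid_ip L J c (\<lambda>s. y s \<tau>)) has_real_derivative grid_ip L J c y') (at \<tau> within S)"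
  unfolding grid_ip_def by (intro DERIV_cmult DERIV_sum assms)

lemma grid_ip_continuous:
  assumes "\<And>s. s \<in> {1..J-1} \<Longrightarrow> continuous_on S (y s)"
  shows "continuous_on S (\<lambda>\<tau>. grid_ip L J c (\<lambda>s. y s \<tau>))"
  unfolding grid_ip_def by (intro continuous_intros) (auto intro: assms)

lemma grid_norm_mean_value:
  assumes L: "0 < L" and ab: "a \<le> b"
    and cont: "\<And>s. s \<in> {1..J-1} \<Longrightarrow> continuous_on {a..b} (y s)"
    and y': "\<And>s \<tau>. s \<in> {1..J-1} \<Longrightarrow> \<tau> \<in> {a<..<b} \<Longrightarrow> (y s has_real_derivative y' s \<tau>) (at \<tau>)"
    and contl: "continuous_on {a..b} \<Lambda>"
    and l': "\<And>\<tau>. \<tau> \<in> {a<..<b} \<Longrightarrow> (\<Lambda> has_real_derivative \<Lambda>' \<tau>) (at \<tau>)"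
    and le: "\<And>\<tau>. \<tau> \<in> {a<..<b} \<Longrightarrow> grid_norm L J (\<lambda>s. y' s \<tau>) \<le> \<Lambda>' \<tau>"
  shows "grid_norm L J (\<lambda>s. y s b - y s a) \<le> \<Lambda> b - \<Lambda> a"
proof (cases "a = b")
  case False
  with ab have ab: "a < b" by simp
  show ?thesis
  proof (rule grid_norm_leI[OF L])
    \<comment> \<open>the majorant is monotone because its derivative dominates a norm\<close>
    have pos: "0 \<le> \<Lambda>' \<tau>" if "\<tau> \<in> {a<..<b}" for \<tau>
      using le[OF that] grid_norm_nonneg[OF L] order_trans by blast
    obtain \<xi> where "a < \<xi>" "\<xi> < b" "\<Lambda> b - \<Lambda> a = \<Lambda>' \<xi> * (b - a)"
      by (rule mvt[OF ab contl, where f'="\<lambda>x h. \<Lambda>' x * h"]) (use l' in \<open>auto simp: has_field_derivative_def\<close>)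
    with pos ab show "0 \<le> \<Lambda> b - \<Lambda> a" by simp
    fix c
    let ?f = "\<lambda>\<tau>. grid_norm L J c * \<Lambda> \<tau> - grid_ip L J c (\<lambda>s. y s \<tau>)"
    let ?f' = "\<lambda>\<tau>. grid_norm L J c * \<Lambda>' \<tau> - grid_ip L J c (\<lambda>s. y' s \<tau>)"
    have "continuous_on {a..b} ?f"
      by (intro continuous_intros contl grid_ip_continuous cont)
    moreover have d: "(?f has_real_derivative ?f' \<tau>) (at \<tau>)" if "\<tau> \<in> {a<..<b}" for \<tau>
      by (intro DERIV_diff DERIV_cmult grid_ip_has_derivative l' y' that)
    ultimately obtain \<xi> where x: "a < \<xi>" "\<xi> < b" "?f b - ?f a = ?f' \<xi> * (b - a)"
      by (rule_tac mvt[OF ab, where f'="\<lambda>x h. ?f' x * h"]) (use d in \<open>auto simp: has_field_derivative_def\<close>)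
    have "0 \<le> ?f' \<xi>"
      using grid_ip_le_norm[OF L, of J c "\<lambda>s. y' s \<xi>"] mult_left_mono[OF le[of \<xi>] grid_norm_nonneg[OF L, of J c]] x(1,2)
      by simp
    with x(3) ab have "0 \<le> ?f b - ?f a" by simp
    then show "grid_ip L J c (\<lambda>s. y s b - y s a) \<le> grid_norm L J c * (\<Lambda> b - \<Lambda> a)"
      by (simp add: grid_ip_diff_right algebra_simps)
  qed
qed simp

section \<open>The kernel and positivity of the memory form\<close>

definition pow_kernel :: "real \<Rightarrow> real \<Rightarrow> real" where
  "pow_kernel p r = max 0 r powr p / Gamma (p + 1)"

lemma pow_kernel_nonpos [simp]: "r \<le> 0 \<Longrightarrow> pow_kernel p r = 0"
  by (simp add: pow_kernel_def max_def)

lemma pow_kernel_nonneg: "0 \<le> p \<Longrightarrow> 0 \<le> pow_kernel p r"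
  by (simp add: pow_kernel_def Gamma_real_nonneg)

lemma pow_kernel_mono: "0 \<le> p \<Longrightarrow> r \<le> s \<Longrightarrow> pow_kernel p r \<le> pow_kernel p s"
  unfolding pow_kernel_def by (intro divide_right_mono powr_mono2) (auto intro: Gamma_real_nonneg)

lemma pow_kernel_continuous: "0 < p \<Longrightarrow> continuous_on S (pow_kernel p)"
  unfolding pow_kernel_def
  by (intro continuous_intros continuous_on_powr') (auto simp: Gamma_eq_zero_iff nonpos_Ints_def)

lemma pow_kernel_eq_beta_kernel: "0 \<le> r \<Longrightarrow> pow_kernel p r = beta_kernel (p + 1) r"
  by (simp add: pow_kernel_def beta_kernel_def)

lemma pow_kernel_has_derivative:
  assumes "0 < p" "0 < r"
  shows "(pow_kernel p has_real_derivative beta_kernel p r) (at r)"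
proof -
  have G: "Gamma (p + 1) = p * Gamma p"
    using assms by (intro Gamma_plus1) (auto simp: nonpos_Ints_def)
  have "((\<lambda>r. r powr p / Gamma (p + 1)) has_real_derivative p * r powr (p - 1) / Gamma (p + 1)) (at r)"
    using assms by (intro DERIV_cdivide has_real_derivative_powr)
  then have "((\<lambda>r. r powr p / Gamma (p + 1)) has_real_derivative beta_kernel p r) (at r)"
    using assms by (simp add: beta_kernel_def G)
  moreover have "\<forall>\<^sub>F x in nhds r. x powr p / Gamma (p + 1) = pow_kernel p x"
    by (rule eventually_mono[OF eventually_nhds_in_open[of "{0<..}" r]])
       (use assms in \<open>simp_all add: pow_kernel_def max_def\<close>)
  ultimately show ?thesis
    by (simp cong: DERIV_cong_ev)
qed

lemma beta_kernel_nonneg: "0 < \<alpha> \<Longrightarrow> 0 \<le> beta_kernel \<alpha> r"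
  by (simp add: beta_kernel_def Gamma_real_nonneg)

lemma beta_kernel_antimono:
  "0 < \<alpha> \<Longrightarrow> \<alpha> < 1 \<Longrightarrow> 0 < r \<Longrightarrow> r \<le> s \<Longrightarrow> beta_kernel \<alpha> s \<le> beta_kernel \<alpha> r"
  unfolding beta_kernel_def by (intro divide_right_mono powr_mono2') (auto intro: Gamma_real_nonneg)

text \<open>The derivative of \<open>pow_kernel \<alpha>\<close> is the decreasing function \<open>beta_kernel \<alpha>\<close>.\<close>

lemma pow_kernel_increment_le:
  assumes "0 < \<alpha>" "\<alpha> < 1" "0 < r" "r \<le> s"
  shows "pow_kernel \<alpha> s - pow_kernel \<alpha> r \<le> (s - r) * beta_kernel \<alpha> r"
proof (cases "r = s")
  case False
  then obtain z where z: "r < z" "z < s" "pow_kernel \<alpha> s - pow_kernel \<alpha> r = (s - r) * beta_kernel \<alpha> z"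
    using MVT2[of r s "pow_kernel \<alpha>" "beta_kernel \<alpha>"] pow_kernel_has_derivative assms by force
  with assms beta_kernel_antimono[of \<alpha> r z] show ?thesis
    by (simp add: mult_left_mono)
qed simp

lemma pow_kernel_shift_has_integral:
  assumes p: "0 < p" and ab: "a \<le> b" "b \<le> T"
  shows "((\<lambda>\<zeta>. beta_kernel p (T - \<zeta>)) has_integral (pow_kernel p (T - a) - pow_kernel p (T - b))) {a..b}"
proof -
  have "((\<lambda>\<zeta>. beta_kernel p (T - \<zeta>)) has_integral (- pow_kernel p (T - b) - - pow_kernel p (T - a))) {a..b}"
  proof (rule fundamental_theorem_of_calculus_interior[OF ab(1)])
    show "continuous_on {a..b} (\<lambda>\<zeta>. - pow_kernel p (T - \<zeta>))"
      by (intro continuous_intros continuous_on_compose2[OF pow_kernel_continuous[OF p, of UNIV]]) auto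
    fix x assume "x \<in> {a<..<b}"
    then show "((\<lambda>\<zeta>. - pow_kernel p (T - \<zeta>)) has_vector_derivative beta_kernel p (T - x)) (at x)"
      using ab p unfolding has_real_derivative_iff_has_vector_derivative[symmetric]
      by (auto intro!: derivative_eq_intros DERIV_chain2[OF pow_kernel_has_derivative])
  qed
  then show ?thesis by simp
qed

lemma one_minus_cos_bound: "0 \<le> 1 - cos (x::real)" "1 - cos x \<le> 2" "1 - cos x \<le> x\<^sup>2 / 2"
proof -
  have "1 - cos x = 2 * (sin (x / 2))\<^sup>2"
    using cos_double_sin[of "x / 2"] by simp
  also have "\<dots> \<le> 2 * (x / 2)\<^sup>2"
    using abs_sin_x_le_abs_x[of "x / 2"] by (simp only: abs_le_square_iff)
  finally show "1 - cos x \<le> x\<^sup>2 / 2" by (simp add: power_divide)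
  show "1 - cos x \<le> 2" using cos_ge_minus_one[of x] by linarith
qed simp

text \<open>The integral over \<open>l\<close> is a positive multiple of \<open>\<bar>r\<bar> powr (\<alpha> + 1)\<close>, which is how this power is
  written as a mixture of the functions \<open>1 - cos (r * l)\<close>.\<close>

definition fourier_density :: "real \<Rightarrow> real \<Rightarrow> real \<Rightarrow> real" where
  "fourier_density \<alpha> r l = indicator {0<..} l * (l powr (- 2 - \<alpha>) * (1 - cos (r * l)))"

lemma fourier_density_measurable [measurable]: "fourier_density \<alpha> r \<in> borel_measurable borel"
  unfolding fourier_density_def by measurable

lemma fourier_density_integrable:
  assumes "0 < \<alpha>" "\<alpha> < 1"
  shows "integrable lborel (fourier_density \<alpha> r)"
proof -
  have 1: "(\<lambda>l. l powr (- \<alpha>)) absolutely_integrable_on {0..1}"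
    using assms by (intro nonnegative_absolutely_integrable_1 integrable_on_powr_from_0) auto
  have 2: "(\<lambda>l. l powr (- 2 - \<alpha>)) absolutely_integrable_on {1..}"
    using assms has_integral_powr_to_inf[of "- 2 - \<alpha>" 1]
    by (intro nonnegative_absolutely_integrable_1) (auto intro: has_integral_integrable)
  \<comment> \<open>\<open>1 - cos x \<le> x\<^sup>2 / 2\<close> makes the density integrable at \<open>0\<close>, and \<open>1 - cos x \<le> 2\<close> at infinity\<close>
  let ?G = "\<lambda>l. (r\<^sup>2 / 2) * (indicator {0..1} l * (l powr (- \<alpha>))) + 2 * (indicator {1..} l * (l powr (- 2 - \<alpha>)))"
  have "integrable lborel ?G"
    using 1 2 by (intro Bochner_Integration.integrable_add integrable_mult_right)
       (auto simp: set_integrable_def integrable_completion)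
  then show ?thesis
  proof (rule Bochner_Integration.integrable_bound)
    show "AE l in lborel. norm (fourier_density \<alpha> r l) \<le> norm (?G l)"
    proof (rule AE_I2)
      fix l :: real
      have G0: "0 \<le> ?G l" by (simp add: indicator_def)
      consider "l \<le> 0" | "0 < l" "l \<le> 1" | "1 < l" by linarith
      then have "fourier_density \<alpha> r l \<le> ?G l"
      proof cases
        case 1 then show ?thesis using G0 by (simp add: fourier_density_def)
      next
        case 2
        have "l powr (- 2 - \<alpha>) * (1 - cos (r * l)) \<le> l powr (- 2 - \<alpha>) * ((r * l)\<^sup>2 / 2)"
          by (intro mult_left_mono one_minus_cos_bound) auto
        also have "l powr (- 2 - \<alpha>) * ((r * l)\<^sup>2 / 2) = r\<^sup>2 / 2 * (l powr (- 2 - \<alpha>) * l powr 2)"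
          using 2 by (simp add: power_mult_distrib)
        also have "\<dots> = r\<^sup>2 / 2 * l powr (- \<alpha>)"
          by (simp flip: powr_add)
        finally show ?thesis using 2 by (simp add: fourier_density_def indicator_def add_increasing2)
      next
        case 3
        have "l powr (- 2 - \<alpha>) * (1 - cos (r * l)) \<le> l powr (- 2 - \<alpha>) * 2"
          by (intro mult_left_mono one_minus_cos_bound) auto
        then show ?thesis using 3 by (simp add: fourier_density_def indicator_def)
      qed
      moreover have "0 \<le> fourier_density \<alpha> r l"
        by (simp add: fourier_density_def one_minus_cos_bound)
      ultimately show "norm (fourier_density \<alpha> r l) \<le> norm (?G l)" using G0 by simp
    qed
  qed measurable
qed

text \<open>The substitution \<open>l / \<bar>r\<bar>\<close> for \<open>l\<close> removes \<open>r\<close> from the cosine and produces the power.\<close>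

lemma fourier_density_integral:
  assumes "0 < \<alpha>" "\<alpha> < 1"
  shows "integral\<^sup>L lborel (fourier_density \<alpha> r) = \<bar>r\<bar> powr (\<alpha> + 1) * integral\<^sup>L lborel (fourier_density \<alpha> 1)"
proof (cases "r = 0")
  case True
  have "fourier_density \<alpha> 0 = (\<lambda>l. 0)" by (simp add: fourier_density_def fun_eq_iff)
  with True show ?thesis by simp
next
  case False
  have "fourier_density \<alpha> r = fourier_density \<alpha> \<bar>r\<bar>"
    by (auto simp: fourier_density_def abs_if)
  then have "integral\<^sup>L lborel (fourier_density \<alpha> r) =
      \<bar>1 / \<bar>r\<bar>\<bar> *\<^sub>R (\<integral>l. fourier_density \<alpha> \<bar>r\<bar> (0 + 1 / \<bar>r\<bar> * l) \<partial>lborel)"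
    using False by (simp only: ) (rule lborel_integral_real_affine, simp)
  also have "(\<lambda>l. fourier_density \<alpha> \<bar>r\<bar> (0 + 1 / \<bar>r\<bar> * l)) = (\<lambda>l. \<bar>r\<bar> powr (\<alpha> + 2) * fourier_density \<alpha> 1 l)"
  proof
    fix l show "fourier_density \<alpha> \<bar>r\<bar> (0 + 1 / \<bar>r\<bar> * l) = \<bar>r\<bar> powr (\<alpha> + 2) * fourier_density \<alpha> 1 l"
    proof (cases "0 < l")
      case True
      have "(l / \<bar>r\<bar>) powr (- 2 - \<alpha>) = l powr (- 2 - \<alpha>) * \<bar>r\<bar> powr (\<alpha> + 2)"
      proof -
        have e: "- 2 - \<alpha> = - (\<alpha> + 2)" by simp
        show ?thesis using True False unfolding e powr_minus by (simp add: powr_divide) (simp add: field_simps)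
      qed
      with True False show ?thesis by (simp add: fourier_density_def)
    next
      case False
      then show ?thesis by (simp add: fourier_density_def zero_less_divide_iff)
    qed
  qed
  also have "\<bar>1 / \<bar>r\<bar>\<bar> *\<^sub>R (\<integral>l. \<bar>r\<bar> powr (\<alpha> + 2) * fourier_density \<alpha> 1 l \<partial>lborel) =
      (\<bar>r\<bar> powr (\<alpha> + 2) / \<bar>r\<bar> powr 1) * integral\<^sup>L lborel (fourier_density \<alpha> 1)"
    using False by (simp add: powr_one)
  also have "\<bar>r\<bar> powr (\<alpha> + 2) / \<bar>r\<bar> powr 1 = \<bar>r\<bar> powr (\<alpha> + 1)"
    unfolding powr_diff[symmetric] by (simp add: add.commute)
  finally show ?thesis .
qed

text \<open>The integrand is nonnegative and bounded below on \<open>{1..2}\<close>, where the cosine stays below \<open>cos 1\<close>.\<close>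

lemma fourier_density_integral_pos:
  assumes "0 < \<alpha>" "\<alpha> < 1"
  shows "0 < integral\<^sup>L lborel (fourier_density \<alpha> 1)"
proof -
  define m where "m = 2 powr (- 2 - \<alpha>) * (1 - cos (1::real))"
  have "cos (1::real) < cos 0" using pi_gt3 by (intro cos_monotone_0_pi) auto
  then have m: "0 < m" by (simp add: m_def)
  have "m * (integral\<^sup>L lborel (indicator {1..2::real} :: real \<Rightarrow> real)) \<le> integral\<^sup>L lborel (fourier_density \<alpha> 1)"
    unfolding integral_mult_right_zero[symmetric]
  proof (rule integral_mono)
    fix l :: real
    show "m * indicator {1..2} l \<le> fourier_density \<alpha> 1 l"
    proof (cases "l \<in> {1..2}")
      case True
      have "cos l \<le> cos 1" using True pi_gt3 by (intro cos_monotone_0_pi_le) auto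
      moreover have "2 powr (- 2 - \<alpha>) \<le> l powr (- 2 - \<alpha>)"
        using True assms by (intro powr_mono2') auto
      moreover have "0 \<le> 1 - cos (1::real)" by simp
      ultimately have "m \<le> l powr (- 2 - \<alpha>) * (1 - cos l)"
        unfolding m_def by (intro mult_mono) auto
      then show ?thesis using True by (simp add: fourier_density_def)
    qed (simp add: fourier_density_def one_minus_cos_bound)
  qed (use fourier_density_integrable[OF assms] in \<open>auto simp: integrable_mult_right\<close>)
  with m show ?thesis by simp
qed

text \<open>Since \<open>\<bar>r\<bar> powr (\<alpha> + 1)\<close> is a positive mixture of the functions \<open>1 - cos (r * l)\<close>, the second
  difference below is a mixture of products, one factor for each of the two intervals, and its
  quadratic form is a mixture of sums of two squares.\<close>

lemma abs_powr_second_difference_nonneg: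
  fixes a b \<phi> :: "'i \<Rightarrow> real"
  assumes \<alpha>: "0 < \<alpha>" "\<alpha> < 1"
  defines "\<Psi> \<equiv> \<lambda>r. \<bar>r\<bar> powr (\<alpha> + 1)"
  shows "0 \<le> (\<Sum>n\<in>I. \<Sum>s\<in>I. \<phi> n * \<phi> s * (\<Psi> (b n - a s) - \<Psi> (b n - b s) - \<Psi> (a n - a s) + \<Psi> (a n - b s)))"
proof -
  define K where "K = integral\<^sup>L lborel (fourier_density \<alpha> 1)"
  have K: "0 < K" unfolding K_def by (rule fourier_density_integral_pos[OF \<alpha>])
  let ?F = "fourier_density \<alpha>"
  let ?D = "\<lambda>n s l. ?F (b n - a s) l - ?F (b n - b s) l - ?F (a n - a s) l + ?F (a n - b s) l"
  note int = fourier_density_integrable[OF \<alpha>]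
  have Psi: "K * \<Psi> r = integral\<^sup>L lborel (?F r)" for r
    unfolding \<Psi>_def K_def fourier_density_integral[OF \<alpha>, of r] by simp
  have "K * (\<Sum>n\<in>I. \<Sum>s\<in>I. \<phi> n * \<phi> s * (\<Psi> (b n - a s) - \<Psi> (b n - b s) - \<Psi> (a n - a s) + \<Psi> (a n - b s)))
     = (\<Sum>n\<in>I. \<Sum>s\<in>I. \<phi> n * \<phi> s * (K * \<Psi> (b n - a s) - K * \<Psi> (b n - b s) - K * \<Psi> (a n - a s) + K * \<Psi> (a n - b s)))"
    by (simp add: sum_distrib_left algebra_simps)
  also have "\<dots> = (\<integral>l. (\<Sum>n\<in>I. \<Sum>s\<in>I. \<phi> n * \<phi> s * ?D n s l) \<partial>lborel)"
    unfolding Psi by (simp add: Bochner_Integration.integral_sum int)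
  also have "0 \<le> \<dots>"
  proof (rule Bochner_Integration.integral_nonneg)
    fix l :: real
    let ?C = "\<lambda>n. cos (b n * l) - cos (a n * l)" and ?S = "\<lambda>n. sin (b n * l) - sin (a n * l)"
    let ?w = "indicator {0<..} l * l powr (- 2 - \<alpha>)"
    have D: "?D n s l = ?w * (?C n * ?C s + ?S n * ?S s)" for n s
      by (simp add: fourier_density_def left_diff_distrib cos_diff) (simp add: algebra_simps)
    have "(\<Sum>n\<in>I. \<Sum>s\<in>I. \<phi> n * \<phi> s * ?D n s l) =
        ?w * (\<Sum>n\<in>I. \<Sum>s\<in>I. (\<phi> n * ?C n) * (\<phi> s * ?C s) + (\<phi> n * ?S n) * (\<phi> s * ?S s))"
      unfolding D sum_distrib_left by (intro sum.cong refl) (simp add: algebra_simps)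
    also have "\<dots> = ?w * ((\<Sum>n\<in>I. \<phi> n * ?C n)\<^sup>2 + (\<Sum>n\<in>I. \<phi> n * ?S n)\<^sup>2)"
      unfolding power2_eq_square sum_product by (simp add: sum.distrib)
    also have "0 \<le> \<dots>" by (intro mult_nonneg_nonneg) auto
    finally show "0 \<le> (\<Sum>n\<in>I. \<Sum>s\<in>I. \<phi> n * \<phi> s * ?D n s l)" .
  qed
  finally show ?thesis using K by (simp add: zero_le_mult_iff)
qed

section \<open>Quadrature weights of the memory term\<close>

lemma pow_kernel_has_derivative':
  assumes "0 < p" "r \<noteq> 0"
  shows "(pow_kernel (p + 1) has_real_derivative pow_kernel p r) (at r)"
proof (cases "0 < r")
  case True
  then show ?thesis
    using pow_kernel_has_derivative[of "p + 1" r] assms by (simp add: pow_kernel_eq_beta_kernel)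
next
  case False
  have "\<forall>\<^sub>F x in nhds r. 0 = pow_kernel (p + 1) x"
    by (rule eventually_mono[OF eventually_nhds_in_open[of "{..<0}" r]])
       (use assms False in \<open>simp_all add: pow_kernel_def max_def\<close>)
  moreover have "((\<lambda>_. 0) has_real_derivative pow_kernel p r) (at r)"
    using False by simp
  ultimately show ?thesis
    using DERIV_cong_ev[OF refl _ refl, of "\<lambda>_. 0" "pow_kernel (p + 1)"] by blast
qed

lemma pow_kernel_has_integral_left:
  assumes p: "0 < p" and ab: "a \<le> b"
  shows "((\<lambda>\<tau>. pow_kernel p (\<tau> - z)) has_integral (pow_kernel (p + 1) (b - z) - pow_kernel (p + 1) (a - z))) {a..b}"
proof (rule fundamental_theorem_of_calculus_interior_strong[of "{z}"])
  show "continuous_on {a..b} (\<lambda>\<tau>. pow_kernel (p + 1) (\<tau> - z))"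
    using p by (intro continuous_intros continuous_on_compose2[OF pow_kernel_continuous[of "p + 1" UNIV]]) auto
  fix x assume "x \<in> {a<..<b} - {z}"
  then have xz: "x - z \<noteq> 0" by simp
  have "((\<lambda>\<tau>. pow_kernel (p + 1) (\<tau> - z)) has_real_derivative pow_kernel p (x - z) * 1) (at x)"
    by (rule DERIV_chain2[where g="\<lambda>\<tau>. \<tau> - z" and x=x, OF pow_kernel_has_derivative'[OF p xz]])
      (auto intro!: derivative_eq_intros)
  then show "((\<lambda>\<tau>. pow_kernel (p + 1) (\<tau> - z)) has_vector_derivative pow_kernel p (x - z)) (at x)"
    by (simp add: has_real_derivative_iff_has_vector_derivative)
qed (use ab in auto)

lemma pow_kernel_has_integral_right:
  assumes p: "0 < p" and ab: "a \<le> b"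
  shows "((\<lambda>\<zeta>. pow_kernel p (z - \<zeta>)) has_integral (pow_kernel (p + 1) (z - a) - pow_kernel (p + 1) (z - b))) {a..b}"
proof -
  have "((\<lambda>\<zeta>. pow_kernel p (z - \<zeta>)) has_integral (- pow_kernel (p + 1) (z - b) - - pow_kernel (p + 1) (z - a))) {a..b}"
  proof (rule fundamental_theorem_of_calculus_interior_strong[of "{z}"])
    show "continuous_on {a..b} (\<lambda>\<zeta>. - pow_kernel (p + 1) (z - \<zeta>))"
      using p by (intro continuous_intros continuous_on_compose2[OF pow_kernel_continuous[of "p + 1" UNIV]]) auto
    fix x assume "x \<in> {a<..<b} - {z}"
    then have xz: "z - x \<noteq> 0" by simp
    have "((\<lambda>\<zeta>. pow_kernel (p + 1) (z - \<zeta>)) has_real_derivative pow_kernel p (z - x) * - 1) (at x)"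
      by (rule DERIV_chain2[where g="\<lambda>\<zeta>. z - \<zeta>" and x=x, OF pow_kernel_has_derivative'[OF p xz]])
        (auto intro!: derivative_eq_intros)
    from DERIV_minus[OF this]
    show "((\<lambda>\<zeta>. - pow_kernel (p + 1) (z - \<zeta>)) has_vector_derivative pow_kernel p (z - x)) (at x)"
      by (simp add: has_real_derivative_iff_has_vector_derivative)
  qed (use ab in auto)
  then show ?thesis by simp
qed

locale time_mesh =
  fixes \<alpha> :: real and t :: "nat \<Rightarrow> real" and N :: nat
  assumes \<alpha>: "0 < \<alpha>" "\<alpha> < 1" and N: "1 \<le> N" and t0: "t 0 = 0"
    and t_step: "\<And>n. n \<in> {1..N} \<Longrightarrow> t (n - 1) < t n"
begin

lemma t_mono: "m \<le> n \<Longrightarrow> n \<le> N \<Longrightarrow> t m \<le> t n"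
proof (induction n)
  case (Suc n)
  then show ?case using t_step[of "Suc n"] by (cases "m = Suc n") auto
qed simp

lemma t_strict_mono: "m < n \<Longrightarrow> n \<le> N \<Longrightarrow> t m < t n"
  using t_mono[of m "n - 1"] t_step[of n] by force

lemma t_nonneg: "n \<le> N \<Longrightarrow> 0 \<le> t n"
  using t_mono[of 0 n] t0 by simp

lemma t_pos: "1 \<le> n \<Longrightarrow> n \<le> N \<Longrightarrow> 0 < t n"
  using t_strict_mono[of 0 n] t0 by simp

lemma step_pos: "n \<in> {1..N} \<Longrightarrow> 0 < step t n"
  using t_step[of n] by (simp add: step_def)

lemma sum_step: "m \<le> n \<Longrightarrow> (\<Sum>s=Suc m..n. step t s) = t n - t m"
  by (induction n rule: dec_induct) (auto simp: step_def)

text \<open>The memory term integrated over the \<open>n\<close>-th time interval is the integral of its argument against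
  \<open>mem_kernel n\<close>; the positive part in \<open>pow_kernel\<close> lets this kernel vanish after \<open>t n\<close>.\<close>

definition mem_kernel :: "nat \<Rightarrow> real \<Rightarrow> real" where
  "mem_kernel n \<zeta> = pow_kernel \<alpha> (t n - \<zeta>) - pow_kernel \<alpha> (t (n - 1) - \<zeta>)"

text \<open>The integral of \<open>mem_kernel n\<close> over the \<open>s\<close>-th interval in closed form. Unlike the quadrature weights
  of the scheme it makes sense for all \<open>n\<close> and \<open>s\<close>, and it is zero for \<open>s > n\<close>, which allows the
  quadratic form to be extended to a full square of indices and symmetrised.\<close>

definition mem_weight :: "nat \<Rightarrow> nat \<Rightarrow> real" where
  "mem_weight n s = pow_kernel (\<alpha> + 1) (t n - t (s - 1)) - pow_kernel (\<alpha> + 1) (t n - t s)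
     - (pow_kernel (\<alpha> + 1) (t (n - 1) - t (s - 1)) - pow_kernel (\<alpha> + 1) (t (n - 1) - t s))"

lemma mem_kernel_continuous: "continuous_on S (mem_kernel n)"
  unfolding mem_kernel_def
  by (intro continuous_intros continuous_on_compose2[OF pow_kernel_continuous[OF \<alpha>(1), of UNIV]]) auto

lemma mem_kernel_nonneg: "n \<in> {1..N} \<Longrightarrow> 0 \<le> mem_kernel n \<zeta>"
  unfolding mem_kernel_def using \<alpha> t_step[of n] by (simp add: pow_kernel_mono)

lemma sum_mem_kernel: "0 \<le> \<zeta> \<Longrightarrow> (\<Sum>n=1..m. mem_kernel n \<zeta>) = pow_kernel \<alpha> (t m - \<zeta>)"
  by (induction m) (auto simp: mem_kernel_def t0)

lemma mem_weight_has_integral: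
  "s \<in> {1..N} \<Longrightarrow> (mem_kernel n has_integral mem_weight n s) {t (s - 1)..t s}"
  unfolding mem_kernel_def mem_weight_def
  by (intro has_integral_diff pow_kernel_has_integral_right \<alpha> less_imp_le t_step)

lemma mem_weight_nonneg: "s \<in> {1..N} \<Longrightarrow> n \<in> {1..N} \<Longrightarrow> 0 \<le> mem_weight n s"
  using has_integral_nonneg[OF mem_weight_has_integral] mem_kernel_nonneg by blast

lemma mem_weight_eq_0: "n < s \<Longrightarrow> s \<le> N \<Longrightarrow> mem_weight n s = 0"
  using t_mono[of n "s - 1"] t_mono[of n s] t_mono[of "n - 1" "s - 1"] t_mono[of "n - 1" s]
  by (simp add: mem_weight_def)

text \<open>The kernels telescope when they are summed over \<open>n\<close>.\<close>

lemma mem_weight_column_le: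
  assumes s: "s \<in> {1..N}"
  shows "(\<Sum>n=1..N. mem_weight n s) \<le> step t s * pow_kernel \<alpha> (t N)"
proof -
  have "((\<lambda>\<zeta>. \<Sum>n=1..N. mem_kernel n \<zeta>) has_integral (\<Sum>n=1..N. mem_weight n s)) {t (s - 1)..t s}"
    by (intro has_integral_sum mem_weight_has_integral s) auto
  moreover have "((\<lambda>\<zeta>. pow_kernel \<alpha> (t N)) has_integral step t s * pow_kernel \<alpha> (t N)) {t (s - 1)..t s}"
    using has_integral_const_real[of "pow_kernel \<alpha> (t N)" "t (s - 1)" "t s"] t_step[OF s]
    by (simp add: step_def)
  ultimately show ?thesis
  proof (rule has_integral_le)
    fix \<zeta> assume "\<zeta> \<in> {t (s - 1)..t s}"
    moreover have "0 \<le> t (s - 1)" using s by (intro t_nonneg) auto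
    ultimately have "0 \<le> \<zeta>" by simp
    then show "(\<Sum>n=1..N. mem_kernel n \<zeta>) \<le> pow_kernel \<alpha> (t N)"
      using \<alpha> sum_mem_kernel[of \<zeta> N] by (simp add: pow_kernel_mono)
  qed
qed

lemma quad_weight_eq:
  assumes "1 \<le> s" "s \<le> n" "n \<le> N"
  shows "step t n * step t s * quad_weight \<alpha> t n s = mem_weight n s"
proof -
  let ?g = "\<lambda>\<tau>. pow_kernel \<alpha> (\<tau> - t (s - 1)) - pow_kernel \<alpha> (\<tau> - t s)"
  have "integral {t (n - 1)..t n} (\<lambda>\<tau>. integral {t (s - 1)..min \<tau> (t s)} (\<lambda>\<zeta>. beta_kernel \<alpha> (\<tau> - \<zeta>)))
      = integral {t (n - 1)..t n} ?g"
  proof (rule Henstock_Kurzweil_Integration.integral_cong)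
    fix \<tau> assume "\<tau> \<in> {t (n - 1)..t n}"
    moreover have "t (s - 1) \<le> t (n - 1)" "t (s - 1) \<le> t s"
      using assms by (intro t_mono; simp)+
    ultimately have "t (s - 1) \<le> min \<tau> (t s)" by simp
    then have "integral {t (s - 1)..min \<tau> (t s)} (\<lambda>\<zeta>. beta_kernel \<alpha> (\<tau> - \<zeta>))
        = pow_kernel \<alpha> (\<tau> - t (s - 1)) - pow_kernel \<alpha> (\<tau> - min \<tau> (t s))"
      by (intro integral_unique pow_kernel_shift_has_integral \<alpha>) auto
    then show "integral {t (s - 1)..min \<tau> (t s)} (\<lambda>\<zeta>. beta_kernel \<alpha> (\<tau> - \<zeta>)) = ?g \<tau>"
      by (auto simp: min_def)
  qed
  also have "\<dots> = mem_weight n s"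
    unfolding mem_weight_def
    using has_integral_diff[OF pow_kernel_has_integral_left[OF \<alpha>(1), of "t (n - 1)" "t n" "t (s - 1)"]
        pow_kernel_has_integral_left[OF \<alpha>(1), of "t (n - 1)" "t n" "t s"]] t_step[of n] assms
    by (simp add: integral_unique)
  finally show ?thesis
    using step_pos[of n] step_pos[of s] assms by (simp add: quad_weight_def)
qed

text \<open>The form does not change when each weight is replaced by its mean with the transposed weight, and
  that mean is, up to a factor, a second difference of \<open>\<bar>r\<bar> powr (\<alpha> + 1)\<close>, by the next identities.\<close>

lemma memory_form_nonneg:
  assumes "m \<le> N"
  shows "0 \<le> (\<Sum>n=1..m. \<Sum>s=1..n. mem_weight n s * \<phi> n * \<phi> s)"
proof -
  define \<Psi> :: "real \<Rightarrow> real" where "\<Psi> = (\<lambda>r. \<bar>r\<bar> powr (\<alpha> + 1))"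
  let ?G = "Gamma (\<alpha> + 2)"
  have G: "0 < ?G" using \<alpha> by (intro Gamma_real_pos) auto
  \<comment> \<open>the powers of the positive and of the negative part add up to the power of the absolute value\<close>
  have pk: "pow_kernel (\<alpha> + 1) (x - y) = \<Psi> (x - y) / ?G - pow_kernel (\<alpha> + 1) (y - x)" for x y
    using \<alpha> by (auto simp: \<Psi>_def pow_kernel_def max_def abs_if add.assoc)
  have sym: "mem_weight n s + mem_weight s n = (\<Psi> (t n - t (s - 1)) - \<Psi> (t n - t s)
      - \<Psi> (t (n - 1) - t (s - 1)) + \<Psi> (t (n - 1) - t s)) / ?G" for n s
    unfolding mem_weight_def add_divide_distrib diff_divide_distrib
    using pk[of "t n" "t (s - 1)"] pk[of "t n" "t s"] pk[of "t (n - 1)" "t (s - 1)"] pk[of "t (n - 1)" "t s"]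
    by linarith
  let ?F = "\<lambda>n s. mem_weight n s * \<phi> n * \<phi> s"
  have "(\<Sum>n=1..m. \<Sum>s=1..n. ?F n s) = (\<Sum>n=1..m. \<Sum>s=1..m. ?F n s)"
    by (intro sum.cong refl sum.mono_neutral_left) (use assms in \<open>auto simp: mem_weight_eq_0\<close>)
  moreover have "(\<Sum>n=1..m. \<Sum>s=1..m. ?F n s) = (\<Sum>n=1..m. \<Sum>s=1..m. ?F s n)"
    by (rule sum.swap)
  moreover have "(\<Sum>n=1..m. \<Sum>s=1..m. ?F n s) + (\<Sum>n=1..m. \<Sum>s=1..m. ?F s n)
      = (\<Sum>n=1..m. \<Sum>s=1..m. ?F n s + ?F s n)"
    by (simp only: sum.distrib)
  moreover have "?F n s + ?F s n = \<phi> n * \<phi> s * (\<Psi> (t n - t (s - 1)) - \<Psi> (t n - t s)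
      - \<Psi> (t (n - 1) - t (s - 1)) + \<Psi> (t (n - 1) - t s)) / ?G" for n s
  proof -
    have "?F n s + ?F s n = \<phi> n * \<phi> s * (mem_weight n s + mem_weight s n)"
      by (simp add: distrib_left)
    then show ?thesis by (simp only: sym times_divide_eq_right)
  qed
  moreover have "0 \<le> (\<Sum>n=1..m. \<Sum>s=1..m. \<phi> n * \<phi> s * (\<Psi> (t n - t (s - 1)) - \<Psi> (t n - t s)
      - \<Psi> (t (n - 1) - t (s - 1)) + \<Psi> (t (n - 1) - t s)) / ?G)"
    using abs_powr_second_difference_nonneg[OF \<alpha>, of \<phi> t "\<lambda>n. t (n - 1)" "{1..m}"] G
    unfolding sum_divide_distrib[symmetric] \<Psi>_def by (intro divide_nonneg_pos)
  ultimately show ?thesis by simp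
qed

end

section \<open>First moments of the memory kernel\<close>

text \<open>Up to its sign, this is the first moment of \<open>pow_kernel \<alpha>\<close> about the midpoint of an interval of
  length \<open>w\<close> whose right end lies \<open>d\<close> before the time of evaluation (\<open>pow_kernel_midpoint_moment\<close>).
  The variable \<open>r\<close> is the distance to that end; \<open>r * (w - r) / 2\<close> is the antiderivative of
  \<open>w / 2 - r\<close> that vanishes at both ends.\<close>

definition peano_moment :: "real \<Rightarrow> real \<Rightarrow> real \<Rightarrow> real" where
  "peano_moment \<alpha> d w = integral {0..w} (\<lambda>r. r * (w - r) / 2 * beta_kernel \<alpha> (d + r))"

lemma absolutely_integrable_continuous_times:
  fixes f h :: "real \<Rightarrow> real"
  assumes "continuous_on {a..b} h" "f absolutely_integrable_on {a..b}"
  shows "(\<lambda>x. h x * f x) absolutely_integrable_on {a..b}"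
  by (intro absolutely_integrable_bounded_measurable_product_real
      continuous_imp_measurable_on_sets_lebesgue compact_imp_bounded compact_continuous_image assms) auto

context
  fixes \<alpha> :: real
  assumes \<alpha>: "0 < \<alpha>" "\<alpha> < 1"
begin

lemma beta_kernel_has_integral:
  assumes "0 \<le> d" "0 \<le> u"
  shows "((\<lambda>r. beta_kernel \<alpha> (d + r)) has_integral (pow_kernel \<alpha> (d + u) - pow_kernel \<alpha> d)) {0..u}"
proof -
  have "((\<lambda>r. beta_kernel \<alpha> (d + r)) has_integral (pow_kernel \<alpha> (d + u) - pow_kernel \<alpha> (d + 0))) {0..u}"
  proof (rule fundamental_theorem_of_calculus_interior)
    show "continuous_on {0..u} (\<lambda>r. pow_kernel \<alpha> (d + r))"
      using \<alpha> by (intro continuous_intros continuous_on_compose2[OF pow_kernel_continuous[of \<alpha> UNIV]]) auto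
    fix x assume x: "x \<in> {0<..<u}"
    have "((\<lambda>r. pow_kernel \<alpha> (d + r)) has_real_derivative beta_kernel \<alpha> (d + x) * 1) (at x)"
      by (rule DERIV_chain2[where g="\<lambda>r. d + r" and x=x, OF pow_kernel_has_derivative])
         (use x assms \<alpha> in \<open>auto intro!: derivative_eq_intros\<close>)
    then show "((\<lambda>r. pow_kernel \<alpha> (d + r)) has_vector_derivative beta_kernel \<alpha> (d + x)) (at x)"
      by (simp add: has_real_derivative_iff_has_vector_derivative)
  qed (use assms in auto)
  then show ?thesis by simp
qed

lemma beta_kernel_continuous_times_integrable:
  assumes "0 \<le> d" "0 \<le> u" "continuous_on {0..u} h"
  shows "(\<lambda>r. h r * beta_kernel \<alpha> (d + r)) integrable_on {0..u}"
proof -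
  have "(\<lambda>r. beta_kernel \<alpha> (d + r)) absolutely_integrable_on {0..u}"
    using beta_kernel_has_integral[OF assms(1,2)] \<alpha>
    by (intro nonnegative_absolutely_integrable_1) (auto simp: beta_kernel_nonneg)
  from absolutely_integrable_continuous_times[OF assms(3) this] show ?thesis
    by (rule set_lebesgue_integral_eq_integral(1))
qed

lemma peano_integrable:
  "0 \<le> d \<Longrightarrow> 0 \<le> u \<Longrightarrow> (\<lambda>r. r * (w - r) / 2 * beta_kernel \<alpha> (d + r)) integrable_on {0..u}"
  by (intro beta_kernel_continuous_times_integrable continuous_intros) auto

lemma peano_moment_nonneg:
  assumes "0 \<le> d" "0 \<le> w" shows "0 \<le> peano_moment \<alpha> d w"
  unfolding peano_moment_def
  using \<alpha> by (intro Henstock_Kurzweil_Integration.integral_nonneg peano_integrable assms) (auto simp: beta_kernel_nonneg)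

lemma peano_weight_le: "0 \<le> r \<Longrightarrow> r \<le> w \<Longrightarrow> w \<le> W \<Longrightarrow> r * (w - r) / 2 \<le> W\<^sup>2 / (8::real)"
proof -
  assume "0 \<le> r" "r \<le> w" "w \<le> W"
  have "r * (w - r) / 2 = w\<^sup>2 / 8 - (r - w / 2)\<^sup>2 / 2" by (simp add: power2_eq_square field_simps)
  also have "\<dots> \<le> w\<^sup>2 / 8" by simp
  also have "\<dots> \<le> W\<^sup>2 / 8" using \<open>0 \<le> r\<close> \<open>r \<le> w\<close> \<open>w \<le> W\<close> by (simp add: power_mono)
  finally show ?thesis .
qed

lemma peano_moment_le:
  assumes "0 \<le> d" "0 \<le> w" "w \<le> W"
  shows "peano_moment \<alpha> d w \<le> W\<^sup>2 / 8 * (pow_kernel \<alpha> (d + w) - pow_kernel \<alpha> d)"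
  unfolding peano_moment_def
proof (rule has_integral_le[OF integrable_integral[OF peano_integrable] has_integral_mult_right[OF beta_kernel_has_integral]])
  fix r assume "r \<in> {0..w}"
  then show "r * (w - r) / 2 * beta_kernel \<alpha> (d + r) \<le> W\<^sup>2 / 8 * beta_kernel \<alpha> (d + r)"
    using assms \<alpha> by (intro mult_right_mono peano_weight_le beta_kernel_nonneg) auto
qed (use assms in auto)

lemma peano_moment_antimono:
  assumes "0 \<le> d" "d \<le> d'" "0 \<le> w"
  shows "peano_moment \<alpha> d' w \<le> peano_moment \<alpha> d w"
  unfolding peano_moment_def
proof (rule integral_le[OF peano_integrable peano_integrable])
  fix r assume r: "r \<in> {0..w}"
  show "r * (w - r) / 2 * beta_kernel \<alpha> (d' + r) \<le> r * (w - r) / 2 * beta_kernel \<alpha> (d + r)"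
  \<comment> \<open>the kernel decreases only on positive arguments, as its value at \<open>0\<close> is \<open>0\<close>; for \<open>r = 0\<close> the
    factor \<open>r\<close> makes both sides vanish\<close>
  proof (cases "r = 0")
    case False
    with r assms \<alpha> show ?thesis by (intro mult_left_mono beta_kernel_antimono) auto
  qed simp
qed (use assms in auto)

text \<open>The difference of the two kernels is nonnegative, so the weight may be replaced by its maximum, and
  the kernels are then integrated exactly.\<close>

lemma peano_moment_diff_le:
  assumes d: "0 < d" "d \<le> d'" and w: "0 \<le> w" "w \<le> W"
  shows "peano_moment \<alpha> d w - peano_moment \<alpha> d' w
    \<le> W\<^sup>2 / 8 * ((pow_kernel \<alpha> (d + w) - pow_kernel \<alpha> d) - (pow_kernel \<alpha> (d' + w) - pow_kernel \<alpha> d'))"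
  unfolding peano_moment_def
proof (rule has_integral_le[OF has_integral_diff[OF integrable_integral[OF peano_integrable] integrable_integral[OF peano_integrable]]
      has_integral_mult_right[OF has_integral_diff[OF beta_kernel_has_integral beta_kernel_has_integral]]])
  fix r assume r: "r \<in> {0..w}"
  have "beta_kernel \<alpha> (d' + r) \<le> beta_kernel \<alpha> (d + r)"
    using r d \<alpha> by (intro beta_kernel_antimono) auto
  then have "r * (w - r) / 2 * (beta_kernel \<alpha> (d + r) - beta_kernel \<alpha> (d' + r))
      \<le> W\<^sup>2 / 8 * (beta_kernel \<alpha> (d + r) - beta_kernel \<alpha> (d' + r))"
    using r w by (intro mult_right_mono peano_weight_le) auto
  then show "r * (w - r) / 2 * beta_kernel \<alpha> (d + r) - r * (w - r) / 2 * beta_kernel \<alpha> (d' + r)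
      \<le> W\<^sup>2 / 8 * (beta_kernel \<alpha> (d + r) - beta_kernel \<alpha> (d' + r))"
    by (simp only: right_diff_distrib)
qed (use assms in auto)

text \<open>On \<open>{0<..w}\<close> the weight grows by \<open>r * (w' - w) / 2\<close> and the kernel is at least
  \<open>beta_kernel \<alpha> (d + w)\<close>; the rest of \<open>{0..w'}\<close> contributes a nonnegative amount.\<close>

lemma peano_moment_widen:
  assumes d: "0 \<le> d" and w: "0 < w" "w \<le> w'"
  shows "w\<^sup>2 / 4 * ((w' - w) * beta_kernel \<alpha> (d + w)) \<le> peano_moment \<alpha> d w' - peano_moment \<alpha> d w"
proof -
  let ?f = "\<lambda>w r. r * (w - r) / 2 * beta_kernel \<alpha> (d + r)"
  have "integral {0..w} (?f w') \<le> integral {0..w'} (?f w')"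
    using d w \<alpha> by (intro integral_subset_le peano_integrable) (auto simp: beta_kernel_nonneg)
  moreover have "w\<^sup>2 / 4 * ((w' - w) * beta_kernel \<alpha> (d + w)) \<le> integral {0..w} (?f w') - integral {0..w} (?f w)"
  proof -
    have "((\<lambda>r. r) has_integral w\<^sup>2 / 2) {0..w}"
      using ident_has_integral[of 0 w] w by simp
    then have "((\<lambda>r. r * ((w' - w) / 2 * beta_kernel \<alpha> (d + w))) has_integral
        w\<^sup>2 / 2 * ((w' - w) / 2 * beta_kernel \<alpha> (d + w))) {0..w}"
      by (rule has_integral_mult_left)
    moreover have "((\<lambda>r. ?f w' r - ?f w r) has_integral integral {0..w} (?f w') - integral {0..w} (?f w)) {0..w}"
      using d w by (intro has_integral_diff integrable_integral peano_integrable) auto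
    ultimately have "w\<^sup>2 / 2 * ((w' - w) / 2 * beta_kernel \<alpha> (d + w)) \<le> integral {0..w} (?f w') - integral {0..w} (?f w)"
    proof (rule has_integral_le)
      fix r assume r: "r \<in> {0..w}"
      show "r * ((w' - w) / 2 * beta_kernel \<alpha> (d + w)) \<le> ?f w' r - ?f w r"
      proof (cases "r = 0")
        case False
        have "r * (w' - w) / 2 * beta_kernel \<alpha> (d + w) \<le> r * (w' - w) / 2 * beta_kernel \<alpha> (d + r)"
          using r d w \<alpha> False by (intro mult_left_mono beta_kernel_antimono) auto
        also have "\<dots> = ?f w' r - ?f w r" by (simp add: field_simps)
        finally show ?thesis by simp
      qed simp
    qed
    then show ?thesis by (simp add: field_simps)
  qed
  ultimately show ?thesis unfolding peano_moment_def by linarith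
qed

text \<open>Integration by parts: the boundary terms vanish with the weight, and the derivative of \<open>pow_kernel \<alpha>\<close>
  is \<open>beta_kernel \<alpha>\<close>.\<close>

lemma pow_kernel_midpoint_moment:
  assumes ab: "a \<le> b" and T: "b \<le> T"
  shows "((\<lambda>\<zeta>. pow_kernel \<alpha> (T - \<zeta>) * (\<zeta> - (a + b) / 2)) has_integral - peano_moment \<alpha> (T - b) (b - a)) {a..b}"
proof -
  define d w where "d = T - b" and "w = b - a"
  let ?F = "\<lambda>r. r * (w - r) / 2 * pow_kernel \<alpha> (d + r)"
  let ?g = "\<lambda>r. (w / 2 - r) * pow_kernel \<alpha> (d + r)"
  have dw: "0 \<le> d" "0 \<le> w" using assms by (auto simp: d_def w_def)
  have cont: "continuous_on S (\<lambda>r. pow_kernel \<alpha> (d + r))" for S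
    using \<alpha> by (intro continuous_intros continuous_on_compose2[OF pow_kernel_continuous[of \<alpha> UNIV]]) auto
  have "((\<lambda>r. ?g r + r * (w - r) / 2 * beta_kernel \<alpha> (d + r)) has_integral ?F w - ?F 0) {0..w}"
  proof (rule fundamental_theorem_of_calculus_interior[OF dw(2)])
    show "continuous_on {0..w} ?F" by (intro continuous_intros cont) auto
    fix x assume x: "x \<in> {0<..<w}"
    have "((\<lambda>r. pow_kernel \<alpha> (d + r)) has_real_derivative beta_kernel \<alpha> (d + x) * 1) (at x)"
      by (rule DERIV_chain2[where g="\<lambda>r. d + r" and x=x, OF pow_kernel_has_derivative])
         (use x dw \<alpha> in \<open>auto intro!: derivative_eq_intros\<close>)
    moreover have "((\<lambda>r. r * (w - r) / 2) has_real_derivative w / 2 - x) (at x)"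
      by (auto intro!: derivative_eq_intros simp: field_simps)
    ultimately have "(?F has_real_derivative (w / 2 - x) * pow_kernel \<alpha> (d + x) + beta_kernel \<alpha> (d + x) * 1 * (x * (w - x) / 2)) (at x)"
      by (intro DERIV_mult)
    then show "(?F has_vector_derivative ?g x + x * (w - x) / 2 * beta_kernel \<alpha> (d + x)) (at x)"
      by (simp add: has_real_derivative_iff_has_vector_derivative mult.commute)
  qed
  from has_integral_diff[OF this integrable_integral[OF peano_integrable[OF dw, where w=w]]]
  have "(?g has_integral - peano_moment \<alpha> d w) {0..w}"
    by (simp add: peano_moment_def)
  from has_integral_affinity[of ?g _ 0 w "- 1" b] this
  have "((\<lambda>\<zeta>. ?g (- \<zeta> + b)) has_integral - peano_moment \<alpha> d w) ((\<lambda>x. b - x) ` {0..w})"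
    by simp
  also have "(\<lambda>x. b - x) ` {0..w} = {a..b}" by (simp add: w_def)
  also have "(\<lambda>\<zeta>. ?g (- \<zeta> + b)) = (\<lambda>\<zeta>. pow_kernel \<alpha> (T - \<zeta>) * (\<zeta> - (a + b) / 2))"
    by (simp add: fun_eq_iff d_def w_def field_simps)
  finally show ?thesis unfolding d_def w_def .
qed

end

section \<open>Summation of the first moments over a mesh with nondecreasing steps\<close>

context time_mesh
begin

text \<open>The offset \<open>d\<close> is what makes the induction of \<open>moment_sum_mono\<close> work: removing the last
  interval of the mesh turns its length into an offset.\<close>

definition moment_sum :: "real \<Rightarrow> nat \<Rightarrow> real" where
  "moment_sum d n = (\<Sum>s=2..n. peano_moment \<alpha> (d + (t n - t s)) (step t s))"

lemma moment_sum_Suc: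
  assumes "1 \<le> n"
  shows "moment_sum d (Suc n) = peano_moment \<alpha> d (step t (Suc n)) + moment_sum (d + step t (Suc n)) n"
proof -
  have "moment_sum d (Suc n) = (\<Sum>s=2..n. peano_moment \<alpha> (d + (t (Suc n) - t s)) (step t s)) + peano_moment \<alpha> d (step t (Suc n))"
    using assms by (simp add: moment_sum_def)
  also have "(\<lambda>s. d + (t (Suc n) - t s)) = (\<lambda>s. d + step t (Suc n) + (t n - t s))"
    by (simp add: step_def fun_eq_iff)
  finally show ?thesis by (simp add: moment_sum_def)
qed

lemma sum_pow_kernel_telescope:
  "1 \<le> n \<Longrightarrow> (\<Sum>s=2..n. pow_kernel \<alpha> (d + (t m - t s) + step t s) - pow_kernel \<alpha> (d + (t m - t s)))
     = pow_kernel \<alpha> (d + (t m - t 1)) - pow_kernel \<alpha> (d + (t m - t n))"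
proof (induction n rule: dec_induct)
  case (step k)
  have "d + (t m - t (Suc k)) + step t (Suc k) = d + (t m - t k)" by (simp add: step_def)
  then have "pow_kernel \<alpha> (d + (t m - t (Suc k)) + step t (Suc k)) = pow_kernel \<alpha> (d + (t m - t k))"
    by (simp only:)
  with step show ?case by simp
qed simp

text \<open>After the weight has been replaced by its maximum, the integrals of the kernel over the intervals
  add up to one integral.\<close>

lemma moment_sum_le:
  assumes n: "1 \<le> n" "n \<le> N" and W: "\<And>s. s \<in> {2..n} \<Longrightarrow> step t s \<le> W" and d: "0 \<le> d"
  shows "moment_sum d n \<le> W\<^sup>2 / 8 * (pow_kernel \<alpha> (d + (t n - t 1)) - pow_kernel \<alpha> d)"
proof -
  have "moment_sum d n \<le> (\<Sum>s=2..n. W\<^sup>2 / 8 * (pow_kernel \<alpha> (d + (t n - t s) + step t s) - pow_kernel \<alpha> (d + (t n - t s))))"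
    unfolding moment_sum_def
  proof (intro sum_mono peano_moment_le \<alpha>)
    fix s assume s: "s \<in> {2..n}"
    then show "0 \<le> d + (t n - t s)" using t_mono[of s n] n d by simp
    show "0 \<le> step t s" using step_pos[of s] s n by simp
  qed (rule W)
  also have "\<dots> = W\<^sup>2 / 8 * (pow_kernel \<alpha> (d + (t n - t 1)) - pow_kernel \<alpha> d)"
    unfolding sum_distrib_left[symmetric] sum_pow_kernel_telescope[OF n(1)] by simp
  finally show ?thesis .
qed

lemma moment_sum_nonneg:
  "n \<le> N \<Longrightarrow> 0 \<le> d \<Longrightarrow> 0 \<le> moment_sum d n"
  unfolding moment_sum_def
  by (intro sum_nonneg peano_moment_nonneg \<alpha> add_nonneg_nonneg) (auto intro: t_mono less_imp_le[OF step_pos])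

end

locale monotone_time_mesh = time_mesh +
  assumes step_mono: "\<And>n. n \<in> {2..<N} \<Longrightarrow> step t n \<le> step t (n + 1)"
begin

lemma step_le: "2 \<le> s \<Longrightarrow> s \<le> n \<Longrightarrow> n \<le> N \<Longrightarrow> step t s \<le> step t n"
proof (induction n)
  case (Suc n)
  then show ?case using step_mono[of n] by (cases "s = Suc n") auto
qed simp

text \<open>Going from \<open>n\<close> to \<open>n + 1\<close> widens every interval, counted backwards from the time of evaluation.
  Widening the nearest interval increases its own moment, by \<open>peano_moment_widen\<close>, and pushes the
  others away. As these are not longer, the loss, bounded by \<open>peano_moment_diff_le\<close> and telescoping,
  is at most half of the gain. The remaining intervals are treated by induction, with the length of
  the nearest one added to the offset.\<close>

lemma moment_sum_mono:
  "1 \<le> n \<Longrightarrow> Suc n \<le> N \<Longrightarrow> 0 \<le> d \<Longrightarrow> moment_sum d n \<le> moment_sum d (Suc n)"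
proof (induction n arbitrary: d rule: dec_induct)
  case base
  then show ?case using moment_sum_nonneg[of "Suc 1" d] by (simp add: moment_sum_def)
next
  case (step n)
  define w w' where "w = step t (Suc n)" and "w' = step t (Suc (Suc n))"
  have w: "0 < w" "w \<le> w'"
    using step_pos[of "Suc n"] step_mono[of "Suc n"] step by (auto simp: w_def w'_def)
  let ?D = "d + w" and ?D' = "d + w'"
  have "moment_sum ?D n - moment_sum ?D' n
      = (\<Sum>s=2..n. peano_moment \<alpha> (?D + (t n - t s)) (step t s) - peano_moment \<alpha> (?D' + (t n - t s)) (step t s))"
    by (simp add: moment_sum_def sum_subtractf)
  also have "\<dots> \<le> (\<Sum>s=2..n. w\<^sup>2 / 8 * ((pow_kernel \<alpha> (?D + (t n - t s) + step t s) - pow_kernel \<alpha> (?D + (t n - t s)))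
      - (pow_kernel \<alpha> (?D' + (t n - t s) + step t s) - pow_kernel \<alpha> (?D' + (t n - t s)))))"
  proof (intro sum_mono peano_moment_diff_le \<alpha>)
    fix s assume s: "s \<in> {2..n}"
    then have "t s \<le> t n" using t_mono[of s n] step by simp
    then show "0 < ?D + (t n - t s)" using w step by simp
    show "0 \<le> step t s" using step_pos[of s] s step by simp
    show "step t s \<le> w" unfolding w_def using step_le[of s "Suc n"] s step by simp
  qed (use w in simp)
  also have "\<dots> = w\<^sup>2 / 8 * ((pow_kernel \<alpha> (?D + (t n - t 1)) - pow_kernel \<alpha> ?D)
      - (pow_kernel \<alpha> (?D' + (t n - t 1)) - pow_kernel \<alpha> ?D'))"
    unfolding sum_distrib_left[symmetric] sum_subtractf sum_subtractf[symmetric, of "\<lambda>s. pow_kernel \<alpha> (_ + _ + _)"]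
    using sum_pow_kernel_telescope[OF step(1), of ?D n] sum_pow_kernel_telescope[OF step(1), of ?D' n]
    by (simp add: sum_subtractf)
  \<comment> \<open>the values at the far ends enter with the favourable sign, as \<open>pow_kernel \<alpha>\<close> is increasing\<close>
  also have "\<dots> \<le> w\<^sup>2 / 8 * (pow_kernel \<alpha> ?D' - pow_kernel \<alpha> ?D)"
    using w \<alpha> by (intro mult_left_mono) (auto simp: pow_kernel_mono)
  also have "\<dots> \<le> w\<^sup>2 / 8 * ((w' - w) * beta_kernel \<alpha> ?D)"
    using pow_kernel_increment_le[OF \<alpha>, of ?D ?D'] w step by (intro mult_left_mono) auto
  also have "\<dots> \<le> w\<^sup>2 / 4 * ((w' - w) * beta_kernel \<alpha> ?D)"
    using w \<alpha> by (intro mult_right_mono) (auto simp: beta_kernel_nonneg)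
  also have "\<dots> \<le> peano_moment \<alpha> d w' - peano_moment \<alpha> d w"
    using step w by (intro peano_moment_widen \<alpha>) auto
  finally have "peano_moment \<alpha> d w + moment_sum ?D n \<le> peano_moment \<alpha> d w' + moment_sum ?D' n"
    by simp
  also have "\<dots> \<le> peano_moment \<alpha> d w' + moment_sum ?D' (Suc n)"
    using step w by (intro add_left_mono step.IH) auto
  finally show ?case
    using moment_sum_Suc[of n d] moment_sum_Suc[of "Suc n" d] step by (simp add: w_def w'_def)
qed

end

lemma sum_by_parts:
  fixes D c :: "nat \<Rightarrow> real"
  assumes "2 \<le> n"
  shows "(\<Sum>s=2..n. D s * c s) = D n * (\<Sum>s=2..n. c s) - (\<Sum>i=2..n-1. (D (Suc i) - D i) * (\<Sum>s=2..i. c s))"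
  using assms
proof (induction n rule: dec_induct)
  case (step n)
  have "{2..Suc n - 1} = insert n {2..n-1}" using step by auto
  moreover have "n \<notin> {2..n-1}" using step by auto
  ultimately show ?case using step by (simp add: algebra_simps)
qed simp

text \<open>Abel summation: each coefficient is exchanged for the next one at the price \<open>\<Delta> i\<close>.\<close>

lemma sum_increments_le:
  fixes d P \<Delta> :: "nat \<Rightarrow> real"
  assumes "2 \<le> n" "P 1 = 0" "\<And>i. i \<in> {2..n} \<Longrightarrow> 0 \<le> P i"
    and d: "\<And>i. i \<in> {2..<n} \<Longrightarrow> d i \<le> d (Suc i) + \<Delta> i"
  shows "(\<Sum>i=2..n. d i * (P i - P (i - 1))) \<le> d n * P n + (\<Sum>i=2..n-1. \<Delta> i * P i)"
  using assms
proof (induction n rule: dec_induct)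
  case base
  then show ?case by simp
next
  case (step n)
  have "(\<Sum>i=2..n. d i * (P i - P (i - 1))) \<le> d n * P n + (\<Sum>i=2..n-1. \<Delta> i * P i)"
    by (rule step.IH) (use step in auto)
  moreover have "d n * P n \<le> (d (Suc n) + \<Delta> n) * P n"
    using step by (intro mult_right_mono) auto
  moreover have "(\<Sum>i=2..Suc n - 1. \<Delta> i * P i) = (\<Sum>i=2..n-1. \<Delta> i * P i) + \<Delta> n * P n"
  proof -
    have "{2..Suc n - 1} = insert n {2..n-1}" "n \<notin> {2..n-1}" using step by auto
    then show ?thesis by simp
  qed
  ultimately show ?case using step by (simp add: algebra_simps)
qed

context monotone_time_mesh
begin

definition moment_weight :: "nat \<Rightarrow> nat \<Rightarrow> real" where
  "moment_weight n s = (if s \<le> n then peano_moment \<alpha> (t n - t s) (step t s) else 0)"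

text \<open>The coefficients of the slopes \<open>D s\<close> do not have small absolute values, only small sums.
  Summation by parts in \<open>s\<close> replaces \<open>D\<close> by its increments and the coefficients by the differences
  of their partial sums at levels \<open>n\<close> and \<open>n - 1\<close>. The complete sums increase with \<open>n\<close>, by
  \<open>moment_sum_mono\<close>; the incomplete ones decrease, since the intervals move away from the time of
  evaluation. With the absolute values gone, the summation over \<open>n\<close> telescopes.\<close>

lemma sum_norm_moments_le:
  assumes L: "0 < L" and N2: "2 \<le> N"
  shows "(\<Sum>n=2..N. grid_norm L J (\<lambda>j. \<Sum>s=2..n. D s j * (moment_weight n s - moment_weight (n - 1) s)))
    \<le> pow_kernel \<alpha> (t N) / 8 * ((step t N)\<^sup>2 * grid_norm L J (D N)
        + 2 * (\<Sum>i=2..N-1. (step t i)\<^sup>2 * grid_norm L J (\<lambda>j. D (Suc i) j - D i j)))"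
proof -
  let ?nrm = "grid_norm L J"
  let ?\<Delta> = "\<lambda>i. ?nrm (\<lambda>j. D (Suc i) j - D i j)"
  define B where "B n i = (\<Sum>s=2..i. moment_weight n s)" for n i
  define P where "P n = B n n" for n
  have P: "P n = moment_sum 0 n" for n
    by (simp add: P_def B_def moment_sum_def moment_weight_def)
  have P0: "0 \<le> P n" if "n \<le> N" for n unfolding P using that by (intro moment_sum_nonneg) auto
  have P_le: "P n \<le> (step t n)\<^sup>2 * (pow_kernel \<alpha> (t N) / 8)" if n: "n \<in> {2..N}" for n
  proof -
    have "P n \<le> (step t n)\<^sup>2 / 8 * (pow_kernel \<alpha> (0 + (t n - t 1)) - pow_kernel \<alpha> 0)"
      unfolding P using n by (intro moment_sum_le step_le) auto
    also have "\<dots> \<le> (step t n)\<^sup>2 / 8 * pow_kernel \<alpha> (t N)"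
      using n t_mono[of n N] t_nonneg[of 1] N \<alpha> by (intro mult_left_mono) (auto intro!: pow_kernel_mono)
    finally show ?thesis by simp
  qed
  have mono: "P (n - 1) \<le> P n" if "n \<in> {2..N}" for n
    unfolding P using moment_sum_mono[of "n - 1" 0] that by (cases n) auto
  have Bmono: "B n i \<le> B (n - 1) i" if "n \<in> {2..N}" "i \<le> n - 1" for n i
    unfolding B_def
  proof (rule sum_mono)
    fix s assume s: "s \<in> {2..i}"
    then show "moment_weight n s \<le> moment_weight (n - 1) s"
      using that t_mono[of s "n - 1"] t_step[of n] step_pos[of s]
      by (auto simp: moment_weight_def intro!: peano_moment_antimono \<alpha>)
  qed
  have B0: "0 \<le> B n i" if "n \<le> N" "i \<le> n" for n i
    unfolding B_def
  proof (rule sum_nonneg)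
    fix s assume s: "s \<in> {2..i}"
    then show "0 \<le> moment_weight n s"
      using that t_mono[of s n] step_pos[of s] by (auto simp: moment_weight_def intro!: peano_moment_nonneg \<alpha>)
  qed
  \<comment> \<open>the last interval has no moment yet at level \<open>n - 1\<close>\<close>
  have complete: "B (n - 1) n = P (n - 1)" if "2 \<le> n" for n
    unfolding B_def P_def by (rule sum.mono_neutral_right) (use that in \<open>auto simp: moment_weight_def\<close>)
  have each: "?nrm (\<lambda>j. \<Sum>s=2..n. D s j * (moment_weight n s - moment_weight (n - 1) s))
      \<le> ?nrm (D n) * (P n - P (n - 1)) + (\<Sum>i=2..n-1. ?\<Delta> i * (B (n - 1) i - B n i))" if n: "n \<in> {2..N}" for n
  proof -
    have "(\<Sum>s=2..n. D s j * (moment_weight n s - moment_weight (n - 1) s))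
        = (P n - P (n - 1)) * D n j + (\<Sum>i=2..n-1. (B (n - 1) i - B n i) * (D (Suc i) j - D i j))" for j
      using n complete[of n]
      by (subst sum_by_parts) (auto simp: sum_subtractf B_def P_def sum_negf[symmetric] algebra_simps)
    then have "?nrm (\<lambda>j. \<Sum>s=2..n. D s j * (moment_weight n s - moment_weight (n - 1) s))
        = ?nrm (\<lambda>j. (P n - P (n - 1)) * D n j + (\<Sum>i=2..n-1. (B (n - 1) i - B n i) * (D (Suc i) j - D i j)))"
      by simp
    also have "\<dots> \<le> ?nrm (\<lambda>j. (P n - P (n - 1)) * D n j) + (\<Sum>i=2..n-1. ?nrm (\<lambda>j. (B (n - 1) i - B n i) * (D (Suc i) j - D i j)))"
      by (rule order_trans[OF grid_norm_triangle[OF L] add_left_mono[OF grid_norm_sum[OF L]]])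
    also have "\<dots> = \<bar>P n - P (n - 1)\<bar> * ?nrm (D n) + (\<Sum>i=2..n-1. \<bar>B (n - 1) i - B n i\<bar> * ?\<Delta> i)"
      by (simp add: grid_norm_scale[OF L])
    also have "\<dots> = ?nrm (D n) * (P n - P (n - 1)) + (\<Sum>i=2..n-1. ?\<Delta> i * (B (n - 1) i - B n i))"
      using mono[OF n] Bmono[OF n] by (intro arg_cong2[where f="(+)"] sum.cong) auto
    finally show ?thesis .
  qed
  have "(\<Sum>n=2..N. ?nrm (\<lambda>j. \<Sum>s=2..n. D s j * (moment_weight n s - moment_weight (n - 1) s)))
      \<le> (\<Sum>n=2..N. ?nrm (D n) * (P n - P (n - 1))) + (\<Sum>n=2..N. \<Sum>i=2..n-1. ?\<Delta> i * (B (n - 1) i - B n i))"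
    unfolding sum.distrib[symmetric] by (rule sum_mono[OF each])
  also have "(\<Sum>n=2..N. ?nrm (D n) * (P n - P (n - 1))) \<le> ?nrm (D N) * P N + (\<Sum>i=2..N-1. ?\<Delta> i * P i)"
  proof (rule sum_increments_le[OF N2])
    fix i
    have "?nrm (D i) = ?nrm (\<lambda>j. D (Suc i) j - (D (Suc i) j - D i j))" by simp
    also have "\<dots> \<le> ?nrm (D (Suc i)) + ?\<Delta> i" by (rule grid_norm_diff[OF L])
    finally show "?nrm (D i) \<le> ?nrm (D (Suc i)) + ?\<Delta> i" .
  qed (use P0 in \<open>auto simp: P moment_sum_def\<close>)
  also have "(\<Sum>n=2..N. \<Sum>i=2..n-1. ?\<Delta> i * (B (n - 1) i - B n i)) \<le> (\<Sum>i=2..N-1. ?\<Delta> i * P i)"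
  proof -
    let ?F = "\<lambda>n i. ?\<Delta> i * (B (n - 1) i - B n i)"
    have "(\<Sum>n=2..N. \<Sum>i=2..n-1. ?F n i) = (\<Sum>(n, i)\<in>(SIGMA n:{2..N}. {2..n-1}). ?F n i)"
      by (rule sum.Sigma) auto
    also have "\<dots> = (\<Sum>(i, n)\<in>(SIGMA i:{2..N-1}. {Suc i..N}). ?F n i)"
      by (rule sum.reindex_bij_witness[of _ "\<lambda>(i, n). (n, i)" "\<lambda>(n, i). (i, n)"]) auto
    also have "\<dots> = (\<Sum>i=2..N-1. \<Sum>n=Suc i..N. ?F n i)"
      by (rule sum.Sigma[symmetric]) auto
    also have "\<dots> \<le> (\<Sum>i=2..N-1. ?\<Delta> i * P i)"
    proof (rule sum_mono)
      fix i assume i: "i \<in> {2..N-1}"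
      have "i \<le> N" using i by auto
      then have "(\<Sum>n=Suc i..N. B (n - 1) i - B n i) = B i i - B N i"
        by (induction N rule: dec_induct) auto
      then have "(\<Sum>n=Suc i..N. B (n - 1) i - B n i) \<le> P i"
        using B0[of N i] \<open>i \<le> N\<close> by (simp add: P_def)
      then show "(\<Sum>n=Suc i..N. ?\<Delta> i * (B (n - 1) i - B n i)) \<le> ?\<Delta> i * P i"
        unfolding sum_distrib_left[symmetric] using L by (intro mult_left_mono) auto
    qed
    finally show ?thesis .
  qed
  also have "?nrm (D N) * P N + (\<Sum>i=2..N-1. ?\<Delta> i * P i) + (\<Sum>i=2..N-1. ?\<Delta> i * P i)
      \<le> ?nrm (D N) * ((step t N)\<^sup>2 * (pow_kernel \<alpha> (t N) / 8))
        + (\<Sum>i=2..N-1. ?\<Delta> i * ((step t i)\<^sup>2 * (pow_kernel \<alpha> (t N) / 8)))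
        + (\<Sum>i=2..N-1. ?\<Delta> i * ((step t i)\<^sup>2 * (pow_kernel \<alpha> (t N) / 8)))"
    using L N2 by (intro add_mono sum_mono mult_left_mono P_le) auto
  also have "\<dots> = pow_kernel \<alpha> (t N) / 8 * ((step t N)\<^sup>2 * ?nrm (D N)
        + 2 * (\<Sum>i=2..N-1. (step t i)\<^sup>2 * ?\<Delta> i))"
    by (simp add: sum_distrib_left algebra_simps)
  finally show ?thesis by simp
qed

end

section \<open>Functions with a weak singularity at the initial time\<close>

lemma powr_minus_integral:
  assumes "\<theta> < (1::real)" "0 \<le> b"
  shows "((\<lambda>\<zeta>. \<zeta> powr (- \<theta>)) has_integral (b powr (1 - \<theta>) / (1 - \<theta>))) {0..b}"
  using has_integral_powr_from_0[of "- \<theta>" b] assms by (simp add: add.commute[of "- \<theta>"])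

text \<open>The value at \<open>0\<close> is arbitrary; it does not affect integrability.\<close>

lemma weakly_singular_absolutely_integrable:
  fixes y :: "real \<Rightarrow> real"
  assumes "\<theta> < 1" "0 \<le> b" "continuous_on {0<..b} y" "\<And>\<zeta>. \<zeta> \<in> {0<..b} \<Longrightarrow> \<bar>y \<zeta>\<bar> \<le> K * \<zeta> powr (- \<theta>)"
  shows "y absolutely_integrable_on {0..b}"
proof -
  have "(\<lambda>\<zeta>. K * \<zeta> powr (- \<theta>)) absolutely_integrable_on {0..b}"
    using powr_minus_integral[OF assms(1,2)]
    by (intro absolutely_integrable_continuous_times nonnegative_absolutely_integrable_1) auto
  then have "(\<lambda>\<zeta>. K * \<zeta> powr (- \<theta>)) absolutely_integrable_on {0<..<b}"
    by (simp add: absolutely_integrable_on_Icc_iff_Ioo)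
  then have K: "(\<lambda>\<zeta>. K * \<zeta> powr (- \<theta>)) integrable_on {0<..<b}"
    by (rule set_lebesgue_integral_eq_integral(1))
  have "continuous_on {0<..<b} y"
    by (rule continuous_on_subset[OF assms(3)]) auto
  then have "y absolutely_integrable_on {0<..<b}"
    by (intro measurable_bounded_by_integrable_imp_absolutely_integrable[OF _ _ K])
       (use assms in \<open>auto intro!: continuous_imp_measurable_on_sets_lebesgue\<close>)
  then show ?thesis by (simp add: absolutely_integrable_on_Icc_iff_Ioo)
qed

lemma absolutely_integrable_imp_integrable_lborel:
  fixes g :: "real \<Rightarrow> real"
  assumes "g absolutely_integrable_on S" "(\<lambda>x. indicator S x * g x) \<in> borel_measurable borel"
  shows "integrable lborel (\<lambda>x. indicator S x * g x)" "(\<integral>x. indicator S x * g x \<partial>lborel) = integral S g"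
proof -
  show *: "integrable lborel (\<lambda>x. indicator S x * g x)"
    using assms by (simp add: set_integrable_def integrable_completion)
  show "(\<integral>x. indicator S x * g x \<partial>lborel) = integral S g"
    using set_borel_integral_eq_integral(2)[of S g] * by (simp add: set_integrable_def set_lebesgue_integral_def)
qed

text \<open>Interchanging the order of integration turns the time integral of the memory term into a
  convolution with the continuous kernel \<open>pow_kernel \<alpha>\<close>.\<close>

lemma frac_integral_has_integral:
  fixes y :: "real \<Rightarrow> real"
  assumes \<alpha>: "0 < \<alpha>" "\<alpha> < 1" and \<theta>: "\<theta> < 1" and b: "0 < b" and cont: "continuous_on {0<..b} y"
    and bound: "\<And>\<zeta>. \<zeta> \<in> {0<..b} \<Longrightarrow> \<bar>y \<zeta>\<bar> \<le> K * \<zeta> powr (- \<theta>)"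
    and conv: "\<And>\<tau>. \<tau> \<in> {0<..b} \<Longrightarrow> (\<lambda>\<zeta>. beta_kernel \<alpha> (\<tau> - \<zeta>) * y \<zeta>) absolutely_integrable_on {0..\<tau>}"
  shows "(frac_integral \<alpha> y has_integral integral {0..b} (\<lambda>\<zeta>. pow_kernel \<alpha> (b - \<zeta>) * y \<zeta>)) {0..b}"
proof -
  define Y where "Y = (\<lambda>\<zeta>. indicator {0<..b} \<zeta> *\<^sub>R y \<zeta>)"
  \<comment> \<open>the integrand on the triangle \<open>0 < \<zeta> < \<tau> \<le> b\<close>, extended by zero to the plane so that Fubini's
    theorem applies\<close>
  define F where "F = (\<lambda>\<zeta> \<tau>. (if \<zeta> < \<tau> \<and> \<tau> \<le> b then beta_kernel \<alpha> (\<tau> - \<zeta>) else 0) * Y \<zeta>)"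
  have Y[measurable]: "Y \<in> borel_measurable borel"
    unfolding Y_def by (rule borel_measurable_continuous_on_indicator[OF _ cont]) simp
  have F_meas: "case_prod F \<in> borel_measurable (lborel \<Otimes>\<^sub>M lborel)"
    unfolding F_def beta_kernel_def by measurable
  have core: "integrable lborel (\<lambda>\<tau>. if \<zeta> < \<tau> \<and> \<tau> \<le> b then beta_kernel \<alpha> (\<tau> - \<zeta>) else 0)"
    "(\<integral>\<tau>. (if \<zeta> < \<tau> \<and> \<tau> \<le> b then beta_kernel \<alpha> (\<tau> - \<zeta>) else 0) \<partial>lborel) = pow_kernel \<alpha> (b - \<zeta>)"
    if z: "\<zeta> \<le> b" for \<zeta>
  proof -
    have "((\<lambda>r. beta_kernel \<alpha> (0 + r)) has_integral (pow_kernel \<alpha> (0 + (b - \<zeta>)) - pow_kernel \<alpha> 0)) {0..b-\<zeta>}"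
      by (rule beta_kernel_has_integral[OF \<alpha>]) (use z in auto)
    from has_integral_shift_real_ivl[OF this, of "- \<zeta>"]
    have hi: "((\<lambda>\<tau>. beta_kernel \<alpha> (\<tau> - \<zeta>)) has_integral pow_kernel \<alpha> (b - \<zeta>)) {\<zeta>..b}"
      by simp
    then have ai: "(\<lambda>\<tau>. beta_kernel \<alpha> (\<tau> - \<zeta>)) absolutely_integrable_on {\<zeta>..b}"
      using \<alpha> by (intro nonnegative_absolutely_integrable_1) (auto simp: beta_kernel_nonneg)
    have eq: "(\<lambda>\<tau>. if \<zeta> < \<tau> \<and> \<tau> \<le> b then beta_kernel \<alpha> (\<tau> - \<zeta>) else 0)
        = (\<lambda>\<tau>. indicator {\<zeta>..b} \<tau> * beta_kernel \<alpha> (\<tau> - \<zeta>))"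
      by (auto simp: fun_eq_iff indicator_def beta_kernel_def)
    have m: "(\<lambda>\<tau>. indicator {\<zeta>..b} \<tau> * beta_kernel \<alpha> (\<tau> - \<zeta>)) \<in> borel_measurable borel"
      unfolding beta_kernel_def by measurable
    show "integrable lborel (\<lambda>\<tau>. if \<zeta> < \<tau> \<and> \<tau> \<le> b then beta_kernel \<alpha> (\<tau> - \<zeta>) else 0)"
      unfolding eq by (rule absolutely_integrable_imp_integrable_lborel[OF ai m])
    show "(\<integral>\<tau>. (if \<zeta> < \<tau> \<and> \<tau> \<le> b then beta_kernel \<alpha> (\<tau> - \<zeta>) else 0) \<partial>lborel) = pow_kernel \<alpha> (b - \<zeta>)"
      unfolding eq absolutely_integrable_imp_integrable_lborel(2)[OF ai m] by (rule integral_unique[OF hi])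
  qed
  have yai: "y absolutely_integrable_on {0..b}"
    by (rule weakly_singular_absolutely_integrable[OF \<theta> _ cont bound]) (use b in auto)
  have pkc: "continuous_on S (\<lambda>\<zeta>. pow_kernel \<alpha> (b - \<zeta>))" for S
    using \<alpha> by (intro continuous_intros continuous_on_compose2[OF pow_kernel_continuous[of \<alpha> UNIV]]) auto
  have pkY: "pow_kernel \<alpha> (b - \<zeta>) * Y \<zeta> = indicator {0<..<b} \<zeta> * (pow_kernel \<alpha> (b - \<zeta>) * y \<zeta>)" for \<zeta>
    by (auto simp: Y_def indicator_def)
  have ai: "(\<lambda>\<zeta>. pow_kernel \<alpha> (b - \<zeta>) * y \<zeta>) absolutely_integrable_on {0..b}"
    by (rule absolutely_integrable_continuous_times[OF pkc yai])
  have m[measurable]: "(\<lambda>\<zeta>. pow_kernel \<alpha> (b - \<zeta>) * Y \<zeta>) \<in> borel_measurable borel"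
    unfolding pow_kernel_def by measurable
  note pk_int = absolutely_integrable_imp_integrable_lborel[OF ai[unfolded absolutely_integrable_on_Icc_iff_Ioo],
      folded pkY, OF m]
  have F_int: "integrable lborel (F \<zeta>)" and F_val: "(\<integral>\<tau>. F \<zeta> \<tau> \<partial>lborel) = pow_kernel \<alpha> (b - \<zeta>) * Y \<zeta>"
    and F_norm: "(\<integral>\<tau>. norm (F \<zeta> \<tau>) \<partial>lborel) = norm (pow_kernel \<alpha> (b - \<zeta>) * Y \<zeta>)" for \<zeta>
  proof -
    have n: "norm (F \<zeta> \<tau>) = (if \<zeta> < \<tau> \<and> \<tau> \<le> b then beta_kernel \<alpha> (\<tau> - \<zeta>) else 0) * norm (Y \<zeta>)" for \<tau>
      using \<alpha> by (simp add: F_def abs_mult beta_kernel_nonneg)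
    show "integrable lborel (F \<zeta>)" "(\<integral>\<tau>. F \<zeta> \<tau> \<partial>lborel) = pow_kernel \<alpha> (b - \<zeta>) * Y \<zeta>"
      "(\<integral>\<tau>. norm (F \<zeta> \<tau>) \<partial>lborel) = norm (pow_kernel \<alpha> (b - \<zeta>) * Y \<zeta>)"
      using core[of \<zeta>] \<alpha> unfolding n
      by (cases "\<zeta> \<le> b"; simp add: F_def abs_mult pow_kernel_nonneg; simp add: Y_def)+
  qed
  have FI: "integrable (lborel \<Otimes>\<^sub>M lborel) (case_prod F)"
    by (rule lborel_pair.Fubini_integrable[OF F_meas])
       (use F_int F_norm integrable_norm[OF pk_int(1)] in \<open>auto\<close>)
  have swap: "(\<integral>\<tau>. (\<integral>\<zeta>. F \<zeta> \<tau> \<partial>lborel) \<partial>lborel) = integral {0..b} (\<lambda>\<zeta>. pow_kernel \<alpha> (b - \<zeta>) * y \<zeta>)"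
    using lborel_pair.Fubini_integral[OF FI] pk_int(2) by (simp add: F_val integral_open_interval_real)
  have inner: "(\<integral>\<zeta>. F \<zeta> \<tau> \<partial>lborel) = (if \<tau> \<in> {0..b} then frac_integral \<alpha> y \<tau> else 0)" for \<tau>
  proof (cases "\<tau> \<in> {0<..b}")
    case True
    have eq: "F \<zeta> \<tau> = indicator {0<..<\<tau>} \<zeta> * (beta_kernel \<alpha> (\<tau> - \<zeta>) * y \<zeta>)" for \<zeta>
      using True by (auto simp: F_def Y_def indicator_def)
    have m: "(\<lambda>\<zeta>. F \<zeta> \<tau>) \<in> borel_measurable borel"
      unfolding F_def beta_kernel_def by measurable
    have "(\<integral>\<zeta>. F \<zeta> \<tau> \<partial>lborel) = integral {0<..<\<tau>} (\<lambda>\<zeta>. beta_kernel \<alpha> (\<tau> - \<zeta>) * y \<zeta>)"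
      using absolutely_integrable_imp_integrable_lborel(2)[OF conv[OF True, unfolded absolutely_integrable_on_Icc_iff_Ioo], folded eq, OF m] .
    then show ?thesis using True by (simp add: frac_integral_def integral_open_interval_real)
  next
    case False
    then have "F \<zeta> \<tau> = 0" for \<zeta> by (auto simp: F_def Y_def indicator_def)
    then show ?thesis using False by (auto simp: frac_integral_def)
  qed
  have "((\<lambda>\<tau>. (\<integral>\<zeta>. F \<zeta> \<tau> \<partial>lborel)) has_integral (\<integral>\<tau>. (\<integral>\<zeta>. F \<zeta> \<tau> \<partial>lborel) \<partial>lborel)) UNIV"
    by (rule has_integral_integral_lborel[OF lborel_pair.integrable_snd[OF FI]])
  then have "((\<lambda>\<tau>. if \<tau> \<in> {0..b} then frac_integral \<alpha> y \<tau> else 0) has_integral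
      integral {0..b} (\<lambda>\<zeta>. pow_kernel \<alpha> (b - \<zeta>) * y \<zeta>)) UNIV"
    unfolding swap unfolding inner .
  then show ?thesis by (simp only: has_integral_restrict_UNIV)
qed

section \<open>Energy estimates for the difference scheme\<close>

definition convection :: "real \<Rightarrow> (nat \<Rightarrow> real) \<Rightarrow> nat \<Rightarrow> real" where
  "convection h w j = local_mean w j * central_diff h w j"

lemma sum_by_parts_grid:
  fixes d v :: "nat \<Rightarrow> real"
  shows "(\<Sum>j=1..n. (d j - d (j - 1)) * v j) = d n * v (Suc n) - d 0 * v 0 - (\<Sum>i\<le>n. d i * (v (Suc i) - v i))"
  by (induction n) (auto simp: algebra_simps)

text \<open>The average \<open>local_mean\<close> is chosen such that \<open>w\<close> times the convection term is a difference of
  neighbouring fluxes, and the fluxes vanish at the ends.\<close>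

lemma grid_ip_convection_self:
  assumes "w 0 = 0" "w J = 0" "1 \<le> J"
  shows "grid_ip L J w (convection h w) = 0"
proof -
  \<comment> \<open>\<open>6 * h\<close> times the flux between the nodes \<open>j\<close> and \<open>j + 1\<close>\<close>
  define a where "a j = (w j)\<^sup>2 * w (Suc j) + (w (Suc j))\<^sup>2 * w j" for j
  have "w j * convection h w j = (a j - a (j - 1)) * (1 / (6 * h))" if j: "j \<in> {1..J-1}" for j
  proof -
    obtain i where "j = Suc i" using j by (auto simp: Suc_le_eq gr0_conv_Suc)
    then show ?thesis
      by (simp add: convection_def local_mean_def central_diff_def a_def power2_eq_square field_simps)
  qed
  then have "(\<Sum>j=1..J-1. w j * convection h w j) = (\<Sum>j=1..J-1. (a j - a (j - 1)) * (1 / (6 * h)))"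
    by (rule sum.cong[OF refl])
  also have "\<dots> = (a (J - 1) - a 0) * (1 / (6 * h))"
    unfolding sum_by_parts_grid[where v="\<lambda>_. 1 / (6 * h)"] by (simp add: algebra_simps diff_divide_distrib)
  also have "\<dots> = 0" using assms by (simp add: a_def)
  finally show ?thesis by (simp add: grid_ip_def)
qed

text \<open>The part that is quadratic in \<open>e\<close> is orthogonal to \<open>e\<close>, so that no bound of \<open>e\<close> enters. Of the two
  linear parts, one has the difference quotient of \<open>v\<close> as a factor, and the other one gets it by
  summation by parts.\<close>

lemma grid_ip_convection_diff_ge:
  assumes L: "0 < L" and J: "1 \<le> J" and e: "e 0 = 0" "e J = 0" and c: "0 \<le> c"
    and v: "\<And>j. j < J \<Longrightarrow> \<bar>v (Suc j) - v j\<bar> \<le> c * (L / real J)"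
  shows "- (2 * c * (grid_norm L J e)\<^sup>2)
    \<le> grid_ip L J e (\<lambda>j. convection (L / real J) (\<lambda>i. v i + e i) j - convection (L / real J) v j)"
proof -
  define h where "h = L / real J"
  have h: "0 < h" using L J by (simp add: h_def)
  define S where "S = (\<Sum>j=1..J-1. (e j)\<^sup>2)"
  define p where "p j = e j * e (Suc j)" for j
  have expand: "convection h (\<lambda>i. v i + e i) j - convection h v j
      = local_mean v j * central_diff h e j + local_mean e j * central_diff h v j + convection h e j" for j
    by (simp add: convection_def local_mean_def central_diff_def add_divide_distrib diff_divide_distrib algebra_simps)
  have shift_sum: "(\<Sum>j=1..J-1. (e (Suc j))\<^sup>2) \<le> S" "(\<Sum>j=1..J-1. (e (j - 1))\<^sup>2) \<le> S"
  proof -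
    have "(\<Sum>j=1..J-1. (e (Suc j))\<^sup>2) = (\<Sum>j=2..J. (e j)\<^sup>2)"
      by (rule sum.reindex_bij_witness[of _ "\<lambda>j. j - 1" Suc]) (use J in auto)
    also have "\<dots> = (\<Sum>j\<in>{2..J} - {J}. (e j)\<^sup>2)"
      by (rule sum.mono_neutral_right) (use e in auto)
    also have "\<dots> \<le> S" unfolding S_def by (rule sum_mono2) auto
    finally show "(\<Sum>j=1..J-1. (e (Suc j))\<^sup>2) \<le> S" .
    have "(\<Sum>j=1..J-1. (e (j - 1))\<^sup>2) = (\<Sum>j\<in>{..<J-1}. (e j)\<^sup>2)"
      by (rule sum.reindex_bij_witness[of _ Suc "\<lambda>j. j - 1"]) auto
    also have "\<dots> = (\<Sum>j\<in>{..<J-1} - {0}. (e j)\<^sup>2)"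
      by (rule sum.mono_neutral_right) (use e in auto)
    also have "\<dots> \<le> S" unfolding S_def by (rule sum_mono2) auto
    finally show "(\<Sum>j=1..J-1. (e (j - 1))\<^sup>2) \<le> S" .
  qed
  \<comment> \<open>products of values at neighbouring nodes are split into squares\<close>
  have ab: "\<bar>x * y\<bar> \<le> (x\<^sup>2 + y\<^sup>2) / 2" for x y :: real
    using sum_squares_bound[of "\<bar>x\<bar>" "\<bar>y\<bar>"] by (simp add: abs_mult)
  have 1: "- (c * S) \<le> (\<Sum>j=1..J-1. e j * (local_mean e j * central_diff h v j))"
  proof -
    have "- (\<Sum>j=1..J-1. e j * (local_mean e j * central_diff h v j))
        \<le> (\<Sum>j=1..J-1. c / 3 * (2 * (e j)\<^sup>2 + (e (j - 1))\<^sup>2 / 2 + (e (Suc j))\<^sup>2 / 2))"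
      unfolding sum_negf[symmetric]
    proof (rule sum_mono)
      fix j assume j: "j \<in> {1..J-1}"
      have "\<bar>v (j + 1) - v (j - 1)\<bar> \<le> 2 * c * h"
      proof -
        have "j < J" "j - 1 < J" "Suc (j - 1) = j" using j by auto
        then show ?thesis using v[of j] v[of "j - 1"] by (simp add: h_def)
      qed
      then have cd: "\<bar>central_diff h v j\<bar> \<le> c"
        using h by (simp add: central_diff_def abs_divide divide_le_eq ac_simps)
      have "\<bar>e j * local_mean e j\<bar> \<le> (2 * (e j)\<^sup>2 + (e (j - 1))\<^sup>2 / 2 + (e (Suc j))\<^sup>2 / 2) / 3"
      proof -
        have "\<bar>x + y + z\<bar> \<le> \<bar>x\<bar> + y + \<bar>z\<bar>" if "0 \<le> y" for x y z :: real
          using that by linarith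
        from this[of "e j * e j" "e j * e (j - 1)" "e j * e (Suc j)"]
          ab[of "e j" "e (j - 1)"] ab[of "e j" "e (Suc j)"]
        show ?thesis
          unfolding local_mean_def by (simp add: power2_eq_square distrib_left)
      qed
      then have "\<bar>e j * local_mean e j\<bar> * \<bar>central_diff h v j\<bar> \<le> (2 * (e j)\<^sup>2 + (e (j - 1))\<^sup>2 / 2 + (e (Suc j))\<^sup>2 / 2) / 3 * c"
        using cd by (intro mult_mono) auto
      then show "- (e j * (local_mean e j * central_diff h v j)) \<le> c / 3 * (2 * (e j)\<^sup>2 + (e (j - 1))\<^sup>2 / 2 + (e (Suc j))\<^sup>2 / 2)"
        unfolding abs_mult[symmetric] using abs_ge_minus_self[of "e j * local_mean e j * central_diff h v j"]
        by (simp add: mult.assoc mult.commute[of c])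
    qed
    also have "\<dots> = c / 3 * (2 * S + (\<Sum>j=1..J-1. (e (j - 1))\<^sup>2) / 2 + (\<Sum>j=1..J-1. (e (Suc j))\<^sup>2) / 2)"
      unfolding sum_distrib_left[symmetric] S_def by (simp add: sum.distrib sum_divide_distrib sum_distrib_left)
    also have "\<dots> \<le> c / 3 * (2 * S + S / 2 + S / 2)"
      using c shift_sum by (intro mult_left_mono) auto
    finally show ?thesis by simp
  qed
  have 2: "- (c * S) \<le> (\<Sum>j=1..J-1. e j * (local_mean v j * central_diff h e j))"
  proof -
    have "(\<Sum>j=1..J-1. e j * (local_mean v j * central_diff h e j)) = (\<Sum>j=1..J-1. (p j - p (j - 1)) * (local_mean v j / (2 * h)))"
    proof (rule sum.cong[OF refl])
      fix j assume "j \<in> {1..J-1}"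
      then obtain i where "j = Suc i" by (auto simp: Suc_le_eq gr0_conv_Suc)
      then show "e j * (local_mean v j * central_diff h e j) = (p j - p (j - 1)) * (local_mean v j / (2 * h))"
        by (simp add: central_diff_def p_def algebra_simps diff_divide_distrib)
    qed
    also have "\<dots> = - (\<Sum>i\<le>J-1. p i * (local_mean v (Suc i) / (2 * h) - local_mean v i / (2 * h)))"
      unfolding sum_by_parts_grid[where d=p and v="\<lambda>j. local_mean v j / (2 * h)"] using e J by (simp add: p_def)
    finally have parts: "(\<Sum>j=1..J-1. e j * (local_mean v j * central_diff h e j))
      = - (\<Sum>i\<le>J-1. p i * (local_mean v (Suc i) / (2 * h) - local_mean v i / (2 * h)))" .
    have "(\<Sum>i\<le>J-1. p i * (local_mean v (Suc i) / (2 * h) - local_mean v i / (2 * h)))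
        \<le> (\<Sum>i\<le>J-1. c / 2 * (((e i)\<^sup>2 + (e (Suc i))\<^sup>2) / 2))"
    proof (rule sum_mono)
      fix i assume i: "i \<in> {..J-1}"
      show "p i * (local_mean v (Suc i) / (2 * h) - local_mean v i / (2 * h)) \<le> c / 2 * (((e i)\<^sup>2 + (e (Suc i))\<^sup>2) / 2)"
      proof (cases "i = 0 \<or> i = J - 1")
        case True
        then have "p i = 0" using e J by (auto simp: p_def)
        then show ?thesis using c by simp
      next
        case False
        then have i: "1 \<le> i" "i + 1 < J" using i by auto
        have "\<bar>v (Suc (Suc i)) - v (i - 1)\<bar> \<le> 3 * (c * h)"
        proof -
          have "Suc i < J" "i < J" "i - 1 < J" "Suc (i - 1) = i" using i by auto
          then show ?thesis using v[of "Suc i"] v[of i] v[of "i - 1"] by (simp add: h_def)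
        qed
        moreover have "local_mean v (Suc i) - local_mean v i = (v (Suc (Suc i)) - v (i - 1)) / 3"
          by (simp add: local_mean_def add_divide_distrib diff_divide_distrib)
        ultimately have "\<bar>local_mean v (Suc i) - local_mean v i\<bar> \<le> c * h" by simp
        then have "\<bar>(local_mean v (Suc i) - local_mean v i) / (2 * h)\<bar> \<le> c / 2"
          using h by (simp add: abs_divide divide_le_eq)
        then have "\<bar>p i\<bar> * \<bar>(local_mean v (Suc i) - local_mean v i) / (2 * h)\<bar> \<le> ((e i)\<^sup>2 + (e (Suc i))\<^sup>2) / 2 * (c / 2)"
          unfolding p_def by (intro mult_mono ab) auto
        then show ?thesis
          unfolding abs_mult[symmetric] diff_divide_distrib by (simp add: mult.commute)
      qed
    qed
    also have "\<dots> = c / 4 * ((\<Sum>i\<le>J-1. (e i)\<^sup>2) + (\<Sum>i\<le>J-1. (e (Suc i))\<^sup>2))"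
      by (simp add: sum_distrib_left[symmetric] sum_divide_distrib[symmetric] sum.distrib)
    also have "(\<Sum>i\<le>J-1. (e i)\<^sup>2) = S"
      unfolding S_def by (rule sum.mono_neutral_right) (use e in \<open>auto simp: not_less_eq_eq\<close>)
    also have "(\<Sum>i\<le>J-1. (e (Suc i))\<^sup>2) = S"
    proof -
      have "(\<Sum>i\<le>J-1. (e (Suc i))\<^sup>2) = (\<Sum>i=1..J. (e i)\<^sup>2)"
        by (rule sum.reindex_bij_witness[of _ "\<lambda>j. j - 1" Suc]) (use J in auto)
      also have "\<dots> = S" using e J by (cases J) (auto simp: S_def)
      finally show ?thesis .
    qed
    also have "c / 4 * (S + S) \<le> c * S"
      using c by (simp add: S_def sum_nonneg mult_nonneg_nonneg)
    finally show ?thesis using parts by simp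
  qed
  have 3: "(\<Sum>j=1..J-1. e j * convection h e j) = 0"
    using grid_ip_convection_self[OF e J, of L h] L J by (simp add: grid_ip_def)
  have "- (2 * c * S) \<le> (\<Sum>j=1..J-1. e j * (local_mean v j * central_diff h e j))
      + (\<Sum>j=1..J-1. e j * (local_mean e j * central_diff h v j)) + (\<Sum>j=1..J-1. e j * convection h e j)"
    using 1 2 3 by simp
  also have "\<dots> = (\<Sum>j=1..J-1. e j * (convection h (\<lambda>i. v i + e i) j - convection h v j))"
    unfolding expand by (simp add: sum.distrib distrib_left)
  finally have "h * - (2 * c * S) \<le> h * (\<Sum>j=1..J-1. e j * (convection h (\<lambda>i. v i + e i) j - convection h v j))"
    using h by (intro mult_left_mono) auto
  moreover have "(grid_norm L J e)\<^sup>2 = h * S"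
    unfolding grid_norm_power2[OF L] grid_ip_def S_def h_def by (simp add: power2_eq_square)
  ultimately show ?thesis by (simp add: grid_ip_def h_def algebra_simps)
qed

lemma grid_ip_second_diff:
  assumes "v 0 = 0" "v J = 0" "1 \<le> J"
  shows "grid_ip L J v (second_diff h w) = - (L / real J / h\<^sup>2) * (\<Sum>i\<le>J-1. (w (Suc i) - w i) * (v (Suc i) - v i))"
proof -
  have "(\<Sum>j=1..J-1. v j * second_diff h w j)
      = (\<Sum>j=1..J-1. ((w (Suc j) - w j) - (w (Suc (j - 1)) - w (j - 1))) * v j) / h\<^sup>2"
    unfolding sum_divide_distrib by (rule sum.cong) (auto simp: second_diff_def algebra_simps)
  also have "\<dots> = - (\<Sum>i\<le>J-1. (w (Suc i) - w i) * (v (Suc i) - v i)) / h\<^sup>2"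
    unfolding sum_by_parts_grid[where d="\<lambda>j. w (Suc j) - w j"] using assms by simp
  finally show ?thesis by (simp add: grid_ip_def)
qed

text \<open>The values at which the scheme evaluates the convection and memory terms: the end value on the
  first interval, where the solution is singular at the other end, and the mean on the others.\<close>

definition level :: "(nat \<Rightarrow> nat \<Rightarrow> real) \<Rightarrow> nat \<Rightarrow> nat \<Rightarrow> real" where
  "level V n = (if n = 1 then V 1 else (\<lambda>i. time_mean (\<lambda>m. V m i) n))"

lemma level_diff: "level (\<lambda>n i. U n i - V n i) n i = level U n i - level V n i"
  by (simp add: level_def time_mean_def diff_divide_distrib add_divide_distrib)

lemma grid_norm_level_le:
  assumes L: "0 < L" and n: "1 \<le> n" and E: "grid_norm L J (V n) \<le> E" "grid_norm L J (V (n - 1)) \<le> E"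
  shows "grid_norm L J (level V n) \<le> E"
proof (cases "n = 1")
  case False
  have "grid_norm L J (\<lambda>i. 1 / 2 * (V n i + V (n - 1) i)) \<le> 1 / 2 * (grid_norm L J (V n) + grid_norm L J (V (n - 1)))"
    unfolding grid_norm_scale[OF L] using grid_norm_triangle[OF L, of J "V n" "V (n - 1)"] by simp
  with E False show ?thesis by (simp add: level_def time_mean_def)
qed (use E in \<open>simp add: level_def\<close>)

text \<open>This is an equality for the mean; for the end value the square of the increment is dropped.\<close>

lemma grid_ip_level_increment:
  assumes L: "0 < L" and n: "1 \<le> n"
  shows "(grid_norm L J (V n))\<^sup>2 - (grid_norm L J (V (n - 1)))\<^sup>2
    \<le> 2 * grid_ip L J (level V n) (\<lambda>j. V n j - V (n - 1) j)"
proof -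
  have "(\<Sum>j=1..J-1. V n j * V n j - V (n - 1) j * V (n - 1) j)
      \<le> (\<Sum>j=1..J-1. 2 * (level V n j * (V n j - V (n - 1) j)))"
  proof (rule sum_mono)
    fix j
    show "V n j * V n j - V (n - 1) j * V (n - 1) j \<le> 2 * (level V n j * (V n j - V (n - 1) j))"
      using zero_le_square[of "V 1 j - V 0 j"]
      by (cases "n = 1") (simp_all add: level_def time_mean_def algebra_simps)
  qed
  then have "(L / real J) * (\<Sum>j=1..J-1. V n j * V n j - V (n - 1) j * V (n - 1) j)
      \<le> (L / real J) * (\<Sum>j=1..J-1. 2 * (level V n j * (V n j - V (n - 1) j)))"
    using L by (intro mult_left_mono) auto
  then show ?thesis
    unfolding grid_norm_power2[OF L] grid_ip_def sum_subtractf right_diff_distrib sum_distrib_left[symmetric]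
    by (simp add: mult.left_commute)
qed

context time_mesh
begin

text \<open>Testing with \<open>level V\<close> and summing by parts in space turns the memory term into the form of
  \<open>memory_form_nonneg\<close>, one copy for each difference quotient of \<open>level V\<close> in space. The form
  enters with a minus sign and can be dropped.\<close>

lemma energy_estimate:
  assumes L: "0 < L" and J: "1 \<le> J" and m: "m \<le> N"
    and bd: "\<And>n. n \<in> {1..N} \<Longrightarrow> V n 0 = 0 \<and> V n J = 0"
    and eq: "\<And>n j. n \<in> {1..N} \<Longrightarrow> j \<in> {1..J-1} \<Longrightarrow>
      V n j - V (n - 1) j = (\<Sum>s=1..n. mem_weight n s * second_diff (L / real J) (level V s) j) + g n j"
  shows "(grid_norm L J (V m))\<^sup>2 \<le> (grid_norm L J (V 0))\<^sup>2 + 2 * (\<Sum>n=1..m. grid_ip L J (level V n) (g n))"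
proof -
  let ?h = "L / real J"
  have lbd: "level V n 0 = 0 \<and> level V n J = 0" if "n \<in> {1..N}" for n
  proof (cases "n = 1")
    case False
    then have "n - 1 \<in> {1..N}" using that by auto
    then show ?thesis using bd[of n] bd[of "n - 1"] that by (auto simp: level_def time_mean_def)
  qed (use bd that in \<open>auto simp: level_def\<close>)
  \<comment> \<open>the quadratic form of the weights, with row \<open>n\<close> only\<close>
  define Q where "Q n = (\<Sum>i\<le>J-1. \<Sum>s=1..n. mem_weight n s * (level V n (Suc i) - level V n i) * (level V s (Suc i) - level V s i))" for n
  have test: "grid_ip L J (level V n) (\<lambda>j. V n j - V (n - 1) j) =
      - (?h / ?h\<^sup>2) * Q n + grid_ip L J (level V n) (g n)" if n: "n \<in> {1..N}" for n
  proof -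
    have "grid_ip L J (level V n) (\<lambda>j. V n j - V (n - 1) j)
        = grid_ip L J (level V n) (\<lambda>j. (\<Sum>s=1..n. mem_weight n s * second_diff ?h (level V s) j) + g n j)"
      by (rule grid_ip_cong) (use eq[OF n] in auto)
    also have "\<dots> = (\<Sum>s=1..n. mem_weight n s * grid_ip L J (level V n) (second_diff ?h (level V s))) + grid_ip L J (level V n) (g n)"
      by (simp add: grid_ip_add_right grid_ip_sum_right grid_ip_scale_right)
    also have "(\<Sum>s=1..n. mem_weight n s * grid_ip L J (level V n) (second_diff ?h (level V s)))
        = - (?h / ?h\<^sup>2) * (\<Sum>s=1..n. \<Sum>i\<le>J-1. mem_weight n s * (level V n (Suc i) - level V n i) * (level V s (Suc i) - level V s i))"
      using lbd[OF n] J by (simp add: grid_ip_second_diff sum_distrib_left sum_distrib_right ac_simps)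
    also have "(\<Sum>s=1..n. \<Sum>i\<le>J-1. mem_weight n s * (level V n (Suc i) - level V n i) * (level V s (Suc i) - level V s i))
        = Q n"
      unfolding Q_def by (rule sum.swap)
    finally show ?thesis .
  qed
  have "(grid_norm L J (V m))\<^sup>2 - (grid_norm L J (V 0))\<^sup>2
      = (\<Sum>n=1..m. (grid_norm L J (V n))\<^sup>2 - (grid_norm L J (V (n - 1)))\<^sup>2)"
    by (induction m) auto
  also have "\<dots> \<le> (\<Sum>n=1..m. 2 * grid_ip L J (level V n) (\<lambda>j. V n j - V (n - 1) j))"
    by (intro sum_mono grid_ip_level_increment[OF L]) auto
  also have "\<dots> = 2 * (\<Sum>n=1..m. grid_ip L J (level V n) (g n))
      - 2 * (?h / ?h\<^sup>2) * (\<Sum>n=1..m. Q n)"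
  proof -
    have "(\<Sum>n=1..m. 2 * grid_ip L J (level V n) (\<lambda>j. V n j - V (n - 1) j))
        = (\<Sum>n=1..m. 2 * grid_ip L J (level V n) (g n) - 2 * (?h / ?h\<^sup>2) * Q n)"
      by (rule sum.cong[OF refl], subst test) (use m in auto)
    then show ?thesis by (simp only: sum_subtractf sum_distrib_left)
  qed
  also have "(\<Sum>n=1..m. Q n)
      = (\<Sum>i\<le>J-1. \<Sum>n=1..m. \<Sum>s=1..n. mem_weight n s * (level V n (Suc i) - level V n i) * (level V s (Suc i) - level V s i))"
    unfolding Q_def by (rule sum.swap)
  also have "2 * (\<Sum>n=1..m. grid_ip L J (level V n) (g n)) - 2 * (?h / ?h\<^sup>2) * \<dots> \<le> 2 * (\<Sum>n=1..m. grid_ip L J (level V n) (g n))"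
    using L sum_nonneg[of "{..J-1}", OF memory_form_nonneg[OF m, of "\<lambda>n. level V n (Suc _) - level V n _"]]
    by (simp add: zero_le_mult_iff)
  finally show ?thesis by simp
qed

end

section \<open>Families with a weak singularity in time\<close>

definition slope :: "(real \<Rightarrow> real) \<Rightarrow> real \<Rightarrow> real \<Rightarrow> real" where
  "slope g a b = (g b - g a) / (b - a)"

text \<open>Both slopes are values of the derivative at intermediate points of \<open>{p..q}\<close>.\<close>

lemma abs_slope_diff_le:
  assumes cont: "continuous_on {p..q} \<phi>"
    and d1: "\<And>\<tau>. \<tau> \<in> {p<..<q} \<Longrightarrow> (\<phi> has_real_derivative \<phi>' \<tau>) (at \<tau>)"
    and d2: "\<And>\<tau>. \<tau> \<in> {p<..<q} \<Longrightarrow> (\<phi>' has_real_derivative \<phi>'' \<tau>) (at \<tau>)"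
    and B: "\<And>\<tau>. \<tau> \<in> {p<..<q} \<Longrightarrow> \<bar>\<phi>'' \<tau>\<bar> \<le> B"
    and ab: "p \<le> a" "a < b" "b \<le> q" and ab': "p \<le> a'" "a' < b'" "b' \<le> q"
  shows "\<bar>slope \<phi> a b - slope \<phi> a' b'\<bar> \<le> (q - p) * B"
proof -
  have mv: "\<exists>\<xi>\<in>{p<..<q}. slope \<phi> a b = \<phi>' \<xi>" if h: "p \<le> a" "a < b" "b \<le> q" for a b
  proof -
    obtain \<xi> where "a < \<xi>" "\<xi> < b" "\<phi> b - \<phi> a = \<phi>' \<xi> * (b - a)"
      by (rule mvt[OF \<open>a < b\<close>, of \<phi> "\<lambda>x h. \<phi>' x * h"])
        (use h d1 continuous_on_subset[OF cont, of "{a..b}"] in \<open>auto simp: has_field_derivative_def\<close>)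
    with h show ?thesis by (intro bexI[of _ \<xi>]) (auto simp: slope_def)
  qed
  obtain \<xi> \<eta> where x: "\<xi> \<in> {p<..<q}" "slope \<phi> a b = \<phi>' \<xi>" and y: "\<eta> \<in> {p<..<q}" "slope \<phi> a' b' = \<phi>' \<eta>"
    using mv[OF ab] mv[OF ab'] by blast
  have "\<bar>\<phi>' \<xi> - \<phi>' \<eta>\<bar> \<le> B * \<bar>\<xi> - \<eta>\<bar>"
    using field_differentiable_bound[of "{p<..<q}" \<phi>' \<phi>'' B \<xi> \<eta>] x y B d2
    by (auto intro: has_field_derivative_at_within simp: abs_minus_commute)
  also have "\<dots> \<le> B * (q - p)"
    using x y B[OF x(1)] by (intro mult_left_mono) auto
  finally show ?thesis using x y by (simp add: mult.commute)
qed

text \<open>A vector of functions of time that behaves like \<open>\<tau> powr (\<sigma> - 1)\<close> near \<open>0\<close>, as far as the norms of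
  the first two derivatives can tell. Only the norms are controlled, not the single components, so
  all later estimates are made for the vector as a whole.\<close>

definition regular_family ::
    "real \<Rightarrow> nat \<Rightarrow> real \<Rightarrow> real \<Rightarrow> real \<Rightarrow> (nat \<Rightarrow> real \<Rightarrow> real) \<Rightarrow> (nat \<Rightarrow> real \<Rightarrow> real) \<Rightarrow> (nat \<Rightarrow> real \<Rightarrow> real) \<Rightarrow> bool" where
  "regular_family L J T \<sigma> M G G' G'' \<longleftrightarrow>
     (\<forall>s\<in>{1..J-1}. \<forall>\<tau>\<in>{0<..T}. (G s has_real_derivative G' s \<tau>) (at \<tau> within {0..T}) \<and>
        (G' s has_real_derivative G'' s \<tau>) (at \<tau> within {0..T})) \<and>
     (\<forall>\<tau>\<in>{0<..T}. grid_norm L J (\<lambda>s. G' s \<tau>) \<le> M * \<tau> powr (\<sigma> - 2) \<and>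
        grid_norm L J (\<lambda>s. G'' s \<tau>) \<le> M * \<tau> powr (\<sigma> - 3))"

lemma powr_le_comparable:
  fixes \<tau> q c e :: real
  assumes "0 < \<tau>" "\<tau> \<le> q" "q \<le> c * \<tau>" "1 \<le> c"
  shows "\<tau> powr e \<le> c powr \<bar>e\<bar> * q powr e"
proof (cases "0 \<le> e")
  case True
  have "\<tau> powr e \<le> 1 * q powr e" using assms True by (simp add: powr_mono2)
  also have "\<dots> \<le> c powr \<bar>e\<bar> * q powr e"
    using assms True ge_one_powr_ge_zero[of c e] by (intro mult_right_mono) auto
  finally show ?thesis .
next
  case False
  have "\<tau> powr e \<le> (q / c) powr e"
    using assms False by (intro powr_mono2') (auto simp: divide_le_eq mult.commute)
  also have "\<dots> = c powr \<bar>e\<bar> * q powr e"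
    using assms False by (simp add: powr_divide powr_minus field_simps)
  finally show ?thesis .
qed

context
  fixes L T \<sigma> M :: real and J :: nat and G G' G'' :: "nat \<Rightarrow> real \<Rightarrow> real"
  assumes L: "0 < L" and M: "0 \<le> M" and reg: "regular_family L J T \<sigma> M G G' G''"
begin

lemma regular_family_deriv:
  assumes "s \<in> {1..J-1}" "0 < \<tau>" "\<tau> < T"
  shows "(G s has_real_derivative G' s \<tau>) (at \<tau>)" "(G' s has_real_derivative G'' s \<tau>) (at \<tau>)"
proof -
  have "at \<tau> within {0..T} = at \<tau>" using assms by (intro at_within_interior) auto
  moreover have "\<tau> \<in> {0<..T}" using assms by auto
  ultimately show "(G s has_real_derivative G' s \<tau>) (at \<tau>)" "(G' s has_real_derivative G'' s \<tau>) (at \<tau>)"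
    using reg assms(1) unfolding regular_family_def by metis+
qed

lemma regular_family_continuous:
  assumes "s \<in> {1..J-1}"
  shows "continuous_on {0<..T} (G s)"
proof (rule continuous_on_subset)
  show "continuous_on {\<tau> \<in> {0..T}. 0 < \<tau>} (G s)"
    unfolding continuous_on_eq_continuous_within
  proof (intro ballI)
    fix \<tau> assume "\<tau> \<in> {\<tau> \<in> {0..T}. 0 < \<tau>}"
    then have "(G s has_real_derivative G' s \<tau>) (at \<tau> within {0..T})"
      using reg assms by (auto simp: regular_family_def)
    then show "continuous (at \<tau> within {\<tau> \<in> {0..T}. 0 < \<tau>}) (G s)"
      by (intro continuous_within_subset[OF DERIV_continuous]) auto
  qed
qed auto

lemma regular_family_norm_deriv:
  assumes "0 < \<tau>" "\<tau> \<le> T"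
  shows "grid_norm L J (\<lambda>s. G' s \<tau>) \<le> M * \<tau> powr (\<sigma> - 2)" "grid_norm L J (\<lambda>s. G'' s \<tau>) \<le> M * \<tau> powr (\<sigma> - 3)"
  using reg assms by (auto simp: regular_family_def)

text \<open>Integrating \<open>\<tau> powr (\<sigma> - 2)\<close> directly would give \<open>\<tau> powr (\<sigma> - 1)\<close>, or a logarithm if \<open>\<sigma> = 1\<close>.
  Splitting off \<open>b powr (\<sigma> - 1 + \<theta>)\<close> treats all \<open>\<sigma>\<close> alike and leaves a singularity that is
  integrable for \<open>\<theta> < 1\<close>.\<close>

lemma regular_family_increment:
  assumes ab: "0 < a" "a \<le> b" "b \<le> T" and \<theta>: "0 < \<theta>" "1 - \<sigma> \<le> \<theta>"
  shows "grid_norm L J (\<lambda>s. G s b - G s a) \<le> M / \<theta> * b powr (\<sigma> - 1 + \<theta>) * (a powr (- \<theta>) - b powr (- \<theta>))"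
proof -
  let ?K = "M / \<theta> * b powr (\<sigma> - 1 + \<theta>)"
  let ?\<Lambda> = "\<lambda>\<tau>. - ?K * \<tau> powr (- \<theta>)"
  have "grid_norm L J (\<lambda>s. G s b - G s a) \<le> ?\<Lambda> b - ?\<Lambda> a"
  proof (rule grid_norm_mean_value[OF L ab(2)])
    fix s assume "s \<in> {1..J-1}"
    then show "continuous_on {a..b} (G s)"
      using ab by (intro continuous_on_subset[OF regular_family_continuous]) auto
  next
    show "continuous_on {a..b} ?\<Lambda>" using ab by (intro continuous_intros) auto
  next
    fix s \<tau> assume "s \<in> {1..J-1}" "\<tau> \<in> {a<..<b}"
    then show "(G s has_real_derivative G' s \<tau>) (at \<tau>)"
      using ab by (intro regular_family_deriv) auto
  next
    fix \<tau> assume t: "\<tau> \<in> {a<..<b}"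
    show "(?\<Lambda> has_real_derivative ?K * \<theta> * \<tau> powr (- \<theta> - 1)) (at \<tau>)"
      using t ab by (auto intro!: derivative_eq_intros)
    have "grid_norm L J (\<lambda>s. G' s \<tau>) \<le> M * \<tau> powr (\<sigma> - 2)"
      using t ab by (intro regular_family_norm_deriv) auto
    also have "\<tau> powr (\<sigma> - 2) = \<tau> powr (\<sigma> - 1 + \<theta>) * \<tau> powr (- \<theta> - 1)"
      by (simp flip: powr_add)
    also have "M * \<dots> \<le> M * (b powr (\<sigma> - 1 + \<theta>) * \<tau> powr (- \<theta> - 1))"
      using t ab \<theta> M by (intro mult_left_mono mult_right_mono powr_mono2) auto
    also have "\<dots> = ?K * \<theta> * \<tau> powr (- \<theta> - 1)" using \<theta> by simp
    finally show "grid_norm L J (\<lambda>s. G' s \<tau>) \<le> ?K * \<theta> * \<tau> powr (- \<theta> - 1)" .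
  qed
  also have "- K * x - - K * y = K * (y - x)" for K x y :: real by algebra
  finally show ?thesis .
qed

text \<open>When the end points are comparable, the singular bound of the derivative is a constant up to a factor.\<close>

lemma regular_family_difference:
  assumes ab: "0 < a" "a \<le> b" "b \<le> T" and c: "1 \<le> c" "b \<le> c * a"
  shows "grid_norm L J (\<lambda>s. G s b - G s a) \<le> (b - a) * (M * c powr \<bar>\<sigma> - 2\<bar> * b powr (\<sigma> - 2))"
proof -
  let ?K = "M * c powr \<bar>\<sigma> - 2\<bar> * b powr (\<sigma> - 2)"
  have "grid_norm L J (\<lambda>s. G s b - G s a) \<le> ?K * b - ?K * a"
  proof (rule grid_norm_mean_value[OF L ab(2)])
    fix s assume "s \<in> {1..J-1}"
    then show "continuous_on {a..b} (G s)"
      using ab by (intro continuous_on_subset[OF regular_family_continuous]) auto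
  next
    fix s \<tau> assume "s \<in> {1..J-1}" "\<tau> \<in> {a<..<b}"
    then show "(G s has_real_derivative G' s \<tau>) (at \<tau>)"
      using ab by (intro regular_family_deriv) auto
  next
    fix \<tau> assume t: "\<tau> \<in> {a<..<b}"
    show "((\<lambda>\<tau>. ?K * \<tau>) has_real_derivative ?K) (at \<tau>)"
      by (auto intro!: derivative_eq_intros)
    have "grid_norm L J (\<lambda>s. G' s \<tau>) \<le> M * \<tau> powr (\<sigma> - 2)"
      using t ab by (intro regular_family_norm_deriv) auto
    also have "\<dots> \<le> M * (c powr \<bar>\<sigma> - 2\<bar> * b powr (\<sigma> - 2))"
    proof -
      have "c * a \<le> c * \<tau>" using t c by (intro mult_left_mono) auto
      with c(2) have "b \<le> c * \<tau>" by linarith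
      then show ?thesis using t ab c by (intro mult_left_mono powr_le_comparable M) auto
    qed
    finally show "grid_norm L J (\<lambda>s. G' s \<tau>) \<le> ?K" by simp
  qed (intro continuous_intros)
  then show ?thesis by (simp add: algebra_simps)
qed

text \<open>A difference of slopes is a second difference. Testing against a fixed vector reduces it to
  \<open>abs_slope_diff_le\<close>; the intermediate points depend on the vector, the bound does not.\<close>

lemma regular_family_slope:
  assumes pq: "0 < p" "p < q" "q \<le> T" and c: "1 \<le> c" "q \<le> c * p"
    and ab: "p \<le> a" "a < b" "b \<le> q" and ab': "p \<le> a'" "a' < b'" "b' \<le> q"
  shows "grid_norm L J (\<lambda>s. slope (G s) a b - slope (G s) a' b') \<le> (q - p) * (M * c powr \<bar>\<sigma> - 3\<bar> * q powr (\<sigma> - 3))"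
proof (rule grid_norm_leI[OF L])
  let ?K = "M * c powr \<bar>\<sigma> - 3\<bar> * q powr (\<sigma> - 3)"
  show "0 \<le> (q - p) * ?K" using pq M by simp
  fix v
  let ?\<phi> = "\<lambda>\<tau>. grid_ip L J v (\<lambda>s. G s \<tau>)"
  have "grid_ip L J v (\<lambda>s. slope (G s) a b - slope (G s) a' b') = slope ?\<phi> a b - slope ?\<phi> a' b'"
  proof -
    have "slope (G s) a b - slope (G s) a' b'
        = 1 / (b - a) * (G s b - G s a) - 1 / (b' - a') * (G s b' - G s a')" for s
      by (simp add: slope_def)
    then show ?thesis by (simp only: grid_ip_diff_right grid_ip_scale_right) (simp add: slope_def)
  qed
  also have "\<dots> \<le> \<bar>slope ?\<phi> a b - slope ?\<phi> a' b'\<bar>" by simp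
  also have "\<dots> \<le> (q - p) * (grid_norm L J v * ?K)"
  proof (rule abs_slope_diff_le[OF _ _ _ _ ab ab'])
    show "continuous_on {p..q} ?\<phi>"
      using pq by (intro grid_ip_continuous continuous_on_subset[OF regular_family_continuous]) auto
    fix \<tau> assume t: "\<tau> \<in> {p<..<q}"
    show "(?\<phi> has_real_derivative grid_ip L J v (\<lambda>s. G' s \<tau>)) (at \<tau>)"
      "((\<lambda>\<tau>. grid_ip L J v (\<lambda>s. G' s \<tau>)) has_real_derivative grid_ip L J v (\<lambda>s. G'' s \<tau>)) (at \<tau>)"
      using t pq by (intro grid_ip_has_derivative regular_family_deriv; simp)+
    have "\<bar>grid_ip L J v (\<lambda>s. G'' s \<tau>)\<bar> \<le> grid_norm L J v * grid_norm L J (\<lambda>s. G'' s \<tau>)"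
      using grid_ip_le_norm[OF L, of J v "\<lambda>s. G'' s \<tau>"] grid_ip_le_norm[OF L, of J v "\<lambda>s. - G'' s \<tau>"]
        grid_ip_scale_right[of L J v "- 1" "\<lambda>s. G'' s \<tau>"]
      by (simp add: grid_norm_minus)
    also have "\<dots> \<le> grid_norm L J v * (M * \<tau> powr (\<sigma> - 3))"
      using t pq L by (intro mult_left_mono regular_family_norm_deriv) auto
    also have "\<dots> \<le> grid_norm L J v * (M * (c powr \<bar>\<sigma> - 3\<bar> * q powr (\<sigma> - 3)))"
    proof -
      have "c * p \<le> c * \<tau>" using t c by (intro mult_left_mono) auto
      with c(2) have "q \<le> c * \<tau>" by linarith
      then show ?thesis using t pq c L by (intro mult_left_mono powr_le_comparable M) auto
    qed
    finally show "\<bar>grid_ip L J v (\<lambda>s. G'' s \<tau>)\<bar> \<le> grid_norm L J v * ?K" by simp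
  qed
  finally show "grid_ip L J v (\<lambda>s. slope (G s) a b - slope (G s) a' b') \<le> grid_norm L J v * ((q - p) * ?K)"
    by (simp add: mult.left_commute)
qed

end

section \<open>From discrete norms to pointwise bounds\<close>

lemma grid_pt_0 [simp]: "grid_pt L J 0 = 0"
  by (simp add: grid_pt_def)

lemma grid_pt_J [simp]: "1 \<le> J \<Longrightarrow> grid_pt L J J = L"
  by (simp add: grid_pt_def)

lemma grid_pt_Suc: "grid_pt L J (Suc j) = grid_pt L J j + L / real J"
  by (simp add: grid_pt_def algebra_simps add_divide_distrib)

lemma grid_pt_le: "0 < L \<Longrightarrow> 1 \<le> J \<Longrightarrow> j \<le> J \<Longrightarrow> grid_pt L J j \<in> {0..L}"
  by (auto simp: grid_pt_def field_simps)

lemma grid_pt_interior: "0 < L \<Longrightarrow> j \<in> {1..J-1} \<Longrightarrow> grid_pt L J j \<in> {0<..<L}"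
  by (auto simp: grid_pt_def field_simps)

text \<open>The integral is a limit of Riemann sums, and each of these is bounded by the discrete L2 norm and the
  Cauchy-Schwarz inequality. The grids have to be refined for this, so the bound is needed on all
  of them.\<close>

lemma integral_abs_le_grid_norm:
  assumes L: "0 < L" and cont: "continuous_on {0..L} g"
    and E: "\<And>J. 1 \<le> J \<Longrightarrow> grid_norm L J (\<lambda>s. g (grid_pt L J s)) \<le> E"
  shows "integral {0..L} (\<lambda>x. \<bar>g x\<bar>) \<le> sqrt L * E"
proof (rule field_le_epsilon)
  fix e :: real assume e: "0 < e"
  define \<eta> where "\<eta> = e / (2 * L)"
  have \<eta>: "0 < \<eta>" using e L by (simp add: \<eta>_def)
  have "uniformly_continuous_on {0..L} (\<lambda>x. \<bar>g x\<bar>)"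
    using cont by (intro compact_uniformly_continuous continuous_intros) auto
  then obtain d where d: "0 < d" "\<And>x y. x \<in> {0..L} \<Longrightarrow> y \<in> {0..L} \<Longrightarrow> dist y x < d \<Longrightarrow> dist \<bar>g y\<bar> \<bar>g x\<bar> < \<eta>"
    using \<eta> unfolding uniformly_continuous_on_def by metis
  \<comment> \<open>fine enough for uniform continuity, and for the boundary node \<open>0\<close>, which the discrete norm leaves
    out, to contribute at most \<open>e / 2\<close>\<close>
  obtain J :: nat where J: "L / d + 2 * L * \<bar>g 0\<bar> / e + 1 < real J" using reals_Archimedean2 by blast
  define h where "h = L / real J"
  have J0: "0 < real J" using J L d e by (smt (verit) divide_nonneg_pos mult_nonneg_nonneg abs_ge_zero)
  then have J1: "1 \<le> J" by simp
  have h: "0 < h" using L J0 by (simp add: h_def)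
  have hd: "h < d"
  proof -
    have "L / d < real J" using J L e by (smt (verit) divide_nonneg_pos mult_nonneg_nonneg abs_ge_zero)
    then show ?thesis using d J0 by (simp add: h_def field_simps)
  qed
  have hg: "h * \<bar>g 0\<bar> \<le> e / 2"
  proof -
    have "2 * L * \<bar>g 0\<bar> / e < real J" using J L d by (smt (verit) divide_nonneg_pos)
    then show ?thesis using e J0 by (simp add: h_def field_simps)
  qed
  have cont': "continuous_on {0..L} (\<lambda>x. \<bar>g x\<bar>)" using cont by (intro continuous_intros)
  have int: "(\<lambda>x. \<bar>g x\<bar>) integrable_on {a..b}" if "0 \<le> a" "b \<le> L" for a b
    by (intro integrable_continuous_real continuous_on_subset[OF cont']) (use that in auto)
  have pt: "grid_pt L J j \<in> {0..L}" if "j \<le> J" for j using grid_pt_le[OF L J1 that] .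
  have riemann: "integral {0..grid_pt L J m} (\<lambda>x. \<bar>g x\<bar>) \<le> (\<Sum>s<m. h * (\<bar>g (grid_pt L J s)\<bar> + \<eta>))" if "m \<le> J" for m
    using that
  proof (induction m)
    case (Suc m)
    let ?a = "grid_pt L J m" and ?b = "grid_pt L J (Suc m)"
    have ab: "?a \<in> {0..L}" "?b \<in> {0..L}" "?b = ?a + h" using pt[of m] pt[of "Suc m"] Suc.prems by (auto simp: grid_pt_Suc h_def)
    have "integral {0..?b} (\<lambda>x. \<bar>g x\<bar>) = integral {0..?a} (\<lambda>x. \<bar>g x\<bar>) + integral {?a..?b} (\<lambda>x. \<bar>g x\<bar>)"
      using ab h by (intro Henstock_Kurzweil_Integration.integral_combine[symmetric] int) auto
    moreover have "integral {?a..?b} (\<lambda>x. \<bar>g x\<bar>) \<le> integral {?a..?b} (\<lambda>x. \<bar>g ?a\<bar> + \<eta>)"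
    proof (rule integral_le[OF int])
      fix x assume "x \<in> {?a..?b}"
      then have "dist \<bar>g x\<bar> \<bar>g ?a\<bar> < \<eta>" using ab hd by (intro d(2)) (auto simp: dist_real_def)
      then show "\<bar>g x\<bar> \<le> \<bar>g ?a\<bar> + \<eta>" by (simp add: dist_real_def)
    qed (use ab in auto)
    moreover have "integral {?a..?b} (\<lambda>x. \<bar>g ?a\<bar> + \<eta>) = h * (\<bar>g ?a\<bar> + \<eta>)"
      using ab h by simp
    moreover have "integral {0..?a} (\<lambda>x. \<bar>g x\<bar>) \<le> (\<Sum>s<m. h * (\<bar>g (grid_pt L J s)\<bar> + \<eta>))"
      using Suc by simp
    ultimately show ?case unfolding sum.lessThan_Suc by linarith
  qed simp
  have "integral {0..L} (\<lambda>x. \<bar>g x\<bar>) \<le> (\<Sum>s<J. h * (\<bar>g (grid_pt L J s)\<bar> + \<eta>))"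
    using riemann[of J] J1 by simp
  also have "\<dots> = h * \<bar>g 0\<bar> + h * (\<Sum>s=1..J-1. \<bar>g (grid_pt L J s)\<bar>) + L * \<eta>"
  proof -
    have "{..<J} = insert 0 {1..J-1}" using J1 by auto
    then have "(\<Sum>s<J. \<bar>g (grid_pt L J s)\<bar>) = \<bar>g 0\<bar> + (\<Sum>s=1..J-1. \<bar>g (grid_pt L J s)\<bar>)" by simp
    moreover have "(\<Sum>s<J. h * (\<bar>g (grid_pt L J s)\<bar> + \<eta>)) = h * (\<Sum>s<J. \<bar>g (grid_pt L J s)\<bar>) + real J * (h * \<eta>)"
      by (simp add: distrib_left sum.distrib sum_distrib_left)
    ultimately show ?thesis using J0 by (simp add: h_def distrib_left)
  qed
  also have "h * (\<Sum>s=1..J-1. \<bar>g (grid_pt L J s)\<bar>) \<le> sqrt L * E"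
  proof -
    have "h * (\<Sum>s=1..J-1. \<bar>g (grid_pt L J s)\<bar>) = grid_ip L J (\<lambda>s. 1) (\<lambda>s. \<bar>g (grid_pt L J s)\<bar>)"
      by (simp add: grid_ip_def h_def)
    also have "\<dots> \<le> grid_norm L J (\<lambda>s. 1) * grid_norm L J (\<lambda>s. \<bar>g (grid_pt L J s)\<bar>)"
      by (rule grid_ip_le_norm[OF L])
    also have "grid_norm L J (\<lambda>s. \<bar>g (grid_pt L J s)\<bar>) = grid_norm L J (\<lambda>s. g (grid_pt L J s))"
      by (simp add: grid_norm_def)
    also have "grid_norm L J (\<lambda>s. 1) * \<dots> \<le> sqrt L * E"
      using grid_norm_bounded[OF L, of J "\<lambda>s. 1" 1] E[OF J1] L
      by (intro mult_mono) auto
    finally show ?thesis .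
  qed
  also have "h * \<bar>g 0\<bar> + sqrt L * E + L * \<eta> \<le> sqrt L * E + e"
    using hg L by (simp add: \<eta>_def)
  finally show "integral {0..L} (\<lambda>x. \<bar>g x\<bar>) \<le> sqrt L * E + e" by simp
qed

text \<open>By Rolle's theorem \<open>v'\<close> has a zero; from there it is bounded by the integral of \<open>\<bar>v''\<bar>\<close>, and
  \<open>v\<close> by the mean value theorem.\<close>

lemma sup_bound_of_grid_norm:
  assumes L: "0 < L" and v0: "v 0 = 0" "v L = 0"
    and d1: "\<And>x. x \<in> {0..L} \<Longrightarrow> (v has_real_derivative v' x) (at x within {0..L})"
    and d2: "\<And>x. x \<in> {0..L} \<Longrightarrow> (v' has_real_derivative v'' x) (at x within {0..L})"
    and cont: "continuous_on {0..L} v''"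
    and E: "\<And>J. 1 \<le> J \<Longrightarrow> grid_norm L J (\<lambda>s. v'' (grid_pt L J s)) \<le> E"
    and x: "x \<in> {0..L}"
  shows "\<bar>v' x\<bar> \<le> sqrt L * E" "\<bar>v x\<bar> \<le> L * (sqrt L * E)"
proof -
  have cv: "continuous_on {0..L} v" using d1 by (intro DERIV_continuous_on) auto
  obtain z where z: "z \<in> {0..L}" "v' z = 0"
  proof -
    have d: "(v has_real_derivative v' z) (at z)" if h: "0 < z" "z < L" for z
      using d1[of z] h at_within_interior[of z "{0..L}"] by auto
    obtain z where "0 < z" "z < L" "v L - v 0 = v' z * (L - 0)"
      by (rule mvt[OF L cv, of "\<lambda>x h. v' x * h"]) (use d in \<open>auto simp: has_field_derivative_def\<close>)
    then show ?thesis using v0 L by (intro that[of z]) auto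
  qed
  have ftc: "\<bar>v' b - v' a\<bar> \<le> integral {0..L} (\<lambda>x. \<bar>v'' x\<bar>)" if "0 \<le> a" "a \<le> b" "b \<le> L" for a b
  proof -
    have "(v'' has_integral v' b - v' a) {a..b}"
      using that by (intro fundamental_theorem_of_calculus)
        (auto simp: has_real_derivative_iff_has_vector_derivative[symmetric] intro!: DERIV_subset[OF d2])
    then have "v' b - v' a = integral {a..b} v''" by (simp add: integral_unique)
    also have "\<bar>\<dots>\<bar> \<le> integral {a..b} (\<lambda>x. \<bar>v'' x\<bar>)"
      using that continuous_on_subset[OF cont, of "{a..b}"]
      unfolding real_norm_def[symmetric]
      by (intro integral_norm_bound_integral integrable_continuous_real continuous_intros) auto
    also have "\<dots> \<le> integral {0..L} (\<lambda>x. \<bar>v'' x\<bar>)"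
      using that continuous_on_subset[OF cont, of "{a..b}"] cont
      by (intro integral_subset_le integrable_continuous_real continuous_intros) auto
    finally show ?thesis .
  qed
  have b1: "\<bar>v' x\<bar> \<le> sqrt L * E" if "x \<in> {0..L}" for x
    using ftc[of x z] ftc[of z x] z that integral_abs_le_grid_norm[OF L cont E] by (cases "x \<le> z") auto
  show "\<bar>v' x\<bar> \<le> sqrt L * E" by (rule b1[OF x])
  have "\<bar>v x - v 0\<bar> \<le> sqrt L * E * \<bar>x - 0\<bar>"
    using field_differentiable_bound[of "{0..L}" v v' "sqrt L * E" x 0] d1 b1 x L by auto
  also have "\<dots> \<le> sqrt L * E * L" using x b1[OF x] by (intro mult_left_mono) auto
  finally show "\<bar>v x\<bar> \<le> L * (sqrt L * E)" using v0 by (simp add: mult.commute)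
qed

section \<open>Consistency of the difference operators in space\<close>

lemma Ck_derivs_unique:
  assumes "Ck_derivs (Suc k) {0..L} w d" "0 < L" "x \<in> {0..L}" "i \<le> k"
    and "\<And>x. x \<in> {0..L} \<Longrightarrow> d i x = g x" "(g has_real_derivative y) (at x within {0..L})"
  shows "d (Suc i) x = y"
proof -
  have "(d i has_real_derivative d (Suc i) x) (at x within {0..L})"
    using assms by (auto simp: Ck_derivs_def)
  moreover have "(d i has_real_derivative y) (at x within {0..L})"
    by (rule has_field_derivative_transform_within[OF assms(6), of 1]) (use assms(3,5) in auto)
  ultimately show ?thesis
    using assms(2,3)
    by (intro vector_derivative_unique_within_closed_interval[of 0 L x "d i"])
       (simp_all add: has_real_derivative_iff_has_vector_derivative)
qed

text \<open>An interpolation between the first and the fourth derivative. In each of the outer thirds of the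
  interval the mean value theorem gives a point where the second derivative is at most \<open>6 * c / L\<close>;
  between two such points there is one where the third derivative is small. From these
  points the bound of the fourth derivative extends the estimates to the whole interval.\<close>

lemma space_derivative_bounds:
  assumes L: "0 < L" and w: "Ck_derivs 4 {0..L} w d"
    and d1: "\<And>x. x \<in> {0..L} \<Longrightarrow> \<bar>d 1 x\<bar> \<le> c" and d4: "\<And>x. x \<in> {0..L} \<Longrightarrow> \<bar>d 4 x\<bar> \<le> B" and x: "x \<in> {0..L}"
  shows "\<bar>d 3 x\<bar> \<le> 36 * c / L\<^sup>2 + B * L" "\<bar>d 2 x\<bar> \<le> 6 * c / L + (36 * c / L\<^sup>2 + B * L) * L"
proof -
  have der: "(d i has_real_derivative d (Suc i) x) (at x within {0..L})" if "i < 4" "x \<in> {0..L}" for i x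
    using w that by (auto simp: Ck_derivs_def)
  have cont: "continuous_on {0..L} (d i)" if "i < 4" for i
    using der[OF that] by (intro DERIV_continuous_on) auto
  have mv: "\<exists>z. a < z \<and> z < b \<and> d i b - d i a = d (Suc i) z * (b - a)" if h: "i < 4" "0 \<le> a" "a < b" "b \<le> L" for i a b
  proof -
    have D: "(d i has_real_derivative d (Suc i) z) (at z)" if "a < z" "z < b" for z
      using der[of i z] h that at_within_interior[of z "{0..L}"] by auto
    obtain z where "a < z" "z < b" "d i b - d i a = d (Suc i) z * (b - a)"
      by (rule mvt[OF h(3) continuous_on_subset[OF cont[OF h(1)]], of "\<lambda>x v. d (Suc i) x * v"])
         (use D h in \<open>auto simp: has_field_derivative_def\<close>)
    then show ?thesis by blast
  qed
  have c0: "0 \<le> c" using d1[OF x] by simp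
  have 1: "\<exists>z. a < z \<and> z < a + L / 3 \<and> \<bar>d 2 z\<bar> \<le> 6 * c / L" if a: "0 \<le> a" "a + L / 3 \<le> L" for a
  proof -
    obtain z where z: "a < z" "z < a + L / 3" "d 1 (a + L / 3) - d 1 a = d 2 z * (L / 3)"
      using mv[of 1 a "a + L / 3"] a L by (auto simp: numeral_2_eq_2)
    have "\<bar>d 2 z * (L / 3)\<bar> \<le> 2 * c"
      unfolding z(3)[symmetric] using d1[of a] d1[of "a + L / 3"] a L by auto
    then have "\<bar>d 2 z\<bar> \<le> 6 * c / L" using L by (simp add: abs_mult field_simps)
    with z show ?thesis by blast
  qed
  obtain z1 where z1: "0 < z1" "z1 < L / 3" "\<bar>d 2 z1\<bar> \<le> 6 * c / L" using 1[of 0] L by auto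
  obtain z2 where z2: "2 * L / 3 < z2" "z2 < L" "\<bar>d 2 z2\<bar> \<le> 6 * c / L" using 1[of "2 * L / 3"] L by auto
  obtain z3 where z3: "z1 < z3" "z3 < z2" "d 2 z2 - d 2 z1 = d 3 z3 * (z2 - z1)"
    using mv[of 2 z1 z2] z1 z2 by (auto simp: numeral_2_eq_2 numeral_3_eq_3)
  have "\<bar>d 3 z3\<bar> * (L / 3) \<le> \<bar>d 3 z3\<bar> * \<bar>z2 - z1\<bar>" using z1 z2 by (intro mult_left_mono) auto
  also have "\<dots> \<le> 12 * c / L" unfolding abs_mult[symmetric] z3(3)[symmetric] using z1 z2 by simp
  finally have b3: "\<bar>d 3 z3\<bar> \<le> 36 * c / L\<^sup>2" using L by (simp add: field_simps power2_eq_square)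
  have d3: "\<bar>d 3 x\<bar> \<le> 36 * c / L\<^sup>2 + B * L" if x: "x \<in> {0..L}" for x
  proof -
    have "\<bar>d 3 x - d 3 z3\<bar> \<le> B * \<bar>x - z3\<bar>"
      using field_differentiable_bound[of "{0..L}" "d 3" "d 4" B x z3] der[of 3] d4 x z1 z2 z3
      by (auto simp: eval_nat_numeral)
    also have "\<dots> \<le> B * L" using x z1 z2 z3 d4[OF x] by (intro mult_left_mono) auto
    finally show ?thesis using b3 by simp
  qed
  show "\<bar>d 3 x\<bar> \<le> 36 * c / L\<^sup>2 + B * L" by (rule d3[OF x])
  have "\<bar>d 2 x - d 2 z1\<bar> \<le> (36 * c / L\<^sup>2 + B * L) * \<bar>x - z1\<bar>"
    using field_differentiable_bound[of "{0..L}" "d 2" "d 3" "36 * c / L\<^sup>2 + B * L" x z1] der[of 2] d3 x z1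
    by (auto simp: eval_nat_numeral)
  also have "\<dots> \<le> (36 * c / L\<^sup>2 + B * L) * L" using x z1 d3[OF x] L by (intro mult_left_mono) auto
  finally show "\<bar>d 2 x\<bar> \<le> 6 * c / L + (36 * c / L\<^sup>2 + B * L) * L" using z1 by simp
qed

text \<open>Taylor expansion; the terms of odd order in the mean and in the second difference cancel, as do
  those of even order in the central difference.\<close>

lemma difference_operators_consistent:
  fixes w :: "nat \<Rightarrow> real" and d :: "nat \<Rightarrow> real \<Rightarrow> real"
  assumes L: "0 < L" and j: "j \<in> {1..J-1}"
    and der: "\<And>i x. i < 4 \<Longrightarrow> x \<in> {0..L} \<Longrightarrow> (d i has_real_derivative d (Suc i) x) (at x within {0..L})"
    and w: "\<And>i. i \<le> J \<Longrightarrow> w i = d 0 (grid_pt L J i)"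
    and B: "\<And>x. x \<in> {0..L} \<Longrightarrow> \<bar>d 2 x\<bar> \<le> B2" "\<And>x. x \<in> {0..L} \<Longrightarrow> \<bar>d 3 x\<bar> \<le> B3" "\<And>x. x \<in> {0..L} \<Longrightarrow> \<bar>d 4 x\<bar> \<le> B4"
  defines "h \<equiv> L / real J" and "x \<equiv> grid_pt L J j"
  shows "\<bar>local_mean w j - d 0 x\<bar> \<le> B2 * h\<^sup>2" "\<bar>central_diff h w j - d 1 x\<bar> \<le> B3 * h\<^sup>2"
    "\<bar>second_diff h w j - d 2 x\<bar> \<le> B4 * h\<^sup>2"
proof -
  have J: "1 \<le> J" using j by auto
  have h: "0 < h" using L J by (simp add: h_def)
  have jm: "Suc (j - 1) = j" using j by auto
  have xp: "grid_pt L J (j + 1) = x + h" and xm: "grid_pt L J (j - 1) = x - h"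
    using grid_pt_Suc[of L J j] grid_pt_Suc[of L J "j - 1"] jm by (auto simp: x_def h_def)
  have wv: "w j = d 0 x" "w (j + 1) = d 0 (x + h)" "w (j - 1) = d 0 (x - h)"
    using w[of j] w[of "j + 1"] w[of "j - 1"] j xp xm by (auto simp: x_def)
  have mem: "x \<in> {0..L}" "x + h \<in> {0..L}" "x - h \<in> {0..L}"
    using grid_pt_le[OF L J, of j] grid_pt_le[OF L J, of "j + 1"] grid_pt_le[OF L J, of "j - 1"] j xp xm
    by (auto simp: x_def)
  have taylor: "\<bar>d 0 y - (\<Sum>i\<le>n. d i x * (y - x) ^ i / fact i)\<bar> \<le> K * \<bar>y - x\<bar> ^ Suc n / fact n"
    if "n < 4" "y \<in> {0..L}" "\<And>x. x \<in> {0..L} \<Longrightarrow> \<bar>d (Suc n) x\<bar> \<le> K" for n y K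
    using field_Taylor[of "{0..L}" n d K x y] that der mem by auto
  have t1: "\<bar>d 0 (x + s) - (d 0 x + d 1 x * s)\<bar> \<le> B2 * \<bar>s\<bar>\<^sup>2" if "x + s \<in> {0..L}" for s
    using taylor[of 1 "x + s" B2] that B by (simp add: numeral_2_eq_2)
  have t2: "\<bar>d 0 (x + s) - (d 0 x + d 1 x * s + d 2 x * s\<^sup>2 / 2)\<bar> \<le> B3 * \<bar>s\<bar> ^ 3 / 2" if "x + s \<in> {0..L}" for s
    using taylor[of 2 "x + s" B3] that B by (simp add: eval_nat_numeral)
  have t3: "\<bar>d 0 (x + s) - (d 0 x + d 1 x * s + d 2 x * s\<^sup>2 / 2 + d 3 x * s ^ 3 / 6)\<bar> \<le> B4 * \<bar>s\<bar> ^ 4 / 6" if "x + s \<in> {0..L}" for s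
    using taylor[of 3 "x + s" B4] that B by (simp add: eval_nat_numeral)
  show "\<bar>local_mean w j - d 0 x\<bar> \<le> B2 * h\<^sup>2"
  proof -
    have eq: "local_mean w j - d 0 x = ((d 0 (x + h) - (d 0 x + d 1 x * h)) + (d 0 (x + - h) - (d 0 x + d 1 x * - h))) / 3"
      by (simp add: local_mean_def wv[simplified] field_simps)
    have b: "\<bar>d 0 (x + h) - (d 0 x + d 1 x * h)\<bar> \<le> B2 * h\<^sup>2" "\<bar>d 0 (x + - h) - (d 0 x + d 1 x * - h)\<bar> \<le> B2 * h\<^sup>2"
      using t1[of h] t1[of "- h"] mem by auto
    have "\<bar>(a + b) / 3\<bar> \<le> K" if "\<bar>a\<bar> \<le> K" "\<bar>b\<bar> \<le> K" for a b K :: real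
      using that abs_triangle_ineq[of a b] abs_ge_zero[of a] by simp
    from this[OF b] show ?thesis unfolding eq .
  qed
  show "\<bar>central_diff h w j - d 1 x\<bar> \<le> B3 * h\<^sup>2"
  proof -
    have "2 * h * (central_diff h w j - d 1 x)
        = (d 0 (x + h) - (d 0 x + d 1 x * h + d 2 x * h\<^sup>2 / 2)) - (d 0 (x + - h) - (d 0 x + d 1 x * - h + d 2 x * (- h)\<^sup>2 / 2))"
      using h by (simp add: central_diff_def wv[simplified] field_simps)
    moreover have "\<bar>d 0 (x + h) - (d 0 x + d 1 x * h + d 2 x * h\<^sup>2 / 2)\<bar> \<le> B3 * h ^ 3 / 2"
      "\<bar>d 0 (x + - h) - (d 0 x + d 1 x * - h + d 2 x * (- h)\<^sup>2 / 2)\<bar> \<le> B3 * h ^ 3 / 2"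
      using t2[of h] t2[of "- h"] mem h by auto
    ultimately have "\<bar>2 * h * (central_diff h w j - d 1 x)\<bar> \<le> B3 * h ^ 3" by linarith
    moreover have "2 * h * \<bar>X\<bar> \<le> 2 * h * (B3 * h\<^sup>2 / 2)" if "\<bar>2 * h * X\<bar> \<le> B3 * h ^ 3" for X
      using that h by (simp add: abs_mult power3_eq_cube power2_eq_square ac_simps)
    ultimately have "2 * h * \<bar>central_diff h w j - d 1 x\<bar> \<le> 2 * h * (B3 * h\<^sup>2 / 2)" by blast
    then have "\<bar>central_diff h w j - d 1 x\<bar> \<le> B3 * h\<^sup>2 / 2" using h by simp
    moreover have "0 \<le> B3 * h\<^sup>2" using B(2)[OF mem(1)] by simp
    ultimately show ?thesis by simp
  qed
  show "\<bar>second_diff h w j - d 2 x\<bar> \<le> B4 * h\<^sup>2"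
  proof -
    have "h\<^sup>2 * (second_diff h w j - d 2 x)
        = (d 0 (x + h) - (d 0 x + d 1 x * h + d 2 x * h\<^sup>2 / 2 + d 3 x * h ^ 3 / 6))
          + (d 0 (x + - h) - (d 0 x + d 1 x * - h + d 2 x * (- h)\<^sup>2 / 2 + d 3 x * (- h) ^ 3 / 6))"
      using h by (simp add: second_diff_def wv[simplified] field_simps)
    moreover have "\<bar>d 0 (x + h) - (d 0 x + d 1 x * h + d 2 x * h\<^sup>2 / 2 + d 3 x * h ^ 3 / 6)\<bar> \<le> B4 * h ^ 4 / 6"
      "\<bar>d 0 (x + - h) - (d 0 x + d 1 x * - h + d 2 x * (- h)\<^sup>2 / 2 + d 3 x * (- h) ^ 3 / 6)\<bar> \<le> B4 * h ^ 4 / 6"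
      using t3[of h] t3[of "- h"] mem h by auto
    ultimately have "\<bar>h\<^sup>2 * (second_diff h w j - d 2 x)\<bar> \<le> B4 * h ^ 4 / 3" by linarith
    also have "\<dots> \<le> B4 * h ^ 4" using B(3)[OF mem(1)] by simp
    finally have "h\<^sup>2 * \<bar>second_diff h w j - d 2 x\<bar> \<le> h\<^sup>2 * (B4 * h\<^sup>2)"
      by (simp add: abs_mult eval_nat_numeral ac_simps)
    then show ?thesis using h by simp
  qed
qed

section \<open>The quadrature error of the memory term\<close>

text \<open>On a fixed grid every component is bounded by the norm. The constant depends on the grid, so this is
  used for integrability only.\<close>

lemma regular_family_weakly_singular:
  assumes L: "0 < L" and M: "0 \<le> M" and reg: "regular_family L J T \<sigma> M G G' G''" and T: "0 < T"
    and \<theta>: "0 < \<theta>" "1 - \<sigma> \<le> \<theta>" and j: "j \<in> {1..J-1}"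
  obtains K where "0 \<le> K" "\<And>\<zeta>. \<zeta> \<in> {0<..T} \<Longrightarrow> \<bar>G j \<zeta>\<bar> \<le> K * \<zeta> powr (- \<theta>)"
proof -
  define K1 where "K1 = sqrt (real J / L) * (M / \<theta> * T powr (\<sigma> - 1 + \<theta>))"
  have K1: "0 \<le> K1" using M \<theta> L by (simp add: K1_def)
  show thesis
  proof (rule that)
    show "0 \<le> \<bar>G j T\<bar> * T powr \<theta> + K1" using K1 by simp
    fix \<zeta> assume z: "\<zeta> \<in> {0<..T}"
    have "\<bar>G j T - G j \<zeta>\<bar> \<le> sqrt (real J / L) * grid_norm L J (\<lambda>s. G s T - G s \<zeta>)"
      by (rule abs_le_grid_norm[OF L j])
    also have "\<dots> \<le> sqrt (real J / L) * (M / \<theta> * T powr (\<sigma> - 1 + \<theta>) * (\<zeta> powr (- \<theta>) - T powr (- \<theta>)))"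
      using z L by (intro mult_left_mono regular_family_increment[OF L M reg] \<theta>) auto
    also have "\<dots> \<le> sqrt (real J / L) * (M / \<theta> * T powr (\<sigma> - 1 + \<theta>) * \<zeta> powr (- \<theta>))"
      using M L \<theta> by (intro mult_left_mono) auto
    finally have 1: "\<bar>G j T - G j \<zeta>\<bar> \<le> K1 * \<zeta> powr (- \<theta>)" by (simp add: K1_def ac_simps)
    have "T powr (- \<theta>) \<le> \<zeta> powr (- \<theta>)" using z \<theta> by (intro powr_mono2') auto
    then have "T powr \<theta> * T powr (- \<theta>) \<le> T powr \<theta> * \<zeta> powr (- \<theta>)" by (intro mult_left_mono) auto
    moreover have "T powr \<theta> * T powr (- \<theta>) = 1" using T by (simp flip: powr_add)
    ultimately have "\<bar>G j T\<bar> * 1 \<le> \<bar>G j T\<bar> * (T powr \<theta> * \<zeta> powr (- \<theta>))" by (intro mult_left_mono) auto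
    with 1 show "\<bar>G j \<zeta>\<bar> \<le> (\<bar>G j T\<bar> * T powr \<theta> + K1) * \<zeta> powr (- \<theta>)"
      by (simp add: algebra_simps)
  qed
qed

context time_mesh
begin

lemma sum_integral_steps:
  fixes f :: "real \<Rightarrow> real"
  assumes "f integrable_on {0..t N}" "m \<le> N"
  shows "(\<Sum>s=1..m. integral {t (s - 1)..t s} f) = integral {0..t m} f"
  using assms(2)
proof (induction m)
  case (Suc m)
  have "integral {0..t m} f + integral {t m..t (Suc m)} f = integral {0..t (Suc m)} f"
    using Suc.prems t_nonneg[of m] t_mono[of m "Suc m"] t_mono[of "Suc m" N]
    by (intro Henstock_Kurzweil_Integration.integral_combine integrable_on_subinterval[OF assms(1)]) auto
  then show ?case using Suc by simp
qed (simp add: t0)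

text \<open>Column sums of the weights are of the size of the step, whatever the mesh.\<close>

lemma sum_mem_weight_times_le:
  assumes "\<And>s. s \<in> S \<Longrightarrow> 0 \<le> e s" "S \<subseteq> {1..N}"
  shows "(\<Sum>n=1..N. \<Sum>s\<in>S. mem_weight n s * e s) \<le> pow_kernel \<alpha> (t N) * (\<Sum>s\<in>S. step t s * e s)"
proof -
  have "(\<Sum>n=1..N. \<Sum>s\<in>S. mem_weight n s * e s) = (\<Sum>s\<in>S. (\<Sum>n=1..N. mem_weight n s) * e s)"
    by (subst sum.swap) (simp add: sum_distrib_right)
  also have "\<dots> \<le> (\<Sum>s\<in>S. step t s * pow_kernel \<alpha> (t N) * e s)"
    using assms by (intro sum_mono mult_right_mono mem_weight_column_le) auto
  also have "\<dots> = pow_kernel \<alpha> (t N) * (\<Sum>s\<in>S. step t s * e s)"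
    by (simp add: sum_distrib_left ac_simps)
  finally show ?thesis .
qed

end

context monotone_time_mesh
begin

lemma mem_kernel_midpoint_moment:
  assumes s: "s \<in> {2..N}" and n: "n \<in> {1..N}"
  shows "((\<lambda>\<zeta>. mem_kernel n \<zeta> * (\<zeta> - (t (s - 1) + t s) / 2)) has_integral
    moment_weight (n - 1) s - moment_weight n s) {t (s - 1)..t s}"
proof -
  have le: "t (s - 1) \<le> t s" using t_step[of s] s by auto
  have part: "((\<lambda>\<zeta>. pow_kernel \<alpha> (t m - \<zeta>) * (\<zeta> - (t (s - 1) + t s) / 2)) has_integral - moment_weight m s) {t (s - 1)..t s}"
    if m: "m \<le> N" for m
  proof (cases "s \<le> m")
    case True
    then show ?thesis
      using pow_kernel_midpoint_moment[OF \<alpha> le, of "t m"] t_mono[of s m] m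
      by (simp add: moment_weight_def step_def)
  next
    case False
    have "pow_kernel \<alpha> (t m - \<zeta>) = 0" if "\<zeta> \<in> {t (s - 1)..t s}" for \<zeta>
    proof -
      have "t m \<le> t (s - 1)" using False s by (intro t_mono) auto
      with that show ?thesis by simp
    qed
    then have "((\<lambda>\<zeta>. pow_kernel \<alpha> (t m - \<zeta>) * (\<zeta> - (t (s - 1) + t s) / 2)) has_integral 0) {t (s - 1)..t s}"
      by (intro has_integral_is_0) auto
    then show ?thesis using False by (simp add: moment_weight_def)
  qed
  have "n - 1 \<le> N" "n \<le> N" using n by auto
  from has_integral_diff[OF part[OF this(2)] part[OF this(1)]]
  show ?thesis by (simp add: mem_kernel_def left_diff_distrib)
qed

text \<open>Quadrature minus integral. Since \<open>mem_kernel n\<close> vanishes after \<open>t n\<close>, the integral effectively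
  ends there.\<close>

definition memory_error :: "(nat \<Rightarrow> real \<Rightarrow> real) \<Rightarrow> nat \<Rightarrow> nat \<Rightarrow> real" where
  "memory_error G n j = (\<Sum>s=1..n. mem_weight n s * level (\<lambda>m i. G i (t m)) s j)
     - integral {0..t N} (\<lambda>\<zeta>. mem_kernel n \<zeta> * G j \<zeta>)"

context
  fixes L \<sigma> M c \<theta> :: real and J :: nat and G G' G'' :: "nat \<Rightarrow> real \<Rightarrow> real"
  assumes L: "0 < L" and M: "0 \<le> M" and reg: "regular_family L J (t N) \<sigma> M G G' G''"
    and c: "1 \<le> c" "\<And>n. n \<in> {2..N} \<Longrightarrow> t n \<le> c * t (n - 1)"
    and \<theta>: "0 < \<theta>" "\<theta> < 1" "1 - \<sigma> \<le> \<theta>"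
begin

lemma family_mem_kernel_integrable:
  assumes j: "j \<in> {1..J-1}" and ab: "0 \<le> a" "b \<le> t N" and h: "continuous_on {0..t N} h"
  shows "(\<lambda>\<zeta>. h \<zeta> * G j \<zeta>) integrable_on {a..b}"
proof -
  obtain K where K: "\<And>\<zeta>. \<zeta> \<in> {0<..t N} \<Longrightarrow> \<bar>G j \<zeta>\<bar> \<le> K * \<zeta> powr (- \<theta>)"
    by (rule regular_family_weakly_singular[OF L M reg t_pos[OF N order_refl] \<theta>(1,3) j]) blast
  have "(G j) absolutely_integrable_on {0..t N}"
    using t_nonneg[of N]
    by (intro weakly_singular_absolutely_integrable[OF \<theta>(2) _ regular_family_continuous[OF L M reg j] K]) auto
  from absolutely_integrable_continuous_times[OF h this]
  have "(\<lambda>\<zeta>. h \<zeta> * G j \<zeta>) integrable_on {0..t N}" by (rule set_lebesgue_integral_eq_integral(1))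
  then show ?thesis by (rule integrable_on_subinterval) (use ab in auto)
qed

text \<open>Linear interpolant minus function, on the \<open>s\<close>-th interval.\<close>

definition interp_error :: "nat \<Rightarrow> nat \<Rightarrow> real \<Rightarrow> real" where
  "interp_error s j \<zeta> = G j (t (s - 1)) + (\<zeta> - t (s - 1)) * slope (G j) (t (s - 1)) (t s) - G j \<zeta>"

text \<open>The interpolation error is the distance to the left end times a difference of two slopes.\<close>

lemma grid_norm_interp_error:
  assumes s: "s \<in> {2..N}" and z: "\<zeta> \<in> {t (s - 1)<..<t s}"
  shows "grid_norm L J (\<lambda>j. interp_error s j \<zeta>) \<le> M * c powr \<bar>\<sigma> - 3\<bar> * ((step t s)\<^sup>2 * t s powr (\<sigma> - 3))"
proof -
  let ?p = "t (s - 1)" and ?q = "t s"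
  have p: "0 < ?p" "?p < ?q" "?q \<le> t N" using s t_pos[of "s - 1"] t_step[of s] t_mono[of s N] by auto
  have "(\<zeta> - ?p) * slope (G j) ?p \<zeta> = G j \<zeta> - G j ?p" for j
    using z by (simp add: slope_def)
  then have "interp_error s j \<zeta> = (\<zeta> - ?p) * (slope (G j) ?p ?q - slope (G j) ?p \<zeta>)" for j
    by (simp add: interp_error_def right_diff_distrib)
  then have "grid_norm L J (\<lambda>j. interp_error s j \<zeta>) = \<bar>\<zeta> - ?p\<bar> * grid_norm L J (\<lambda>j. slope (G j) ?p ?q - slope (G j) ?p \<zeta>)"
    by (simp only: grid_norm_scale[OF L])
  also have "\<dots> \<le> (?q - ?p) * ((?q - ?p) * (M * c powr \<bar>\<sigma> - 3\<bar> * ?q powr (\<sigma> - 3)))"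
    using z p c s L by (intro mult_mono regular_family_slope[OF L M reg]) auto
  also have "\<dots> = M * c powr \<bar>\<sigma> - 3\<bar> * ((step t s)\<^sup>2 * t s powr (\<sigma> - 3))"
    by (simp add: step_def power2_eq_square)
  finally show ?thesis .
qed

text \<open>The mean of the end values is the value of the linear interpolant at the midpoint.\<close>

lemma level_error_split:
  assumes s: "s \<in> {2..N}"
  shows "level (\<lambda>m i. G i (t m)) s j - G j \<zeta>
    = interp_error s j \<zeta> - slope (G j) (t (s - 1)) (t s) * (\<zeta> - (t (s - 1) + t s) / 2)"
proof -
  have "t s - t (s - 1) \<noteq> 0" using t_step[of s] s by auto
  moreover have "(b + a) / 2 - g = a + (z - p) * ((b - a) / (q - p)) - g - (b - a) / (q - p) * (z - (p + q) / 2)"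
    if "q - p \<noteq> 0" for a b g z p q :: real
  proof -
    define x where "x = (b - a) / (q - p)"
    have "b - a = x * (q - p)" using that by (simp add: x_def)
    then have b: "b = a + x * (q - p)" by simp
    show ?thesis unfolding x_def[symmetric] unfolding b by (simp add: field_simps)
  qed
  ultimately show ?thesis
    using s by (auto simp: level_def time_mean_def interp_error_def slope_def)
qed

text \<open>The three parts come from the first interval, from the linear interpolation on the others, and from
  the distance to the midpoint, whose moments against \<open>mem_kernel n\<close> are differences of moments
  against \<open>pow_kernel \<alpha>\<close>.\<close>

lemma memory_error_split:
  assumes n: "n \<in> {1..N}" and j: "j \<in> {1..J-1}"
  shows "memory_error G n j =
      integral {0<..<t 1} (\<lambda>\<zeta>. mem_kernel n \<zeta> * (G j (t 1) - G j \<zeta>))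
      + (\<Sum>s=2..N. integral {t (s - 1)<..<t s} (\<lambda>\<zeta>. mem_kernel n \<zeta> * interp_error s j \<zeta>))
      + (\<Sum>s=2..n. slope (G j) (t (s - 1)) (t s) * (moment_weight n s - moment_weight (n - 1) s))"
proof -
  let ?l = "\<lambda>s. level (\<lambda>m i. G i (t m)) s j"
  let ?D = "\<lambda>s. slope (G j) (t (s - 1)) (t s)"
  have int: "(\<lambda>\<zeta>. mem_kernel n \<zeta> * G j \<zeta>) integrable_on {t (s - 1)..t s}" if "s \<in> {1..N}" for s
    using that t_nonneg[of "s - 1"] t_mono[of s N]
    by (intro family_mem_kernel_integrable j mem_kernel_continuous) auto
  have piece: "mem_weight n s * ?l s - integral {t (s - 1)..t s} (\<lambda>\<zeta>. mem_kernel n \<zeta> * G j \<zeta>)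
      = integral {t (s - 1)..t s} (\<lambda>\<zeta>. mem_kernel n \<zeta> * (?l s - G j \<zeta>))" if "s \<in> {1..N}" for s
    using has_integral_diff[OF has_integral_mult_left[OF mem_weight_has_integral[OF that, of n], where c="?l s"] integrable_integral[OF int[OF that]]]
    by (simp add: right_diff_distrib integral_unique)
  have "memory_error G n j = (\<Sum>s=1..N. mem_weight n s * ?l s) - (\<Sum>s=1..N. integral {t (s - 1)..t s} (\<lambda>\<zeta>. mem_kernel n \<zeta> * G j \<zeta>))"
  proof -
    have "(\<Sum>s=1..n. mem_weight n s * ?l s) = (\<Sum>s=1..N. mem_weight n s * ?l s)"
      by (rule sum.mono_neutral_left) (use n in \<open>auto simp: mem_weight_eq_0\<close>)
    moreover have "(\<Sum>s=1..N. integral {t (s - 1)..t s} (\<lambda>\<zeta>. mem_kernel n \<zeta> * G j \<zeta>)) = integral {0..t N} (\<lambda>\<zeta>. mem_kernel n \<zeta> * G j \<zeta>)"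
      by (intro sum_integral_steps family_mem_kernel_integrable j mem_kernel_continuous) auto
    ultimately show ?thesis by (simp add: memory_error_def)
  qed
  also have "\<dots> = (\<Sum>s=1..N. integral {t (s - 1)..t s} (\<lambda>\<zeta>. mem_kernel n \<zeta> * (?l s - G j \<zeta>)))"
    unfolding sum_subtractf[symmetric] by (rule sum.cong[OF refl piece])
  also have "\<dots> = integral {t 0..t 1} (\<lambda>\<zeta>. mem_kernel n \<zeta> * (?l 1 - G j \<zeta>))
      + (\<Sum>s=2..N. integral {t (s - 1)..t s} (\<lambda>\<zeta>. mem_kernel n \<zeta> * (?l s - G j \<zeta>)))"
    using N by (simp add: sum.atLeast_Suc_atMost numeral_2_eq_2)
  also have "integral {t 0..t 1} (\<lambda>\<zeta>. mem_kernel n \<zeta> * (?l 1 - G j \<zeta>)) = integral {0<..<t 1} (\<lambda>\<zeta>. mem_kernel n \<zeta> * (G j (t 1) - G j \<zeta>))"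
    by (simp add: level_def t0 integral_open_interval_real)
  also have "(\<Sum>s=2..N. integral {t (s - 1)..t s} (\<lambda>\<zeta>. mem_kernel n \<zeta> * (?l s - G j \<zeta>)))
      = (\<Sum>s=2..N. integral {t (s - 1)<..<t s} (\<lambda>\<zeta>. mem_kernel n \<zeta> * interp_error s j \<zeta>) + ?D s * (moment_weight n s - moment_weight (n - 1) s))"
  proof (rule sum.cong[OF refl])
    fix s assume s: "s \<in> {2..N}"
    then have s1: "s \<in> {1..N}" by auto
    have hm: "((\<lambda>\<zeta>. ?D s * (mem_kernel n \<zeta> * (\<zeta> - (t (s - 1) + t s) / 2))) has_integral
        ?D s * (moment_weight (n - 1) s - moment_weight n s)) {t (s - 1)..t s}"
      by (intro has_integral_mult_right mem_kernel_midpoint_moment s n)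
    have hl: "((\<lambda>\<zeta>. mem_kernel n \<zeta> * (?l s - G j \<zeta>)) has_integral
        integral {t (s - 1)..t s} (\<lambda>\<zeta>. mem_kernel n \<zeta> * (?l s - G j \<zeta>))) {t (s - 1)..t s}"
      using has_integral_diff[OF has_integral_mult_left[OF mem_weight_has_integral[OF s1, of n], where c="?l s"] integrable_integral[OF int[OF s1]]]
      by (intro integrable_integral) (auto simp: right_diff_distrib)
    have "mem_kernel n \<zeta> * (?l s - G j \<zeta>) + ?D s * (mem_kernel n \<zeta> * (\<zeta> - (t (s - 1) + t s) / 2))
        = mem_kernel n \<zeta> * interp_error s j \<zeta>" for \<zeta>
      unfolding level_error_split[OF s] by (simp add: algebra_simps)
    with has_integral_add[OF hl hm]
    have "((\<lambda>\<zeta>. mem_kernel n \<zeta> * interp_error s j \<zeta>) has_integral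
        integral {t (s - 1)..t s} (\<lambda>\<zeta>. mem_kernel n \<zeta> * (?l s - G j \<zeta>)) + ?D s * (moment_weight (n - 1) s - moment_weight n s)) {t (s - 1)..t s}"
      by simp
    from integral_unique[OF this]
    show "integral {t (s - 1)..t s} (\<lambda>\<zeta>. mem_kernel n \<zeta> * (?l s - G j \<zeta>))
        = integral {t (s - 1)<..<t s} (\<lambda>\<zeta>. mem_kernel n \<zeta> * interp_error s j \<zeta>) + ?D s * (moment_weight n s - moment_weight (n - 1) s)"
      unfolding integral_open_interval_real[symmetric] right_diff_distrib[of "?D s"] by linarith
  qed
  also have "\<dots> = (\<Sum>s=2..N. integral {t (s - 1)<..<t s} (\<lambda>\<zeta>. mem_kernel n \<zeta> * interp_error s j \<zeta>))
      + (\<Sum>s=2..N. ?D s * (moment_weight n s - moment_weight (n - 1) s))"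
    by (rule sum.distrib)
  also have "(\<Sum>s=2..N. ?D s * (moment_weight n s - moment_weight (n - 1) s)) = (\<Sum>s=2..n. ?D s * (moment_weight n s - moment_weight (n - 1) s))"
    by (rule sum.mono_neutral_right) (use n in \<open>auto simp: moment_weight_def\<close>)
  finally show ?thesis by simp
qed

text \<open>The increments of the family on the first interval are bounded by an integrable power, and the sum
  of the kernels over \<open>n\<close> is bounded uniformly, so the sum over \<open>n\<close> is taken inside the integral.\<close>

lemma first_interval_error:
  "(\<Sum>n=1..N. grid_norm L J (\<lambda>j. integral {0<..<t 1} (\<lambda>\<zeta>. mem_kernel n \<zeta> * (G j (t 1) - G j \<zeta>))))
    \<le> pow_kernel \<alpha> (t N) * (M / (\<theta> * (1 - \<theta>)) * t 1 powr \<sigma>)"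
proof -
  define K where "K = M / \<theta> * t 1 powr (\<sigma> - 1 + \<theta>)"
  have t1: "0 < t 1" "t 1 \<le> t N" using N t_pos[of 1] t_mono[of 1 N] by auto
  have K: "0 \<le> K" using M \<theta> by (simp add: K_def)
  have ai: "(\<lambda>\<zeta>. K * \<zeta> powr (- \<theta>)) absolutely_integrable_on {0..t 1}"
    using powr_minus_integral[OF \<theta>(2), of "t 1"] t1
    by (intro absolutely_integrable_continuous_times nonnegative_absolutely_integrable_1) auto
  have kint: "(\<lambda>\<zeta>. mem_kernel n \<zeta> * (K * \<zeta> powr (- \<theta>))) integrable_on {0<..<t 1}" for n
    using set_lebesgue_integral_eq_integral(1)[OF absolutely_integrable_continuous_times[OF mem_kernel_continuous ai]]
    by (simp add: integrable_on_Icc_iff_Ioo)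
  have "(\<Sum>n=1..N. grid_norm L J (\<lambda>j. integral {0<..<t 1} (\<lambda>\<zeta>. mem_kernel n \<zeta> * (G j (t 1) - G j \<zeta>))))
      \<le> (\<Sum>n=1..N. integral {0<..<t 1} (\<lambda>\<zeta>. mem_kernel n \<zeta> * (K * \<zeta> powr (- \<theta>))))"
  proof (intro sum_mono grid_norm_integral_le[OF L _ kint])
    fix n j assume n: "n \<in> {1..N}" and j: "j \<in> {1..J-1}"
    have "(\<lambda>\<zeta>. mem_kernel n \<zeta> * G j (t 1)) integrable_on {0..t 1}"
      by (intro integrable_continuous_real continuous_intros mem_kernel_continuous)
    moreover have "(\<lambda>\<zeta>. mem_kernel n \<zeta> * G j \<zeta>) integrable_on {0..t 1}"
      using t1 by (intro family_mem_kernel_integrable j mem_kernel_continuous) auto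
    ultimately have "(\<lambda>\<zeta>. mem_kernel n \<zeta> * (G j (t 1) - G j \<zeta>)) integrable_on {0..t 1}"
      unfolding right_diff_distrib by (rule integrable_diff)
    then show "(\<lambda>\<zeta>. mem_kernel n \<zeta> * (G j (t 1) - G j \<zeta>)) integrable_on {0<..<t 1}"
      by (simp add: integrable_on_Icc_iff_Ioo)
  next
    fix n \<zeta> assume n: "n \<in> {1..N}" and z: "\<zeta> \<in> {0<..<t 1}"
    have "grid_norm L J (\<lambda>j. G j (t 1) - G j \<zeta>) \<le> M / \<theta> * t 1 powr (\<sigma> - 1 + \<theta>) * (\<zeta> powr (- \<theta>) - t 1 powr (- \<theta>))"
      using z t1 by (intro regular_family_increment[OF L M reg] \<theta>) auto
    also have "\<dots> \<le> K * \<zeta> powr (- \<theta>)" unfolding K_def[symmetric] using K by (intro mult_left_mono) auto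
    finally show "grid_norm L J (\<lambda>j. mem_kernel n \<zeta> * (G j (t 1) - G j \<zeta>)) \<le> mem_kernel n \<zeta> * (K * \<zeta> powr (- \<theta>))"
      using mem_kernel_nonneg[OF n, of \<zeta>] by (simp add: grid_norm_scale[OF L] mult_left_mono)
  qed
  also have "\<dots> = integral {0<..<t 1} (\<lambda>\<zeta>. \<Sum>n=1..N. mem_kernel n \<zeta> * (K * \<zeta> powr (- \<theta>)))"
    by (rule Henstock_Kurzweil_Integration.integral_sum[symmetric]) (use kint in auto)
  also have "\<dots> \<le> integral {0<..<t 1} (\<lambda>\<zeta>. pow_kernel \<alpha> (t N) * (K * \<zeta> powr (- \<theta>)))"
  proof (rule integral_le)
    show "(\<lambda>\<zeta>. \<Sum>n=1..N. mem_kernel n \<zeta> * (K * \<zeta> powr (- \<theta>))) integrable_on {0<..<t 1}"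
      using kint by (intro integrable_sum) auto
    show "(\<lambda>\<zeta>. pow_kernel \<alpha> (t N) * (K * \<zeta> powr (- \<theta>))) integrable_on {0<..<t 1}"
      using integrable_cmul[OF set_lebesgue_integral_eq_integral(1)[OF ai], of "pow_kernel \<alpha> (t N)"]
      by (simp add: integrable_on_Icc_iff_Ioo)
    fix \<zeta> assume z: "\<zeta> \<in> {0<..<t 1}"
    have "(\<Sum>n=1..N. mem_kernel n \<zeta> * (K * \<zeta> powr (- \<theta>))) = pow_kernel \<alpha> (t N - \<zeta>) * (K * \<zeta> powr (- \<theta>))"
      unfolding sum_distrib_right[symmetric] using z by (subst sum_mem_kernel) auto
    also have "\<dots> \<le> pow_kernel \<alpha> (t N) * (K * \<zeta> powr (- \<theta>))"
      using z K \<alpha> by (intro mult_right_mono pow_kernel_mono) auto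
    finally show "(\<Sum>n=1..N. mem_kernel n \<zeta> * (K * \<zeta> powr (- \<theta>))) \<le> pow_kernel \<alpha> (t N) * (K * \<zeta> powr (- \<theta>))" .
  qed
  also have "\<dots> = pow_kernel \<alpha> (t N) * (K * (t 1 powr (1 - \<theta>) / (1 - \<theta>)))"
    using integral_unique[OF powr_minus_integral[OF \<theta>(2), of "t 1"]] t1
    by (simp add: integral_open_interval_real[symmetric])
  also have "K * (t 1 powr (1 - \<theta>) / (1 - \<theta>)) = M / (\<theta> * (1 - \<theta>)) * (t 1 powr (\<sigma> - 1 + \<theta>) * t 1 powr (1 - \<theta>))"
    by (simp add: K_def)
  also have "t 1 powr (\<sigma> - 1 + \<theta>) * t 1 powr (1 - \<theta>) = t 1 powr \<sigma>"
    by (simp flip: powr_add)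
  finally show ?thesis .
qed

text \<open>The interpolation errors depend on \<open>s\<close> only, so the weights may be summed over \<open>n\<close> first.\<close>

lemma interpolation_error:
  "(\<Sum>n=1..N. grid_norm L J (\<lambda>j. \<Sum>s=2..N. integral {t (s - 1)<..<t s} (\<lambda>\<zeta>. mem_kernel n \<zeta> * interp_error s j \<zeta>)))
    \<le> pow_kernel \<alpha> (t N) * (M * c powr \<bar>\<sigma> - 3\<bar> * (\<Sum>s=2..N. step t s ^ 3 * t s powr (\<sigma> - 3)))"
proof -
  define e where "e s = M * c powr \<bar>\<sigma> - 3\<bar> * ((step t s)\<^sup>2 * t s powr (\<sigma> - 3))" for s
  have e: "0 \<le> e s" for s using M by (simp add: e_def)
  have one: "grid_norm L J (\<lambda>j. integral {t (s - 1)<..<t s} (\<lambda>\<zeta>. mem_kernel n \<zeta> * interp_error s j \<zeta>)) \<le> mem_weight n s * e s"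
    if n: "n \<in> {1..N}" and s: "s \<in> {2..N}" for n s
  proof -
    have s1: "s \<in> {1..N}" using s by auto
    have hi: "((\<lambda>\<zeta>. mem_kernel n \<zeta> * e s) has_integral mem_weight n s * e s) {t (s - 1)..t s}"
      by (intro has_integral_mult_left mem_weight_has_integral s1)
    have "grid_norm L J (\<lambda>j. integral {t (s - 1)<..<t s} (\<lambda>\<zeta>. mem_kernel n \<zeta> * interp_error s j \<zeta>))
        \<le> integral {t (s - 1)<..<t s} (\<lambda>\<zeta>. mem_kernel n \<zeta> * e s)"
    proof (rule grid_norm_integral_le[OF L])
      fix j assume j: "j \<in> {1..J-1}"
      have "(\<lambda>\<zeta>. mem_kernel n \<zeta> * (G j (t (s - 1)) + (\<zeta> - t (s - 1)) * slope (G j) (t (s - 1)) (t s))) integrable_on {t (s - 1)..t s}"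
        by (intro integrable_continuous_real continuous_intros mem_kernel_continuous)
      moreover have "(\<lambda>\<zeta>. mem_kernel n \<zeta> * G j \<zeta>) integrable_on {t (s - 1)..t s}"
        using s t_nonneg[of "s - 1"] t_mono[of s N] by (intro family_mem_kernel_integrable j mem_kernel_continuous) auto
      ultimately have "(\<lambda>\<zeta>. mem_kernel n \<zeta> * interp_error s j \<zeta>) integrable_on {t (s - 1)..t s}"
        unfolding interp_error_def right_diff_distrib by (rule integrable_diff)
      then show "(\<lambda>\<zeta>. mem_kernel n \<zeta> * interp_error s j \<zeta>) integrable_on {t (s - 1)<..<t s}"
        by (simp add: integrable_on_Icc_iff_Ioo)
    next
      show "(\<lambda>\<zeta>. mem_kernel n \<zeta> * e s) integrable_on {t (s - 1)<..<t s}"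
        using hi by (auto simp: integrable_on_Icc_iff_Ioo[symmetric])
    next
      fix \<zeta> assume z: "\<zeta> \<in> {t (s - 1)<..<t s}"
      show "grid_norm L J (\<lambda>j. mem_kernel n \<zeta> * interp_error s j \<zeta>) \<le> mem_kernel n \<zeta> * e s"
        using mem_kernel_nonneg[OF n, of \<zeta>] grid_norm_interp_error[OF s z]
        by (simp add: grid_norm_scale[OF L] mult_left_mono e_def)
    qed
    also have "\<dots> = mem_weight n s * e s"
      using integral_unique[OF hi] by (simp only: integral_open_interval_real)
    finally show ?thesis .
  qed
  have "(\<Sum>n=1..N. grid_norm L J (\<lambda>j. \<Sum>s=2..N. integral {t (s - 1)<..<t s} (\<lambda>\<zeta>. mem_kernel n \<zeta> * interp_error s j \<zeta>)))
      \<le> (\<Sum>n=1..N. \<Sum>s=2..N. mem_weight n s * e s)"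
    by (rule sum_mono, rule order_trans[OF grid_norm_sum[OF L]], rule sum_mono, rule one)
  also have "\<dots> \<le> pow_kernel \<alpha> (t N) * (\<Sum>s=2..N. step t s * e s)"
    by (rule sum_mem_weight_times_le) (use e in auto)
  also have "(\<Sum>s=2..N. step t s * e s) = M * c powr \<bar>\<sigma> - 3\<bar> * (\<Sum>s=2..N. step t s ^ 3 * t s powr (\<sigma> - 3))"
    unfolding e_def sum_distrib_left by (intro sum.cong refl) (simp add: power3_eq_cube power2_eq_square)
  finally show ?thesis .
qed

text \<open>Slopes on neighbouring intervals differ by a second difference, and the steps and times of
  neighbouring intervals are comparable.\<close>

lemma moment_error:
  assumes N2: "2 \<le> N"
  shows "(\<Sum>n=2..N. grid_norm L J (\<lambda>j. \<Sum>s=2..n. slope (G j) (t (s - 1)) (t s) * (moment_weight n s - moment_weight (n - 1) s)))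
    \<le> pow_kernel \<alpha> (t N) * (M * c powr \<bar>\<sigma> - 2\<bar> * ((step t N)\<^sup>2 * t N powr (\<sigma> - 2))
        + M * (c\<^sup>2) powr \<bar>\<sigma> - 3\<bar> * (\<Sum>s=2..N. step t s ^ 3 * t s powr (\<sigma> - 3)))"
proof -
  define D where "D s j = slope (G j) (t (s - 1)) (t s)" for s j
  define S where "S = (\<Sum>s=2..N. step t s ^ 3 * t s powr (\<sigma> - 3))"
  have DN: "grid_norm L J (D N) \<le> M * c powr \<bar>\<sigma> - 2\<bar> * t N powr (\<sigma> - 2)"
  proof -
    have sN: "0 < step t N" using step_pos[of N] N by auto
    have "grid_norm L J (D N) = grid_norm L J (\<lambda>j. 1 / step t N * (G j (t N) - G j (t (N - 1))))"
      by (rule grid_norm_cong) (simp add: D_def slope_def step_def)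
    also have "\<dots> = 1 / step t N * grid_norm L J (\<lambda>j. G j (t N) - G j (t (N - 1)))"
      using sN by (subst grid_norm_scale[OF L]) simp
    also have "\<dots> \<le> 1 / step t N * ((t N - t (N - 1)) * (M * c powr \<bar>\<sigma> - 2\<bar> * t N powr (\<sigma> - 2)))"
      using sN N2 t_pos[of "N - 1"] t_step[of N] c
      by (intro mult_left_mono regular_family_difference[OF L M reg]) auto
    also have "\<dots> = M * c powr \<bar>\<sigma> - 2\<bar> * t N powr (\<sigma> - 2)"
      unfolding step_def[symmetric] using sN by simp
    finally show ?thesis .
  qed
  have inc: "(step t i)\<^sup>2 * grid_norm L J (\<lambda>j. D (Suc i) j - D i j)
      \<le> 2 * (M * (c\<^sup>2) powr \<bar>\<sigma> - 3\<bar>) * (step t (Suc i) ^ 3 * t (Suc i) powr (\<sigma> - 3))" if i: "i \<in> {2..N-1}" for i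
  proof -
    let ?p = "t (i - 1)" and ?q = "t (Suc i)"
    have ip: "0 < ?p" "?p < t i" "t i < ?q" "?q \<le> t N"
      using i t_pos[of "i - 1"] t_step[of i] t_step[of "Suc i"] t_mono[of "Suc i" N] by auto
    have "?q \<le> c * t i" "t i \<le> c * ?p" using c(2)[of "Suc i"] c(2)[of i] i by auto
    then have "?q \<le> c * (c * ?p)" using c(1) by (elim order_trans) (intro mult_left_mono, auto)
    then have qc: "?q \<le> c\<^sup>2 * ?p" by (simp add: power2_eq_square mult.assoc)
    have k: "0 < step t i" "step t i \<le> step t (Suc i)" using step_pos[of i] step_mono[of i] i by auto
    have "grid_norm L J (\<lambda>j. D (Suc i) j - D i j) = grid_norm L J (\<lambda>j. slope (G j) (t i) ?q - slope (G j) ?p (t i))"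
      by (simp add: D_def)
    also have "\<dots> \<le> (?q - ?p) * (M * (c\<^sup>2) powr \<bar>\<sigma> - 3\<bar> * ?q powr (\<sigma> - 3))"
      using ip c(1) qc by (intro regular_family_slope[OF L M reg]) (auto simp: one_le_power)
    also have "\<dots> \<le> (2 * step t (Suc i)) * (M * (c\<^sup>2) powr \<bar>\<sigma> - 3\<bar> * ?q powr (\<sigma> - 3))"
      using k M by (intro mult_right_mono) (auto simp: step_def)
    finally have "(step t i)\<^sup>2 * grid_norm L J (\<lambda>j. D (Suc i) j - D i j)
        \<le> (step t (Suc i))\<^sup>2 * ((2 * step t (Suc i)) * (M * (c\<^sup>2) powr \<bar>\<sigma> - 3\<bar> * ?q powr (\<sigma> - 3)))"
      using k L by (intro mult_mono power_mono) auto
    then show ?thesis by (simp add: power3_eq_cube power2_eq_square ac_simps)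
  qed
  have "(\<Sum>i=2..N-1. (step t i)\<^sup>2 * grid_norm L J (\<lambda>j. D (Suc i) j - D i j))
      \<le> (\<Sum>i=2..N-1. 2 * (M * (c\<^sup>2) powr \<bar>\<sigma> - 3\<bar>) * (step t (Suc i) ^ 3 * t (Suc i) powr (\<sigma> - 3)))"
    by (rule sum_mono[OF inc])
  also have "\<dots> = 2 * (M * (c\<^sup>2) powr \<bar>\<sigma> - 3\<bar>) * (\<Sum>s=3..N. step t s ^ 3 * t s powr (\<sigma> - 3))"
    unfolding sum_distrib_left[symmetric]
    by (rule arg_cong2[where f="(*)", OF refl], rule sum.reindex_bij_witness[of _ "\<lambda>s. s - 1" Suc]) auto
  also have "\<dots> \<le> 2 * (M * (c\<^sup>2) powr \<bar>\<sigma> - 3\<bar>) * S"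
    unfolding S_def using M step_pos by (intro mult_left_mono sum_mono2) (auto intro!: mult_nonneg_nonneg less_imp_le[OF step_pos] zero_le_power)
  finally have incs: "(\<Sum>i=2..N-1. (step t i)\<^sup>2 * grid_norm L J (\<lambda>j. D (Suc i) j - D i j)) \<le> 2 * (M * (c\<^sup>2) powr \<bar>\<sigma> - 3\<bar>) * S" .
  have S0: "0 \<le> S" unfolding S_def by (intro sum_nonneg mult_nonneg_nonneg zero_le_power less_imp_le[OF step_pos]) auto
  have "(\<Sum>n=2..N. grid_norm L J (\<lambda>j. \<Sum>s=2..n. D s j * (moment_weight n s - moment_weight (n - 1) s)))
      \<le> pow_kernel \<alpha> (t N) / 8 * ((step t N)\<^sup>2 * grid_norm L J (D N)
        + 2 * (\<Sum>i=2..N-1. (step t i)\<^sup>2 * grid_norm L J (\<lambda>j. D (Suc i) j - D i j)))"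
    by (rule sum_norm_moments_le[OF L N2])
  also have "\<dots> \<le> pow_kernel \<alpha> (t N) / 8 * ((step t N)\<^sup>2 * (M * c powr \<bar>\<sigma> - 2\<bar> * t N powr (\<sigma> - 2))
        + 2 * (2 * (M * (c\<^sup>2) powr \<bar>\<sigma> - 3\<bar>) * S))"
    using DN incs \<alpha> by (intro mult_left_mono add_mono divide_nonneg_nonneg pow_kernel_nonneg) auto
  also have "\<dots> = pow_kernel \<alpha> (t N) * (M * c powr \<bar>\<sigma> - 2\<bar> * ((step t N)\<^sup>2 * t N powr (\<sigma> - 2)) / 8
        + M * (c\<^sup>2) powr \<bar>\<sigma> - 3\<bar> * S / 2)"
    by (simp add: field_simps)
  also have "\<dots> \<le> pow_kernel \<alpha> (t N) * (M * c powr \<bar>\<sigma> - 2\<bar> * ((step t N)\<^sup>2 * t N powr (\<sigma> - 2))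
        + M * (c\<^sup>2) powr \<bar>\<sigma> - 3\<bar> * S)"
  proof (intro mult_left_mono add_mono pow_kernel_nonneg)
    have frac: "x / 8 \<le> x" "x / 2 \<le> x" if "0 \<le> x" for x :: real using that by auto
    show "M * c powr \<bar>\<sigma> - 2\<bar> * ((step t N)\<^sup>2 * t N powr (\<sigma> - 2)) / 8 \<le> M * c powr \<bar>\<sigma> - 2\<bar> * ((step t N)\<^sup>2 * t N powr (\<sigma> - 2))"
      using M by (intro frac) simp
    show "M * (c\<^sup>2) powr \<bar>\<sigma> - 3\<bar> * S / 2 \<le> M * (c\<^sup>2) powr \<bar>\<sigma> - 3\<bar> * S"
      using M S0 by (intro frac) simp
  qed (use \<alpha> in auto)
  finally show ?thesis unfolding D_def S_def .
qed

lemma sum_norm_memory_error: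
  "(\<Sum>n=1..N. grid_norm L J (memory_error G n)) \<le> pow_kernel \<alpha> (t N) *
    (M / (\<theta> * (1 - \<theta>)) * t 1 powr \<sigma>
     + M * (c powr \<bar>\<sigma> - 3\<bar> + (c\<^sup>2) powr \<bar>\<sigma> - 3\<bar>) * (\<Sum>s=2..N. step t s ^ 3 * t s powr (\<sigma> - 3))
     + (if 2 \<le> N then M * c powr \<bar>\<sigma> - 2\<bar> * ((step t N)\<^sup>2 * t N powr (\<sigma> - 2)) else 0))"
proof -
  let ?a = "\<lambda>n j. integral {0<..<t 1} (\<lambda>\<zeta>. mem_kernel n \<zeta> * (G j (t 1) - G j \<zeta>))"
  let ?b = "\<lambda>n j. \<Sum>s=2..N. integral {t (s - 1)<..<t s} (\<lambda>\<zeta>. mem_kernel n \<zeta> * interp_error s j \<zeta>)"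
  let ?c = "\<lambda>n j. \<Sum>s=2..n. slope (G j) (t (s - 1)) (t s) * (moment_weight n s - moment_weight (n - 1) s)"
  let ?n = "grid_norm L J"
  have "(\<Sum>n=1..N. ?n (memory_error G n)) \<le> (\<Sum>n=1..N. ?n (?a n) + ?n (?b n) + ?n (?c n))"
  proof (rule sum_mono)
    fix n assume n: "n \<in> {1..N}"
    have "?n (memory_error G n) = ?n (\<lambda>j. (?a n j + ?b n j) + ?c n j)"
      by (rule grid_norm_cong) (rule memory_error_split[OF n])
    also have "\<dots> \<le> ?n (\<lambda>j. ?a n j + ?b n j) + ?n (?c n)" by (rule grid_norm_triangle[OF L])
    also have "?n (\<lambda>j. ?a n j + ?b n j) \<le> ?n (?a n) + ?n (?b n)" by (rule grid_norm_triangle[OF L])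
    finally show "?n (memory_error G n) \<le> ?n (?a n) + ?n (?b n) + ?n (?c n)" by simp
  qed
  also have "\<dots> = (\<Sum>n=1..N. ?n (?a n)) + (\<Sum>n=1..N. ?n (?b n)) + (\<Sum>n=1..N. ?n (?c n))"
    by (simp only: sum.distrib)
  also have "(\<Sum>n=1..N. ?n (?c n)) = (\<Sum>n=2..N. ?n (?c n))"
    by (rule sum.mono_neutral_right) (auto simp: not_le)
  also have "\<dots> \<le> pow_kernel \<alpha> (t N) * ((if 2 \<le> N then M * c powr \<bar>\<sigma> - 2\<bar> * ((step t N)\<^sup>2 * t N powr (\<sigma> - 2)) else 0)
        + M * (c\<^sup>2) powr \<bar>\<sigma> - 3\<bar> * (\<Sum>s=2..N. step t s ^ 3 * t s powr (\<sigma> - 3)))"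
    using moment_error by (cases "2 \<le> N") simp_all
  also note first_interval_error
  also note interpolation_error
  finally show ?thesis by (simp add: algebra_simps)
qed

end

end

section \<open>Sums over a graded mesh\<close>

lemma graded_mesh_monotone:
  assumes "0 < \<alpha>" "\<alpha> < 1" "graded_mesh T \<gamma> Cg cg k N t"
  shows "monotone_time_mesh \<alpha> t N"
  using assms by unfold_locales (auto simp: graded_mesh_def)

lemma graded_mesh_comparable:
  assumes "graded_mesh T \<gamma> Cg cg k N t" "n \<in> {2..N}"
  shows "t n \<le> max 1 Cg * t (n - 1)"
proof -
  interpret monotone_time_mesh "1 / 2" t N by (rule graded_mesh_monotone[OF _ _ assms(1)]) auto
  have "t n \<le> Cg * t (n - 1)" using assms by (auto simp: graded_mesh_def)
  also have "\<dots> \<le> max 1 Cg * t (n - 1)"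
    using t_nonneg[of "n - 1"] assms by (intro mult_right_mono) auto
  finally show ?thesis .
qed

locale mesh_parameters =
  fixes T \<gamma> \<sigma> Cg cg \<rho> :: real
  assumes T: "0 < T" and \<gamma>: "1 \<le> \<gamma>" and \<sigma>: "0 < \<sigma>" and Cg: "0 < Cg" and cg: "0 < cg" and \<rho>: "1 < \<rho>"
begin

text \<open>The condition with \<open>\<rho>\<close> keeps the logarithm in \<open>K_L\<close> away from zero in the critical case; for
  \<open>N = 1\<close> this logarithm would be \<open>0\<close>.\<close>

definition admissible_mesh :: "real \<Rightarrow> nat \<Rightarrow> (nat \<Rightarrow> real) \<Rightarrow> bool" where
  "admissible_mesh k N t \<longleftrightarrow> graded_mesh T \<gamma> Cg cg k N t \<and> (\<gamma> = 2 / \<sigma> \<longrightarrow> \<rho> * t 1 \<le> t N)"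

lemma critical_cases: "\<gamma> < 2 / \<sigma> \<longleftrightarrow> \<gamma> * \<sigma> < 2" "\<gamma> = 2 / \<sigma> \<longleftrightarrow> \<gamma> * \<sigma> = 2"
  using \<sigma> by (auto simp: field_simps)

context
  fixes k :: real and N :: nat and t :: "nat \<Rightarrow> real"
  assumes mesh: "admissible_mesh k N t"
begin

interpretation mesh: monotone_time_mesh "1 / 2" t N
  using mesh by (intro graded_mesh_monotone) (auto simp: admissible_mesh_def)

lemma k_pos: "0 < k" and tN: "t N = T" and t1_lower: "cg * k powr \<gamma> \<le> t 1"
  and step_le_min: "n \<in> {1..N} \<Longrightarrow> step t n \<le> Cg * k * min 1 (t n powr (1 - 1 / \<gamma>))"
  using mesh by (auto simp: admissible_mesh_def graded_mesh_def)

lemma log_lower: "\<gamma> = 2 / \<sigma> \<Longrightarrow> \<rho> \<le> t N / t 1"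
  using mesh mesh.t_pos[of 1] mesh.N unfolding admissible_mesh_def by (simp add: pos_le_divide_eq)

text \<open>The first step is of size at least \<open>k powr \<gamma>\<close>, up to a constant, and at most \<open>T\<close>.\<close>

lemma k_le: "k \<le> (T / cg) powr (1 / \<gamma>)"
proof -
  have "cg * k powr \<gamma> \<le> T" using t1_lower mesh.t_mono[of 1 N] mesh.N tN by simp
  then have "k powr \<gamma> \<le> T / cg" using cg by (simp add: field_simps)
  then have "(k powr \<gamma>) powr (1 / \<gamma>) \<le> (T / cg) powr (1 / \<gamma>)" using \<gamma> by (intro powr_mono2) auto
  then show ?thesis using k_pos \<gamma> by (simp add: powr_powr)
qed

lemma step_le_k: "n \<in> {1..N} \<Longrightarrow> step t n \<le> Cg * k"
  by (rule order_trans[OF step_le_min mult_left_le]) (use Cg k_pos in auto)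

lemma step_le_graded: "n \<in> {1..N} \<Longrightarrow> step t n \<le> Cg * k * t n powr (1 - 1 / \<gamma>)"
  by (rule order_trans[OF step_le_min mult_left_mono]) (use Cg k_pos in auto)

text \<open>The grading condition at \<open>n = 1\<close> bounds \<open>t 1\<close> by \<open>k\<close> times a power of \<open>t 1\<close>, and is solved for \<open>t 1\<close>.\<close>

lemma t1_powr_le: "t 1 powr \<sigma> \<le> Cg powr (\<gamma> * \<sigma>) * k powr (\<gamma> * \<sigma>)"
proof -
  have t1: "0 < t 1" using mesh.t_pos[of 1] mesh.N by simp
  have "t 1 \<le> Cg * k * t 1 powr (1 - 1 / \<gamma>)"
    using step_le_graded[of 1] mesh.N mesh.t0 by (simp add: step_def)
  moreover have "t 1 = t 1 powr (1 / \<gamma>) * t 1 powr (1 - 1 / \<gamma>)"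
    using t1 by (simp flip: powr_add)
  ultimately have "t 1 powr (1 / \<gamma>) * t 1 powr (1 - 1 / \<gamma>) \<le> Cg * k * t 1 powr (1 - 1 / \<gamma>)" by simp
  then have "t 1 powr (1 / \<gamma>) \<le> Cg * k" using t1 by (simp add: mult_le_cancel_right)
  then have "(t 1 powr (1 / \<gamma>)) powr (\<gamma> * \<sigma>) \<le> (Cg * k) powr (\<gamma> * \<sigma>)"
    using \<gamma> \<sigma> by (intro powr_mono2) auto
  then show ?thesis using \<gamma> Cg k_pos by (simp add: powr_powr powr_mult)
qed

text \<open>A Riemann sum of the integral of \<open>x powr (p - 1)\<close>; the end points of each interval are comparable, so
  the value at the right end may be replaced by the one at the intermediate point of the mean
  value theorem.\<close>

lemma sum_step_powr_le:
  assumes "p \<noteq> 0"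
  shows "(\<Sum>s=2..N. step t s * t s powr (p - 1)) \<le> max 1 Cg powr \<bar>p - 1\<bar> * ((t N powr p - t 1 powr p) / p)"
proof -
  let ?c = "max 1 Cg"
  have "(\<Sum>s=2..m. step t s * t s powr (p - 1)) \<le> ?c powr \<bar>p - 1\<bar> * ((t m powr p - t 1 powr p) / p)" if "1 \<le> m" "m \<le> N" for m
    using that
  proof (induction m rule: dec_induct)
    case (step m)
    let ?a = "t m" and ?b = "t (Suc m)"
    have ab: "0 < ?a" "?a < ?b" using mesh.t_pos[of m] mesh.t_step[of "Suc m"] step by auto
    have cb: "?b \<le> ?c * ?a" using graded_mesh_comparable[of T \<gamma> Cg cg k N t "Suc m"] mesh step by (simp add: admissible_mesh_def)
    obtain \<xi> where x: "?a < \<xi>" "\<xi> < ?b" "?b powr p / p - ?a powr p / p = (?b - ?a) * \<xi> powr (p - 1)"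
    proof -
      have "((\<lambda>x. x powr p / p) has_real_derivative x powr (p - 1)) (at x)" if "0 < x" for x
        using that assms by (auto intro!: derivative_eq_intros)
      then show ?thesis
        using MVT2[OF ab(2), of "\<lambda>x. x powr p / p" "\<lambda>x. x powr (p - 1)"] ab that by force
    qed
    have "?c * ?a \<le> ?c * \<xi>" using x by (intro mult_left_mono) auto
    with cb have "?b \<le> ?c * \<xi>" by linarith
    with x ab have "\<xi> powr (- (p - 1)) \<le> ?c powr \<bar>- (p - 1)\<bar> * ?b powr (- (p - 1))"
      by (intro powr_le_comparable) auto
    moreover have "\<bar>- (p - 1)\<bar> = \<bar>p - 1\<bar>" by simp
    ultimately have "1 / \<xi> powr (p - 1) \<le> ?c powr \<bar>p - 1\<bar> / ?b powr (p - 1)"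
      by (simp only: powr_minus_divide) simp
    then have "?b powr (p - 1) \<le> ?c powr \<bar>p - 1\<bar> * \<xi> powr (p - 1)"
      using x ab by (simp add: field_simps)
    then have "step t (Suc m) * ?b powr (p - 1) \<le> step t (Suc m) * (?c powr \<bar>p - 1\<bar> * \<xi> powr (p - 1))"
      using ab by (intro mult_left_mono) (auto simp: step_def)
    also have "\<dots> = ?c powr \<bar>p - 1\<bar> * (?b powr p / p - ?a powr p / p)"
      unfolding x(3) by (simp add: step_def)
    finally have "step t (Suc m) * ?b powr (p - 1) \<le> ?c powr \<bar>p - 1\<bar> * (?b powr p / p - ?a powr p / p)" .
    then show ?case using step by (simp add: diff_divide_distrib right_diff_distrib)
  qed simp
  then show ?thesis using mesh.N by simp
qed

lemma sum_step_inverse_le: "(\<Sum>s=2..N. step t s * t s powr (0 - 1)) \<le> ln (t N / t 1)"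
proof -
  have "(\<Sum>s=2..m. step t s * t s powr (0 - 1)) \<le> ln (t m) - ln (t 1)" if "1 \<le> m" "m \<le> N" for m
    using that
  proof (induction m rule: dec_induct)
    case (step m)
    let ?a = "t m" and ?b = "t (Suc m)"
    have ab: "0 < ?a" "?a < ?b" using mesh.t_pos[of m] mesh.t_step[of "Suc m"] step by auto
    have "ln (?a / ?b) \<le> ?a / ?b - 1" using ab by (intro ln_le_minus_one) auto
    then have "step t (Suc m) * ?b powr (0 - 1) \<le> ln ?b - ln ?a"
      using ab by (simp add: step_def ln_div powr_minus field_simps)
    then show ?case using step by simp
  qed simp
  then show ?thesis using mesh.N mesh.t_pos[of 1] mesh.t_pos[of N] by (simp add: ln_div)
qed

text \<open>Two of the three factors \<open>step t s\<close> are replaced by the grading condition, the third one is kept for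
  the Riemann sum.\<close>

lemma sum_step_cubed_le:
  "(\<Sum>s=2..N. step t s ^ 3 * t s powr (\<sigma> - 3)) \<le> Cg\<^sup>2 * k\<^sup>2 * (\<Sum>s=2..N. step t s * t s powr (\<sigma> - 2 / \<gamma> - 1))"
  unfolding sum_distrib_left
proof (rule sum_mono)
  fix s assume s: "s \<in> {2..N}"
  have k: "0 < step t s" and ts: "0 < t s" using mesh.step_pos[of s] mesh.t_pos[of s] s by auto
  have "(step t s)\<^sup>2 \<le> (Cg * k * t s powr (1 - 1 / \<gamma>))\<^sup>2"
    using k s step_le_graded[of s] by (intro power_mono) auto
  also have "\<dots> = Cg\<^sup>2 * k\<^sup>2 * (t s powr (1 - 1 / \<gamma>) * t s powr (1 - 1 / \<gamma>))"
    by (simp add: power2_eq_square ac_simps)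
  also have "t s powr (1 - 1 / \<gamma>) * t s powr (1 - 1 / \<gamma>) = t s powr (2 - 2 / \<gamma>)"
    by (simp flip: powr_add)
  finally have "(step t s)\<^sup>2 * (step t s * t s powr (\<sigma> - 3)) \<le> Cg\<^sup>2 * k\<^sup>2 * t s powr (2 - 2 / \<gamma>) * (step t s * t s powr (\<sigma> - 3))"
    using k by (intro mult_right_mono) auto
  also have "\<dots> = Cg\<^sup>2 * k\<^sup>2 * (step t s * (t s powr (2 - 2 / \<gamma>) * t s powr (\<sigma> - 3)))" by simp
  also have "t s powr (2 - 2 / \<gamma>) * t s powr (\<sigma> - 3) = t s powr (\<sigma> - 2 / \<gamma> - 1)"
    by (simp flip: powr_add)
  finally show "step t s ^ 3 * t s powr (\<sigma> - 3) \<le> Cg\<^sup>2 * k\<^sup>2 * (step t s * t s powr (\<sigma> - 2 / \<gamma> - 1))"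
    by (simp add: power3_eq_cube power2_eq_square ac_simps)
qed

end

text \<open>In the first case \<open>K_L\<close> is a smaller power of the bounded quantity \<open>k\<close>; in the critical case the
  logarithm is at least \<open>ln \<rho>\<close>.\<close>

lemma square_le_K_L: "\<exists>C\<ge>0. \<forall>k N t. admissible_mesh k N t \<longrightarrow> k\<^sup>2 \<le> C * K_L \<gamma> \<sigma> k N t"
proof -
  define m where "m = (T / cg) powr (1 / \<gamma>)"
  consider "\<gamma> * \<sigma> < 2" | "\<gamma> * \<sigma> = 2" | "2 < \<gamma> * \<sigma>" by linarith
  then show ?thesis
  proof cases
    case 1
    have "k\<^sup>2 \<le> m powr (2 - \<gamma> * \<sigma>) * K_L \<gamma> \<sigma> k N t" if "admissible_mesh k N t" for k N t
    proof -
      have k: "0 < k" "k \<le> m" using k_pos[OF that] k_le[OF that] by (auto simp: m_def)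
      have "k\<^sup>2 = k powr (2 - \<gamma> * \<sigma>) * k powr (\<gamma> * \<sigma>)" using k by (simp flip: powr_add)
      also have "\<dots> \<le> m powr (2 - \<gamma> * \<sigma>) * k powr (\<gamma> * \<sigma>)" using k 1 by (intro mult_right_mono powr_mono2) auto
      finally show ?thesis using 1 by (simp add: K_L_def critical_cases)
    qed
    then show ?thesis by (intro exI[of _ "m powr (2 - \<gamma> * \<sigma>)"]) auto
  next
    case 2
    have "k\<^sup>2 \<le> 1 / ln \<rho> * K_L \<gamma> \<sigma> k N t" if mesh: "admissible_mesh k N t" for k N t
    proof -
      have "ln \<rho> \<le> ln (t N / t 1)" using log_lower[OF mesh] 2 critical_cases \<rho> by simp
      then have "1 \<le> ln (t N / t 1) / ln \<rho>" using \<rho> by (simp add: field_simps)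
      then have "k\<^sup>2 * 1 \<le> k\<^sup>2 * (ln (t N / t 1) / ln \<rho>)" by (intro mult_left_mono) auto
      then show ?thesis using 2 by (simp add: K_L_def critical_cases)
    qed
    then show ?thesis using \<rho> by (intro exI[of _ "1 / ln \<rho>"]) auto
  next
    case 3
    then show ?thesis by (intro exI[of _ 1]) (auto simp: K_L_def critical_cases)
  qed
qed

lemma K_L_nonneg: assumes "admissible_mesh k N t" shows "0 \<le> K_L \<gamma> \<sigma> k N t"
proof -
  have "0 \<le> ln (t N / t 1)" if "\<gamma> = 2 / \<sigma>" using log_lower[OF assms that] \<rho> by simp
  then show ?thesis by (auto simp: K_L_def)
qed

lemma K_L_lower:
  assumes "0 < k0" shows "\<exists>c>0. \<forall>k N t. admissible_mesh k N t \<longrightarrow> k0 \<le> k \<longrightarrow> c \<le> K_L \<gamma> \<sigma> k N t"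
proof -
  obtain C where C: "0 \<le> C" "\<And>k N t. admissible_mesh k N t \<Longrightarrow> k\<^sup>2 \<le> C * K_L \<gamma> \<sigma> k N t"
    using square_le_K_L by blast
  have "k0\<^sup>2 / (C + 1) \<le> K_L \<gamma> \<sigma> k N t" if "admissible_mesh k N t" "k0 \<le> k" for k N t
  proof -
    have "k0\<^sup>2 \<le> k\<^sup>2" using that assms by (intro power_mono) auto
    also have "\<dots> \<le> C * K_L \<gamma> \<sigma> k N t" by (rule C(2)[OF that(1)])
    also have "\<dots> \<le> (C + 1) * K_L \<gamma> \<sigma> k N t" using K_L_nonneg[OF that(1)] by (intro mult_right_mono) auto
    finally show ?thesis using C(1) by (simp add: pos_divide_le_eq mult.commute)
  qed
  then show ?thesis using C(1) assms by (intro exI[of _ "k0\<^sup>2 / (C + 1)"]) auto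
qed

lemma powr_le_K_L: "\<exists>C\<ge>0. \<forall>k N t. admissible_mesh k N t \<longrightarrow> k powr (\<gamma> * \<sigma>) \<le> C * K_L \<gamma> \<sigma> k N t"
proof (cases "\<gamma> * \<sigma> < 2")
  case True
  then show ?thesis by (intro exI[of _ 1]) (auto simp: K_L_def critical_cases)
next
  case False
  define m where "m = (T / cg) powr (1 / \<gamma>)"
  obtain C where C: "0 \<le> C" "\<And>k N t. admissible_mesh k N t \<Longrightarrow> k\<^sup>2 \<le> C * K_L \<gamma> \<sigma> k N t"
    using square_le_K_L by blast
  have "k powr (\<gamma> * \<sigma>) \<le> (m powr (\<gamma> * \<sigma> - 2) * C) * K_L \<gamma> \<sigma> k N t" if "admissible_mesh k N t" for k N t
  proof -
    have k: "0 < k" "k \<le> m" using k_pos[OF that] k_le[OF that] by (auto simp: m_def)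
    have "k powr (\<gamma> * \<sigma>) = k powr (\<gamma> * \<sigma> - 2) * k powr 2" by (simp flip: powr_add)
    also have "\<dots> \<le> m powr (\<gamma> * \<sigma> - 2) * (C * K_L \<gamma> \<sigma> k N t)"
      using k False C(2)[OF that] by (intro mult_mono powr_mono2) auto
    finally show ?thesis by simp
  qed
  then show ?thesis using C(1) by (intro exI[of _ "m powr (\<gamma> * \<sigma> - 2) * C"]) auto
qed

lemma initial_step_le_K_L: "\<exists>C\<ge>0. \<forall>k N t. admissible_mesh k N t \<longrightarrow> t 1 powr \<sigma> \<le> C * K_L \<gamma> \<sigma> k N t"
proof -
  obtain C where C: "0 \<le> C" "\<And>k N t. admissible_mesh k N t \<Longrightarrow> k powr (\<gamma> * \<sigma>) \<le> C * K_L \<gamma> \<sigma> k N t"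
    using powr_le_K_L by blast
  have "t 1 powr \<sigma> \<le> (Cg powr (\<gamma> * \<sigma>) * C) * K_L \<gamma> \<sigma> k N t" if "admissible_mesh k N t" for k N t
    using t1_powr_le[OF that] mult_left_mono[OF C(2)[OF that], of "Cg powr (\<gamma> * \<sigma>)"] by (simp add: mult.assoc)
  then show ?thesis using C(1) by (intro exI[of _ "Cg powr (\<gamma> * \<sigma>) * C"]) auto
qed

lemma sum_step_cubed_le_K_L:
  "\<exists>C\<ge>0. \<forall>k N t. admissible_mesh k N t \<longrightarrow> (\<Sum>s=2..N. step t s ^ 3 * t s powr (\<sigma> - 3)) \<le> C * K_L \<gamma> \<sigma> k N t"
proof -
  let ?p = "\<sigma> - 2 / \<gamma>"
  let ?c = "max 1 Cg powr \<bar>?p - 1\<bar>"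
  \<comment> \<open>the sign of the exponent decides whether the sum of \<open>step t s * t s powr (?p - 1)\<close> is dominated by
    its beginning, evenly distributed, or bounded; these are the three cases of \<open>K_L\<close>\<close>
  consider "?p < 0" | "?p = 0" | "0 < ?p" by linarith
  then have "\<exists>C\<ge>0. \<forall>k N t. admissible_mesh k N t \<longrightarrow> k\<^sup>2 * (\<Sum>s=2..N. step t s * t s powr (?p - 1)) \<le> C * K_L \<gamma> \<sigma> k N t"
  proof cases
    case 1
    have g: "\<gamma> * \<sigma> < 2" using 1 \<gamma> by (simp add: field_simps)
    have "k\<^sup>2 * (\<Sum>s=2..N. step t s * t s powr (?p - 1)) \<le> (?c * (cg powr ?p / \<bar>?p\<bar>)) * K_L \<gamma> \<sigma> k N t"
      if mesh: "admissible_mesh k N t" for k N t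
    proof -
      have k: "0 < k" by (rule k_pos[OF mesh])
      have t1: "t 1 powr ?p \<le> cg powr ?p * k powr (\<gamma> * \<sigma> - 2)"
      proof -
        have "t 1 powr ?p \<le> (cg * k powr \<gamma>) powr ?p"
          using t1_lower[OF mesh] 1 cg k by (intro powr_mono2') auto
        also have "\<dots> = cg powr ?p * k powr (\<gamma> * ?p)" using cg k by (simp add: powr_mult powr_powr)
        also have "\<gamma> * ?p = \<gamma> * \<sigma> - 2" using \<gamma> by (simp add: right_diff_distrib)
        finally show ?thesis .
      qed
      have "(\<Sum>s=2..N. step t s * t s powr (?p - 1)) \<le> ?c * ((t N powr ?p - t 1 powr ?p) / ?p)"
        using 1 by (intro sum_step_powr_le[OF mesh]) auto
      also have "\<dots> \<le> ?c * (t 1 powr ?p / \<bar>?p\<bar>)"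
        using 1 by (intro mult_left_mono) (auto simp: divide_simps)
      also have "\<dots> \<le> ?c * (cg powr ?p * k powr (\<gamma> * \<sigma> - 2) / \<bar>?p\<bar>)"
        using t1 by (intro mult_left_mono divide_right_mono) auto
      finally have "k\<^sup>2 * (\<Sum>s=2..N. step t s * t s powr (?p - 1)) \<le> k\<^sup>2 * (?c * (cg powr ?p * k powr (\<gamma> * \<sigma> - 2) / \<bar>?p\<bar>))"
        by (intro mult_left_mono) auto
      also have "\<dots> = ?c * (cg powr ?p / \<bar>?p\<bar>) * (k powr (\<gamma> * \<sigma> - 2) * k powr 2)"
        using k by simp
      also have "k powr (\<gamma> * \<sigma> - 2) * k powr 2 = K_L \<gamma> \<sigma> k N t"
        using g by (simp add: K_L_def critical_cases flip: powr_add)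
      finally show ?thesis .
    qed
    then show ?thesis by (intro exI[of _ "?c * (cg powr ?p / \<bar>?p\<bar>)"]) auto
  next
    case 2
    have g: "\<gamma> * \<sigma> = 2" using 2 \<gamma> by (simp add: field_simps)
    have "k\<^sup>2 * (\<Sum>s=2..N. step t s * t s powr (?p - 1)) \<le> 1 * K_L \<gamma> \<sigma> k N t"
      if mesh: "admissible_mesh k N t" for k N t
      using mult_left_mono[OF sum_step_inverse_le[OF mesh], of "k\<^sup>2"] g unfolding 2 by (simp add: K_L_def critical_cases)
    then show ?thesis by (intro exI[of _ 1]) auto
  next
    case 3
    have g: "2 < \<gamma> * \<sigma>" using 3 \<gamma> by (simp add: field_simps)
    have "k\<^sup>2 * (\<Sum>s=2..N. step t s * t s powr (?p - 1)) \<le> (?c * (T powr ?p / ?p)) * K_L \<gamma> \<sigma> k N t"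
      if mesh: "admissible_mesh k N t" for k N t
    proof -
      have "(\<Sum>s=2..N. step t s * t s powr (?p - 1)) \<le> ?c * ((t N powr ?p - t 1 powr ?p) / ?p)"
        using 3 by (intro sum_step_powr_le[OF mesh]) auto
      also have "\<dots> \<le> ?c * (T powr ?p / ?p)"
        using 3 tN[OF mesh] by (intro mult_left_mono divide_right_mono) auto
      finally have "k\<^sup>2 * (\<Sum>s=2..N. step t s * t s powr (?p - 1)) \<le> k\<^sup>2 * (?c * (T powr ?p / ?p))"
        by (intro mult_left_mono) auto
      then show ?thesis using g by (simp add: K_L_def critical_cases mult.commute)
    qed
    then show ?thesis using 3 by (intro exI[of _ "?c * (T powr ?p / ?p)"]) auto
  qed
  then obtain C where C: "0 \<le> C" "\<And>k N t. admissible_mesh k N t \<Longrightarrow> k\<^sup>2 * (\<Sum>s=2..N. step t s * t s powr (?p - 1)) \<le> C * K_L \<gamma> \<sigma> k N t"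
    by blast
  have "(\<Sum>s=2..N. step t s ^ 3 * t s powr (\<sigma> - 3)) \<le> (Cg\<^sup>2 * C) * K_L \<gamma> \<sigma> k N t" if mesh: "admissible_mesh k N t" for k N t
    using sum_step_cubed_le[OF mesh] mult_left_mono[OF C(2)[OF mesh], of "Cg\<^sup>2"] by (simp add: mult.assoc)
  then show ?thesis using C(1) by (intro exI[of _ "Cg\<^sup>2 * C"]) auto
qed

lemma last_step_le_K_L:
  "\<exists>C\<ge>0. \<forall>k N t. admissible_mesh k N t \<longrightarrow> (step t N)\<^sup>2 * t N powr (\<sigma> - 2) \<le> C * K_L \<gamma> \<sigma> k N t"
proof -
  obtain C where C: "0 \<le> C" "\<And>k N t. admissible_mesh k N t \<Longrightarrow> k\<^sup>2 \<le> C * K_L \<gamma> \<sigma> k N t"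
    using square_le_K_L by blast
  have "(step t N)\<^sup>2 * t N powr (\<sigma> - 2) \<le> (Cg\<^sup>2 * T powr (\<sigma> - 2) * C) * K_L \<gamma> \<sigma> k N t" if mesh: "admissible_mesh k N t" for k N t
  proof -
    interpret monotone_time_mesh "1 / 2" t N
      using mesh by (intro graded_mesh_monotone) (auto simp: admissible_mesh_def)
    have "(step t N)\<^sup>2 \<le> (Cg * k)\<^sup>2"
      using step_pos[of N] N step_le_k[OF mesh, of N] by (intro power_mono) auto
    also have "\<dots> = Cg\<^sup>2 * k\<^sup>2" by (simp add: power_mult_distrib)
    also have "\<dots> \<le> Cg\<^sup>2 * (C * K_L \<gamma> \<sigma> k N t)" by (intro mult_left_mono C(2)[OF mesh]) auto
    finally have "(step t N)\<^sup>2 * T powr (\<sigma> - 2) \<le> Cg\<^sup>2 * (C * K_L \<gamma> \<sigma> k N t) * T powr (\<sigma> - 2)"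
      by (intro mult_right_mono) auto
    then show ?thesis using tN[OF mesh] by (simp add: ac_simps)
  qed
  then show ?thesis using C(1) by (intro exI[of _ "Cg\<^sup>2 * T powr (\<sigma> - 2) * C"]) auto
qed

end

section \<open>A discrete Gronwall inequality\<close>

text \<open>Taking the maximum of \<open>a\<close> up to \<open>m\<close> allows one factor to be cancelled in the quadratic inequality, as
  \<open>l n\<close> is bounded by that maximum. The scheme is implicit, so the last term of the sum contains the
  unknown maximum itself; it is absorbed on the left, which is where the bound \<open>1 / 4\<close> of \<open>\<kappa>\<close> is used.\<close>

lemma discrete_gronwall:
  fixes a l F \<kappa> :: "nat \<Rightarrow> real"
  assumes a: "\<And>n. 0 \<le> a n" and F: "\<And>n. 0 \<le> F n" and \<kappa>: "\<And>n. n \<in> {1..N} \<Longrightarrow> 0 \<le> \<kappa> n \<and> \<kappa> n \<le> 1 / 4"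
    and l: "\<And>n. n \<in> {1..N} \<Longrightarrow> 0 \<le> l n \<and> l n \<le> max (a n) (a (n - 1))"
    and en: "\<And>m. m \<le> N \<Longrightarrow> (a m)\<^sup>2 \<le> (a 0)\<^sup>2 + 2 * (\<Sum>n=1..m. l n * (\<kappa> n * l n + F n))"
    and m: "m \<le> N"
  shows "a m \<le> 2 * (a 0 + 2 * (\<Sum>n=1..N. F n)) * exp (4 * (\<Sum>n=1..N. \<kappa> n))"
proof -
  define E where "E m = Max (a ` {..m})" for m
  define A where "A = a 0 + 2 * (\<Sum>n=1..N. F n)"
  define S where "S m = 2 * A + 4 * (\<Sum>n=1..m. \<kappa> n * E n)" for m
  have aE: "a i \<le> E m" if "i \<le> m" for i m using that by (auto simp: E_def)
  have E0: "0 \<le> E m" for m using aE[of 0 m] a[of 0] by simp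
  have A0: "0 \<le> A" using a F by (simp add: A_def sum_nonneg)
  have Emono: "E i \<le> E m" if "i \<le> m" for i m unfolding E_def using that by (intro Max_mono) auto
  have lE: "l n \<le> E n" if "n \<in> {1..N}" for n
    using l[OF that] aE[of n n] aE[of "n - 1" n] by (simp add: max_def split: if_splits)
  have main: "E m \<le> A + 2 * (\<Sum>n=1..m. \<kappa> n * E n)" if m: "m \<le> N" for m
  proof -
    have "E m \<in> a ` {..m}" unfolding E_def by (rule Max_in) auto
    then obtain i where i: "i \<le> m" "E m = a i" by auto
    have "E m * E m \<le> (a 0)\<^sup>2 + 2 * (\<Sum>n=1..i. l n * (\<kappa> n * l n + F n))"
      using en[of i] i m by (simp add: power2_eq_square)
    also have "(a 0)\<^sup>2 \<le> E m * a 0" using aE[of 0 m] a[of 0] by (simp add: power2_eq_square mult_right_mono)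
    also have "(\<Sum>n=1..i. l n * (\<kappa> n * l n + F n)) \<le> (\<Sum>n=1..i. E m * (\<kappa> n * E n + F n))"
    proof (rule sum_mono)
      fix n assume n: "n \<in> {1..i}"
      then have n': "n \<in> {1..N}" using i m by auto
      show "l n * (\<kappa> n * l n + F n) \<le> E m * (\<kappa> n * E n + F n)"
        using l[OF n'] lE[OF n'] \<kappa>[OF n'] F[of n] E0[of m] Emono[of n m] n i
        by (intro mult_mono add_mono add_nonneg_nonneg mult_nonneg_nonneg) auto
    qed
    also have "\<dots> \<le> (\<Sum>n=1..m. E m * (\<kappa> n * E n + F n))"
    proof (rule sum_mono2)
      fix n assume "n \<in> {1..m} - {1..i}"
      then have "n \<in> {1..N}" using m by auto
      then show "0 \<le> E m * (\<kappa> n * E n + F n)"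
        using \<kappa> E0 F by (intro mult_nonneg_nonneg add_nonneg_nonneg) auto
    qed (use i in auto)
    also have "\<dots> = E m * (\<Sum>n=1..m. \<kappa> n * E n) + E m * (\<Sum>n=1..m. F n)"
      by (simp add: sum_distrib_left sum.distrib distrib_left)
    also have "E m * (\<Sum>n=1..m. F n) \<le> E m * (\<Sum>n=1..N. F n)"
      using m F E0 by (intro mult_left_mono sum_mono2) auto
    finally have *: "E m * E m \<le> E m * (A + 2 * (\<Sum>n=1..m. \<kappa> n * E n))"
      by (simp add: A_def algebra_simps)
    have "0 \<le> (\<Sum>n=1..m. \<kappa> n * E n)" using \<kappa> E0 m by (intro sum_nonneg mult_nonneg_nonneg) auto
    with * A0 E0[of m] show ?thesis by (cases "E m = 0") (auto simp: mult_le_cancel_left)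
  qed
  \<comment> \<open>the summand with index \<open>Suc m\<close> is at most \<open>E (Suc m) / 2\<close> and is absorbed\<close>
  have ES: "E (Suc m) \<le> S m" if "Suc m \<le> N" for m
    using main[OF that] \<kappa>[of "Suc m"] that mult_right_mono[of "\<kappa> (Suc m)" "1 / 4" "E (Suc m)"] E0[of "Suc m"]
    by (simp add: S_def)
  have SE: "S m \<le> 2 * A * exp (4 * (\<Sum>n=1..m. \<kappa> n))" if "m \<le> N" for m
    using that
  proof (induction m)
    case (Suc m)
    have k: "0 \<le> \<kappa> (Suc m)" using \<kappa>[of "Suc m"] Suc.prems by auto
    have "S (Suc m) = S m + 4 * \<kappa> (Suc m) * E (Suc m)" by (simp add: S_def)
    also have "\<dots> \<le> S m + 4 * \<kappa> (Suc m) * S m" using ES[of m] Suc.prems k by (intro add_left_mono mult_left_mono) auto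
    also have "\<dots> = S m * (1 + 4 * \<kappa> (Suc m))" by (simp add: algebra_simps)
    also have "\<dots> \<le> (2 * A * exp (4 * (\<Sum>n=1..m. \<kappa> n))) * exp (4 * \<kappa> (Suc m))"
      using Suc k A0 by (intro mult_mono exp_ge_add_one_self) auto
    finally show ?case by (simp add: exp_add distrib_left mult.assoc)
  qed (simp add: S_def)
  have "a m \<le> 2 * A * exp (4 * (\<Sum>n=1..m - 1. \<kappa> n))"
  proof (cases m)
    case 0
    have "a 0 \<le> A" using F by (simp add: A_def sum_nonneg)
    with A0 0 show ?thesis by simp
  next
    case (Suc i)
    then show ?thesis using ES[of i] SE[of i] aE[of m m] m by simp
  qed
  also have "\<dots> \<le> 2 * A * exp (4 * (\<Sum>n=1..N. \<kappa> n))"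
    using A0 m \<kappa> by (intro mult_left_mono iffD2[OF exp_le_cancel_iff] sum_mono2) auto
  finally show ?thesis unfolding A_def .
qed

section \<open>Time averages of products\<close>

text \<open>Replace both factors by their linear interpolants, at the price of second differences. In the product
  of the interpolants the linear term has mean zero, and the quadratic term is bounded by the
  product of the two increments.\<close>

lemma product_midpoint_error:
  fixes a b :: "real \<Rightarrow> real"
  assumes pq: "p < q" and cont: "continuous_on {p..q} (\<lambda>\<tau>. a \<tau> * b \<tau>)"
    and bound: "\<And>\<tau>. \<tau> \<in> {p..q} \<Longrightarrow> \<bar>a \<tau>\<bar> \<le> c \<and> \<bar>b \<tau>\<bar> \<le> c"
    and S: "\<And>\<tau>. \<tau> \<in> {p<..<q} \<Longrightarrow> \<bar>slope a p q - slope a p \<tau>\<bar> \<le> S \<and> \<bar>slope b p q - slope b p \<tau>\<bar> \<le> S"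
    and R: "\<bar>a q - a p\<bar> \<le> R" "\<bar>b q - b p\<bar> \<le> R"
  shows "\<bar>integral {p..q} (\<lambda>\<tau>. a \<tau> * b \<tau>) - (q - p) * ((a q + a p) / 2 * ((b q + b p) / 2))\<bar> \<le> (q - p) * (2 * c * ((q - p) * S) + R\<^sup>2)"
proof -
  define A B m where "A = (a q + a p) / 2" and "B = (b q + b p) / 2" and "m = (p + q) / 2"
  define sa sb where "sa = slope a p q" and "sb = slope b p q"
  have c0: "0 \<le> c" using bound[of p] pq by auto
  have R0: "0 \<le> R" using R(1) by linarith
  have S0: "0 \<le> S" using S[of "(p + q) / 2"] pq by auto
  have lin: "\<bar>g p + (\<tau> - p) * slope g p q - g \<tau>\<bar> \<le> (q - p) * S"
    if t: "\<tau> \<in> {p<..<q}" and g: "\<bar>slope g p q - slope g p \<tau>\<bar> \<le> S" for g \<tau>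
  proof -
    have "(\<tau> - p) * slope g p \<tau> = g \<tau> - g p" using t by (simp add: slope_def)
    then have "g p + (\<tau> - p) * slope g p q - g \<tau> = (\<tau> - p) * (slope g p q - slope g p \<tau>)"
      by (simp add: right_diff_distrib)
    then have "\<bar>g p + (\<tau> - p) * slope g p q - g \<tau>\<bar> = \<bar>\<tau> - p\<bar> * \<bar>slope g p q - slope g p \<tau>\<bar>"
      by (simp add: abs_mult)
    also have "\<dots> \<le> (q - p) * S" using t g by (intro mult_mono) auto
    finally show ?thesis .
  qed
  have mid: "g p + (\<tau> - p) * slope g p q = (g q + g p) / 2 + (\<tau> - m) * slope g p q" for g \<tau>
  proof -
    have "slope g p q * (q - p) = g q - g p" using pq by (simp add: slope_def)
    then have gq: "g q = g p + slope g p q * (q - p)" by simp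
    show ?thesis unfolding m_def gq by (simp add: field_simps)
  qed
  have pointwise: "\<bar>a \<tau> * b \<tau> - A * B - (\<tau> - m) * (A * sb + B * sa)\<bar> \<le> 2 * c * ((q - p) * S) + R\<^sup>2"
    if t: "\<tau> \<in> {p<..<q}" for \<tau>
  proof -
    define pa pb where "pa = A + (\<tau> - m) * sa" and "pb = B + (\<tau> - m) * sb"
    have ea: "\<bar>pa - a \<tau>\<bar> \<le> (q - p) * S" and eb: "\<bar>pb - b \<tau>\<bar> \<le> (q - p) * S"
      using lin[OF t, of a] lin[OF t, of b] S[OF t] mid[of a \<tau>] mid[of b \<tau>]
      by (simp_all add: pa_def pb_def A_def B_def sa_def sb_def)
    \<comment> \<open>the interpolant is a convex combination of the end values\<close>
    have pac: "\<bar>pa\<bar> \<le> c"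
    proof -
      have "pa = (q - \<tau>) / (q - p) * a p + (\<tau> - p) / (q - p) * a q"
      proof -
        have gen: "(w - v) / w * x + v / w * y = x + v * ((y - x) / w)" if "w \<noteq> 0" for w v x y :: real
          using that by (simp add: divide_simps) (simp add: algebra_simps)
        have "q - p - (\<tau> - p) = q - \<tau>" by simp
        then show ?thesis
          using gen[of "q - p" "\<tau> - p" "a p" "a q"] mid[of a \<tau>] pq by (simp add: pa_def A_def sa_def slope_def)
      qed
      also have "\<bar>\<dots>\<bar> \<le> \<bar>(q - \<tau>) / (q - p)\<bar> * \<bar>a p\<bar> + \<bar>(\<tau> - p) / (q - p)\<bar> * \<bar>a q\<bar>"
        by (metis abs_mult abs_triangle_ineq)
      also have "\<dots> \<le> (q - \<tau>) / (q - p) * c + (\<tau> - p) / (q - p) * c"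
        using t pq bound[of p] bound[of q] by (intro add_mono mult_mono) auto
      also have "\<dots> = ((q - \<tau>) / (q - p) + (\<tau> - p) / (q - p)) * c" by (simp only: distrib_right)
      also have "(q - \<tau>) / (q - p) + (\<tau> - p) / (q - p) = 1" using pq by (simp flip: add_divide_distrib)
      finally show ?thesis by simp
    qed
    have "\<bar>sa * (q - p)\<bar> \<le> R" "\<bar>sb * (q - p)\<bar> \<le> R" using R pq by (simp_all add: sa_def sb_def slope_def)
    then have ss: "\<bar>sa * (q - p)\<bar> * \<bar>sb * (q - p)\<bar> \<le> R * R" by (intro mult_mono) (use R0 in auto)
    have "\<bar>\<tau> - m\<bar> * \<bar>\<tau> - m\<bar> \<le> (q - p) * (q - p)" using t by (intro mult_mono) (auto simp: m_def abs_if field_simps)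
    then have "(\<bar>\<tau> - m\<bar> * \<bar>\<tau> - m\<bar>) * \<bar>sa * sb\<bar> \<le> ((q - p) * (q - p)) * \<bar>sa * sb\<bar>" by (intro mult_right_mono) auto
    also have "\<dots> = \<bar>sa * (q - p)\<bar> * \<bar>sb * (q - p)\<bar>" using pq by (simp add: abs_mult ac_simps)
    finally have quad: "\<bar>(\<tau> - m) * (\<tau> - m) * (sa * sb)\<bar> \<le> R\<^sup>2"
      using ss by (simp add: abs_mult power2_eq_square)
    have "a \<tau> * b \<tau> - A * B - (\<tau> - m) * (A * sb + B * sa)
        = - (pa * (pb - b \<tau>)) - (pa - a \<tau>) * b \<tau> + (\<tau> - m) * (\<tau> - m) * (sa * sb)"
      by (simp add: pa_def pb_def algebra_simps)
    also have "\<bar>\<dots>\<bar> \<le> \<bar>pa\<bar> * \<bar>pb - b \<tau>\<bar> + \<bar>pa - a \<tau>\<bar> * \<bar>b \<tau>\<bar> + \<bar>(\<tau> - m) * (\<tau> - m) * (sa * sb)\<bar>"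
      unfolding abs_mult[symmetric] by linarith
    also have "\<dots> \<le> c * ((q - p) * S) + (q - p) * S * c + R\<^sup>2"
      using pac ea eb quad bound[of \<tau>] t c0 S0 pq by (intro add_mono mult_mono) auto
    also have "\<dots> = 2 * c * ((q - p) * S) + R\<^sup>2" by simp
    finally show ?thesis .
  qed
  have lin_int: "((\<lambda>\<tau>. (\<tau> - m) * (A * sb + B * sa)) has_integral 0) {p..q}"
  proof -
    have "((\<lambda>\<tau>. \<tau> - m) has_integral (q\<^sup>2 / 2 - p\<^sup>2 / 2 - (q - p) * m)) {p..q}"
      using has_integral_diff[OF ident_has_integral[of p q] has_integral_const_real[of m p q]] pq
      by (simp add: diff_divide_distrib)
    moreover have "q\<^sup>2 / 2 - p\<^sup>2 / 2 - (q - p) * m = 0" by (simp add: m_def power2_eq_square field_simps)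
    ultimately show ?thesis using has_integral_mult_left[of "\<lambda>\<tau>. \<tau> - m" 0 "{p..q}" "A * sb + B * sa"] by simp
  qed
  have int: "((\<lambda>\<tau>. a \<tau> * b \<tau> - A * B - (\<tau> - m) * (A * sb + B * sa)) has_integral
      integral {p..q} (\<lambda>\<tau>. a \<tau> * b \<tau>) - (q - p) * (A * B) - 0) {p..q}"
    using has_integral_const_real[of "A * B" p q] pq
    by (intro has_integral_diff lin_int integrable_integral integrable_continuous_real cont) simp
  have K: "0 \<le> 2 * c * ((q - p) * S) + R\<^sup>2" using c0 S0 pq by simp
  have "norm (integral {p..q} (\<lambda>\<tau>. a \<tau> * b \<tau>) - (q - p) * (A * B) - 0) \<le> (2 * c * ((q - p) * S) + R\<^sup>2) * measure lborel {p..q}"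
    by (rule has_integral_bound_real[OF K _ int, of "{p, q}"]) (use pointwise in auto)
  then show ?thesis using pq by (simp add: A_def B_def mult.commute)
qed

section \<open>Regularity of the exact solution\<close>

locale exact_solution =
  fixes \<alpha> L T \<sigma> M c0 :: real
    and u0 :: "real \<Rightarrow> real"
    and f ft ftt u ut ux uxx uxxt uxxtt :: "real \<Rightarrow> real \<Rightarrow> real"
  assumes L: "0 < L" and T: "0 < T" and \<alpha>: "0 < \<alpha>" "\<alpha> < 1" and \<sigma>: "0 < \<sigma>" and M: "0 < M"
    and sol: "classical_solution \<alpha> L T u0 f u ut ux uxx"
    and c0: "\<And>x t. \<lbrakk>x \<in> {0..L}; t \<in> {0<..T}\<rbrakk> \<Longrightarrow> \<bar>u x t\<bar> \<le> c0 \<and> \<bar>ux x t\<bar> \<le> c0"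
    and uxxt: "\<And>x t. \<lbrakk>x \<in> {0<..<L}; t \<in> {0<..T}\<rbrakk> \<Longrightarrow> (uxx x has_real_derivative uxxt x t) (at t within {0..T})"
    and uxxtt: "\<And>x t. \<lbrakk>x \<in> {0<..<L}; t \<in> {0<..T}\<rbrakk> \<Longrightarrow> (uxxt x has_real_derivative uxxtt x t) (at t within {0..T})"
    and ft: "\<And>x t. \<lbrakk>x \<in> {0<..<L}; t \<in> {0<..T}\<rbrakk> \<Longrightarrow> (f x has_real_derivative ft x t) (at t within {0..T})"
    and ftt: "\<And>x t. \<lbrakk>x \<in> {0<..<L}; t \<in> {0<..T}\<rbrakk> \<Longrightarrow> (ft x has_real_derivative ftt x t) (at t within {0..T})"
    and u_reg: "\<And>J t. \<lbrakk>1 \<le> J; t \<in> {0<..T}\<rbrakk> \<Longrightarrow>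
      t * fun_norm L J (\<lambda>x. uxxt x t) + t\<^sup>2 * fun_norm L J (\<lambda>x. uxxtt x t) \<le> M * t powr (\<sigma> - 1)"
    and f_reg: "\<And>J t. \<lbrakk>1 \<le> J; t \<in> {0<..T}\<rbrakk> \<Longrightarrow>
      t * fun_norm L J (\<lambda>x. ft x t) + t\<^sup>2 * fun_norm L J (\<lambda>x. ftt x t) \<le> M * t powr (\<sigma> - 1)"
begin

definition on_grid :: "nat \<Rightarrow> (real \<Rightarrow> real \<Rightarrow> real) \<Rightarrow> nat \<Rightarrow> real \<Rightarrow> real" where
  "on_grid J g j \<tau> = g (grid_pt L J j) \<tau>"

text \<open>An exponent strictly between \<open>0\<close> and \<open>1\<close> with \<open>1 - \<sigma> \<le> \<theta>\<close>: the singularity \<open>\<tau> powr (- \<theta>)\<close> is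
  integrable and, on bounded intervals, dominates \<open>\<tau> powr (\<sigma> - 1)\<close> up to a constant factor. No
  logarithm appears for \<open>\<sigma> = 1\<close>.\<close>

definition \<theta> :: real where "\<theta> = 1 - min \<sigma> 1 / 2"

lemma \<theta>: "0 < \<theta>" "\<theta> < 1" "1 - \<sigma> \<le> \<theta>"
  using \<sigma> by (auto simp: \<theta>_def min_def)

lemma c0_nonneg: "0 \<le> c0"
  using c0[of 0 T] L T by auto

text \<open>Both terms on the left of the bound are nonnegative, so each of them is bounded separately.\<close>

lemma regular_familyI:
  assumes "\<And>x t. \<lbrakk>x \<in> {0<..<L}; t \<in> {0<..T}\<rbrakk> \<Longrightarrow> (g x has_real_derivative g' x t) (at t within {0..T})"
    and "\<And>x t. \<lbrakk>x \<in> {0<..<L}; t \<in> {0<..T}\<rbrakk> \<Longrightarrow> (g' x has_real_derivative g'' x t) (at t within {0..T})"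
    and bound: "\<And>t. t \<in> {0<..T} \<Longrightarrow> t * fun_norm L J (\<lambda>x. g' x t) + t\<^sup>2 * fun_norm L J (\<lambda>x. g'' x t) \<le> M * t powr (\<sigma> - 1)"
  shows "regular_family L J T \<sigma> M (on_grid J g) (on_grid J g') (on_grid J g'')"
  unfolding regular_family_def
proof (intro conjI ballI)
  fix j \<tau> assume j: "j \<in> {1..J-1}" and \<tau>: "\<tau> \<in> {0<..T}"
  show "(on_grid J g j has_real_derivative on_grid J g' j \<tau>) (at \<tau> within {0..T})"
    "(on_grid J g' j has_real_derivative on_grid J g'' j \<tau>) (at \<tau> within {0..T})"
    using assms(1,2)[OF grid_pt_interior[OF L j] \<tau>] unfolding on_grid_def by auto
next
  fix \<tau> assume \<tau>: "\<tau> \<in> {0<..T}"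
  have n: "0 \<le> grid_norm L J (\<lambda>s. on_grid J g' s \<tau>)" "0 \<le> grid_norm L J (\<lambda>s. on_grid J g'' s \<tau>)" using L by auto
  have b: "\<tau> * grid_norm L J (\<lambda>s. on_grid J g' s \<tau>) + \<tau>\<^sup>2 * grid_norm L J (\<lambda>s. on_grid J g'' s \<tau>) \<le> M * \<tau> powr (\<sigma> - 1)"
    using bound[OF \<tau>] by (simp add: fun_norm_def on_grid_def)
  have p: "\<tau> powr (\<sigma> - 1) = \<tau> * \<tau> powr (\<sigma> - 2)" "\<tau> powr (\<sigma> - 1) = \<tau>\<^sup>2 * \<tau> powr (\<sigma> - 3)"
    using \<tau> powr_add[of \<tau> 1 "\<sigma> - 2"] powr_add[of \<tau> 2 "\<sigma> - 3"] by simp_all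
  have t: "0 < \<tau>" using \<tau> by simp
  have "\<tau> * grid_norm L J (\<lambda>s. on_grid J g' s \<tau>) \<le> \<tau> * (M * \<tau> powr (\<sigma> - 2))"
    using b mult_nonneg_nonneg[OF zero_le_power2[of \<tau>] n(2)] unfolding p(1) by (simp only: mult.left_commute[of M])
  then show "grid_norm L J (\<lambda>s. on_grid J g' s \<tau>) \<le> M * \<tau> powr (\<sigma> - 2)" using t by simp
  have "\<tau>\<^sup>2 * grid_norm L J (\<lambda>s. on_grid J g'' s \<tau>) \<le> \<tau>\<^sup>2 * (M * \<tau> powr (\<sigma> - 3))"
    using b mult_nonneg_nonneg[OF less_imp_le[OF t] n(1)] unfolding p(2) by (simp only: mult.left_commute[of M])
  then show "grid_norm L J (\<lambda>s. on_grid J g'' s \<tau>) \<le> M * \<tau> powr (\<sigma> - 3)" using t by simp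
qed

lemma regular_uxx: "1 \<le> J \<Longrightarrow> regular_family L J T \<sigma> M (on_grid J uxx) (on_grid J uxxt) (on_grid J uxxtt)"
  by (rule regular_familyI) (use uxxt uxxtt u_reg in auto)

lemma regular_f: "1 \<le> J \<Longrightarrow> regular_family L J T \<sigma> M (on_grid J f) (on_grid J ft) (on_grid J ftt)"
  by (rule regular_familyI) (use ft ftt f_reg in auto)

lemma u_deriv: "x \<in> {0..L} \<Longrightarrow> \<tau> \<in> {0<..T} \<Longrightarrow> ((\<lambda>y. u y \<tau>) has_real_derivative ux x \<tau>) (at x within {0..L})"
  and ux_deriv: "x \<in> {0..L} \<Longrightarrow> \<tau> \<in> {0<..T} \<Longrightarrow> ((\<lambda>y. ux y \<tau>) has_real_derivative uxx x \<tau>) (at x within {0..L})"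
  and uxx_cont: "\<tau> \<in> {0<..T} \<Longrightarrow> continuous_on {0..L} (\<lambda>x. uxx x \<tau>)"
  and u_bd: "\<tau> \<in> {0<..T} \<Longrightarrow> u 0 \<tau> = 0" "\<tau> \<in> {0<..T} \<Longrightarrow> u L \<tau> = 0"
  and u_init: "x \<in> {0..L} \<Longrightarrow> u x 0 = u0 x"
  using sol by (auto simp: classical_solution_def)

definition embed_const :: real where "embed_const = (1 + L) * sqrt L"

lemma embed_const_pos: "0 < embed_const" using L by (simp add: embed_const_def)

text \<open>Since \<open>u\<close> vanishes at both end points, differences of \<open>u\<close> and \<open>u\<^sub>x\<close> in time are controlled
  pointwise by the same differences of \<open>u\<^sub>x\<^sub>x\<close> in the discrete norms.\<close>

lemma difference_bound:
  assumes ab: "a \<in> {0<..T}" "b \<in> {0<..T}"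
    and E: "\<And>J. 1 \<le> J \<Longrightarrow> grid_norm L J (\<lambda>s. on_grid J uxx s b - on_grid J uxx s a) \<le> E" and x: "x \<in> {0..L}"
  shows "\<bar>u x b - u x a\<bar> \<le> embed_const * E" "\<bar>ux x b - ux x a\<bar> \<le> embed_const * E"
proof -
  have E0: "0 \<le> E" using E[of 1] grid_norm_nonneg[OF L] order_trans by blast
  have d1: "((\<lambda>x. u x b - u x a) has_real_derivative ux x b - ux x a) (at x within {0..L})"
    and d2: "((\<lambda>x. ux x b - ux x a) has_real_derivative uxx x b - uxx x a) (at x within {0..L})" if "x \<in> {0..L}" for x
    by (intro DERIV_diff u_deriv ux_deriv ab that)+
  have cont: "continuous_on {0..L} (\<lambda>x. uxx x b - uxx x a)"
    by (intro continuous_on_diff uxx_cont ab)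
  have zero: "u 0 b - u 0 a = 0" "u L b - u L a = 0" using ab by (simp_all add: u_bd)
  note * = sup_bound_of_grid_norm[of L "\<lambda>x. u x b - u x a", OF L zero d1 d2 cont E[unfolded on_grid_def] x]
  have "sqrt L * E \<le> embed_const * E" "L * (sqrt L * E) \<le> embed_const * E"
    using L E0 by (auto simp: embed_const_def algebra_simps)
  with * show "\<bar>u x b - u x a\<bar> \<le> embed_const * E" "\<bar>ux x b - ux x a\<bar> \<le> embed_const * E" by linarith+
qed

lemma slope_bound:
  assumes ab: "a \<in> {0<..T}" "b \<in> {0<..T}" "a' \<in> {0<..T}" "b' \<in> {0<..T}"
    and E: "\<And>J. 1 \<le> J \<Longrightarrow> grid_norm L J (\<lambda>s. slope (on_grid J uxx s) a b - slope (on_grid J uxx s) a' b') \<le> E" and x: "x \<in> {0..L}"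
  shows "\<bar>slope (u x) a b - slope (u x) a' b'\<bar> \<le> embed_const * E" "\<bar>slope (ux x) a b - slope (ux x) a' b'\<bar> \<le> embed_const * E"
proof -
  have E0: "0 \<le> E" using E[of 1] grid_norm_nonneg[OF L] order_trans by blast
  let ?d = "\<lambda>v x. slope (v x) a b - slope (v x) a' b'"
  have d1: "(?d u has_real_derivative ?d ux x) (at x within {0..L})"
    and d2: "(?d ux has_real_derivative ?d uxx x) (at x within {0..L})" if "x \<in> {0..L}" for x
    unfolding slope_def by (intro DERIV_diff DERIV_cdivide u_deriv ux_deriv ab that)+
  have cont: "continuous_on {0..L} (?d uxx)"
    unfolding slope_def divide_inverse by (intro continuous_on_diff continuous_on_mult continuous_on_const uxx_cont ab)
  have zero: "?d u 0 = 0" "?d u L = 0" using ab by (simp_all add: u_bd slope_def)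
  have E': "grid_norm L J (\<lambda>s. ?d uxx (grid_pt L J s)) \<le> E" if "1 \<le> J" for J
    using E[OF that] by (simp add: slope_def on_grid_def)
  note * = sup_bound_of_grid_norm[of L "?d u", OF L zero d1 d2 cont E' x]
  have "sqrt L * E \<le> embed_const * E" "L * (sqrt L * E) \<le> embed_const * E"
    using L E0 by (auto simp: embed_const_def algebra_simps)
  with * show "\<bar>slope (u x) a b - slope (u x) a' b'\<bar> \<le> embed_const * E" "\<bar>slope (ux x) a b - slope (ux x) a' b'\<bar> \<le> embed_const * E" by linarith+
qed

lemma u_increment:
  assumes ab: "0 < a" "a \<le> b" "b \<le> T" and x: "x \<in> {0..L}"
  defines "E \<equiv> embed_const * (M / \<theta> * b powr (\<sigma> - 1 + \<theta>) * (a powr (- \<theta>) - b powr (- \<theta>)))"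
  shows "\<bar>u x b - u x a\<bar> \<le> E" "\<bar>ux x b - ux x a\<bar> \<le> E"
  unfolding E_def
  using difference_bound[OF _ _ regular_family_increment[OF L less_imp_le[OF M] regular_uxx ab \<theta>(1,3)] x] ab by auto

lemma u_difference:
  assumes ab: "0 < a" "a \<le> b" "b \<le> T" and c: "1 \<le> c" "b \<le> c * a" and x: "x \<in> {0..L}"
  defines "E \<equiv> embed_const * ((b - a) * (M * c powr \<bar>\<sigma> - 2\<bar> * b powr (\<sigma> - 2)))"
  shows "\<bar>u x b - u x a\<bar> \<le> E" "\<bar>ux x b - ux x a\<bar> \<le> E"
  unfolding E_def
  using difference_bound[OF _ _ regular_family_difference[OF L less_imp_le[OF M] regular_uxx ab c] x] ab by auto

lemma u_slope:
  assumes pq: "0 < p" "p < q" "q \<le> T" and c: "1 \<le> c" "q \<le> c * p"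
    and ab: "p \<le> a" "a < b" "b \<le> q" and ab': "p \<le> a'" "a' < b'" "b' \<le> q" and x: "x \<in> {0..L}"
  defines "E \<equiv> embed_const * ((q - p) * (M * c powr \<bar>\<sigma> - 3\<bar> * q powr (\<sigma> - 3)))"
  shows "\<bar>slope (u x) a b - slope (u x) a' b'\<bar> \<le> E" "\<bar>slope (ux x) a b - slope (ux x) a' b'\<bar> \<le> E"
  unfolding E_def
  using slope_bound[OF _ _ _ _ regular_family_slope[OF L less_imp_le[OF M] regular_uxx pq c ab ab'] x] pq ab ab' by auto

text \<open>For \<open>u\<^sub>x\<close>, no derivative in time is given; continuity comes from the bound of the increments.\<close>

lemma u_continuous:
  assumes x: "x \<in> {0..L}"
  shows "continuous_on {0<..T} (u x)" "continuous_on {0<..T} (ux x)"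
proof -
  define K where "K = embed_const * (M / \<theta> * T powr (\<sigma> - 1 + \<theta>))"
  have K: "0 < K" using M embed_const_pos T \<theta> by (simp add: K_def)
  have incr: "\<bar>u x b - u x a\<bar> \<le> K * \<bar>b powr (- \<theta>) - a powr (- \<theta>)\<bar> \<and> \<bar>ux x b - ux x a\<bar> \<le> K * \<bar>b powr (- \<theta>) - a powr (- \<theta>)\<bar>"
    if ab: "0 < a" "a \<le> b" "b \<le> T" for a b
  proof -
    have d: "0 \<le> a powr (- \<theta>) - b powr (- \<theta>)" using ab \<theta> by (simp add: powr_mono2')
    have "embed_const * (M / \<theta> * b powr (\<sigma> - 1 + \<theta>) * (a powr (- \<theta>) - b powr (- \<theta>)))
        \<le> embed_const * (M / \<theta> * T powr (\<sigma> - 1 + \<theta>) * (a powr (- \<theta>) - b powr (- \<theta>)))"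
    proof -
      have "b powr (\<sigma> - 1 + \<theta>) \<le> T powr (\<sigma> - 1 + \<theta>)" using ab \<theta> by (intro powr_mono2) auto
      moreover have "0 \<le> embed_const * (M / \<theta>)" using embed_const_pos M \<theta> by simp
      ultimately show ?thesis using d
        by (simp only: mult.assoc[symmetric]) (intro mult_right_mono mult_left_mono)
    qed
    also have "\<dots> = K * \<bar>b powr (- \<theta>) - a powr (- \<theta>)\<bar>" using d by (simp add: K_def)
    finally show ?thesis using u_increment[OF ab x] by (blast intro: order_trans)
  qed
  have sym: "\<bar>u x s - u x \<tau>\<bar> \<le> K * \<bar>s powr (- \<theta>) - \<tau> powr (- \<theta>)\<bar> \<and> \<bar>ux x s - ux x \<tau>\<bar> \<le> K * \<bar>s powr (- \<theta>) - \<tau> powr (- \<theta>)\<bar>"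
    if "s \<in> {0<..T}" "\<tau> \<in> {0<..T}" for s \<tau>
    using incr[of s \<tau>] incr[of \<tau> s] that by (cases "s \<le> \<tau>") (auto simp: abs_minus_commute)
  have cont: "continuous_on {0<..T} (\<lambda>\<tau>. \<tau> powr (- \<theta>))" by (intro continuous_intros) auto
  have gen: "continuous_on {0<..T} X"
    if X: "\<And>s \<tau>. s \<in> {0<..T} \<Longrightarrow> \<tau> \<in> {0<..T} \<Longrightarrow> \<bar>X s - X \<tau>\<bar> \<le> K * \<bar>s powr (- \<theta>) - \<tau> powr (- \<theta>)\<bar>" for X :: "real \<Rightarrow> real"
    unfolding continuous_on_iff
  proof (intro ballI allI impI)
    fix \<tau> e :: real assume \<tau>: "\<tau> \<in> {0<..T}" and e: "0 < e"
    then obtain d where d: "0 < d" "\<And>s. s \<in> {0<..T} \<Longrightarrow> dist s \<tau> < d \<Longrightarrow> dist (s powr (- \<theta>)) (\<tau> powr (- \<theta>)) < e / K"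
      using cont[unfolded continuous_on_iff, rule_format, of \<tau> "e / K"] K by auto
    have "dist (X s) (X \<tau>) < e" if s: "s \<in> {0<..T}" "dist s \<tau> < d" for s
    proof -
      have "K * \<bar>s powr (- \<theta>) - \<tau> powr (- \<theta>)\<bar> < K * (e / K)"
        using d(2)[OF s] K unfolding dist_real_def by (intro mult_strict_left_mono)
      then show ?thesis using X[OF s(1) \<tau>] K by (simp add: dist_real_def)
    qed
    with d(1) show "\<exists>d>0. \<forall>s\<in>{0<..T}. dist s \<tau> < d \<longrightarrow> dist (X s) (X \<tau>) < e" by blast
  qed
  show "continuous_on {0<..T} (u x)" "continuous_on {0<..T} (ux x)"
    by (rule gen, use sym in blast)+
qed

section \<open>Interpolated increments of the solution\<close>

text \<open>For \<open>\<sigma> \<ge> 1\<close> the first-order bound suffices. Otherwise this is an interpolation inequality of Landau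
  type: \<open>X\<close> is bounded, so its slope over an interval of length \<open>l\<close> is at most \<open>2 * c0 / l\<close>; its slopes
  vary slowly, so the slope over a shorter interval is not much larger. The choice
  of \<open>l\<close> balances the two contributions. The exponent is half of \<open>\<sigma> - 3\<close>, so that the product of two
  such increments is as small as a second difference.\<close>

lemma increment_interpolation:
  assumes c: "1 \<le> c" and K: "0 \<le> K"
    and bound: "\<And>\<tau>. \<tau> \<in> {0<..T} \<Longrightarrow> \<bar>X \<tau>\<bar> \<le> c0"
    and first: "\<And>a b. \<lbrakk>0 < a; a \<le> b; b \<le> T; b \<le> c * a\<rbrakk> \<Longrightarrow> \<bar>X b - X a\<bar> \<le> K * ((b - a) * b powr (\<sigma> - 2))"
    and second: "\<And>p q a. \<lbrakk>0 < p; p < a; a < q; q \<le> T; q \<le> 2 * p\<rbrakk> \<Longrightarrow>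
      \<bar>slope X a q - slope X p q\<bar> \<le> K * ((q - p) * q powr (\<sigma> - 3))"
    and ab: "0 < a" "a < b" "b \<le> T" "b \<le> c * a"
  defines "\<kappa> \<equiv> 1 / (2 * T powr ((1 - \<sigma>) / 2))"
  shows "\<bar>X b - X a\<bar> \<le> (K * T powr ((\<sigma> - 1) / 2) + K * \<kappa> + 2 * c0 / \<kappa>) * ((b - a) * b powr ((\<sigma> - 3) / 2))"
proof -
  let ?C = "K * T powr ((\<sigma> - 1) / 2) + K * \<kappa> + 2 * c0 / \<kappa>"
  let ?e = "b powr ((\<sigma> - 3) / 2)"
  have \<kappa>: "0 < \<kappa>" using T by (simp add: \<kappa>_def)
  have parts: "0 \<le> K * T powr ((\<sigma> - 1) / 2)" "0 \<le> K * \<kappa>" "0 \<le> 2 * c0 / \<kappa>" using K \<kappa> c0_nonneg by auto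
  have weaken: "\<bar>X b - X a\<bar> \<le> ?C * ((b - a) * ?e)" if "\<bar>X b - X a\<bar> \<le> C' * ((b - a) * ?e)" "C' \<le> ?C" for C'
    by (rule order_trans[OF that(1) mult_right_mono[OF that(2)]]) (use ab in auto)
  show ?thesis
  proof (cases "1 \<le> \<sigma>")
    case True
    have "(\<sigma> - 1) / 2 + (\<sigma> - 3) / 2 = \<sigma> - 2" by (simp add: field_simps)
    then have "b powr (\<sigma> - 2) = b powr ((\<sigma> - 1) / 2) * ?e" by (simp only: powr_add[symmetric])
    also have "\<dots> \<le> T powr ((\<sigma> - 1) / 2) * ?e" using ab True by (intro mult_right_mono powr_mono2) auto
    finally have "(b - a) * b powr (\<sigma> - 2) \<le> (b - a) * (T powr ((\<sigma> - 1) / 2) * ?e)" using ab by (intro mult_left_mono) auto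
    then have "K * ((b - a) * b powr (\<sigma> - 2)) \<le> K * ((b - a) * (T powr ((\<sigma> - 1) / 2) * ?e))"
      using K by (rule mult_left_mono)
    with first[of a b] ab have "\<bar>X b - X a\<bar> \<le> K * ((b - a) * (T powr ((\<sigma> - 1) / 2) * ?e))" by linarith
    also have "\<dots> = K * T powr ((\<sigma> - 1) / 2) * ((b - a) * ?e)" by (simp only: ac_simps)
    finally show ?thesis by (rule weaken) (use parts in linarith)
  next
    case False
    \<comment> \<open>the constant \<open>\<kappa>\<close> ensures \<open>l \<le> b / 2\<close>, so that \<open>b - l\<close> is comparable with \<open>b\<close>\<close>
    define l where "l = \<kappa> * b powr ((3 - \<sigma>) / 2)"
    have l: "0 < l" using \<kappa> ab by (simp add: l_def)
    have le: "l * ?e = \<kappa>" using ab by (simp add: l_def mult.assoc powr_add[symmetric] flip: add_divide_distrib)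
    have l_half: "l \<le> b / 2"
    proof -
      have "b powr ((3 - \<sigma>) / 2) = b powr ((1 - \<sigma>) / 2) * b powr 1" by (simp only: powr_add[symmetric]) (simp add: field_simps)
      also have "\<dots> \<le> T powr ((1 - \<sigma>) / 2) * b" using ab False by (auto intro!: mult_right_mono powr_mono2)
      finally have "l \<le> \<kappa> * (T powr ((1 - \<sigma>) / 2) * b)" unfolding l_def using \<kappa> by (intro mult_left_mono) auto
      also have "\<dots> = b / 2" using T by (simp add: \<kappa>_def)
      finally show ?thesis .
    qed
    have inv_l: "1 / l = ?e / \<kappa>" using l \<kappa> le by (simp add: field_simps)
    show ?thesis
    proof (cases "l \<le> b - a")
      case True
      have "\<bar>X b - X a\<bar> \<le> 2 * c0" using bound[of a] bound[of b] ab by auto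
      also have "\<dots> = 2 * c0 * 1" by simp
      also have "\<dots> \<le> 2 * c0 * ((b - a) * (1 / l))"
        using True l c0_nonneg by (intro mult_left_mono) auto
      also have "\<dots> = 2 * c0 / \<kappa> * ((b - a) * ?e)" unfolding inv_l by simp
      finally show ?thesis by (rule weaken) (use parts in linarith)
    next
      case False
      let ?p = "b - l"
      have p: "0 < ?p" "?p < a" "b \<le> 2 * ?p" using l l_half False ab by auto
      have "\<bar>slope X ?p b\<bar> \<le> 2 * c0 / l"
      proof -
        have "\<bar>X b - X ?p\<bar> \<le> 2 * c0" using bound[of b] bound[of ?p] p ab by auto
        then show ?thesis using l by (simp add: slope_def abs_divide divide_right_mono)
      qed
      also have "2 * c0 / l = 2 * c0 * (1 / l)" by simp
      also have "\<dots> = 2 * c0 / \<kappa> * ?e" unfolding inv_l by simp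
      finally have s1: "\<bar>slope X ?p b\<bar> \<le> 2 * c0 / \<kappa> * ?e" .
      have "\<bar>slope X a b - slope X ?p b\<bar> \<le> K * (l * b powr (\<sigma> - 3))"
        using second[of ?p a b] p ab by simp
      also have "b powr (\<sigma> - 3) = ?e * ?e" by (simp flip: powr_add)
      also have "K * (l * (?e * ?e)) = K * \<kappa> * ?e" unfolding le[symmetric] by simp
      finally have s2: "\<bar>slope X a b - slope X ?p b\<bar> \<le> K * \<kappa> * ?e" .
      have "\<bar>slope X a b\<bar> \<le> (K * \<kappa> + 2 * c0 / \<kappa>) * ?e" using s1 s2 unfolding distrib_right by linarith
      then have "(b - a) * \<bar>slope X a b\<bar> \<le> (b - a) * ((K * \<kappa> + 2 * c0 / \<kappa>) * ?e)" using ab by (intro mult_left_mono) auto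
      moreover have "(b - a) * \<bar>slope X a b\<bar> = \<bar>X b - X a\<bar>" using ab by (simp add: slope_def abs_divide)
      ultimately have "\<bar>X b - X a\<bar> \<le> (K * \<kappa> + 2 * c0 / \<kappa>) * ((b - a) * ?e)" by (simp only: mult.left_commute)
      then show ?thesis by (rule weaken) (use parts in linarith)
    qed
  qed
qed

lemma u_increment_interpolated:
  assumes c: "1 \<le> c"
  shows "\<exists>C\<ge>0. \<forall>x\<in>{0..L}. \<forall>a b. 0 < a \<longrightarrow> a < b \<longrightarrow> b \<le> T \<longrightarrow> b \<le> c * a \<longrightarrow>
    \<bar>u x b - u x a\<bar> \<le> C * ((b - a) * b powr ((\<sigma> - 3) / 2)) \<and> \<bar>ux x b - ux x a\<bar> \<le> C * ((b - a) * b powr ((\<sigma> - 3) / 2))"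
proof -
  define K1 K2 K \<kappa> where "K1 = embed_const * M * c powr \<bar>\<sigma> - 2\<bar>" and "K2 = embed_const * M * 2 powr \<bar>\<sigma> - 3\<bar>"
    and "K = max K1 K2" and "\<kappa> = 1 / (2 * T powr ((1 - \<sigma>) / 2))"
  let ?C = "K * T powr ((\<sigma> - 1) / 2) + K * \<kappa> + 2 * c0 / \<kappa>"
  have K0: "0 \<le> K1" using embed_const_pos M by (simp add: K1_def)
  then have K: "0 \<le> K" "K1 \<le> K" "K2 \<le> K" by (auto simp: K_def)
  have \<kappa>: "0 < \<kappa>" using T by (simp add: \<kappa>_def)
  have "\<bar>u x b - u x a\<bar> \<le> ?C * ((b - a) * b powr ((\<sigma> - 3) / 2)) \<and> \<bar>ux x b - ux x a\<bar> \<le> ?C * ((b - a) * b powr ((\<sigma> - 3) / 2))"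
    if x: "x \<in> {0..L}" and ab: "0 < a" "a < b" "b \<le> T" "b \<le> c * a" for x a b
  proof -
    have first: "\<bar>u x b - u x a\<bar> \<le> K * ((b - a) * b powr (\<sigma> - 2)) \<and> \<bar>ux x b - ux x a\<bar> \<le> K * ((b - a) * b powr (\<sigma> - 2))"
      if ab: "0 < a" "a \<le> b" "b \<le> T" "b \<le> c * a" for a b
    proof -
      have "embed_const * ((b - a) * (M * c powr \<bar>\<sigma> - 2\<bar> * b powr (\<sigma> - 2))) = K1 * ((b - a) * b powr (\<sigma> - 2))"
        by (simp add: K1_def)
      also have "\<dots> \<le> K * ((b - a) * b powr (\<sigma> - 2))" using K ab by (intro mult_right_mono) auto
      finally show ?thesis using u_difference[OF ab(1,2,3) c ab(4) x] by (blast intro: order_trans)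
    qed
    have second: "\<bar>slope (u x) a q - slope (u x) p q\<bar> \<le> K * ((q - p) * q powr (\<sigma> - 3)) \<and>
        \<bar>slope (ux x) a q - slope (ux x) p q\<bar> \<le> K * ((q - p) * q powr (\<sigma> - 3))"
      if pq: "0 < p" "p < a" "a < q" "q \<le> T" "q \<le> 2 * p" for p q a
    proof -
      have "embed_const * ((q - p) * (M * 2 powr \<bar>\<sigma> - 3\<bar> * q powr (\<sigma> - 3))) = K2 * ((q - p) * q powr (\<sigma> - 3))"
        by (simp add: K2_def)
      also have "\<dots> \<le> K * ((q - p) * q powr (\<sigma> - 3))" using K pq by (intro mult_right_mono) auto
      finally show ?thesis using u_slope[of p q 2 a q p q x] pq x by (auto intro: order_trans)
    qed
    show ?thesis
      unfolding \<kappa>_def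
      by (intro conjI increment_interpolation[OF c K(1) _ _ _ ab]) (use c0 x first second in auto)
  qed
  moreover have "0 \<le> ?C" using K \<kappa> c0_nonneg by auto
  ultimately show ?thesis by blast
qed

section \<open>The equation integrated in time\<close>

lemma powr_minus_absolutely_integrable:
  "0 \<le> b \<Longrightarrow> (\<lambda>\<zeta>. K * \<zeta> powr (- \<theta>)) absolutely_integrable_on {0..b}"
  using powr_minus_integral[OF \<theta>(2), of b]
  by (intro absolutely_integrable_continuous_times nonnegative_absolutely_integrable_1) auto

lemma uxx_weakly_singular:
  assumes "j \<in> {1..J-1}"
  obtains K where "0 \<le> K" "\<And>\<zeta>. \<zeta> \<in> {0<..T} \<Longrightarrow> \<bar>on_grid J uxx j \<zeta>\<bar> \<le> K * \<zeta> powr (- \<theta>)"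
proof -
  have "1 \<le> J" using assms by auto
  from regular_family_weakly_singular[OF L less_imp_le[OF M] regular_uxx[OF this] T \<theta>(1,3) assms]
  show thesis using that by blast
qed

lemma product_integrable:
  assumes x: "x \<in> {0..L}" and ab: "0 \<le> a" "b \<le> T"
  shows "(\<lambda>\<tau>. u x \<tau> * ux x \<tau>) integrable_on {a..b}"
proof -
  have "(\<lambda>\<tau>. u x \<tau> * ux x \<tau>) absolutely_integrable_on {0..T}"
  proof (rule weakly_singular_absolutely_integrable[of 0])
    show "continuous_on {0<..T} (\<lambda>\<tau>. u x \<tau> * ux x \<tau>)" by (intro continuous_intros u_continuous x)
    fix \<zeta> assume z: "\<zeta> \<in> {0<..T}"
    then show "\<bar>u x \<zeta> * ux x \<zeta>\<bar> \<le> (c0 * c0) * \<zeta> powr (- 0)"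
      using c0[OF x z] c0_nonneg by (simp add: abs_mult mult_mono)
  qed (use T in auto)
  then show ?thesis
    using ab by (intro integrable_on_subinterval[OF set_lebesgue_integral_eq_integral(1)]) auto
qed

text \<open>The memory term integrated from \<open>0\<close> to \<open>b\<close>. The positive part in the kernel cuts the integral off
  at \<open>b\<close>; the fixed range makes differences in \<open>b\<close> easy to form.\<close>

definition memory_integral :: "real \<Rightarrow> real \<Rightarrow> real" where
  "memory_integral x b = integral {0..T} (\<lambda>\<zeta>. pow_kernel \<alpha> (b - \<zeta>) * uxx x \<zeta>)"

lemma pow_kernel_diff_continuous: "continuous_on S (\<lambda>\<zeta>. pow_kernel \<alpha> (b - \<zeta>))"
  using \<alpha> by (intro continuous_intros continuous_on_compose2[OF pow_kernel_continuous[of \<alpha> UNIV]]) auto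

lemma memory_integrand_integrable:
  assumes j: "j \<in> {1..J-1}"
  shows "(\<lambda>\<zeta>. pow_kernel \<alpha> (b - \<zeta>) * on_grid J uxx j \<zeta>) integrable_on {0..T}"
proof -
  obtain K where K: "\<And>\<zeta>. \<zeta> \<in> {0<..T} \<Longrightarrow> \<bar>on_grid J uxx j \<zeta>\<bar> \<le> K * \<zeta> powr (- \<theta>)"
    using uxx_weakly_singular[OF j] by metis
  have J: "1 \<le> J" using j by auto
  have "on_grid J uxx j absolutely_integrable_on {0..T}"
    by (rule weakly_singular_absolutely_integrable[OF \<theta>(2) less_imp_le[OF T] regular_family_continuous[OF L less_imp_le[OF M] regular_uxx[OF J] j] K])
  then show ?thesis
    by (intro set_lebesgue_integral_eq_integral(1)[OF absolutely_integrable_continuous_times] pow_kernel_diff_continuous)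
qed

lemma initial_value_bound:
  assumes x: "x \<in> {0<..<L}" shows "\<bar>u x 0\<bar> \<le> c0"
proof (rule tendsto_upperbound)
  have "continuous_on {0..T} (u x)" using sol x by (auto simp: classical_solution_def)
  then have "(u x \<longlongrightarrow> u x 0) (at 0 within {0..T})" using T by (auto simp: continuous_on_def)
  then have "(u x \<longlongrightarrow> u x 0) (at_right 0)" using T by (simp add: at_within_Icc_at_right)
  then show "((\<lambda>\<tau>. \<bar>u x \<tau>\<bar>) \<longlongrightarrow> \<bar>u x 0\<bar>) (at_right 0)" by (rule tendsto_rabs)
  show "\<forall>\<^sub>F \<tau> in at_right 0. \<bar>u x \<tau>\<bar> \<le> c0"
    using eventually_at_right_less[of 0] eventually_at_right_real[OF T]
    by eventually_elim (use c0 x in auto)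
qed simp

text \<open>The integrability of \<open>f\<close> up to \<open>0\<close> is a conclusion: all other terms of the equation are integrable.\<close>

lemma integrated_equation_from_0:
  assumes j: "j \<in> {1..J-1}" and b: "0 \<le> b" "b \<le> T"
  defines "x \<equiv> grid_pt L J j"
  shows "(f x has_integral u x b - u x 0 + integral {0..b} (\<lambda>\<tau>. u x \<tau> * ux x \<tau>) - memory_integral x b) {0..b}"
proof (cases "b = 0")
  case True
  have "memory_integral x 0 = integral {0..T} (\<lambda>\<zeta>. 0)"
    unfolding memory_integral_def by (rule Henstock_Kurzweil_Integration.integral_cong) auto
  moreover have "(f x has_integral 0) (cbox 0 0)" by (rule has_integral_refl)
  ultimately show ?thesis using True by simp
next
  case False
  with b have b0: "0 < b" by simp
  have x: "x \<in> {0<..<L}" "x \<in> {0..L}" using grid_pt_interior[OF L j] by (auto simp: x_def)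
  have J: "1 \<le> J" using j by auto
  obtain K where K: "\<And>\<zeta>. \<zeta> \<in> {0<..T} \<Longrightarrow> \<bar>uxx x \<zeta>\<bar> \<le> K * \<zeta> powr (- \<theta>)"
    using uxx_weakly_singular[OF j] unfolding on_grid_def x_def by metis
  have cont: "continuous_on {0<..T} (uxx x)"
    using regular_family_continuous[OF L less_imp_le[OF M] regular_uxx[OF J] j] unfolding on_grid_def x_def .
  have ut: "(ut x has_integral u x b - u x 0) {0..b}"
  proof (rule fundamental_theorem_of_calculus_interior)
    show "continuous_on {0..b} (u x)"
    proof (rule continuous_on_subset)
      show "continuous_on {0..T} (u x)" using sol x by (auto simp: classical_solution_def)
    qed (use b in auto)
    fix \<tau> assume \<tau>: "\<tau> \<in> {0<..<b}"
    then have "(u x has_real_derivative ut x \<tau>) (at \<tau> within {0..T})"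
      using sol x b by (auto simp: classical_solution_def)
    moreover have "at \<tau> within {0..T} = at \<tau>" using \<tau> b by (intro at_within_interior) auto
    ultimately show "(u x has_vector_derivative ut x \<tau>) (at \<tau>)"
      by (simp add: has_real_derivative_iff_has_vector_derivative)
  qed (use b in auto)
  have prod: "((\<lambda>\<tau>. u x \<tau> * ux x \<tau>) has_integral integral {0..b} (\<lambda>\<tau>. u x \<tau> * ux x \<tau>)) {0..b}"
    by (intro integrable_integral product_integrable x b) auto
  have "(frac_integral \<alpha> (uxx x) has_integral integral {0..b} (\<lambda>\<zeta>. pow_kernel \<alpha> (b - \<zeta>) * uxx x \<zeta>)) {0..b}"
  proof (rule frac_integral_has_integral[OF \<alpha> \<theta>(2) b0])
    show "continuous_on {0<..b} (uxx x)" using b by (intro continuous_on_subset[OF cont]) auto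
    show "\<bar>uxx x \<zeta>\<bar> \<le> K * \<zeta> powr (- \<theta>)" if "\<zeta> \<in> {0<..b}" for \<zeta> using K[of \<zeta>] that b by auto
    show "(\<lambda>\<zeta>. beta_kernel \<alpha> (\<tau> - \<zeta>) * uxx x \<zeta>) absolutely_integrable_on {0..\<tau>}" if "\<tau> \<in> {0<..b}" for \<tau>
      using sol x b that by (auto simp: classical_solution_def)
  qed
  also have "integral {0..b} (\<lambda>\<zeta>. pow_kernel \<alpha> (b - \<zeta>) * uxx x \<zeta>) = memory_integral x b"
  proof -
    have int: "(\<lambda>\<zeta>. pow_kernel \<alpha> (b - \<zeta>) * uxx x \<zeta>) integrable_on {0..T}"
      using memory_integrand_integrable[OF j, of b] unfolding on_grid_def x_def .
    have "integral {b..T} (\<lambda>\<zeta>. pow_kernel \<alpha> (b - \<zeta>) * uxx x \<zeta>) = integral {b..T} (\<lambda>\<zeta>. 0)"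
      by (rule Henstock_Kurzweil_Integration.integral_cong) auto
    then show ?thesis
      unfolding memory_integral_def using Henstock_Kurzweil_Integration.integral_combine[OF b int] by simp
  qed
  finally have frac: "(frac_integral \<alpha> (uxx x) has_integral memory_integral x b) {0..b}" .
  from has_integral_diff[OF has_integral_add[OF ut prod] frac]
  have "((\<lambda>\<tau>. ut x \<tau> + u x \<tau> * ux x \<tau> - frac_integral \<alpha> (uxx x) \<tau>) has_integral
      u x b - u x 0 + integral {0..b} (\<lambda>\<tau>. u x \<tau> * ux x \<tau>) - memory_integral x b) {0..b}" .
  then show ?thesis
  proof (rule has_integral_spike_finite[of "{0}", rotated 2])
    fix \<tau> assume "\<tau> \<in> {0..b} - {0}"
    then show "f x \<tau> = ut x \<tau> + u x \<tau> * ux x \<tau> - frac_integral \<alpha> (uxx x) \<tau>"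
      using sol x b by (auto simp: classical_solution_def)
  qed simp
qed

lemma integrated_equation:
  assumes j: "j \<in> {1..J-1}" and ab: "0 \<le> a" "a \<le> b" "b \<le> T"
  defines "x \<equiv> grid_pt L J j"
  shows "u x b - u x a = integral {a..b} (f x) - integral {a..b} (\<lambda>\<tau>. u x \<tau> * ux x \<tau>) + (memory_integral x b - memory_integral x a)"
    "f x integrable_on {a..b}"
proof -
  have x: "x \<in> {0..L}" using grid_pt_interior[OF L j] by (auto simp: x_def)
  have fa: "(f x has_integral u x a - u x 0 + integral {0..a} (\<lambda>\<tau>. u x \<tau> * ux x \<tau>) - memory_integral x a) {0..a}"
    and fb: "(f x has_integral u x b - u x 0 + integral {0..b} (\<lambda>\<tau>. u x \<tau> * ux x \<tau>) - memory_integral x b) {0..b}"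
    unfolding x_def by (intro integrated_equation_from_0[OF j]; use ab in auto)+
  have fint: "f x integrable_on {0..b}" using fb by blast
  have "integral {0..a} (f x) + integral {a..b} (f x) = integral {0..b} (f x)"
    by (rule Henstock_Kurzweil_Integration.integral_combine[OF ab(1,2) fint])
  moreover have "integral {0..a} (\<lambda>\<tau>. u x \<tau> * ux x \<tau>) + integral {a..b} (\<lambda>\<tau>. u x \<tau> * ux x \<tau>) = integral {0..b} (\<lambda>\<tau>. u x \<tau> * ux x \<tau>)"
    by (rule Henstock_Kurzweil_Integration.integral_combine[OF ab(1,2) product_integrable]) (use x ab in auto)
  ultimately show "u x b - u x a = integral {a..b} (f x) - integral {a..b} (\<lambda>\<tau>. u x \<tau> * ux x \<tau>) + (memory_integral x b - memory_integral x a)"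
    using integral_unique[OF fa] integral_unique[OF fb] by linarith
  show "f x integrable_on {a..b}" by (rule integrable_on_subinterval[OF fint]) (use ab in auto)
qed

section \<open>A bound for the forcing term\<close>

definition singular_const :: real where "singular_const = M / \<theta> * T powr (\<sigma> - 1 + \<theta>)"

lemma singular_const_nonneg: "0 \<le> singular_const"
  using M \<theta> by (simp add: singular_const_def)

lemma regular_family_increment_singular:
  assumes "regular_family L J T \<sigma> M G G' G''" "0 < a" "a \<le> T"
  shows "grid_norm L J (\<lambda>s. G s T - G s a) \<le> singular_const * a powr (- \<theta>)"
proof -
  have "grid_norm L J (\<lambda>s. G s T - G s a) \<le> singular_const * (a powr (- \<theta>) - T powr (- \<theta>))"
    unfolding singular_const_def
    by (rule regular_family_increment[OF L less_imp_le[OF M] assms(1,2,3) order_refl \<theta>(1,3)])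
  also have "\<dots> \<le> singular_const * a powr (- \<theta>)" using singular_const_nonneg by (intro mult_left_mono) auto
  finally show ?thesis .
qed

lemma powr_minus_integral': "0 \<le> b \<Longrightarrow> ((\<lambda>\<zeta>. K1 + K2 * \<zeta> powr (- \<theta>)) has_integral K1 * b + K2 * (b powr (1 - \<theta>) / (1 - \<theta>))) {0..b}"
  using has_integral_add[OF has_integral_const_real[of K1 0 b] has_integral_mult_right[OF powr_minus_integral[OF \<theta>(2), of b], of K2]]
  by (simp add: mult.commute)

text \<open>The hypotheses on \<open>f\<close> bound only its increments. A bound of its size comes from the mean over
  \<open>{0..T}\<close>, which the integrated equation expresses through bounded quantities, and from the
  deviation of \<open>f\<close> from its final value.\<close>

lemma final_forcing_bound: "\<exists>\<Phi>\<ge>0. \<forall>J\<ge>1. grid_norm L J (\<lambda>j. on_grid J f j T) \<le> \<Phi>"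
proof -
  define I where "I = T powr (1 - \<theta>) / (1 - \<theta>)"
  have I0: "0 \<le> I" using \<theta> by (simp add: I_def)
  obtain m where m: "\<And>x. x \<in> {0..L} \<Longrightarrow> \<bar>uxx x T\<bar> \<le> m"
  proof -
    have "bounded ((\<lambda>x. uxx x T) ` {0..L})"
      using uxx_cont[of T] T by (intro compact_imp_bounded compact_continuous_image) auto
    then obtain m where "\<forall>x\<in>{0..L}. \<bar>uxx x T\<bar> \<le> m" by (auto simp: bounded_iff)
    then show ?thesis by (intro that) auto
  qed
  have m0: "0 \<le> m" using m[of 0] L by auto
  define Q where "Q = pow_kernel \<alpha> T * (m * sqrt L * T + singular_const * I)"
  define \<Phi> where "\<Phi> = (singular_const * I + (2 * c0 + c0 * c0 * T) * sqrt L + Q) / T"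
  have pT: "0 \<le> pow_kernel \<alpha> T" using \<alpha> by (simp add: pow_kernel_nonneg)
  have Q0: "0 \<le> Q" using pT m0 T L singular_const_nonneg I0 by (simp add: Q_def)
  have "grid_norm L J (\<lambda>j. on_grid J f j T) \<le> \<Phi>" if J: "1 \<le> J" for J
  proof -
    let ?n = "grid_norm L J"
    let ?x = "\<lambda>j. grid_pt L J j"
    have a: "?n (\<lambda>j. integral {0<..<T} (\<lambda>s. on_grid J f j T - on_grid J f j s)) \<le> singular_const * I"
    proof -
      have "?n (\<lambda>j. integral {0<..<T} (\<lambda>s. on_grid J f j T - on_grid J f j s)) \<le> integral {0<..<T} (\<lambda>s. singular_const * s powr (- \<theta>))"
      proof (rule grid_norm_integral_le[OF L])
        fix j assume j: "j \<in> {1..J-1}"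
        have "(\<lambda>s. on_grid J f j T - on_grid J f j s) integrable_on {0..T}"
          using integrated_equation(2)[OF j, of 0 T] T unfolding on_grid_def by (intro integrable_diff) auto
        then show "(\<lambda>s. on_grid J f j T - on_grid J f j s) integrable_on {0<..<T}" by (simp add: integrable_on_Icc_iff_Ioo)
      next
        show "(\<lambda>s. singular_const * s powr (- \<theta>)) integrable_on {0<..<T}"
          using set_lebesgue_integral_eq_integral(1)[OF powr_minus_absolutely_integrable[of T singular_const]] T
          by (simp add: integrable_on_Icc_iff_Ioo)
      next
        fix s assume "s \<in> {0<..<T}"
        then show "?n (\<lambda>j. on_grid J f j T - on_grid J f j s) \<le> singular_const * s powr (- \<theta>)"
          by (intro regular_family_increment_singular[OF regular_f[OF J]]) auto
      qed
      also have "\<dots> = singular_const * I"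
        using integral_unique[OF powr_minus_integral'[of T 0 singular_const]] T
        by (simp add: integral_open_interval_real[symmetric] I_def)
      finally show ?thesis .
    qed
    have b: "?n (\<lambda>j. u (?x j) T - u (?x j) 0 + integral {0..T} (\<lambda>\<tau>. u (?x j) \<tau> * ux (?x j) \<tau>)) \<le> (2 * c0 + c0 * c0 * T) * sqrt L"
    proof (rule grid_norm_bounded[OF L])
      fix j assume j: "j \<in> {1..J-1}"
      have x: "?x j \<in> {0<..<L}" "?x j \<in> {0..L}" using grid_pt_interior[OF L j] by auto
      have "\<bar>u (?x j) 0\<bar> \<le> c0" by (rule initial_value_bound[OF x(1)])
      moreover have "\<bar>u (?x j) T\<bar> \<le> c0" using c0[OF x(2), of T] T by auto
      moreover have "\<bar>integral {0..T} (\<lambda>\<tau>. u (?x j) \<tau> * ux (?x j) \<tau>)\<bar> \<le> c0 * c0 * T"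
      proof -
        have "norm (integral {0..T} (\<lambda>\<tau>. u (?x j) \<tau> * ux (?x j) \<tau>)) \<le> (c0 * c0) * measure lborel {0..T}"
        proof (rule has_integral_bound_real[of _ "{0}"])
          show "((\<lambda>\<tau>. u (?x j) \<tau> * ux (?x j) \<tau>) has_integral integral {0..T} (\<lambda>\<tau>. u (?x j) \<tau> * ux (?x j) \<tau>)) {0..T}"
            by (intro integrable_integral product_integrable x) auto
          fix \<tau> assume "\<tau> \<in> {0..T} - {0}"
          then show "norm (u (?x j) \<tau> * ux (?x j) \<tau>) \<le> c0 * c0"
            using c0[OF x(2), of \<tau>] c0_nonneg by (auto simp: abs_mult intro!: mult_mono)
        qed (use c0_nonneg in auto)
        then show ?thesis using T by simp
      qed
      ultimately show "\<bar>u (?x j) T - u (?x j) 0 + integral {0..T} (\<lambda>\<tau>. u (?x j) \<tau> * ux (?x j) \<tau>)\<bar> \<le> 2 * c0 + c0 * c0 * T"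
        by linarith
    qed (use c0_nonneg T in auto)
    have c: "?n (\<lambda>j. memory_integral (?x j) T) \<le> Q"
    proof -
      let ?e = "\<lambda>\<zeta>. pow_kernel \<alpha> T * (m * sqrt L + singular_const * \<zeta> powr (- \<theta>))"
      have ei: "(?e has_integral Q) {0..T}"
        unfolding Q_def I_def using T by (intro has_integral_mult_right powr_minus_integral') auto
      have "?n (\<lambda>j. integral {0<..<T} (\<lambda>\<zeta>. pow_kernel \<alpha> (T - \<zeta>) * on_grid J uxx j \<zeta>)) \<le> integral {0<..<T} ?e"
      proof (rule grid_norm_integral_le[OF L])
        fix j assume j: "j \<in> {1..J-1}"
        show "(\<lambda>\<zeta>. pow_kernel \<alpha> (T - \<zeta>) * on_grid J uxx j \<zeta>) integrable_on {0<..<T}"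
          using memory_integrand_integrable[OF j, of T] by (simp add: integrable_on_Icc_iff_Ioo)
      next
        show "?e integrable_on {0<..<T}" using ei by (auto simp: integrable_on_Icc_iff_Ioo[symmetric])
      next
        fix \<zeta> assume z: "\<zeta> \<in> {0<..<T}"
        have "?n (\<lambda>j. on_grid J uxx j \<zeta>) = ?n (\<lambda>j. on_grid J uxx j T - (on_grid J uxx j T - on_grid J uxx j \<zeta>))" by simp
        also have "\<dots> \<le> ?n (\<lambda>j. on_grid J uxx j T) + ?n (\<lambda>j. on_grid J uxx j T - on_grid J uxx j \<zeta>)"
          by (rule grid_norm_diff[OF L])
        also have "?n (\<lambda>j. on_grid J uxx j T) \<le> m * sqrt L"
        proof (rule grid_norm_bounded[OF L _ m0])
          fix j assume "j \<in> {1..J-1}"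
          then have "?x j \<in> {0..L}" using grid_pt_interior[OF L] by (auto simp: less_imp_le)
          then show "\<bar>on_grid J uxx j T\<bar> \<le> m" unfolding on_grid_def by (rule m)
        qed
        also have "?n (\<lambda>j. on_grid J uxx j T - on_grid J uxx j \<zeta>) \<le> singular_const * \<zeta> powr (- \<theta>)"
          using z by (intro regular_family_increment_singular[OF regular_uxx[OF J]]) auto
        finally have n: "?n (\<lambda>j. on_grid J uxx j \<zeta>) \<le> m * sqrt L + singular_const * \<zeta> powr (- \<theta>)" by simp
        have "?n (\<lambda>j. pow_kernel \<alpha> (T - \<zeta>) * on_grid J uxx j \<zeta>) = pow_kernel \<alpha> (T - \<zeta>) * ?n (\<lambda>j. on_grid J uxx j \<zeta>)"
          using \<alpha> by (simp add: grid_norm_scale[OF L] pow_kernel_nonneg)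
        also have "\<dots> \<le> ?e \<zeta>"
          using z \<alpha> n L by (intro mult_mono pow_kernel_mono) (auto simp: pow_kernel_nonneg)
        finally show "?n (\<lambda>j. pow_kernel \<alpha> (T - \<zeta>) * on_grid J uxx j \<zeta>) \<le> ?e \<zeta>" .
      qed
      also have "\<dots> = Q" using integral_unique[OF ei] by (simp add: integral_open_interval_real)
      finally show ?thesis by (simp add: memory_integral_def on_grid_def integral_open_interval_real)
    qed
    have "T * on_grid J f j T = integral {0<..<T} (\<lambda>s. on_grid J f j T - on_grid J f j s)
        + ((u (?x j) T - u (?x j) 0 + integral {0..T} (\<lambda>\<tau>. u (?x j) \<tau> * ux (?x j) \<tau>)) - memory_integral (?x j) T)" if j: "j \<in> {1..J-1}" for j
    proof -
      have "((\<lambda>s. on_grid J f j T - on_grid J f j s) has_integral T * on_grid J f j T - integral {0..T} (f (?x j))) {0..T}"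
        using has_integral_diff[OF has_integral_const_real[of "on_grid J f j T" 0 T] integrable_integral[OF integrated_equation(2)[OF j, of 0 T]]] T
        by (simp add: on_grid_def)
      then have "integral {0<..<T} (\<lambda>s. on_grid J f j T - on_grid J f j s) = T * on_grid J f j T - integral {0..T} (f (?x j))"
        by (simp add: integral_unique integral_open_interval_real[symmetric])
      moreover have "integral {0..T} (f (?x j)) = u (?x j) T - u (?x j) 0 + integral {0..T} (\<lambda>\<tau>. u (?x j) \<tau> * ux (?x j) \<tau>) - memory_integral (?x j) T"
        using T by (intro integral_unique integrated_equation_from_0[OF j]) auto
      ultimately show ?thesis by simp
    qed
    then have "?n (\<lambda>j. T * on_grid J f j T) = ?n (\<lambda>j. integral {0<..<T} (\<lambda>s. on_grid J f j T - on_grid J f j s)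
        + ((u (?x j) T - u (?x j) 0 + integral {0..T} (\<lambda>\<tau>. u (?x j) \<tau> * ux (?x j) \<tau>)) - memory_integral (?x j) T))"
      by (rule grid_norm_cong)
    also have "\<dots> \<le> singular_const * I + ((2 * c0 + c0 * c0 * T) * sqrt L + Q)"
      by (rule order_trans[OF grid_norm_triangle[OF L] add_mono[OF a order_trans[OF grid_norm_diff[OF L] add_mono[OF b c]]]])
    finally have "T * ?n (\<lambda>j. on_grid J f j T) \<le> singular_const * I + ((2 * c0 + c0 * c0 * T) * sqrt L + Q)"
      using T by (simp add: grid_norm_scale[OF L])
    then show ?thesis using T by (simp add: \<Phi>_def pos_le_divide_eq mult.commute add.assoc)
  qed
  moreover have "0 \<le> \<Phi>" using singular_const_nonneg I0 c0_nonneg T L Q0 by (simp add: \<Phi>_def)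
  ultimately show ?thesis by blast
qed

end

section \<open>Truncation errors\<close>

lemma field_derivative_increment_le:
  fixes g :: "real \<Rightarrow> real"
  assumes "\<And>x. x \<in> {0..L} \<Longrightarrow> (g has_real_derivative g' x) (at x within {0..L})" "\<And>x. x \<in> {0..L} \<Longrightarrow> \<bar>g' x\<bar> \<le> c"
    and "x \<in> {0..L}" "y \<in> {0..L}"
  shows "\<bar>g x - g y\<bar> \<le> c * \<bar>x - y\<bar>"
  using field_differentiable_bound[of "{0..L}" g g' c x y] assms by auto

lemma abs_average_le: "\<bar>a\<bar> \<le> K \<Longrightarrow> \<bar>b\<bar> \<le> K \<Longrightarrow> \<bar>(a + b) / 2\<bar> \<le> K" for a b K :: real
  using abs_triangle_ineq[of a b] by simp

lemma abs_average_diff_le: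
  fixes a b a' b' K :: real
  assumes "\<bar>a - a'\<bar> \<le> K" "\<bar>b - b'\<bar> \<le> K"
  shows "\<bar>(a + b) / 2 - (a' + b') / 2\<bar> \<le> K"
proof -
  have "(a + b) / 2 - (a' + b') / 2 = ((a - a') + (b - b')) / 2" by (simp add: field_simps)
  then show ?thesis using abs_average_le[OF assms] by (simp only:)
qed

lemma abs_product_diff_le: "\<bar>m * d - v * x\<bar> \<le> \<bar>m - v\<bar> * \<bar>d\<bar> + \<bar>v\<bar> * \<bar>d - x\<bar>" for m d v x :: real
proof -
  have "m * d - v * x = (m - v) * d + v * (d - x)" by (simp add: algebra_simps)
  then show ?thesis unfolding abs_mult[symmetric] by (metis abs_triangle_ineq)
qed

lemma difference_operators_average:
  "local_mean (\<lambda>i. (a i + b i) / 2) j = (local_mean a j + local_mean b j) / 2"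
  "central_diff H (\<lambda>i. (a i + b i) / 2) j = (central_diff H a j + central_diff H b j) / 2"
  "second_diff H (\<lambda>i. (a i + b i) / 2) j = (second_diff H a j + second_diff H b j) / 2"
  by (simp_all add: local_mean_def central_diff_def second_diff_def add_divide_distrib diff_divide_distrib)

locale discretised_solution =
  sol: exact_solution \<alpha> L T \<sigma> M c0 u0 f ft ftt u ut ux uxx uxxt uxxtt +
  par: mesh_parameters T \<gamma> \<sigma> Cg cg \<rho>
  for \<alpha> L T \<sigma> M c0 :: real and u0 :: "real \<Rightarrow> real"
    and f ft ftt u ut ux uxx uxxt uxxtt :: "real \<Rightarrow> real \<Rightarrow> real" and \<gamma> Cg cg \<rho> :: real +
  fixes Cf B :: real
  assumes Cf: "0 < Cf"
begin

abbreviation "\<theta> \<equiv> sol.\<theta>"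

definition ratio :: real where "ratio = max 1 Cg"

lemma ratio_ge_1: "1 \<le> ratio" by (simp add: ratio_def)

text \<open>A choice once and for all, so that the constant depends on the solution and on the ratio of
  neighbouring mesh points, but not on the mesh.\<close>

definition interp_const :: real where
  "interp_const = (SOME C. 0 \<le> C \<and> (\<forall>x\<in>{0..L}. \<forall>a b. 0 < a \<longrightarrow> a < b \<longrightarrow> b \<le> T \<longrightarrow> b \<le> ratio * a \<longrightarrow>
    \<bar>u x b - u x a\<bar> \<le> C * ((b - a) * b powr ((\<sigma> - 3) / 2)) \<and> \<bar>ux x b - ux x a\<bar> \<le> C * ((b - a) * b powr ((\<sigma> - 3) / 2))))"

lemma interp_const: "0 \<le> interp_const"
  "\<lbrakk>x \<in> {0..L}; 0 < a; a < b; b \<le> T; b \<le> ratio * a\<rbrakk> \<Longrightarrow>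
    \<bar>u x b - u x a\<bar> \<le> interp_const * ((b - a) * b powr ((\<sigma> - 3) / 2)) \<and>
    \<bar>ux x b - ux x a\<bar> \<le> interp_const * ((b - a) * b powr ((\<sigma> - 3) / 2))"
  using someI_ex[OF sol.u_increment_interpolated[OF ratio_ge_1, unfolded Bex_def conj_assoc], folded interp_const_def]
  by auto

definition B3 :: real where "B3 = 36 * c0 / L\<^sup>2 + B * L"
definition B2 :: real where "B2 = 6 * c0 / L + B3 * L"

definition smooth_at :: "real \<Rightarrow> bool" where
  "smooth_at \<tau> \<longleftrightarrow> (\<exists>d. Ck_derivs 4 {0..L} (\<lambda>x. u x \<tau>) d \<and> (\<forall>x\<in>{0..L}. \<bar>d 4 x\<bar> \<le> B))"

lemma smooth_at_B: "smooth_at \<tau> \<Longrightarrow> 0 \<le> B"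
  using sol.L unfolding smooth_at_def by (metis abs_ge_zero atLeastAtMost_iff less_eq_real_def order_trans)

text \<open>The derivatives in the smoothness hypothesis agree with \<open>ux\<close> and \<open>uxx\<close>, so that the first one is
  bounded by \<open>c0\<close>; the second and third ones follow by interpolation.\<close>

lemma space_consistency:
  assumes \<tau>: "\<tau> \<in> {0<..T}" and smooth: "smooth_at \<tau>" and j: "j \<in> {1..J-1}"
  defines "h \<equiv> L / real J" and "x \<equiv> grid_pt L J j" and "w \<equiv> \<lambda>i. u (grid_pt L J i) \<tau>"
  shows "\<bar>local_mean w j - u x \<tau>\<bar> \<le> B2 * h\<^sup>2" "\<bar>central_diff h w j - ux x \<tau>\<bar> \<le> B3 * h\<^sup>2"
    "\<bar>second_diff h w j - uxx x \<tau>\<bar> \<le> B * h\<^sup>2"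
proof -
  obtain d where d: "Ck_derivs 4 {0..L} (\<lambda>x. u x \<tau>) d" and d4: "\<And>x. x \<in> {0..L} \<Longrightarrow> \<bar>d 4 x\<bar> \<le> B"
    using smooth unfolding smooth_at_def by blast
  have d': "Ck_derivs (Suc 3) {0..L} (\<lambda>x. u x \<tau>) d" using d by (simp add: eval_nat_numeral)
  have d0: "d 0 x = u x \<tau>" if "x \<in> {0..L}" for x using d that by (simp add: Ck_derivs_def)
  have d1: "d 1 x = ux x \<tau>" if "x \<in> {0..L}" for x
    using Ck_derivs_unique[OF d' sol.L that, of 0, OF _ d0 sol.u_deriv[OF that \<tau>]] by simp
  have d2: "d 2 x = uxx x \<tau>" if "x \<in> {0..L}" for x
    using Ck_derivs_unique[OF d' sol.L that, of 1, OF _ d1 sol.ux_deriv[OF that \<tau>]] by (simp add: numeral_2_eq_2)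
  have d1b: "\<bar>d 1 x\<bar> \<le> c0" if "x \<in> {0..L}" for x using d1[OF that] sol.c0[OF that \<tau>] by simp
  have b3: "\<bar>d 3 x\<bar> \<le> B3" and b2: "\<bar>d 2 x\<bar> \<le> B2" if "x \<in> {0..L}" for x
    using space_derivative_bounds[OF sol.L d d1b d4 that] by (simp_all add: B2_def B3_def)
  have der: "(d i has_real_derivative d (Suc i) x) (at x within {0..L})" if "i < 4" "x \<in> {0..L}" for i x
    using d that by (auto simp: Ck_derivs_def)
  have J: "1 \<le> J" using j by auto
  have w: "w i = d 0 (grid_pt L J i)" if "i \<le> J" for i
    unfolding w_def by (rule d0[OF grid_pt_le[OF sol.L J that], symmetric])
  have x: "x \<in> {0..L}" using grid_pt_interior[OF sol.L j] by (auto simp: x_def)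
  note c = difference_operators_consistent[OF sol.L j der w b2 b3 d4, folded h_def x_def]
  show "\<bar>local_mean w j - u x \<tau>\<bar> \<le> B2 * h\<^sup>2" "\<bar>central_diff h w j - ux x \<tau>\<bar> \<le> B3 * h\<^sup>2"
    "\<bar>second_diff h w j - uxx x \<tau>\<bar> \<le> B * h\<^sup>2"
    using c d0[OF x] d1[OF x] d2[OF x] by simp_all
qed

definition nodal :: "nat \<Rightarrow> (real \<Rightarrow> real \<Rightarrow> real) \<Rightarrow> (nat \<Rightarrow> real) \<Rightarrow> nat \<Rightarrow> nat \<Rightarrow> real" where
  "nodal J g t m i = g (grid_pt L J i) (t m)"

text \<open>The three sizes in which all errors in time are measured: the first interval, second-order
  errors on the others, and the boundary term at the final time from the summation by parts.\<close>

definition mesh_error :: "nat \<Rightarrow> (nat \<Rightarrow> real) \<Rightarrow> real" where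
  "mesh_error N t = t 1 powr \<sigma> + (\<Sum>s=2..N. step t s ^ 3 * t s powr (\<sigma> - 3)) + (step t N)\<^sup>2 * t N powr (\<sigma> - 2)"

definition memory_const :: real where
  "memory_const = pow_kernel \<alpha> T * (M * (1 / (\<theta> * (1 - \<theta>)) + ratio powr \<bar>\<sigma> - 3\<bar> + ratio\<^sup>2 powr \<bar>\<sigma> - 3\<bar> + ratio powr \<bar>\<sigma> - 2\<bar>))"

definition time_convection_const :: real where
  "time_convection_const = 2 * c0 * (sol.embed_const * M / (\<theta> * (1 - \<theta>)))
     + 2 * c0 * (sol.embed_const * (M * ratio powr \<bar>\<sigma> - 3\<bar>)) + interp_const\<^sup>2"

context
  fixes J N :: nat and k :: real and t :: "nat \<Rightarrow> real"
  assumes J: "1 \<le> J" and mesh: "par.admissible_mesh k N t" and smooth: "\<And>n. n \<in> {1..N} \<Longrightarrow> smooth_at (t n)"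
begin

interpretation mesh: monotone_time_mesh \<alpha> t N
  using mesh sol.\<alpha> by (intro graded_mesh_monotone) (auto simp: par.admissible_mesh_def)

abbreviation "h \<equiv> L / real J"

lemma tN: "t N = T" by (rule par.tN[OF mesh])

lemma t_mem: "n \<in> {1..N} \<Longrightarrow> t n \<in> {0<..T}"
  using mesh.t_pos[of n] mesh.t_mono[of n N] tN by auto

lemma t_ratio: "n \<in> {2..N} \<Longrightarrow> t n \<le> ratio * t (n - 1)"
  unfolding ratio_def using mesh by (intro graded_mesh_comparable) (auto simp: par.admissible_mesh_def)

lemma smooth_B: "0 \<le> B"
  using smooth[of N] mesh.N smooth_at_B by auto

lemma B2_B3: "0 \<le> B2" "0 \<le> B3"
  using smooth_B sol.c0_nonneg sol.L by (auto simp: B2_def B3_def)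

lemma level_cases:
  assumes n: "n \<in> {1..N}"
  obtains "n = 1" | m where "n = Suc m" "m \<in> {1..N}" "n \<noteq> 1"
  using n by (cases "n = 1") (metis One_nat_def Suc_le_D atLeastAtMost_iff le_SucE Suc_leD not_less_eq_eq le_0_eq not_le)+

lemma level_consistency:
  assumes n: "n \<in> {1..N}" and j: "j \<in> {1..J-1}"
  shows "\<bar>local_mean (level (nodal J u t) n) j - level (nodal J u t) n j\<bar> \<le> B2 * h\<^sup>2"
    "\<bar>central_diff h (level (nodal J u t) n) j - level (nodal J ux t) n j\<bar> \<le> B3 * h\<^sup>2"
    "\<bar>second_diff h (level (nodal J u t) n) j - level (nodal J uxx t) n j\<bar> \<le> B * h\<^sup>2"
proof -
  have c: "\<bar>local_mean (nodal J u t m) j - nodal J u t m j\<bar> \<le> B2 * h\<^sup>2 \<and>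
    \<bar>central_diff h (nodal J u t m) j - nodal J ux t m j\<bar> \<le> B3 * h\<^sup>2 \<and>
    \<bar>second_diff h (nodal J u t m) j - nodal J uxx t m j\<bar> \<le> B * h\<^sup>2" if m: "m \<in> {1..N}" for m
    using space_consistency[OF t_mem[OF m] smooth[OF m] j] unfolding nodal_def by simp
  have "\<bar>local_mean (level (nodal J u t) n) j - level (nodal J u t) n j\<bar> \<le> B2 * h\<^sup>2 \<and>
    \<bar>central_diff h (level (nodal J u t) n) j - level (nodal J ux t) n j\<bar> \<le> B3 * h\<^sup>2 \<and>
    \<bar>second_diff h (level (nodal J u t) n) j - level (nodal J uxx t) n j\<bar> \<le> B * h\<^sup>2"
    using n
  proof (cases rule: level_cases)
    case 1
    then show ?thesis using c[OF n] by (simp add: level_def)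
  next
    case (2 m)
    let ?V = "nodal J u t"
    have ops: "local_mean (level ?V n) j = (local_mean (?V n) j + local_mean (?V m) j) / 2"
      "central_diff h (level ?V n) j = (central_diff h (?V n) j + central_diff h (?V m) j) / 2"
      "second_diff h (level ?V n) j = (second_diff h (?V n) j + second_diff h (?V m) j) / 2"
      and lev: "level W n j = (W n j + W m j) / 2" for W
    proof -
      have "level W n = (\<lambda>i. (W n i + W m i) / 2)" for W using 2 by (simp add: level_def time_mean_def fun_eq_iff)
      then show "local_mean (level ?V n) j = (local_mean (?V n) j + local_mean (?V m) j) / 2"
        "central_diff h (level ?V n) j = (central_diff h (?V n) j + central_diff h (?V m) j) / 2"
        "second_diff h (level ?V n) j = (second_diff h (?V n) j + second_diff h (?V m) j) / 2"
        "level W n j = (W n j + W m j) / 2"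
        by (simp_all only: difference_operators_average)
    qed
    show ?thesis
      unfolding ops lev using c[OF n] c[OF 2(2)] by (intro conjI abs_average_diff_le) auto
  qed
  then show "\<bar>local_mean (level (nodal J u t) n) j - level (nodal J u t) n j\<bar> \<le> B2 * h\<^sup>2"
    "\<bar>central_diff h (level (nodal J u t) n) j - level (nodal J ux t) n j\<bar> \<le> B3 * h\<^sup>2"
    "\<bar>second_diff h (level (nodal J u t) n) j - level (nodal J uxx t) n j\<bar> \<le> B * h\<^sup>2"
    by auto
qed

lemma nodal_step:
  assumes m: "m \<in> {1..N}" and j: "j < J"
  shows "\<bar>nodal J u t m (Suc j) - nodal J u t m j\<bar> \<le> c0 * h"
proof -
  have "\<bar>u (grid_pt L J (Suc j)) (t m) - u (grid_pt L J j) (t m)\<bar> \<le> c0 * \<bar>grid_pt L J (Suc j) - grid_pt L J j\<bar>"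
    by (rule field_derivative_increment_le[OF sol.u_deriv[OF _ t_mem[OF m]]])
       (use sol.c0[OF _ t_mem[OF m]] grid_pt_le[OF sol.L J] j in auto)
  then show ?thesis using sol.L by (simp add: nodal_def grid_pt_Suc)
qed

lemma level_bounds:
  assumes n: "n \<in> {1..N}"
  shows "j < J \<Longrightarrow> \<bar>level (nodal J u t) n (Suc j) - level (nodal J u t) n j\<bar> \<le> c0 * h"
    "j \<le> J \<Longrightarrow> \<bar>level (nodal J u t) n j\<bar> \<le> c0" "j \<le> J \<Longrightarrow> \<bar>level (nodal J ux t) n j\<bar> \<le> c0"
proof -
  have b: "\<bar>nodal J u t m j\<bar> \<le> c0 \<and> \<bar>nodal J ux t m j\<bar> \<le> c0" if "m \<in> {1..N}" "j \<le> J" for m j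
    using sol.c0[OF grid_pt_le[OF sol.L J that(2)] t_mem[OF that(1)]] by (simp add: nodal_def)
  have gen: "\<bar>level W n j\<bar> \<le> c0" if W: "\<And>m. m \<in> {1..N} \<Longrightarrow> \<bar>W m j\<bar> \<le> c0" for W
    using n
  proof (cases rule: level_cases)
    case 1
    then show ?thesis using W[OF n] by (simp add: level_def)
  next
    case (2 m)
    then have "level W n j = (W n j + W m j) / 2" by (simp add: level_def time_mean_def)
    then show ?thesis using abs_average_le[OF W[OF n] W[OF 2(2)]] by simp
  qed
  show "j \<le> J \<Longrightarrow> \<bar>level (nodal J u t) n j\<bar> \<le> c0" "j \<le> J \<Longrightarrow> \<bar>level (nodal J ux t) n j\<bar> \<le> c0"
    by (rule gen, use b in blast)+
  show "j < J \<Longrightarrow> \<bar>level (nodal J u t) n (Suc j) - level (nodal J u t) n j\<bar> \<le> c0 * h"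
    using n
  proof (cases rule: level_cases)
    case 1
    then show "j < J \<Longrightarrow> ?thesis" using nodal_step[of 1 j] n by (simp add: level_def)
  next
    case (2 m)
    then show "j < J \<Longrightarrow> ?thesis"
      using nodal_step[of n j] nodal_step[of m j] n by (simp add: level_def time_mean_def abs_average_diff_le del: of_nat_Suc)
  qed
qed

lemma sum_cubed_nonneg: "0 \<le> (\<Sum>s=2..N. step t s ^ 3 * t s powr (\<sigma> - 3))"
  by (intro sum_nonneg mult_nonneg_nonneg zero_le_power less_imp_le[OF mesh.step_pos]) auto

lemma mesh_error_parts: "0 \<le> mesh_error N t" "t 1 powr \<sigma> \<le> mesh_error N t"
  "(\<Sum>s=2..N. step t s ^ 3 * t s powr (\<sigma> - 3)) \<le> mesh_error N t" "(step t N)\<^sup>2 * t N powr (\<sigma> - 2) \<le> mesh_error N t"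
  using sum_cubed_nonneg by (auto simp: mesh_error_def)

definition forcing_error :: "(nat \<Rightarrow> real \<Rightarrow> real) \<Rightarrow> nat \<Rightarrow> nat \<Rightarrow> real" where
  "forcing_error fh n j = fh n (grid_pt L J j) * step t n - integral {t (n - 1)..t n} (f (grid_pt L J j))"

lemma split_first: "(\<Sum>n=1..N. F n) = F 1 + (\<Sum>n=2..N. F n)" for F :: "nat \<Rightarrow> real"
  using mesh.N by (simp add: sum.atLeast_Suc_atMost numeral_2_eq_2)

text \<open>The discrete norms of the time derivatives of \<open>f\<close> need not be integrable functions of time. Their
  integral then has the default value \<open>0\<close>, which obeys the bound as well.\<close>

lemma integral_le_or_zero:
  fixes g :: "real \<Rightarrow> real"
  assumes "(e has_integral I) S" "\<And>x. x \<in> S \<Longrightarrow> g x \<le> e x" "0 \<le> I"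
  shows "integral S g \<le> I"
proof (cases "g integrable_on S")
  case True
  then show ?thesis using has_integral_le[OF integrable_integral assms(1)] assms(2) by blast
qed (use assms(3) in \<open>simp add: not_integrable_integral\<close>)

text \<open>On the first interval the weight \<open>s\<close> in the hypothesis makes the singularity integrable.\<close>

lemma sum_forcing_error:
  assumes fh: "forcing_approx Cf L J N t f ft ftt fh"
  shows "(\<Sum>n=1..N. grid_norm L J (forcing_error fh n)) \<le> Cf * M * (1 / \<sigma> + ratio powr \<bar>\<sigma> - 3\<bar>) * mesh_error N t"
proof -
  let ?n = "grid_norm L J"
  let ?S = "\<Sum>s=2..N. step t s ^ 3 * t s powr (\<sigma> - 3)"
  note nd = regular_family_norm_deriv[OF sol.L less_imp_le[OF sol.M] sol.regular_f[OF J], unfolded sol.on_grid_def]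
  have fe: "forcing_error fh n = (\<lambda>j. fh n (grid_pt L J j) * step t n - integral {t (n - 1)..t n} (f (grid_pt L J j)))" for n
    by (simp add: fun_eq_iff forcing_error_def)
  have first: "?n (forcing_error fh 1) \<le> Cf * (M * (t 1 powr \<sigma> / \<sigma>))"
  proof -
    have "?n (forcing_error fh 1) \<le> Cf * integral {t 0..t 1} (\<lambda>s. s * fun_norm L J (\<lambda>x. ft x s))"
      unfolding fe using fh by (simp add: forcing_approx_def fun_norm_def)
    also have "integral {t 0..t 1} (\<lambda>s. s * fun_norm L J (\<lambda>x. ft x s)) \<le> M * (t 1 powr \<sigma> / \<sigma>)"
    proof (rule integral_le_or_zero)
      show "((\<lambda>s. M * s powr (\<sigma> - 1)) has_integral M * (t 1 powr \<sigma> / \<sigma>)) {t 0..t 1}"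
        using has_integral_mult_right[OF has_integral_powr_from_0[of "\<sigma> - 1" "t 1"], of M] sol.\<sigma> mesh.t_pos[of 1] mesh.N
        by (simp add: mesh.t0)
      fix s assume s: "s \<in> {t 0..t 1}"
      show "s * fun_norm L J (\<lambda>x. ft x s) \<le> M * s powr (\<sigma> - 1)"
      proof (cases "s = 0")
        case False
        with s have s0: "0 < s" "s \<le> T" using mesh.t0 t_mem[of 1] mesh.N by auto
        have "s * fun_norm L J (\<lambda>x. ft x s) \<le> s * (M * s powr (\<sigma> - 2))"
          using nd(1)[OF s0] s0 unfolding fun_norm_def by (intro mult_left_mono) auto
        also have "\<dots> = M * (s powr 1 * s powr (\<sigma> - 2))" using s0 by simp
        also have "s powr 1 * s powr (\<sigma> - 2) = s powr (\<sigma> - 1)" by (simp only: powr_add[symmetric]) simp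
        finally show ?thesis .
      qed simp
    qed (use sol.M sol.\<sigma> in simp)
    finally show ?thesis using Cf by simp
  qed
  have later: "?n (forcing_error fh n) \<le> Cf * (M * ratio powr \<bar>\<sigma> - 3\<bar> * (step t n ^ 3 * t n powr (\<sigma> - 3)))" if n: "n \<in> {2..N}" for n
  proof -
    have k: "0 < step t n" using mesh.step_pos[of n] n by auto
    have tp: "0 < t (n - 1)" "t (n - 1) < t n" "t n \<le> T" using n mesh.t_pos[of "n - 1"] mesh.t_step[of n] t_mem[of n] by auto
    let ?K = "M * (ratio powr \<bar>\<sigma> - 3\<bar> * t n powr (\<sigma> - 3))"
    have "?n (forcing_error fh n) \<le> Cf * (step t n)\<^sup>2 * integral {t (n - 1)..t n} (\<lambda>s. fun_norm L J (\<lambda>x. ftt x s))"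
      unfolding fe using fh n by (auto simp: forcing_approx_def fun_norm_def)
    also have "integral {t (n - 1)..t n} (\<lambda>s. fun_norm L J (\<lambda>x. ftt x s)) \<le> step t n * ?K"
    proof (rule integral_le_or_zero)
      show "((\<lambda>s. ?K) has_integral step t n * ?K) {t (n - 1)..t n}"
        using has_integral_const_real[of ?K "t (n - 1)" "t n"] tp by (simp add: step_def)
      fix s assume s: "s \<in> {t (n - 1)..t n}"
      then have s0: "0 < s" "s \<le> T" using tp by auto
      have "ratio * t (n - 1) \<le> ratio * s" using s ratio_ge_1 by (intro mult_left_mono) auto
      then have "t n \<le> ratio * s" using t_ratio[OF n] by linarith
      then have "s powr (\<sigma> - 3) \<le> ratio powr \<bar>\<sigma> - 3\<bar> * t n powr (\<sigma> - 3)"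
        using s s0 ratio_ge_1 by (intro powr_le_comparable) auto
      then have "M * s powr (\<sigma> - 3) \<le> ?K" using sol.M by (intro mult_left_mono) auto
      then show "fun_norm L J (\<lambda>x. ftt x s) \<le> ?K" using nd(2)[OF s0] unfolding fun_norm_def by linarith
    qed (use k sol.M in simp)
    finally have "?n (forcing_error fh n) \<le> Cf * (step t n)\<^sup>2 * (step t n * ?K)" using Cf by (simp add: mult_left_mono)
    also have "\<dots> = Cf * (M * ratio powr \<bar>\<sigma> - 3\<bar> * (step t n ^ 3 * t n powr (\<sigma> - 3)))"
      by (simp add: power3_eq_cube power2_eq_square)
    finally show ?thesis .
  qed
  have "(\<Sum>n=1..N. ?n (forcing_error fh n)) \<le> Cf * (M * (t 1 powr \<sigma> / \<sigma>)) + (\<Sum>n=2..N. Cf * (M * ratio powr \<bar>\<sigma> - 3\<bar> * (step t n ^ 3 * t n powr (\<sigma> - 3))))"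
    unfolding split_first by (intro add_mono first sum_mono later)
  also have "\<dots> = Cf * M * (1 / \<sigma> * t 1 powr \<sigma> + ratio powr \<bar>\<sigma> - 3\<bar> * ?S)"
    by (simp add: sum_distrib_left distrib_left ac_simps)
  also have "\<dots> \<le> Cf * M * (1 / \<sigma> * mesh_error N t + ratio powr \<bar>\<sigma> - 3\<bar> * mesh_error N t)"
    using Cf sol.M sol.\<sigma> mesh_error_parts by (intro mult_left_mono add_mono) auto
  also have "\<dots> = Cf * M * (1 / \<sigma> + ratio powr \<bar>\<sigma> - 3\<bar>) * mesh_error N t" by (simp add: algebra_simps)
  finally show ?thesis .
qed

text \<open>The time part of the memory error, for \<open>u\<^sub>x\<^sub>x\<close> itself rather than its second difference in space.\<close>

lemma sum_memory_error:
  "(\<Sum>n=1..N. grid_norm L J (mesh.memory_error (sol.on_grid J uxx) n)) \<le> memory_const * mesh_error N t"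
proof -
  let ?S = "\<Sum>s=2..N. step t s ^ 3 * t s powr (\<sigma> - 3)"
  let ?Z = "(step t N)\<^sup>2 * t N powr (\<sigma> - 2)"
  have reg: "regular_family L J (t N) \<sigma> M (sol.on_grid J uxx) (sol.on_grid J uxxt) (sol.on_grid J uxxtt)"
    using sol.regular_uxx[OF J] tN by simp
  have "(\<Sum>n=1..N. grid_norm L J (mesh.memory_error (sol.on_grid J uxx) n)) \<le> pow_kernel \<alpha> (t N) *
    (M / (\<theta> * (1 - \<theta>)) * t 1 powr \<sigma> + M * (ratio powr \<bar>\<sigma> - 3\<bar> + (ratio\<^sup>2) powr \<bar>\<sigma> - 3\<bar>) * ?S
     + (if 2 \<le> N then M * ratio powr \<bar>\<sigma> - 2\<bar> * ?Z else 0))"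
    by (rule mesh.sum_norm_memory_error[OF sol.L less_imp_le[OF sol.M] reg ratio_ge_1 t_ratio sol.\<theta>])
  also have "\<dots> \<le> pow_kernel \<alpha> (t N) *
    (M / (\<theta> * (1 - \<theta>)) * mesh_error N t + M * (ratio powr \<bar>\<sigma> - 3\<bar> + (ratio\<^sup>2) powr \<bar>\<sigma> - 3\<bar>) * mesh_error N t + M * ratio powr \<bar>\<sigma> - 2\<bar> * mesh_error N t)"
  proof (intro mult_left_mono add_mono)
    have "M * ratio powr \<bar>\<sigma> - 2\<bar> * ?Z \<le> M * ratio powr \<bar>\<sigma> - 2\<bar> * mesh_error N t"
      using sol.M mesh_error_parts by (intro mult_left_mono) auto
    moreover have "0 \<le> M * ratio powr \<bar>\<sigma> - 2\<bar> * mesh_error N t" using sol.M mesh_error_parts by simp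
    ultimately show "(if 2 \<le> N then M * ratio powr \<bar>\<sigma> - 2\<bar> * ?Z else 0) \<le> M * ratio powr \<bar>\<sigma> - 2\<bar> * mesh_error N t" by simp
  qed (use sol.M sol.\<theta> sol.\<alpha> mesh_error_parts in \<open>auto simp: pow_kernel_nonneg\<close>)
  also have "\<dots> = memory_const * mesh_error N t"
    unfolding memory_const_def tN by (simp add: algebra_simps add_divide_distrib)
  finally show ?thesis .
qed

definition space_memory_error :: "nat \<Rightarrow> nat \<Rightarrow> real" where
  "space_memory_error n j = (\<Sum>s=1..n. mesh.mem_weight n s *
     (second_diff h (level (nodal J u t) s) j - level (nodal J uxx t) s j))"

lemma sum_space_memory_error:
  "(\<Sum>n=1..N. grid_norm L J (space_memory_error n)) \<le> pow_kernel \<alpha> T * T * (B * sqrt L) * h\<^sup>2"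
proof -
  have "(\<Sum>n=1..N. grid_norm L J (space_memory_error n)) \<le> (\<Sum>n=1..N. \<Sum>s\<in>{1..N}. mesh.mem_weight n s * (B * h\<^sup>2 * sqrt L))"
  proof (rule sum_mono)
    fix n assume n: "n \<in> {1..N}"
    have w: "0 \<le> mesh.mem_weight n s" if "s \<in> {1..N}" for s using mesh.mem_weight_nonneg that n by blast
    have "grid_norm L J (space_memory_error n) \<le> (\<Sum>s=1..n. grid_norm L J (\<lambda>j. mesh.mem_weight n s *
        (second_diff h (level (nodal J u t) s) j - level (nodal J uxx t) s j)))"
      unfolding space_memory_error_def by (rule grid_norm_sum[OF sol.L])
    also have "\<dots> \<le> (\<Sum>s=1..n. mesh.mem_weight n s * (B * h\<^sup>2 * sqrt L))"
    proof (rule sum_mono)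
      fix s assume s: "s \<in> {1..n}"
      then have s': "s \<in> {1..N}" using n by auto
      have "grid_norm L J (\<lambda>j. second_diff h (level (nodal J u t) s) j - level (nodal J uxx t) s j) \<le> B * h\<^sup>2 * sqrt L"
        using smooth_B by (intro grid_norm_bounded[OF sol.L] level_consistency(3)[OF s']) auto
      then show "grid_norm L J (\<lambda>j. mesh.mem_weight n s * (second_diff h (level (nodal J u t) s) j - level (nodal J uxx t) s j))
          \<le> mesh.mem_weight n s * (B * h\<^sup>2 * sqrt L)"
        using w[OF s'] by (simp add: grid_norm_scale[OF sol.L] mult_left_mono)
    qed
    also have "\<dots> \<le> (\<Sum>s\<in>{1..N}. mesh.mem_weight n s * (B * h\<^sup>2 * sqrt L))"
    proof (rule sum_mono2)
      fix s assume "s \<in> {1..N} - {1..n}"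
      then show "0 \<le> mesh.mem_weight n s * (B * h\<^sup>2 * sqrt L)"
        using w smooth_B sol.L by (intro mult_nonneg_nonneg) auto
    qed (use n in auto)
    finally show "grid_norm L J (space_memory_error n) \<le> (\<Sum>s\<in>{1..N}. mesh.mem_weight n s * (B * h\<^sup>2 * sqrt L))" .
  qed
  also have "\<dots> \<le> pow_kernel \<alpha> (t N) * (\<Sum>s\<in>{1..N}. step t s * (B * h\<^sup>2 * sqrt L))"
    using smooth_B sol.L by (intro mesh.sum_mem_weight_times_le) auto
  also have "(\<Sum>s\<in>{1..N}. step t s * (B * h\<^sup>2 * sqrt L)) = T * (B * h\<^sup>2 * sqrt L)"
    using mesh.sum_step[of 0 N] tN mesh.t0 by (simp add: sum_distrib_right[symmetric])
  finally show ?thesis unfolding tN by (simp add: ac_simps)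
qed

definition convection_error :: "nat \<Rightarrow> nat \<Rightarrow> real" where
  "convection_error n j = step t n * convection h (level (nodal J u t) n) j
     - integral {t (n - 1)..t n} (\<lambda>\<tau>. u (grid_pt L J j) \<tau> * ux (grid_pt L J j) \<tau>)"

lemma space_convection_error:
  assumes n: "n \<in> {1..N}" and j: "j \<in> {1..J-1}"
  shows "\<bar>convection h (level (nodal J u t) n) j - level (nodal J u t) n j * level (nodal J ux t) n j\<bar> \<le> c0 * (B2 + B3) * h\<^sup>2"
proof -
  let ?V = "level (nodal J u t) n" and ?X = "level (nodal J ux t) n"
  have hp: "0 < h" using sol.L J by simp
  have cd: "\<bar>central_diff h ?V j\<bar> \<le> c0"
  proof -
    have jj: "j < J" "j - 1 < J" "Suc (j - 1) = j" using j by auto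
    have "\<bar>?V (Suc (j - 1)) - ?V (j - 1)\<bar> \<le> c0 * h" by (rule level_bounds(1)[OF n jj(2)])
    then have "\<bar>(?V (Suc j) - ?V j) + (?V j - ?V (j - 1))\<bar> \<le> c0 * h + c0 * h"
      unfolding jj(3) by (intro order_trans[OF abs_triangle_ineq add_mono] level_bounds(1)[OF n jj(1)])
    then have "\<bar>?V (Suc j) - ?V (j - 1)\<bar> \<le> c0 * h + c0 * h" by simp
    moreover have quot: "\<bar>x / (2 * H)\<bar> \<le> c0" if "\<bar>x\<bar> \<le> c0 * H + c0 * H" "0 < H" for x H :: real
      using that by (simp add: abs_divide pos_divide_le_eq algebra_simps)
    ultimately have "\<bar>(?V (Suc j) - ?V (j - 1)) / (2 * h)\<bar> \<le> c0" using quot[OF _ hp] by blast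
    then show ?thesis by (simp only: central_diff_def Suc_eq_plus1)
  qed
  have vb: "\<bar>?V j\<bar> \<le> c0" using level_bounds(2)[OF n, of j] j by auto
  have "0 \<le> B2 * h\<^sup>2" using B2_B3 by simp
  then have bound: "\<bar>local_mean ?V j - ?V j\<bar> * \<bar>central_diff h ?V j\<bar> + \<bar>?V j\<bar> * \<bar>central_diff h ?V j - ?X j\<bar>
      \<le> B2 * h\<^sup>2 * c0 + c0 * (B3 * h\<^sup>2)"
    by (intro add_mono mult_mono level_consistency(1,2)[OF n j] cd vb sol.c0_nonneg abs_ge_zero)
  have collect: "b * H * c + c * (b' * H) = c * (b + b') * H" for b b' c H :: real by (simp add: algebra_simps)
  show ?thesis
    unfolding convection_def collect[symmetric] by (rule order_trans[OF abs_product_diff_le bound])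
qed

text \<open>Near \<open>0\<close> the increments of \<open>u\<close> and \<open>u\<^sub>x\<close> are bounded by an integrable power, and the product is
  compared with its value at \<open>t 1\<close>.\<close>

lemma time_convection_error_first:
  assumes j: "j \<in> {1..J-1}"
  defines "x \<equiv> grid_pt L J j"
  shows "\<bar>step t 1 * (level (nodal J u t) 1 j * level (nodal J ux t) 1 j) - integral {t 0..t 1} (\<lambda>\<tau>. u x \<tau> * ux x \<tau>)\<bar>
    \<le> 2 * c0 * (sol.embed_const * M / (\<theta> * (1 - \<theta>))) * t 1 powr \<sigma>"
proof -
  have x: "x \<in> {0..L}" using grid_pt_interior[OF sol.L j] by (auto simp: x_def)
  have t1: "t 1 \<in> {0<..T}" using t_mem[of 1] mesh.N by simp
  define K where "K = 2 * c0 * (sol.embed_const * (M / \<theta> * t 1 powr (\<sigma> - 1 + \<theta>)))"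
  have K: "0 \<le> K" using sol.c0_nonneg sol.embed_const_pos sol.M sol.\<theta> by (simp add: K_def)
  have e: "((\<lambda>\<zeta>. 0 + K * \<zeta> powr (- \<theta>)) has_integral 0 * t 1 + K * (t 1 powr (1 - \<theta>) / (1 - \<theta>))) {0..t 1}"
    using t1 by (intro sol.powr_minus_integral') auto
  have int: "((\<lambda>\<tau>. u x (t 1) * ux x (t 1) - u x \<tau> * ux x \<tau>) has_integral
      t 1 * (u x (t 1) * ux x (t 1)) - integral {0..t 1} (\<lambda>\<tau>. u x \<tau> * ux x \<tau>)) {0..t 1}"
    using has_integral_diff[OF has_integral_const_real[of "u x (t 1) * ux x (t 1)" 0 "t 1"]
        integrable_integral[OF sol.product_integrable[OF x, of 0 "t 1"]]] t1 by simp
  have "norm (integral {0<..<t 1} (\<lambda>\<tau>. u x (t 1) * ux x (t 1) - u x \<tau> * ux x \<tau>)) \<le> integral {0<..<t 1} (\<lambda>\<zeta>. 0 + K * \<zeta> powr (- \<theta>))"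
  proof (rule integral_norm_bound_integral)
    show "(\<lambda>\<tau>. u x (t 1) * ux x (t 1) - u x \<tau> * ux x \<tau>) integrable_on {0<..<t 1}"
      using int unfolding integrable_on_Icc_iff_Ioo[symmetric] by blast
    show "(\<lambda>\<zeta>. 0 + K * \<zeta> powr (- \<theta>)) integrable_on {0<..<t 1}"
      using e unfolding integrable_on_Icc_iff_Ioo[symmetric] by blast
    fix \<tau> assume \<tau>: "\<tau> \<in> {0<..<t 1}"
    let ?E = "sol.embed_const * (M / \<theta> * t 1 powr (\<sigma> - 1 + \<theta>) * (\<tau> powr (- \<theta>) - t 1 powr (- \<theta>)))"
    have le: "?E \<le> sol.embed_const * (M / \<theta> * t 1 powr (\<sigma> - 1 + \<theta>) * \<tau> powr (- \<theta>))"
      using sol.embed_const_pos sol.M sol.\<theta> by (intro mult_left_mono) auto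
    have inc: "\<bar>u x (t 1) - u x \<tau>\<bar> \<le> ?E" "\<bar>ux x (t 1) - ux x \<tau>\<bar> \<le> ?E"
      using \<tau> t1 by (intro sol.u_increment x; simp)+
    have b: "\<bar>u x (t 1)\<bar> \<le> c0" "\<bar>ux x \<tau>\<bar> \<le> c0" using sol.c0[OF x, of "t 1"] sol.c0[OF x, of \<tau>] t1 \<tau> by auto
    have "u x (t 1) * ux x (t 1) - u x \<tau> * ux x \<tau> = u x (t 1) * (ux x (t 1) - ux x \<tau>) + (u x (t 1) - u x \<tau>) * ux x \<tau>"
      by (simp add: algebra_simps)
    also have "\<bar>\<dots>\<bar> \<le> \<bar>u x (t 1)\<bar> * \<bar>ux x (t 1) - ux x \<tau>\<bar> + \<bar>u x (t 1) - u x \<tau>\<bar> * \<bar>ux x \<tau>\<bar>"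
      unfolding abs_mult[symmetric] by (rule abs_triangle_ineq)
    also have "\<dots> \<le> c0 * ?E + ?E * c0" using inc b sol.c0_nonneg by (intro add_mono mult_mono) (auto intro: order_trans[OF abs_ge_zero])
    also have "\<dots> = 2 * c0 * ?E" by simp
    also have "\<dots> \<le> 2 * c0 * (sol.embed_const * (M / \<theta> * t 1 powr (\<sigma> - 1 + \<theta>) * \<tau> powr (- \<theta>)))"
      by (rule mult_left_mono[OF le]) (use sol.c0_nonneg in simp)
    also have "\<dots> = 0 + K * \<tau> powr (- \<theta>)" by (simp add: K_def)
    finally show "norm (u x (t 1) * ux x (t 1) - u x \<tau> * ux x \<tau>) \<le> 0 + K * \<tau> powr (- \<theta>)" by simp
  qed
  then have "\<bar>t 1 * (u x (t 1) * ux x (t 1)) - integral {0..t 1} (\<lambda>\<tau>. u x \<tau> * ux x \<tau>)\<bar> \<le> K * (t 1 powr (1 - \<theta>) / (1 - \<theta>))"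
    using integral_unique[OF int] integral_unique[OF e] by (simp only: integral_open_interval_real[symmetric]) simp
  also have "\<dots> = 2 * c0 * (sol.embed_const * M / (\<theta> * (1 - \<theta>))) * (t 1 powr (\<sigma> - 1 + \<theta>) * t 1 powr (1 - \<theta>))"
    by (simp add: K_def)
  also have "t 1 powr (\<sigma> - 1 + \<theta>) * t 1 powr (1 - \<theta>) = t 1 powr \<sigma>" by (simp only: powr_add[symmetric]) simp
  finally show ?thesis by (simp add: step_def mesh.t0 level_def nodal_def x_def)
qed

text \<open>The midpoint rule for products; the interpolated bound makes the product of the two increments a
  quantity of second order.\<close>

lemma time_convection_error_later:
  assumes n: "n \<in> {2..N}" and j: "j \<in> {1..J-1}"
  defines "x \<equiv> grid_pt L J j"
  shows "\<bar>step t n * (level (nodal J u t) n j * level (nodal J ux t) n j) - integral {t (n - 1)..t n} (\<lambda>\<tau>. u x \<tau> * ux x \<tau>)\<bar>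
    \<le> (2 * c0 * (sol.embed_const * (M * ratio powr \<bar>\<sigma> - 3\<bar>)) + interp_const\<^sup>2) * (step t n ^ 3 * t n powr (\<sigma> - 3))"
proof -
  have x: "x \<in> {0..L}" using grid_pt_interior[OF sol.L j] by (auto simp: x_def)
  let ?p = "t (n - 1)" and ?q = "t n"
  have pq: "0 < ?p" "?p < ?q" "?q \<le> T" "?q \<le> ratio * ?p"
    using n mesh.t_pos[of "n - 1"] mesh.t_step[of n] t_mem[of n] t_ratio[of n] by auto
  let ?S = "sol.embed_const * ((?q - ?p) * (M * ratio powr \<bar>\<sigma> - 3\<bar> * ?q powr (\<sigma> - 3)))"
  let ?R = "interp_const * ((?q - ?p) * ?q powr ((\<sigma> - 3) / 2))"
  have "\<bar>integral {?p..?q} (\<lambda>\<tau>. u x \<tau> * ux x \<tau>) - (?q - ?p) * ((u x ?q + u x ?p) / 2 * ((ux x ?q + ux x ?p) / 2))\<bar>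
      \<le> (?q - ?p) * (2 * c0 * ((?q - ?p) * ?S) + ?R\<^sup>2)"
  proof (rule product_midpoint_error[OF pq(2)])
    show "continuous_on {?p..?q} (\<lambda>\<tau>. u x \<tau> * ux x \<tau>)"
      by (intro continuous_on_mult continuous_on_subset[OF sol.u_continuous(1)[OF x]] continuous_on_subset[OF sol.u_continuous(2)[OF x]])
         (use pq in auto)
    show "\<bar>u x \<tau>\<bar> \<le> c0 \<and> \<bar>ux x \<tau>\<bar> \<le> c0" if "\<tau> \<in> {?p..?q}" for \<tau>
      using sol.c0[OF x, of \<tau>] that pq by auto
    show "\<bar>slope (u x) ?p ?q - slope (u x) ?p \<tau>\<bar> \<le> ?S \<and> \<bar>slope (ux x) ?p ?q - slope (ux x) ?p \<tau>\<bar> \<le> ?S" if "\<tau> \<in> {?p<..<?q}" for \<tau>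
      by (intro conjI sol.u_slope[OF pq(1-3) ratio_ge_1 pq(4) _ _ _ _ _ _ x]) (use that pq in auto)
    show "\<bar>u x ?q - u x ?p\<bar> \<le> ?R" "\<bar>ux x ?q - ux x ?p\<bar> \<le> ?R"
      using interp_const(2)[OF x pq] by auto
  qed
  also have "(?q - ?p) * (2 * c0 * ((?q - ?p) * ?S) + ?R\<^sup>2)
      = (2 * c0 * (sol.embed_const * (M * ratio powr \<bar>\<sigma> - 3\<bar>)) + interp_const\<^sup>2) * (step t n ^ 3 * ?q powr (\<sigma> - 3))"
  proof -
    have "(?q powr ((\<sigma> - 3) / 2))\<^sup>2 = ?q powr (\<sigma> - 3)" by (simp add: power2_eq_square powr_add[symmetric])
    then show ?thesis by (simp add: step_def power_mult_distrib power3_eq_cube power2_eq_square algebra_simps)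
  qed
  finally show ?thesis using n by (simp add: step_def level_def nodal_def time_mean_def x_def abs_minus_commute)
qed

lemma sum_convection_error:
  "(\<Sum>n=1..N. grid_norm L J (convection_error n)) \<le> T * (c0 * (B2 + B3) * sqrt L) * h\<^sup>2 + time_convection_const * sqrt L * mesh_error N t"
proof -
  let ?n = "grid_norm L J"
  define C1 C2 where "C1 = 2 * c0 * (sol.embed_const * M / (\<theta> * (1 - \<theta>)))"
    and "C2 = 2 * c0 * (sol.embed_const * (M * ratio powr \<bar>\<sigma> - 3\<bar>)) + interp_const\<^sup>2"
  have C: "0 \<le> C1" "0 \<le> C2" "time_convection_const = C1 + C2"
    using sol.c0_nonneg sol.embed_const_pos sol.M sol.\<theta> by (simp_all add: C1_def C2_def time_convection_const_def)
  define E where "E n = (if n = 1 then C1 * t 1 powr \<sigma> else C2 * (step t n ^ 3 * t n powr (\<sigma> - 3)))" for n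
  have E0: "0 \<le> E n" if "n \<in> {1..N}" for n
    using C mesh.step_pos[OF that] by (simp add: E_def)
  have one: "?n (convection_error n) \<le> (step t n * (c0 * (B2 + B3) * h\<^sup>2) + E n) * sqrt L" if n: "n \<in> {1..N}" for n
  proof (rule grid_norm_bounded[OF sol.L])
    have k: "0 < step t n" by (rule mesh.step_pos[OF n])
    show "0 \<le> step t n * (c0 * (B2 + B3) * h\<^sup>2) + E n" using k E0[OF n] sol.c0_nonneg B2_B3 by simp
    fix j assume j: "j \<in> {1..J-1}"
    let ?x = "grid_pt L J j" and ?V = "level (nodal J u t) n" and ?X = "level (nodal J ux t) n"
    let ?I = "integral {t (n - 1)..t n} (\<lambda>\<tau>. u ?x \<tau> * ux ?x \<tau>)"
    have "\<bar>step t n * (?V j * ?X j) - ?I\<bar> \<le> E n"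
    proof (cases "n = 1")
      case True
      then show ?thesis using time_convection_error_first[OF j] by (simp add: E_def C1_def)
    next
      case False
      then show ?thesis using time_convection_error_later[of n j] n j by (simp add: E_def C2_def)
    qed
    moreover have "\<bar>step t n * (convection h ?V j - ?V j * ?X j)\<bar> \<le> step t n * (c0 * (B2 + B3) * h\<^sup>2)"
      using mult_left_mono[OF space_convection_error[OF n j] less_imp_le[OF k]] k by (simp add: abs_mult)
    moreover have "convection_error n j = step t n * (convection h ?V j - ?V j * ?X j) + (step t n * (?V j * ?X j) - ?I)"
      by (simp add: convection_error_def right_diff_distrib)
    ultimately show "\<bar>convection_error n j\<bar> \<le> step t n * (c0 * (B2 + B3) * h\<^sup>2) + E n" by linarith
  qed
  have "(\<Sum>n=1..N. ?n (convection_error n)) \<le> (\<Sum>n=1..N. (step t n * (c0 * (B2 + B3) * h\<^sup>2) + E n) * sqrt L)"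
    by (rule sum_mono[OF one])
  also have "\<dots> = ((\<Sum>n=1..N. step t n) * (c0 * (B2 + B3) * h\<^sup>2) + (\<Sum>n=1..N. E n)) * sqrt L"
    by (simp only: sum_distrib_right sum.distrib distrib_right)
  also have "(\<Sum>n=1..N. step t n) = T" using mesh.sum_step[of 0 N] tN mesh.t0 by simp
  also have "(\<Sum>n=1..N. E n) = C1 * t 1 powr \<sigma> + C2 * (\<Sum>n=2..N. step t n ^ 3 * t n powr (\<sigma> - 3))"
    unfolding split_first sum_distrib_left by (simp add: E_def)
  also have "\<dots> \<le> C1 * mesh_error N t + C2 * mesh_error N t"
    using C mesh_error_parts by (intro add_mono mult_left_mono) auto
  finally show ?thesis using sol.L by (simp add: C(3) algebra_simps)
qed

section \<open>The error equation\<close>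

lemma time_mean_second_diff:
  "time_mean (\<lambda>m. second_diff H (V m) j) s = second_diff H (\<lambda>i. time_mean (\<lambda>m. V m i) s) j"
  unfolding time_mean_def difference_operators_average ..

lemma frac_quad_eq:
  assumes n: "n \<in> {1..N}"
  shows "step t n * frac_quad \<alpha> t (\<lambda>m. second_diff H (V m) j) n = (\<Sum>s=1..n. mesh.mem_weight n s * second_diff H (level V s) j)"
proof -
  have w: "step t n * (quad_weight \<alpha> t n s * X * step t s) = mesh.mem_weight n s * X" if "s \<in> {1..n}" for s X
  proof -
    have "step t n * (quad_weight \<alpha> t n s * X * step t s) = (step t n * step t s * quad_weight \<alpha> t n s) * X" by simp
    also have "step t n * step t s * quad_weight \<alpha> t n s = mesh.mem_weight n s"
      using that n by (intro mesh.quad_weight_eq) auto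
    finally show ?thesis .
  qed
  have "step t n * frac_quad \<alpha> t (\<lambda>m. second_diff H (V m) j) n
      = step t n * (quad_weight \<alpha> t n 1 * second_diff H (V 1) j * step t 1)
        + (\<Sum>s=2..n. step t n * (quad_weight \<alpha> t n s * time_mean (\<lambda>m. second_diff H (V m) j) s * step t s))"
    by (simp only: frac_quad_def distrib_left sum_distrib_left)
  also have "\<dots> = mesh.mem_weight n 1 * second_diff H (level V 1) j + (\<Sum>s=2..n. mesh.mem_weight n s * second_diff H (level V s) j)"
  proof (intro arg_cong2[where f="(+)"] sum.cong refl)
    show "step t n * (quad_weight \<alpha> t n 1 * second_diff H (V 1) j * step t 1) = mesh.mem_weight n 1 * second_diff H (level V 1) j"
      using w[of 1] n by (simp add: level_def)
    fix s assume s: "s \<in> {2..n}"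
    then have "level V s = (\<lambda>i. time_mean (\<lambda>m. V m i) s)" by (simp add: level_def)
    then show "step t n * (quad_weight \<alpha> t n s * time_mean (\<lambda>m. second_diff H (V m) j) s * step t s) = mesh.mem_weight n s * second_diff H (level V s) j"
      using s by (subst w) (simp_all add: time_mean_second_diff)
  qed
  also have "\<dots> = (\<Sum>s=1..n. mesh.mem_weight n s * second_diff H (level V s) j)"
    using n by (simp add: sum.atLeast_Suc_atMost numeral_2_eq_2)
  finally show ?thesis .
qed

lemma scheme_step:
  assumes U: "scheme_solution \<alpha> L J N t u0 fh U" and n: "n \<in> {1..N}" and j: "j \<in> {1..J-1}"
  shows "U n j - U (n - 1) j = (\<Sum>s=1..n. mesh.mem_weight n s * second_diff h (level U s) j)
    + (step t n * fh n (grid_pt L J j) - step t n * convection h (level U n) j)"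
proof -
  have k: "0 < step t n" by (rule mesh.step_pos[OF n])
  have eq: "time_diff t (\<lambda>m. U m j) n + convection h (level U n) j
      = frac_quad \<alpha> t (\<lambda>m. second_diff h (U m) j) n + fh n (grid_pt L J j)"
  proof (cases "n = 1")
    case True
    have "level U 1 = U 1" by (simp add: level_def)
    then show ?thesis using U j unfolding True scheme_solution_def Let_def convection_def by simp
  next
    case False
    with n have "n \<in> {2..N}" by auto
    moreover have "level U n = (\<lambda>i. time_mean (\<lambda>m. U m i) n)" using False by (simp add: level_def)
    ultimately show ?thesis using U j unfolding scheme_solution_def Let_def convection_def by simp
  qed
  have "U n j - U (n - 1) j = step t n * time_diff t (\<lambda>m. U m j) n" using k by (simp add: time_diff_def)
  also have "time_diff t (\<lambda>m. U m j) n = frac_quad \<alpha> t (\<lambda>m. second_diff h (U m) j) n + (fh n (grid_pt L J j) - convection h (level U n) j)"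
    using eq by linarith
  also have "step t n * \<dots> = step t n * frac_quad \<alpha> t (\<lambda>m. second_diff h (U m) j) n + (step t n * fh n (grid_pt L J j) - step t n * convection h (level U n) j)"
    by (simp only: distrib_left right_diff_distrib)
  also note frac_quad_eq[OF n]
  finally show ?thesis .
qed

text \<open>Sign: the exact solution satisfies the scheme with the residual subtracted on the right, so that
  the equation of the error contains it with a plus sign.\<close>

definition residual :: "(nat \<Rightarrow> real \<Rightarrow> real) \<Rightarrow> nat \<Rightarrow> nat \<Rightarrow> real" where
  "residual fh n j = forcing_error fh n j + (mesh.memory_error (sol.on_grid J uxx) n j + (space_memory_error n j - convection_error n j))"

text \<open>The equation integrated over the \<open>n\<close>-th interval, each integral being exchanged for its discrete
  counterpart minus the error committed.\<close>

lemma exact_step: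
  assumes n: "n \<in> {1..N}" and j: "j \<in> {1..J-1}"
  shows "nodal J u t n j - nodal J u t (n - 1) j = (\<Sum>s=1..n. mesh.mem_weight n s * second_diff h (level (nodal J u t) s) j)
    + (step t n * fh n (grid_pt L J j) - step t n * convection h (level (nodal J u t) n) j) - residual fh n j"
proof -
  let ?x = "grid_pt L J j"
  have tn: "0 \<le> t (n - 1)" "t (n - 1) \<le> t n" "t n \<le> T"
    using mesh.t_nonneg[of "n - 1"] mesh.t_step[OF n] t_mem[OF n] n by auto
  have "sol.memory_integral ?x (t n) - sol.memory_integral ?x (t (n - 1))
      = integral {0..T} (\<lambda>\<zeta>. mesh.mem_kernel n \<zeta> * sol.on_grid J uxx j \<zeta>)"
    unfolding sol.memory_integral_def mesh.mem_kernel_def left_diff_distrib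
    using sol.memory_integrand_integrable[OF j]
    by (subst Henstock_Kurzweil_Integration.integral_diff) (simp_all add: sol.on_grid_def)
  moreover have "mesh.memory_error (sol.on_grid J uxx) n j
      = (\<Sum>s=1..n. mesh.mem_weight n s * level (nodal J uxx t) s j) - integral {0..T} (\<lambda>\<zeta>. mesh.mem_kernel n \<zeta> * sol.on_grid J uxx j \<zeta>)"
  proof -
    have "(\<lambda>m i. sol.on_grid J uxx i (t m)) = nodal J uxx t" by (simp add: nodal_def sol.on_grid_def fun_eq_iff)
    then show ?thesis unfolding mesh.memory_error_def tN by simp
  qed
  moreover have "space_memory_error n j = (\<Sum>s=1..n. mesh.mem_weight n s * second_diff h (level (nodal J u t) s) j)
      - (\<Sum>s=1..n. mesh.mem_weight n s * level (nodal J uxx t) s j)"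
    by (simp only: space_memory_error_def right_diff_distrib sum_subtractf)
  moreover have "nodal J u t n j - nodal J u t (n - 1) j = u ?x (t n) - u ?x (t (n - 1))" by (simp add: nodal_def)
  moreover note sol.integrated_equation(1)[OF j tn]
  moreover have "forcing_error fh n j = step t n * fh n ?x - integral {t (n - 1)..t n} (f ?x)"
    by (simp add: forcing_error_def mult.commute)
  ultimately show ?thesis unfolding residual_def convection_error_def by linarith
qed

lemma sum_residual:
  assumes fh: "forcing_approx Cf L J N t f ft ftt fh"
  shows "(\<Sum>n=1..N. grid_norm L J (residual fh n))
    \<le> (Cf * M * (1 / \<sigma> + ratio powr \<bar>\<sigma> - 3\<bar>) + memory_const + time_convection_const * sqrt L) * mesh_error N t
      + (pow_kernel \<alpha> T * T * (B * sqrt L) + T * (c0 * (B2 + B3) * sqrt L)) * h\<^sup>2"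
proof -
  let ?n = "grid_norm L J"
  let ?m = "\<lambda>n. mesh.memory_error (sol.on_grid J uxx) n"
  have "(\<Sum>n=1..N. ?n (residual fh n)) \<le> (\<Sum>n=1..N. ?n (forcing_error fh n) + (?n (?m n) + (?n (space_memory_error n) + ?n (convection_error n))))"
  proof (rule sum_mono)
    fix n
    have "?n (residual fh n) = ?n (\<lambda>j. forcing_error fh n j + (?m n j + (space_memory_error n j - convection_error n j)))"
      by (rule grid_norm_cong) (rule residual_def)
    also have "\<dots> \<le> ?n (forcing_error fh n) + (?n (?m n) + (?n (space_memory_error n) + ?n (convection_error n)))"
      by (intro order_trans[OF grid_norm_triangle[OF sol.L]] add_left_mono grid_norm_diff[OF sol.L])
    finally show "?n (residual fh n) \<le> ?n (forcing_error fh n) + (?n (?m n) + (?n (space_memory_error n) + ?n (convection_error n)))" .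
  qed
  also have "\<dots> = (\<Sum>n=1..N. ?n (forcing_error fh n)) + ((\<Sum>n=1..N. ?n (?m n)) + ((\<Sum>n=1..N. ?n (space_memory_error n)) + (\<Sum>n=1..N. ?n (convection_error n))))"
    by (simp only: sum.distrib)
  also have "\<dots> \<le> Cf * M * (1 / \<sigma> + ratio powr \<bar>\<sigma> - 3\<bar>) * mesh_error N t + (memory_const * mesh_error N t
      + (pow_kernel \<alpha> T * T * (B * sqrt L) * h\<^sup>2 + (T * (c0 * (B2 + B3) * sqrt L) * h\<^sup>2 + time_convection_const * sqrt L * mesh_error N t)))"
    by (intro add_mono sum_forcing_error[OF fh] sum_memory_error sum_space_memory_error sum_convection_error)
  also have "\<dots> = (Cf * M * (1 / \<sigma> + ratio powr \<bar>\<sigma> - 3\<bar>) + memory_const + time_convection_const * sqrt L) * mesh_error N t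
      + (pow_kernel \<alpha> T * T * (B * sqrt L) + T * (c0 * (B2 + B3) * sqrt L)) * h\<^sup>2"
  proof -
    have "a * Q + (b * Q + (p * H + (q * H + d * Q))) = (a + b + d) * Q + (p + q) * H" for a b d p q Q H :: real
      by (simp add: algebra_simps)
    then show ?thesis .
  qed
  finally show ?thesis .
qed

definition error :: "(nat \<Rightarrow> nat \<Rightarrow> real) \<Rightarrow> nat \<Rightarrow> nat \<Rightarrow> real" where
  "error U n j = U n j - nodal J u t n j"

lemma error_eq: "error U n = (\<lambda>j. U n j - u (grid_pt L J j) (t n))"
  by (simp add: fun_eq_iff error_def nodal_def)

lemma level_error: "level (error U) n i = level U n i - level (nodal J u t) n i"
  unfolding error_def by (rule level_diff)

lemma second_diff_diff: "second_diff H (\<lambda>i. a i - b i) j = second_diff H a j - second_diff H b j"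
  by (simp add: second_diff_def algebra_simps add_divide_distrib diff_divide_distrib)

lemma boundary_zero:
  assumes U: "scheme_solution \<alpha> L J N t u0 fh U" and n: "n \<in> {1..N}"
  shows "U n 0 = 0 \<and> U n J = 0" "nodal J u t n 0 = 0 \<and> nodal J u t n J = 0"
  using U n sol.u_bd[OF t_mem[OF n]] J by (auto simp: scheme_solution_def Let_def nodal_def)

lemma level_boundary_zero:
  assumes W: "\<And>n. n \<in> {1..N} \<Longrightarrow> W n 0 = 0 \<and> W n J = 0" and n: "n \<in> {1..N}"
  shows "level W n 0 = 0" "level W n J = 0"
  using n W[OF n] W by (cases rule: level_cases; auto simp: level_def time_mean_def)+

lemma level_norm:
  assumes n: "n \<in> {1..N}"
  shows "0 \<le> grid_norm L J (level W n) \<and> grid_norm L J (level W n) \<le> max (grid_norm L J (W n)) (grid_norm L J (W (n - 1)))"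
  using n sol.L by (intro conjI grid_norm_nonneg grid_norm_level_le) auto

text \<open>The convection terms of \<open>U\<close> and \<open>u\<close> differ by at most \<open>2 * c0\<close> times the square of the norm when
  tested with the error, so that Gronwall's inequality applies with \<open>\<kappa> n = 2 * c0 * step t n\<close>.\<close>

lemma error_bound_small_steps:
  assumes U: "scheme_solution \<alpha> L J N t u0 fh U" and small: "\<And>n. n \<in> {1..N} \<Longrightarrow> 2 * c0 * step t n \<le> 1 / 4" and m: "m \<le> N"
  shows "grid_norm L J (error U m) \<le> 4 * exp (8 * c0 * T) * (\<Sum>n=1..N. grid_norm L J (residual fh n))"
proof -
  let ?n = "grid_norm L J"
  let ?V = "nodal J u t"
  define g where "g n j = residual fh n j - step t n * (convection h (level U n) j - convection h (level ?V n) j)" for n j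
  have bd: "error U n 0 = 0 \<and> error U n J = 0" if "n \<in> {1..N}" for n
    using boundary_zero[OF U that] by (simp add: error_def)
  have eq: "error U n j - error U (n - 1) j = (\<Sum>s=1..n. mesh.mem_weight n s * second_diff h (level (error U) s) j) + g n j"
    if n: "n \<in> {1..N}" and j: "j \<in> {1..J-1}" for n j
  proof -
    have "(\<Sum>s=1..n. mesh.mem_weight n s * second_diff h (level (error U) s) j)
        = (\<Sum>s=1..n. mesh.mem_weight n s * second_diff h (level U s) j) - (\<Sum>s=1..n. mesh.mem_weight n s * second_diff h (level ?V s) j)"
    proof -
      have "level (error U) s = (\<lambda>i. level U s i - level ?V s i)" for s by (simp add: level_error fun_eq_iff)
      then show ?thesis by (simp only: second_diff_diff right_diff_distrib sum_subtractf)
    qed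
    then show ?thesis
      using scheme_step[OF U n j] exact_step[OF n j, of fh] unfolding error_def g_def right_diff_distrib by linarith
  qed
  have e0: "?n (error U 0) = 0"
  proof -
    have "?n (error U 0) = ?n (\<lambda>j. 0)"
    proof (rule grid_norm_cong)
      fix j assume j: "j \<in> {1..J-1}"
      have "U 0 j = u0 (grid_pt L J j)" using U j by (auto simp: scheme_solution_def Let_def)
      moreover have "u (grid_pt L J j) 0 = u0 (grid_pt L J j)" using grid_pt_interior[OF sol.L j] by (intro sol.u_init) auto
      ultimately show "error U 0 j = 0" by (simp add: error_def nodal_def mesh.t0)
    qed
    then show ?thesis by simp
  qed
  have test: "grid_ip L J (level (error U) n) (g n) \<le> ?n (level (error U) n) * (2 * c0 * step t n * ?n (level (error U) n) + ?n (residual fh n))"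
    if n: "n \<in> {1..N}" for n
  proof -
    let ?e = "level (error U) n"
    have ue: "level U n = (\<lambda>i. level ?V n i + ?e i)" by (simp add: level_error fun_eq_iff)
    have "- (2 * c0 * (?n ?e)\<^sup>2) \<le> grid_ip L J ?e (\<lambda>j. convection h (\<lambda>i. level ?V n i + ?e i) j - convection h (level ?V n) j)"
      using level_boundary_zero[of "error U", OF bd n] sol.c0_nonneg level_bounds(1)[OF n]
      by (intro grid_ip_convection_diff_ge[OF sol.L J]) auto
    then have "- (2 * c0 * (?n ?e)\<^sup>2) \<le> grid_ip L J ?e (\<lambda>j. convection h (level U n) j - convection h (level ?V n) j)"
      unfolding ue[symmetric] .
    then have "step t n * - (2 * c0 * (?n ?e)\<^sup>2) \<le> step t n * grid_ip L J ?e (\<lambda>j. convection h (level U n) j - convection h (level ?V n) j)"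
      using mesh.step_pos[OF n] by (intro mult_left_mono) auto
    moreover have "grid_ip L J ?e (g n) = grid_ip L J ?e (residual fh n) - step t n * grid_ip L J ?e (\<lambda>j. convection h (level U n) j - convection h (level ?V n) j)"
    proof -
      have "g n = (\<lambda>j. residual fh n j - step t n * (convection h (level U n) j - convection h (level ?V n) j))" by (simp add: g_def fun_eq_iff)
      then show ?thesis by (simp only: grid_ip_diff_right grid_ip_scale_right)
    qed
    moreover have "grid_ip L J ?e (residual fh n) \<le> ?n ?e * ?n (residual fh n)" by (rule grid_ip_le_norm[OF sol.L])
    moreover have "a * (2 * c0 * s * a + r) = s * (2 * c0 * a\<^sup>2) + a * r" for a s r :: real by (simp add: algebra_simps power2_eq_square)
    ultimately show ?thesis by simp
  qed
  have "?n (error U m) \<le> 2 * (?n (error U 0) + 2 * (\<Sum>n=1..N. ?n (residual fh n))) * exp (4 * (\<Sum>n=1..N. 2 * c0 * step t n))"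
  proof (rule discrete_gronwall[where l="\<lambda>n. ?n (level (error U) n)"])
    fix m assume m: "m \<le> N"
    have "(?n (error U m))\<^sup>2 \<le> (?n (error U 0))\<^sup>2 + 2 * (\<Sum>n=1..m. grid_ip L J (level (error U) n) (g n))"
      by (rule mesh.energy_estimate[OF sol.L J m bd eq])
    also have "(\<Sum>n=1..m. grid_ip L J (level (error U) n) (g n)) \<le> (\<Sum>n=1..m. ?n (level (error U) n) * (2 * c0 * step t n * ?n (level (error U) n) + ?n (residual fh n)))"
      by (intro sum_mono test) (use m in auto)
    finally show "(?n (error U m))\<^sup>2 \<le> (?n (error U 0))\<^sup>2 + 2 * (\<Sum>n=1..m. ?n (level (error U) n) * (2 * c0 * step t n * ?n (level (error U) n) + ?n (residual fh n)))"
      by simp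
  next
    fix n assume n: "n \<in> {1..N}"
    show "0 \<le> 2 * c0 * step t n \<and> 2 * c0 * step t n \<le> 1 / 4"
      using small[OF n] sol.c0_nonneg mesh.step_pos[OF n] by simp
    show "0 \<le> ?n (level (error U) n) \<and> ?n (level (error U) n) \<le> max (?n (error U n)) (?n (error U (n - 1)))"
      by (rule level_norm[OF n])
  qed (use sol.L m in auto)
  also have "(\<Sum>n=1..N. 2 * c0 * step t n) = 2 * c0 * T"
    using mesh.sum_step[of 0 N] tN mesh.t0 by (simp add: sum_distrib_left[symmetric])
  finally show ?thesis unfolding e0 by (simp add: ac_simps)
qed

text \<open>Tested with its own solution the scheme has no convection term, so \<open>U\<close> is bounded by its data on any
  mesh: by the initial values and by the forcing term, which is integrable in time uniformly in
  the grid.\<close>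

lemma error_bound_stability:
  assumes U: "scheme_solution \<alpha> L J N t u0 fh U" and fh: "forcing_approx Cf L J N t f ft ftt fh"
    and \<Phi>: "grid_norm L J (\<lambda>j. sol.on_grid J f j T) \<le> \<Phi>" and m: "m \<in> {1..N}"
  shows "grid_norm L J (error U m) \<le> 3 * c0 * sqrt L + 4 * (\<Phi> * T + sol.singular_const * (T powr (1 - \<theta>) / (1 - \<theta>)))
    + 4 * (Cf * M * (1 / \<sigma> + ratio powr \<bar>\<sigma> - 3\<bar>)) * mesh_error N t"
proof -
  let ?n = "grid_norm L J"
  define F where "F n j = step t n * fh n (grid_pt L J j)" for n j
  define g where "g n j = F n j - step t n * convection h (level U n) j" for n j
  have bd: "U n 0 = 0 \<and> U n J = 0" if "n \<in> {1..N}" for n by (rule boundary_zero(1)[OF U that])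
  have test: "grid_ip L J (level U n) (g n) \<le> ?n (level U n) * (0 * ?n (level U n) + ?n (F n))" if n: "n \<in> {1..N}" for n
  proof -
    have "g n = (\<lambda>j. F n j - step t n * convection h (level U n) j)" by (simp add: g_def fun_eq_iff)
    then have "grid_ip L J (level U n) (g n) = grid_ip L J (level U n) (F n) - step t n * grid_ip L J (level U n) (convection h (level U n))"
      by (simp only: grid_ip_diff_right grid_ip_scale_right)
    also have "grid_ip L J (level U n) (convection h (level U n)) = 0"
      by (rule grid_ip_convection_self[OF level_boundary_zero[of U, OF bd n] J])
    finally show ?thesis using grid_ip_le_norm[OF sol.L, of J "level U n" "F n"] by simp
  qed
  \<comment> \<open>Gronwall's inequality with all \<open>\<kappa> n = 0\<close>, as the convection term is gone\<close>
  have stab: "?n (U m) \<le> 2 * (?n (U 0) + 2 * (\<Sum>n=1..N. ?n (F n))) * exp (4 * (\<Sum>n=1..N. 0))"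
  proof (rule discrete_gronwall[where l="\<lambda>n. ?n (level U n)"])
    fix m assume m: "m \<le> N"
    have "(?n (U m))\<^sup>2 \<le> (?n (U 0))\<^sup>2 + 2 * (\<Sum>n=1..m. grid_ip L J (level U n) (g n))"
      by (rule mesh.energy_estimate[OF sol.L J m bd]) (use scheme_step[OF U] in \<open>simp_all only: g_def F_def\<close>)
    also have "(\<Sum>n=1..m. grid_ip L J (level U n) (g n)) \<le> (\<Sum>n=1..m. ?n (level U n) * (0 * ?n (level U n) + ?n (F n)))"
      by (intro sum_mono test) (use m in auto)
    finally show "(?n (U m))\<^sup>2 \<le> (?n (U 0))\<^sup>2 + 2 * (\<Sum>n=1..m. ?n (level U n) * (0 * ?n (level U n) + ?n (F n)))"
      by simp
  next
    fix n assume n: "n \<in> {1..N}"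
    show "0 \<le> ?n (level U n) \<and> ?n (level U n) \<le> max (?n (U n)) (?n (U (n - 1)))"
      by (rule level_norm[OF n])
  qed (use sol.L m in auto)
  have U0: "?n (U 0) \<le> c0 * sqrt L"
  proof (rule grid_norm_bounded[OF sol.L _ sol.c0_nonneg])
    fix j assume j: "j \<in> {1..J-1}"
    have x: "grid_pt L J j \<in> {0<..<L}" by (rule grid_pt_interior[OF sol.L j])
    have "U 0 j = u0 (grid_pt L J j)" using U j by (auto simp: scheme_solution_def Let_def)
    also have "\<dots> = u (grid_pt L J j) 0" using x by (intro sol.u_init[symmetric]) auto
    finally show "\<bar>U 0 j\<bar> \<le> c0" using sol.initial_value_bound[OF x] by simp
  qed
  have V: "?n (nodal J u t m) \<le> c0 * sqrt L"
  proof (rule grid_norm_bounded[OF sol.L _ sol.c0_nonneg])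
    fix j assume j: "j \<in> {1..J-1}"
    have "grid_pt L J j \<in> {0..L}" using grid_pt_interior[OF sol.L j] by auto
    then show "\<bar>nodal J u t m j\<bar> \<le> c0" using sol.c0[OF _ t_mem[OF m]] by (simp add: nodal_def)
  qed
  define \<epsilon> where "\<epsilon> \<zeta> = \<Phi> + sol.singular_const * \<zeta> powr (- \<theta>)" for \<zeta>
  have \<epsilon>: "(\<epsilon> has_integral \<Phi> * T + sol.singular_const * (T powr (1 - \<theta>) / (1 - \<theta>))) {0..t N}"
    unfolding \<epsilon>_def tN using sol.T by (intro sol.powr_minus_integral') auto
  have If: "?n (\<lambda>j. integral {t (n - 1)..t n} (f (grid_pt L J j))) \<le> integral {t (n - 1)..t n} \<epsilon>" if n: "n \<in> {1..N}" for n
  proof -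
    have tn: "0 \<le> t (n - 1)" "t (n - 1) \<le> t n" "t n \<le> T"
      using mesh.t_nonneg[of "n - 1"] mesh.t_step[OF n] t_mem[OF n] n by auto
    have "?n (\<lambda>j. integral {t (n - 1)<..<t n} (f (grid_pt L J j))) \<le> integral {t (n - 1)<..<t n} \<epsilon>"
    proof (rule grid_norm_integral_le[OF sol.L])
      show "f (grid_pt L J j) integrable_on {t (n - 1)<..<t n}" if "j \<in> {1..J-1}" for j
        using sol.integrated_equation(2)[OF that tn] by (simp add: integrable_on_Icc_iff_Ioo)
      have "\<epsilon> integrable_on {t (n - 1)..t n}"
        by (rule integrable_on_subinterval[OF has_integral_integrable[OF \<epsilon>]]) (use tn tN in auto)
      then show "\<epsilon> integrable_on {t (n - 1)<..<t n}" by (simp add: integrable_on_Icc_iff_Ioo)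
      fix \<zeta> assume z: "\<zeta> \<in> {t (n - 1)<..<t n}"
      have "?n (\<lambda>j. f (grid_pt L J j) \<zeta>) = ?n (\<lambda>j. sol.on_grid J f j T - (sol.on_grid J f j T - sol.on_grid J f j \<zeta>))"
        by (simp add: sol.on_grid_def)
      also have "\<dots> \<le> ?n (\<lambda>j. sol.on_grid J f j T) + ?n (\<lambda>j. sol.on_grid J f j T - sol.on_grid J f j \<zeta>)"
        by (rule grid_norm_diff[OF sol.L])
      also have "\<dots> \<le> \<epsilon> \<zeta>"
        unfolding \<epsilon>_def using z tn by (intro add_mono \<Phi> sol.regular_family_increment_singular[OF sol.regular_f[OF J]]) auto
      finally show "?n (\<lambda>j. f (grid_pt L J j) \<zeta>) \<le> \<epsilon> \<zeta>" .
    qed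
    then show ?thesis by (simp only: integral_open_interval_real)
  qed
  have "(\<Sum>n=1..N. ?n (F n)) \<le> (\<Sum>n=1..N. ?n (forcing_error fh n) + integral {t (n - 1)..t n} \<epsilon>)"
  proof (rule sum_mono)
    fix n assume n: "n \<in> {1..N}"
    have "?n (F n) = ?n (\<lambda>j. forcing_error fh n j + integral {t (n - 1)..t n} (f (grid_pt L J j)))"
      by (rule grid_norm_cong) (simp add: F_def forcing_error_def)
    also have "\<dots> \<le> ?n (forcing_error fh n) + integral {t (n - 1)..t n} \<epsilon>"
      by (rule order_trans[OF grid_norm_triangle[OF sol.L] add_left_mono[OF If[OF n]]])
    finally show "?n (F n) \<le> ?n (forcing_error fh n) + integral {t (n - 1)..t n} \<epsilon>" .
  qed
  also have "\<dots> = (\<Sum>n=1..N. ?n (forcing_error fh n)) + integral {0..t N} \<epsilon>"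
    using mesh.sum_integral_steps[OF has_integral_integrable[OF \<epsilon>], of N] by (simp add: sum.distrib)
  also have "\<dots> \<le> Cf * M * (1 / \<sigma> + ratio powr \<bar>\<sigma> - 3\<bar>) * mesh_error N t + (\<Phi> * T + sol.singular_const * (T powr (1 - \<theta>) / (1 - \<theta>)))"
    by (intro add_mono sum_forcing_error[OF fh]) (simp add: integral_unique[OF \<epsilon>])
  finally have F: "(\<Sum>n=1..N. ?n (F n)) \<le> Cf * M * (1 / \<sigma> + ratio powr \<bar>\<sigma> - 3\<bar>) * mesh_error N t + (\<Phi> * T + sol.singular_const * (T powr (1 - \<theta>) / (1 - \<theta>)))" .
  have "?n (error U m) \<le> ?n (U m) + ?n (nodal J u t m)"
    using grid_norm_diff[OF sol.L, of J "U m" "nodal J u t m"] by (simp add: error_def[abs_def])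
  also have "\<dots> \<le> 2 * (c0 * sqrt L + 2 * (Cf * M * (1 / \<sigma> + ratio powr \<bar>\<sigma> - 3\<bar>) * mesh_error N t + (\<Phi> * T + sol.singular_const * (T powr (1 - \<theta>) / (1 - \<theta>))))) + c0 * sqrt L"
    using stab U0 F V by simp
  finally show ?thesis by (simp add: algebra_simps)
qed

end

end

section \<open>Convergence\<close>

context discretised_solution
begin

lemma mesh_error_le_K_L:
  "\<exists>C\<ge>0. \<forall>k N t. par.admissible_mesh k N t \<longrightarrow> mesh_error N t \<le> C * K_L \<gamma> \<sigma> k N t"
proof -
  obtain C1 where C1: "0 \<le> C1" "\<And>k N t. par.admissible_mesh k N t \<Longrightarrow> t 1 powr \<sigma> \<le> C1 * K_L \<gamma> \<sigma> k N t"
    using par.initial_step_le_K_L by blast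
  obtain C2 where C2: "0 \<le> C2" "\<And>k N t. par.admissible_mesh k N t \<Longrightarrow> (\<Sum>s=2..N. step t s ^ 3 * t s powr (\<sigma> - 3)) \<le> C2 * K_L \<gamma> \<sigma> k N t"
    using par.sum_step_cubed_le_K_L by blast
  obtain C3 where C3: "0 \<le> C3" "\<And>k N t. par.admissible_mesh k N t \<Longrightarrow> (step t N)\<^sup>2 * t N powr (\<sigma> - 2) \<le> C3 * K_L \<gamma> \<sigma> k N t"
    using par.last_step_le_K_L by blast
  have "mesh_error N t \<le> (C1 + C2 + C3) * K_L \<gamma> \<sigma> k N t" if "par.admissible_mesh k N t" for k N t
    unfolding mesh_error_def distrib_right by (intro add_mono C1(2) C2(2) C3(2) that)
  then show ?thesis using C1(1) C2(1) C3(1) by (intro exI[of _ "C1 + C2 + C3"]) auto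
qed

text \<open>For \<open>k \<le> k0\<close> the steps satisfy the smallness condition of the Gronwall argument. For larger \<open>k\<close> the
  quantity \<open>K_L\<close> has a positive lower bound, and the error is bounded in any case.\<close>

lemma convergence:
  "\<exists>C>0. \<forall>J N k t fh U. 1 \<le> J \<longrightarrow> par.admissible_mesh k N t \<longrightarrow> (\<forall>n\<in>{1..N}. smooth_at (t n)) \<longrightarrow>
     forcing_approx Cf L J N t f ft ftt fh \<longrightarrow> scheme_solution \<alpha> L J N t u0 fh U \<longrightarrow>
     (\<forall>m\<in>{1..N}. grid_norm L J (\<lambda>j. U m j - u (grid_pt L J j) (t m)) \<le> C * ((L / real J)\<^sup>2 + K_L \<gamma> \<sigma> k N t))"
proof -
  obtain Cm where Cm: "0 \<le> Cm" "\<And>k N t. par.admissible_mesh k N t \<Longrightarrow> mesh_error N t \<le> Cm * K_L \<gamma> \<sigma> k N t"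
    using mesh_error_le_K_L by blast
  obtain \<Phi> where \<Phi>: "0 \<le> \<Phi>" "\<And>J. 1 \<le> J \<Longrightarrow> grid_norm L J (\<lambda>j. sol.on_grid J f j T) \<le> \<Phi>"
    using sol.final_forcing_bound by blast
  \<comment> \<open>steps are at most \<open>Cg * k\<close>, and \<open>2 * c0 * Cg * k0 \<le> 1 / 4\<close>; adding \<open>1\<close> covers \<open>c0 = 0\<close>\<close>
  define k0 where "k0 = 1 / (8 * (c0 + 1) * Cg)"
  have k0: "0 < k0" using sol.c0_nonneg par.Cg by (simp add: k0_def)
  obtain cL where cL: "0 < cL" "\<And>k N t. par.admissible_mesh k N t \<Longrightarrow> k0 \<le> k \<Longrightarrow> cL \<le> K_L \<gamma> \<sigma> k N t"
    using par.K_L_lower[OF k0] by blast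
  define R1 where "R1 = Cf * M * (1 / \<sigma> + ratio powr \<bar>\<sigma> - 3\<bar>) + memory_const + time_convection_const * sqrt L"
  define R2 where "R2 = pow_kernel \<alpha> T * T * (B * sqrt L) + T * (c0 * (B2 + B3) * sqrt L)"
  define A1 where "A1 = 3 * c0 * sqrt L + 4 * (\<Phi> * T + sol.singular_const * (T powr (1 - \<theta>) / (1 - \<theta>)))"
  define A2 where "A2 = 4 * (Cf * M * (1 / \<sigma> + ratio powr \<bar>\<sigma> - 3\<bar>))"
  have A: "0 \<le> A1" "0 \<le> A2"
    using sol.c0_nonneg sol.L sol.T \<Phi>(1) sol.singular_const_nonneg sol.\<theta> Cf sol.M sol.\<sigma> by (simp_all add: A1_def A2_def)
  define S where "S = 4 * exp (8 * c0 * T) * (\<bar>R1\<bar> * Cm + \<bar>R2\<bar>)"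
  define G where "G = A1 / cL + A2 * Cm"
  have SG: "0 \<le> S" "0 \<le> G" using Cm(1) A cL(1) by (simp_all add: S_def G_def)
  have "grid_norm L J (\<lambda>j. U m j - u (grid_pt L J j) (t m)) \<le> (S + G + 1) * ((L / real J)\<^sup>2 + K_L \<gamma> \<sigma> k N t)"
    if J: "1 \<le> J" and mesh: "par.admissible_mesh k N t" and smooth: "\<forall>n\<in>{1..N}. smooth_at (t n)"
      and fh: "forcing_approx Cf L J N t f ft ftt fh" and U: "scheme_solution \<alpha> L J N t u0 fh U" and m: "m \<in> {1..N}" for J N k t fh U m
  proof -
    let ?K = "K_L \<gamma> \<sigma> k N t" and ?H = "(L / real J)\<^sup>2" and ?e = "grid_norm L J (error J t U m)"
    have sm: "\<And>n. n \<in> {1..N} \<Longrightarrow> smooth_at (t n)" using smooth by blast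
    have K: "0 \<le> ?K" by (rule par.K_L_nonneg[OF mesh])
    have me: "0 \<le> mesh_error N t" "mesh_error N t \<le> Cm * ?K"
      using mesh_error_parts(1)[OF J mesh sm] Cm(2)[OF mesh] by auto
    have "?e \<le> S * (?H + ?K) \<or> ?e \<le> G * ?K"
    proof (cases "k \<le> k0")
      case True
      have small: "2 * c0 * step t n \<le> 1 / 4" if "n \<in> {1..N}" for n
      proof -
        have "step t n \<le> Cg * k" by (rule par.step_le_k[OF mesh that])
        also have "\<dots> \<le> Cg * k0" using True par.Cg by (intro mult_left_mono) auto
        also have "\<dots> = 1 / (8 * (c0 + 1))" using par.Cg by (simp add: k0_def)
        finally have "2 * c0 * step t n \<le> 2 * c0 * (1 / (8 * (c0 + 1)))" using sol.c0_nonneg by (intro mult_left_mono) auto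
        also have "\<dots> \<le> 1 / 4" using sol.c0_nonneg by (simp add: field_simps)
        finally show ?thesis .
      qed
      have "(\<Sum>n=1..N. grid_norm L J (residual J N t fh n)) \<le> R1 * mesh_error N t + R2 * ?H"
        unfolding R1_def R2_def by (rule sum_residual[OF J mesh sm fh])
      also have "\<dots> \<le> \<bar>R1\<bar> * (Cm * ?K) + \<bar>R2\<bar> * ?H"
        using me by (intro add_mono mult_mono mult_right_mono) auto
      also have "\<dots> \<le> (\<bar>R1\<bar> * Cm + \<bar>R2\<bar>) * (?H + ?K)"
      proof -
        have "a * (c * K) + b * H \<le> (a * c + b) * (H + K)" if "0 \<le> a" "0 \<le> b" "0 \<le> c" "0 \<le> H" "0 \<le> K" for a b c H K :: real
          using that by (simp add: algebra_simps)
        then show ?thesis using Cm(1) K by simp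
      qed
      finally have res: "(\<Sum>n=1..N. grid_norm L J (residual J N t fh n)) \<le> (\<bar>R1\<bar> * Cm + \<bar>R2\<bar>) * (?H + ?K)" .
      have "?e \<le> 4 * exp (8 * c0 * T) * (\<Sum>n=1..N. grid_norm L J (residual J N t fh n))"
        using m by (intro error_bound_small_steps[OF J mesh sm U small]) auto
      also have "\<dots> \<le> 4 * exp (8 * c0 * T) * ((\<bar>R1\<bar> * Cm + \<bar>R2\<bar>) * (?H + ?K))" by (rule mult_left_mono[OF res]) simp
      finally have "?e \<le> S * (?H + ?K)" by (simp only: S_def mult.assoc)
      then show ?thesis ..
    next
      case False
      then have cK: "cL \<le> ?K" by (intro cL(2)[OF mesh]) auto
      have "?e \<le> A1 + A2 * mesh_error N t"
        unfolding A1_def A2_def by (rule error_bound_stability[OF J mesh sm U fh \<Phi>(2)[OF J] m])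
      also have "A1 = A1 / cL * cL" using cL(1) by simp
      also have "A1 / cL * cL + A2 * mesh_error N t \<le> A1 / cL * ?K + A2 * (Cm * ?K)"
        using A cL(1) cK me by (intro add_mono mult_left_mono) auto
      also have "\<dots> = G * ?K" by (simp add: G_def distrib_right)
      finally show ?thesis by simp
    qed
    moreover have "S * (?H + ?K) \<le> (S + G + 1) * (?H + ?K)" using SG K by (intro mult_right_mono) auto
    moreover have "G * ?K \<le> (S + G + 1) * (?H + ?K)" using SG K by (intro mult_mono) auto
    ultimately have "?e \<le> (S + G + 1) * (?H + ?K)" by linarith
    then show ?thesis by (simp only: error_eq[OF J mesh sm])
  qed
  moreover have "0 < S + G + 1" using SG by simp
  ultimately show ?thesis by blast
qed

end

theorem theorem4p3:
  fixes L T \<alpha> \<gamma> \<sigma> M c0 Cf Cg cg B \<rho> :: real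
    and u0 :: "real \<Rightarrow> real"
    and f ft ftt u ut ux uxx uxxt uxxtt :: "real \<Rightarrow> real \<Rightarrow> real"
  assumes "0 < L" "0 < T" "0 < \<alpha>" "\<alpha> < 1" "1 \<le> \<gamma>" "0 < \<sigma>"
    and "0 < M" "0 < Cf" "0 < Cg" "0 < cg" "1 < \<rho>"
    and sol: "classical_solution \<alpha> L T u0 f u ut ux uxx"
    and c0: "\<And>x t. \<lbrakk>x \<in> {0..L}; t \<in> {0<..T}\<rbrakk> \<Longrightarrow> \<bar>u x t\<bar> \<le> c0 \<and> \<bar>ux x t\<bar> \<le> c0"
    and uxxt: "\<And>x t. \<lbrakk>x \<in> {0<..<L}; t \<in> {0<..T}\<rbrakk> \<Longrightarrow>
      (uxx x has_real_derivative uxxt x t) (at t within {0..T})"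
    and uxxtt: "\<And>x t. \<lbrakk>x \<in> {0<..<L}; t \<in> {0<..T}\<rbrakk> \<Longrightarrow>
      (uxxt x has_real_derivative uxxtt x t) (at t within {0..T})"
    and ft: "\<And>x t. \<lbrakk>x \<in> {0<..<L}; t \<in> {0<..T}\<rbrakk> \<Longrightarrow>
      (f x has_real_derivative ft x t) (at t within {0..T})"
    and ftt: "\<And>x t. \<lbrakk>x \<in> {0<..<L}; t \<in> {0<..T}\<rbrakk> \<Longrightarrow>
      (ft x has_real_derivative ftt x t) (at t within {0..T})"
    and u_reg: "\<And>J t. \<lbrakk>1 \<le> J; t \<in> {0<..T}\<rbrakk> \<Longrightarrow>
      t * fun_norm L J (\<lambda>x. uxxt x t) + t\<^sup>2 * fun_norm L J (\<lambda>x. uxxtt x t) \<le> M * t powr (\<sigma> - 1)"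
    and f_reg: "\<And>J t. \<lbrakk>1 \<le> J; t \<in> {0<..T}\<rbrakk> \<Longrightarrow>
      t * fun_norm L J (\<lambda>x. ft x t) + t\<^sup>2 * fun_norm L J (\<lambda>x. ftt x t) \<le> M * t powr (\<sigma> - 1)"
  shows "\<exists>C>0. \<forall>(J::nat) (N::nat) (k::real) (t :: nat \<Rightarrow> real)
      (fh :: nat \<Rightarrow> real \<Rightarrow> real) (U :: nat \<Rightarrow> nat \<Rightarrow> real).
    1 \<le> J \<longrightarrow>
    graded_mesh T \<gamma> Cg cg k N t \<longrightarrow>
    (\<gamma> = 2 / \<sigma> \<longrightarrow> \<rho> * t 1 \<le> t N) \<longrightarrow>
    (\<forall>n\<le>N. \<exists>d. Ck_derivs 4 {0..L} (\<lambda>x. u x (t n)) d \<and> (\<forall>x\<in>{0..L}. \<bar>d 4 x\<bar> \<le> B)) \<longrightarrow>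
    forcing_approx Cf L J N t f ft ftt fh \<longrightarrow>
    scheme_solution \<alpha> L J N t u0 fh U \<longrightarrow>
    (MAX n\<in>{1..N}. grid_norm L J (\<lambda>j. U n j - u (grid_pt L J j) (t n)))
      \<le> C * ((L / real J)\<^sup>2 + K_L \<gamma> \<sigma> k N t)"
proof -
  interpret mesh_parameters T \<gamma> \<sigma> Cg cg \<rho> by unfold_locales (use assms in auto)
  interpret discretised_solution \<alpha> L T \<sigma> M c0 u0 f ft ftt u ut ux uxx uxxt uxxtt \<gamma> Cg cg \<rho> Cf B
    by unfold_locales (fact assms)+
  obtain C where C: "0 < C" "\<And>J N k t fh U m. \<lbrakk>1 \<le> J; admissible_mesh k N t; \<forall>n\<in>{1..N}. smooth_at (t n);
      forcing_approx Cf L J N t f ft ftt fh; scheme_solution \<alpha> L J N t u0 fh U; m \<in> {1..N}\<rbrakk> \<Longrightarrow>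
      grid_norm L J (\<lambda>j. U m j - u (grid_pt L J j) (t m)) \<le> C * ((L / real J)\<^sup>2 + K_L \<gamma> \<sigma> k N t)"
    using convergence by blast
  show ?thesis
  proof (intro exI[of _ C] conjI allI impI C(1))
    fix J N k t fh U
    assume J: "1 \<le> J" and mesh: "graded_mesh T \<gamma> Cg cg k N t" and \<rho>: "\<gamma> = 2 / \<sigma> \<longrightarrow> \<rho> * t 1 \<le> t N"
      and smooth: "\<forall>n\<le>N. \<exists>d. Ck_derivs 4 {0..L} (\<lambda>x. u x (t n)) d \<and> (\<forall>x\<in>{0..L}. \<bar>d 4 x\<bar> \<le> B)"
      and fh: "forcing_approx Cf L J N t f ft ftt fh" and U: "scheme_solution \<alpha> L J N t u0 fh U"
    have "admissible_mesh k N t" using mesh \<rho> by (simp add: admissible_mesh_def)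
    moreover have "\<forall>n\<in>{1..N}. smooth_at (t n)" using smooth by (simp add: smooth_at_def)
    moreover have "1 \<le> N" using mesh by (simp add: graded_mesh_def)
    ultimately show "(MAX n\<in>{1..N}. grid_norm L J (\<lambda>j. U n j - u (grid_pt L J j) (t n)))
        \<le> C * ((L / real J)\<^sup>2 + K_L \<gamma> \<sigma> k N t)"
      using C(2)[OF J _ _ fh U] by (intro Max.boundedI) auto
  qed
qed

end
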